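(* Let $Q$ be a finite acyclic quiver, $A$ a finite-dimensional algebra over a field $k$, and $\Lambda = A\otimes_k kQ$. Let $X=(X_i, X_\alpha, i\in Q_0,\alpha\in Q_1)$ be a $\Lambda$-module, viewed as a representation of $Q$ over $A$. Then $X$ is a Gorenstein-projective $\Lambda$-module if and only if $X$ is a monic representation of $Q$ over $A$ and, for each $i\in Q_0$, both $X_i$ and the quotient $X_i/\bigl(\bigoplus_{\alpha\in Q_1,\ e(\alpha)=i}\operatorname{Im}X_\alpha\bigr)$ are Gorenstein-projective $A$-modules.
   Context: All modules are finite-dimensional left modules. A quiver is $Q=(Q_0,Q_1,s,e)$, where the arrow $\alpha$ goes from $s(\alpha)$ to $e(\alpha)$; acyclic means without oriented cycles. Paths are composed from right to left. Representations: a representation $X$ of $Q$ over $A$ consists of a finite-dimensional $A$-module $X_i$ for each $i\in Q_0$ and an $A$-linear map $X_\alpha: X_{s(\alpha)}\to X_{e(\alpha)}$ for each $\alpha\in Q_1$. Morphisms are families of $A$-linear maps $(f_i)_{i\in Q_0}$ commuting with the structure maps. Modules over $\Lambda=A\otimes_k kQ$ (the path algebra of $Q$ over $A$) are identified with representations of $Q$ over $A$: $X_i=(1\otimes e_i)X$, where $e_i$ is the trivial path at $i$, and $X_\alpha$ is the left action of $1\otimes\alpha$. Monic representations: $X$ is monic if for each $i\in Q_0$ the $A$-map $(X_\alpha)_{e(\alpha)=i}: \bigoplus_{\alpha\in Q_1, e(\alpha)=i}X_{s(\alpha)}\to X_i$ is injective; equivalently, every $X_\alpha$ is injective and for each $i\in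 Q_0$ the sum $\sum_{e(\alpha)=i}\operatorname{Im}X_\alpha$ inside $X_i$ is direct. Gorenstein-projective modules: for a finite-dimensional algebra $R$, a complete $R$-projective resolution is an exact complex $P^\bullet=\cdots\to P^{-1}\to P^0\xrightarrow{d^0}P^1\to\cdots$ of finitely generated projective $R$-modules such that $\operatorname{Hom}_R(P^\bullet,R)$ is also exact. An $R$-module $M$ is Gorenstein-projective if $M\cong\operatorname{Ker}d^0$ for some complete $R$-projective resolution. *)

theory Defs
  imports "Graph_Theory.Arc_Walk" "HOL-Algebra.Module" "HOL-Algebra.AbelCoset"
begin

no_notation dominates ("_ \<rightarrow>\<index> _" [100,100] 40)  \<comment> \<open>clashes with \<^const>\<open>Pi\<close>\<close>

section \<open>Modules over noncommutative rings\<close>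

text \<open>
  The library locale \<^locale>\<open>module\<close> requires a commutative ring of scalars. The record type
  of the library is reused for left modules over arbitrary rings; its ring fields \<open>mult\<close> and
  \<open>one\<close> carry no meaning for a module.
\<close>

locale left_module = R?: ring R + M?: abelian_group M for R (structure) and M (structure) +
  assumes smult_closed [simp, intro]:
      "\<lbrakk>a \<in> carrier R; x \<in> carrier M\<rbrakk> \<Longrightarrow> a \<odot>\<^bsub>M\<^esub> x \<in> carrier M"
    and smult_l_distr:
      "\<lbrakk>a \<in> carrier R; b \<in> carrier R; x \<in> carrier M\<rbrakk> \<Longrightarrow>
        (a \<oplus> b) \<odot>\<^bsub>M\<^esub> x = a \<odot>\<^bsub>M\<^esub> x \<oplus>\<^bsub>M\<^esub> b \<odot>\<^bsub>M\<^esub> x"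
    and smult_r_distr:
      "\<lbrakk>a \<in> carrier R; x \<in> carrier M; y \<in> carrier M\<rbrakk> \<Longrightarrow>
        a \<odot>\<^bsub>M\<^esub> (x \<oplus>\<^bsub>M\<^esub> y) = a \<odot>\<^bsub>M\<^esub> x \<oplus>\<^bsub>M\<^esub> a \<odot>\<^bsub>M\<^esub> y"
    and smult_assoc1:
      "\<lbrakk>a \<in> carrier R; b \<in> carrier R; x \<in> carrier M\<rbrakk> \<Longrightarrow>
        (a \<otimes> b) \<odot>\<^bsub>M\<^esub> x = a \<odot>\<^bsub>M\<^esub> (b \<odot>\<^bsub>M\<^esub> x)"
    and smult_one [simp]: "x \<in> carrier M \<Longrightarrow> \<one> \<odot>\<^bsub>M\<^esub> x = x"

definition mod_hom ::
  "('r, 'z) ring_scheme \<Rightarrow> ('r, 'm) module \<Rightarrow> ('r, 'n) module \<Rightarrow> ('m \<Rightarrow> 'n) set" where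
  "mod_hom R M N = {f \<in> carrier M \<rightarrow> carrier N.
     (\<forall>x\<in>carrier M. \<forall>y\<in>carrier M. f (x \<oplus>\<^bsub>M\<^esub> y) = f x \<oplus>\<^bsub>N\<^esub> f y) \<and>
     (\<forall>a\<in>carrier R. \<forall>x\<in>carrier M. f (a \<odot>\<^bsub>M\<^esub> x) = a \<odot>\<^bsub>N\<^esub> f x)}"

definition mod_iso ::
  "('r, 'z) ring_scheme \<Rightarrow> ('r, 'm) module \<Rightarrow> ('r, 'n) module \<Rightarrow> bool" where
  "mod_iso R M N \<longleftrightarrow> (\<exists>f\<in>mod_hom R M N. bij_betw f (carrier M) (carrier N))"

definition restrict_carrier :: "('r, 'm) module \<Rightarrow> 'm set \<Rightarrow> ('r, 'm) module" where
  "restrict_carrier M N = M\<lparr>carrier := N\<rparr>"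

definition quotient_module :: "('r, 'm) module \<Rightarrow> 'm set \<Rightarrow> ('r, 'm set) module" where
  "quotient_module M N = \<lparr>carrier = a_rcosets\<^bsub>M\<^esub> N, mult = undefined, one = undefined,
     zero = N, add = set_add M, smult = (\<lambda>a C. \<Union>x\<in>C. N +>\<^bsub>M\<^esub> (a \<odot>\<^bsub>M\<^esub> x))\<rparr>"

definition regular_module :: "('r, 'z) ring_scheme \<Rightarrow> ('r, 'r) module" where
  "regular_module R = \<lparr>carrier = carrier R, mult = mult R, one = one R,
     zero = zero R, add = add R, smult = mult R\<rparr>"

definition free_module :: "('r, 'z) ring_scheme \<Rightarrow> nat \<Rightarrow> ('r, nat \<Rightarrow> 'r) module" where
  "free_module R n = \<lparr>carrier = {..<n} \<rightarrow>\<^sub>E carrier R, mult = undefined, one = undefined,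
     zero = (\<lambda>i\<in>{..<n}. \<zero>\<^bsub>R\<^esub>), add = (\<lambda>x y. \<lambda>i\<in>{..<n}. x i \<oplus>\<^bsub>R\<^esub> y i),
     smult = (\<lambda>a x. \<lambda>i\<in>{..<n}. a \<otimes>\<^bsub>R\<^esub> x i)\<rparr>"

definition finitely_generated :: "('r, 'z) ring_scheme \<Rightarrow> ('r, 'm) module \<Rightarrow> bool" where
  "finitely_generated R M \<longleftrightarrow> (\<exists>S. finite S \<and> S \<subseteq> carrier M \<and>
     (\<forall>x\<in>carrier M. \<exists>c\<in>S \<rightarrow> carrier R. x = (\<Oplus>\<^bsub>M\<^esub>s\<in>S. c s \<odot>\<^bsub>M\<^esub> s)))"

text \<open>Finitely generated projective: a direct summand of some \<open>R\<^sup>n\<close>, up to isomorphism.\<close>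

definition fg_projective :: "('r, 'z) ring_scheme \<Rightarrow> ('r, 'm) module \<Rightarrow> bool" where
  "fg_projective R P \<longleftrightarrow> left_module R P \<and>
     (\<exists>n. \<exists>i\<in>mod_hom R P (free_module R n). \<exists>p\<in>mod_hom R (free_module R n) P.
        \<forall>x\<in>carrier P. p (i x) = x)"


section \<open>Gorenstein-projective modules\<close>

definition complete_projective_resolution ::
  "('r, 'z) ring_scheme \<Rightarrow> (int \<Rightarrow> ('r, 'm) module) \<Rightarrow> (int \<Rightarrow> 'm \<Rightarrow> 'm) \<Rightarrow> bool" where
  "complete_projective_resolution R P d \<longleftrightarrow>
     (\<forall>n. fg_projective R (P n)) \<and>
     (\<forall>n. d n \<in> mod_hom R (P n) (P (n + 1))) \<and>
     (\<forall>n. a_kernel (P n) (P (n + 1)) (d n) = d (n - 1) ` carrier (P (n - 1))) \<and>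
     (\<forall>n. \<forall>f\<in>mod_hom R (P n) (regular_module R).
        (\<forall>x\<in>carrier (P (n - 1)). f (d (n - 1) x) = \<zero>\<^bsub>R\<^esub>) \<longleftrightarrow>
        (\<exists>g\<in>mod_hom R (P (n + 1)) (regular_module R). \<forall>x\<in>carrier (P n). f x = g (d n x)))"

text \<open>
  The terms of the resolution are taken with elements in \<^typ>\<open>nat \<Rightarrow> 'r\<close>. This is no restriction:
  by \<open>fg_projective_representative\<close> below, every finitely generated projective module, whatever
  the type of its elements, is isomorphic to one of this kind.
\<close>

definition gorenstein_projective :: "('r, 'z) ring_scheme \<Rightarrow> ('r, 'm) module \<Rightarrow> bool" where
  "gorenstein_projective R M \<longleftrightarrow> left_module R M \<and>
     (\<exists>(P :: int \<Rightarrow> ('r, nat \<Rightarrow> 'r) module) d.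
        complete_projective_resolution R P d \<and>
        mod_iso R M (restrict_carrier (P 0) (a_kernel (P 0) (P 1) (d 0))))"


section \<open>Finite-dimensional algebras and their modules\<close>

text \<open>The library locale \<^locale>\<open>algebra\<close> requires a commutative multiplication.\<close>

locale fd_algebra = K?: field K + A?: ring A + module K A for K (structure) and A (structure) +
  assumes smult_mult_left:
      "\<lbrakk>c \<in> carrier K; a \<in> carrier A; b \<in> carrier A\<rbrakk> \<Longrightarrow>
        (c \<odot>\<^bsub>A\<^esub> a) \<otimes>\<^bsub>A\<^esub> b = c \<odot>\<^bsub>A\<^esub> (a \<otimes>\<^bsub>A\<^esub> b)"
    and smult_mult_right:
      "\<lbrakk>c \<in> carrier K; a \<in> carrier A; b \<in> carrier A\<rbrakk> \<Longrightarrow>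
        a \<otimes>\<^bsub>A\<^esub> (c \<odot>\<^bsub>A\<^esub> b) = c \<odot>\<^bsub>A\<^esub> (a \<otimes>\<^bsub>A\<^esub> b)"
    and finite_dimensional: "finitely_generated K A"

text \<open>The vector space underlying a module \<open>M\<close> over a \<open>K\<close>-algebra \<open>R\<close>.\<close>

definition scalar_restriction :: "('k, 'r) module \<Rightarrow> ('r, 'm) module \<Rightarrow> ('k, 'm) module" where
  "scalar_restriction R M = \<lparr>carrier = carrier M, mult = mult M, one = one M,
     zero = zero M, add = add M, smult = (\<lambda>c x. (c \<odot>\<^bsub>R\<^esub> \<one>\<^bsub>R\<^esub>) \<odot>\<^bsub>M\<^esub> x)\<rparr>"

definition fd_module :: "('k, 'z) ring_scheme \<Rightarrow> ('k, 'r) module \<Rightarrow> ('r, 'm) module \<Rightarrow> bool" where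
  "fd_module K R M \<longleftrightarrow> left_module R M \<and> finitely_generated K (scalar_restriction R M)"


section \<open>The path algebra of a quiver over an algebra\<close>

text \<open>
  Quivers are multidigraphs, \<^const>\<open>tail\<close> and \<^const>\<open>head\<close> being the maps \<open>s\<close> and \<open>e\<close>.
  A path is given by its start, its list of arrows in the order in which they are traversed,
  and its end.
\<close>

type_synonym ('v, 'e) path = "'v \<times> 'e list \<times> 'v"

definition paths :: "('v, 'e) pre_digraph \<Rightarrow> ('v, 'e) path set" where
  "paths Q = {(u, p, v). pre_digraph.awalk Q u p v}"

definition trivial_path :: "'v \<Rightarrow> ('v, 'e) path" where
  "trivial_path i = (i, [], i)"

definition arrow_path :: "('v, 'e) pre_digraph \<Rightarrow> 'e \<Rightarrow> ('v, 'e) path" where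
  "arrow_path Q \<alpha> = (tail Q \<alpha>, [\<alpha>], head Q \<alpha>)"

definition factorizations ::
  "('v, 'e) pre_digraph \<Rightarrow> ('v, 'e) path \<Rightarrow> (('v, 'e) path \<times> ('v, 'e) path) set" where
  "factorizations Q r = {((w, q, v), (u, p, w)) | u v w p q.
     (w, q, v) \<in> paths Q \<and> (u, p, w) \<in> paths Q \<and> r = (u, p @ q, v)}"

text \<open>
  An element \<open>f\<close> stands for the sum of the \<open>f x \<cdot> x\<close> over all paths \<open>x\<close>; there are only finitely
  many paths when the quiver is finite and acyclic, so no finiteness of the support is imposed.
  Paths are composed from right to left: in a product \<open>f g\<close> the path of \<open>g\<close> is traversed first.
\<close>

definition path_algebra ::
  "('k, 'a) module \<Rightarrow> ('v, 'e) pre_digraph \<Rightarrow> ('k, ('v, 'e) path \<Rightarrow> 'a) module" where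
  "path_algebra A Q = \<lparr>carrier = paths Q \<rightarrow>\<^sub>E carrier A,
     mult = (\<lambda>f g. \<lambda>r\<in>paths Q.
       \<Oplus>\<^bsub>A\<^esub>z\<in>factorizations Q r. f (fst z) \<otimes>\<^bsub>A\<^esub> g (snd z)),
     one = (\<lambda>(u, r, v)\<in>paths Q. if r = [] then \<one>\<^bsub>A\<^esub> else \<zero>\<^bsub>A\<^esub>),
     zero = (\<lambda>x\<in>paths Q. \<zero>\<^bsub>A\<^esub>),
     add = (\<lambda>f g. \<lambda>x\<in>paths Q. f x \<oplus>\<^bsub>A\<^esub> g x),
     smult = (\<lambda>c f. \<lambda>x\<in>paths Q. c \<odot>\<^bsub>A\<^esub> f x)\<rparr>"

text \<open>
  The algebra \<open>kQ\<close> is \<^term>\<open>path_algebra (regular_module K) Q\<close>, and \<^term>\<open>path_algebra A Q\<close>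
  is a model of its tensor product with \<open>A\<close> over \<open>k\<close>, with the following pure tensors; see the
  lemmas at the end.
\<close>

definition path_basis ::
  "('k, 'z) ring_scheme \<Rightarrow> ('v, 'e) pre_digraph \<Rightarrow> ('v, 'e) path \<Rightarrow> ('v, 'e) path \<Rightarrow> 'k" where
  "path_basis K Q x = (\<lambda>y\<in>paths Q. if y = x then \<one>\<^bsub>K\<^esub> else \<zero>\<^bsub>K\<^esub>)"

definition pure_tensor ::
  "('k, 'a) module \<Rightarrow> ('v, 'e) pre_digraph \<Rightarrow> 'a \<Rightarrow> (('v, 'e) path \<Rightarrow> 'k) \<Rightarrow> ('v, 'e) path \<Rightarrow> 'a" where
  "pure_tensor A Q a \<xi> = (\<lambda>x\<in>paths Q. \<xi> x \<odot>\<^bsub>A\<^esub> a)"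


section \<open>The representation of a quiver belonging to a module over the path algebra\<close>

text \<open>The \<open>A\<close>-module \<open>X\<^sub>i = (1 \<otimes> e\<^sub>i) X\<close>, on which \<open>a\<close> acts as \<open>a \<otimes> 1\<close>, and the map \<open>X\<^sub>\<alpha>\<close>.\<close>

definition rep_space :: "('k, 'z) ring_scheme \<Rightarrow> ('k, 'a) module \<Rightarrow> ('v, 'e) pre_digraph \<Rightarrow>
    (('v, 'e) path \<Rightarrow> 'a, 'm) module \<Rightarrow> 'v \<Rightarrow> ('a, 'm) module" where
  "rep_space K A Q X i = \<lparr>
     carrier = (\<lambda>x. pure_tensor A Q \<one>\<^bsub>A\<^esub> (path_basis K Q (trivial_path i)) \<odot>\<^bsub>X\<^esub> x) ` carrier X,
     mult = mult X, one = one X, zero = zero X, add = add X,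
     smult = (\<lambda>a x. pure_tensor A Q a \<one>\<^bsub>path_algebra (regular_module K) Q\<^esub> \<odot>\<^bsub>X\<^esub> x)\<rparr>"

definition rep_map :: "('k, 'z) ring_scheme \<Rightarrow> ('k, 'a) module \<Rightarrow> ('v, 'e) pre_digraph \<Rightarrow>
    (('v, 'e) path \<Rightarrow> 'a, 'm) module \<Rightarrow> 'e \<Rightarrow> 'm \<Rightarrow> 'm" where
  "rep_map K A Q X \<alpha> x = pure_tensor A Q \<one>\<^bsub>A\<^esub> (path_basis K Q (arrow_path Q \<alpha>)) \<odot>\<^bsub>X\<^esub> x"

text \<open>
  A representation is given by a family \<open>V\<close> of \<open>A\<close>-modules and a family \<open>\<phi>\<close> of maps.
  Elements of the direct sum of the \<open>V (tail Q \<alpha>)\<close> over the finitely many arrows \<open>\<alpha>\<close> ending at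
  \<open>i\<close> are families indexed by these arrows.
\<close>

definition monic_rep :: "('v, 'e) pre_digraph \<Rightarrow> ('v \<Rightarrow> ('a, 'm) module) \<Rightarrow>
    ('e \<Rightarrow> 'm \<Rightarrow> 'm) \<Rightarrow> bool" where
  "monic_rep Q V \<phi> \<longleftrightarrow> (\<forall>i\<in>verts Q.
     inj_on (\<lambda>x. \<Oplus>\<^bsub>V i\<^esub>\<alpha>\<in>in_arcs Q i. \<phi> \<alpha> (x \<alpha>))
       (\<Pi>\<^sub>E \<alpha>\<in>in_arcs Q i. carrier (V (tail Q \<alpha>))))"

text \<open>The sum of the images of the maps belonging to the arrows that end at \<open>i\<close>.\<close>

definition incoming_image :: "('v, 'e) pre_digraph \<Rightarrow> ('v \<Rightarrow> ('a, 'm) module) \<Rightarrow>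
    ('e \<Rightarrow> 'm \<Rightarrow> 'm) \<Rightarrow> 'v \<Rightarrow> 'm set" where
  "incoming_image Q V \<phi> i = {\<Oplus>\<^bsub>V i\<^esub>\<alpha>\<in>in_arcs Q i. y \<alpha> | y.
     \<forall>\<alpha>\<in>in_arcs Q i. y \<alpha> \<in> \<phi> \<alpha> ` carrier (V (tail Q \<alpha>))}"


section \<open>The path algebra as a tensor product\<close>

lemma (in abelian_monoid) finsum_Sigma:
  assumes "finite I" "\<And>i. i \<in> I \<Longrightarrow> finite (B i)"
    and "\<And>i j. i \<in> I \<Longrightarrow> j \<in> B i \<Longrightarrow> h i j \<in> carrier G"
  shows "(\<Oplus>i\<in>I. \<Oplus>j\<in>B i. h i j) = (\<Oplus>z\<in>Sigma I B. h (fst z) (snd z))"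
proof -
  have S: "Sigma I B = (\<Union>i\<in>I. Pair i ` B i)" by auto
  have "(\<Oplus>z\<in>Sigma I B. h (fst z) (snd z)) = (\<Oplus>i\<in>I. \<Oplus>z\<in>Pair i ` B i. h (fst z) (snd z))"
    unfolding S
    by (rule add.finprod_UN_disjoint) (use assms in \<open>auto simp: pairwise_def disjnt_def\<close>)
  also have "\<dots> = (\<Oplus>i\<in>I. \<Oplus>j\<in>B i. h i j)"
  proof (rule finsum_cong')
    show "(\<lambda>i. \<Oplus>j\<in>B i. h i j) \<in> I \<rightarrow> carrier G"
      using assms by (auto intro!: finsum_closed)
    show "(\<Oplus>z\<in>Pair i ` B i. h (fst z) (snd z)) = (\<Oplus>j\<in>B i. h i j)" if "i \<in> I" for i
      by (subst finsum_reindex) (use assms that in \<open>auto simp: inj_on_def\<close>)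
  qed simp
  finally show ?thesis by simp
qed

lemma (in abelian_monoid) finsum_delta:
  assumes "finite I" "i \<in> I" "h i \<in> carrier G" "\<And>j. j \<in> I \<Longrightarrow> j \<noteq> i \<Longrightarrow> h j = \<zero>"
  shows "(\<Oplus>j\<in>I. h j) = h i"
proof -
  have "(\<Oplus>j\<in>I. h j) = (\<Oplus>j\<in>I. if i = j then h j else \<zero>)"
    by (rule finsum_cong') (use assms in auto)
  also have "\<dots> = h i"
  proof (rule finsum_singleton)
    show "h \<in> I \<rightarrow> carrier G" using assms(3,4) zero_closed by (metis Pi_I)
  qed (use assms in auto)
  finally show ?thesis .
qed

locale acyclic_quiver = fin_digraph Q for Q (structure) +
  assumes acyclic: "\<nexists>c. pre_digraph.cycle Q c"
begin

lemma finite_paths: "finite (paths Q)"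
proof (rule finite_subset)
  show "paths Q \<subseteq> verts Q \<times> {p. set p \<subseteq> arcs Q \<and> distinct p} \<times> verts Q"
  proof (clarsimp simp: paths_def)
    fix u p v assume p: "awalk u p v"
    then have "distinct (awalk_verts u p)"
      using acyclic closed_w_imp_cycle by (metis awalk_cyc_decompE')
    then show "u \<in> verts Q \<and> set p \<subseteq> arcs Q \<and> distinct p \<and> v \<in> verts Q"
      using p distinct_tl_verts_imp_distinct[OF p]
      by (auto simp: distinct_tl)
  qed
  show "finite (verts Q \<times> {p. set p \<subseteq> arcs Q \<and> distinct p} \<times> verts Q)"
    by (intro finite_cartesian_product finite_subset_distinct) auto
qed

lemma factorizations_subset: "factorizations Q r \<subseteq> paths Q \<times> paths Q"
  by (auto simp: factorizations_def)

lemma finite_factorizations: "finite (factorizations Q r)"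
  by (rule finite_subset[OF factorizations_subset]) (simp add: finite_paths)

lemma factorizations_paths:
  assumes "(y, x) \<in> factorizations Q r" shows "y \<in> paths Q" "x \<in> paths Q" "r \<in> paths Q"
  using assms by (auto simp: factorizations_def paths_def intro: awalk_appendI)

lemma trivial_path_in_paths [simp]: "i \<in> verts Q \<Longrightarrow> trivial_path i \<in> paths Q"
  by (simp add: trivial_path_def paths_def awalk_Nil_iff)

lemma arrow_path_in_paths [simp]: "\<alpha> \<in> arcs Q \<Longrightarrow> arrow_path Q \<alpha> \<in> paths Q"
  by (simp add: arrow_path_def paths_def arc_implies_awalk)

end

lemma finsum_regular: "finsum (regular_module K) g S = finsum K g S"
  by (simp add: finsum_def finprod_def regular_module_def)

locale quiver_algebra = fd_algebra K A + acyclic_quiver Q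
  for K (structure) and A (structure) and Q (structure)
begin

abbreviation "L \<equiv> path_algebra A Q"

lemma carrier_L: "carrier L = paths Q \<rightarrow>\<^sub>E carrier A" by (simp add: path_algebra_def)

lemma L_closed [simp]: "f \<in> carrier L \<Longrightarrow> x \<in> paths Q \<Longrightarrow> f x \<in> carrier A"
  by (auto simp: carrier_L)

lemma L_eqI:
  "f \<in> carrier L \<Longrightarrow> g \<in> carrier L \<Longrightarrow> (\<And>x. x \<in> paths Q \<Longrightarrow> f x = g x) \<Longrightarrow> f = g"
  unfolding carrier_L by (rule PiE_ext)

lemma mult_L: "x \<in> paths Q \<Longrightarrow> (f \<otimes>\<^bsub>L\<^esub> g) x = (\<Oplus>\<^bsub>A\<^esub>z\<in>factorizations Q x. f (fst z) \<otimes>\<^bsub>A\<^esub> g (snd z))"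
  and add_L: "x \<in> paths Q \<Longrightarrow> (f \<oplus>\<^bsub>L\<^esub> g) x = f x \<oplus>\<^bsub>A\<^esub> g x"
  and zero_L: "x \<in> paths Q \<Longrightarrow> \<zero>\<^bsub>L\<^esub> x = \<zero>\<^bsub>A\<^esub>"
  and smult_L: "x \<in> paths Q \<Longrightarrow> (c \<odot>\<^bsub>L\<^esub> f) x = c \<odot>\<^bsub>A\<^esub> f x"
  and one_L: "(u, r, v) \<in> paths Q \<Longrightarrow> \<one>\<^bsub>L\<^esub> (u, r, v) = (if r = [] then \<one>\<^bsub>A\<^esub> else \<zero>\<^bsub>A\<^esub>)"
  by (auto simp: path_algebra_def)

lemma fac_closed:
  assumes "f \<in> carrier L" "g \<in> carrier L" "z \<in> factorizations Q x"
  shows "f (fst z) \<in> carrier A" "g (snd z) \<in> carrier A"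
  using assms by (cases z; auto dest: factorizations_paths)+

lemma L_mult_closed:
  assumes "f \<in> carrier L" "g \<in> carrier L" shows "f \<otimes>\<^bsub>L\<^esub> g \<in> carrier L"
  using fac_closed[OF assms] unfolding path_algebra_def by (auto intro!: A.finsum_closed)

lemma L_add_closed: "f \<in> carrier L \<Longrightarrow> g \<in> carrier L \<Longrightarrow> f \<oplus>\<^bsub>L\<^esub> g \<in> carrier L"
  by (auto simp: path_algebra_def)

lemma L_zero_closed: "\<zero>\<^bsub>L\<^esub> \<in> carrier L" by (auto simp: path_algebra_def)
lemma L_one_closed: "\<one>\<^bsub>L\<^esub> \<in> carrier L" by (auto simp: path_algebra_def)
lemma L_smult_closed: "c \<in> carrier K \<Longrightarrow> f \<in> carrier L \<Longrightarrow> c \<odot>\<^bsub>L\<^esub> f \<in> carrier L"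
  by (auto simp: path_algebra_def)

lemmas L_closeds = L_mult_closed L_add_closed L_zero_closed L_one_closed L_smult_closed

lemma abelian_group_L: "abelian_group L"
proof (rule abelian_groupI)
  fix f assume f: "f \<in> carrier L"
  show "\<exists>g\<in>carrier L. g \<oplus>\<^bsub>L\<^esub> f = \<zero>\<^bsub>L\<^esub>"
  proof (rule bexI)
    show g: "(\<lambda>x\<in>paths Q. \<ominus>\<^bsub>A\<^esub> f x) \<in> carrier L" using f by (auto simp: carrier_L)
    show "(\<lambda>x\<in>paths Q. \<ominus>\<^bsub>A\<^esub> f x) \<oplus>\<^bsub>L\<^esub> f = \<zero>\<^bsub>L\<^esub>"
      by (rule L_eqI) (use f g in \<open>auto simp: L_closeds add_L zero_L A.l_neg\<close>)
  qed
qed (auto intro!: L_eqI simp: L_closeds add_L zero_L A.add.m_ac)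

lemma L_assoc:
  assumes f: "f \<in> carrier L" and g: "g \<in> carrier L" and h: "h \<in> carrier L"
  shows "(f \<otimes>\<^bsub>L\<^esub> g) \<otimes>\<^bsub>L\<^esub> h = f \<otimes>\<^bsub>L\<^esub> (g \<otimes>\<^bsub>L\<^esub> h)"
proof (rule L_eqI)
  fix r assume r: "r \<in> paths Q"
  let ?F = "factorizations Q"
  let ?S = "Sigma (?F r) (\<lambda>z. ?F (fst z))" and ?T = "Sigma (?F r) (\<lambda>z. ?F (snd z))"
  have pq: "\<And>z x. z \<in> ?F x \<Longrightarrow> fst z \<in> paths Q \<and> snd z \<in> paths Q"
    by (auto dest: factorizations_paths)
  have fin: "finite (?F x)" for x by (rule finite_factorizations)
  let ?u = "\<lambda>w. f (fst (snd w)) \<otimes>\<^bsub>A\<^esub> (g (snd (snd w)) \<otimes>\<^bsub>A\<^esub> h (snd (fst w)))"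
  let ?v = "\<lambda>w. f (fst (fst w)) \<otimes>\<^bsub>A\<^esub> (g (fst (snd w)) \<otimes>\<^bsub>A\<^esub> h (snd (snd w)))"
  have "((f \<otimes>\<^bsub>L\<^esub> g) \<otimes>\<^bsub>L\<^esub> h) r =
      (\<Oplus>\<^bsub>A\<^esub>z\<in>?F r. \<Oplus>\<^bsub>A\<^esub>y\<in>?F (fst z). f (fst y) \<otimes>\<^bsub>A\<^esub> (g (snd y) \<otimes>\<^bsub>A\<^esub> h (snd z)))"
    unfolding mult_L[OF r]
  proof (rule A.finsum_cong'[OF refl])
    fix z assume z: "z \<in> ?F r"
    have "(f \<otimes>\<^bsub>L\<^esub> g) (fst z) \<otimes>\<^bsub>A\<^esub> h (snd z) =
        (\<Oplus>\<^bsub>A\<^esub>y\<in>?F (fst z). (f (fst y) \<otimes>\<^bsub>A\<^esub> g (snd y)) \<otimes>\<^bsub>A\<^esub> h (snd z))"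
      using pq[OF z] f g h
      by (subst mult_L) (auto intro!: A.finsum_ldistr fin A.m_closed dest: pq simp del: split_paired_All)
    also have "\<dots> = (\<Oplus>\<^bsub>A\<^esub>y\<in>?F (fst z). f (fst y) \<otimes>\<^bsub>A\<^esub> (g (snd y) \<otimes>\<^bsub>A\<^esub> h (snd z)))"
      by (rule A.finsum_cong') (use pq[OF z] f g h in \<open>auto intro!: A.m_assoc dest!: pq\<close>)
    finally show "(f \<otimes>\<^bsub>L\<^esub> g) (fst z) \<otimes>\<^bsub>A\<^esub> h (snd z) =
        (\<Oplus>\<^bsub>A\<^esub>y\<in>?F (fst z). f (fst y) \<otimes>\<^bsub>A\<^esub> (g (snd y) \<otimes>\<^bsub>A\<^esub> h (snd z)))" .
  qed (use f g h in \<open>auto intro!: A.finsum_closed dest!: pq\<close>)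
  also have "\<dots> = (\<Oplus>\<^bsub>A\<^esub>w\<in>?S. ?u w)"
    by (rule A.finsum_Sigma) (use f g h in \<open>auto intro!: fin dest!: pq\<close>)
  also have "\<dots> = (\<Oplus>\<^bsub>A\<^esub>w\<in>?T. ?v w)"
  proof -
    have inj: "inj_on (\<lambda>w. ((fst (snd w), (fst (snd (fst w)), fst (snd (snd (fst w))) @ fst (snd (snd (snd w))), snd (snd (snd (snd w))))), (snd (snd w), snd (fst w)))) ?S" (is "inj_on ?\<theta> _")
      by (auto simp: inj_on_def factorizations_def)
    have im: "?\<theta> ` ?S = ?T"
    proof (intro equalityI subsetI)
      fix w assume "w \<in> ?\<theta> ` ?S"
      then show "w \<in> ?T"
        by (force simp: factorizations_def paths_def awalk_appendI)
    next
      fix W assume "W \<in> ?T"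
      moreover obtain a b c d where W: "W = ((a, b), (c, d))" by (metis surj_pair)
      ultimately have "((a, b), (c, d)) \<in> ?T" by simp
      then obtain u v w w' p1 p2 q where
          "a = (w, q, v)" "b = (u, p1 @ p2, w)" "c = (w', p2, w)" "d = (u, p1, w')"
          "r = (u, (p1 @ p2) @ q, v)"
          "(w, q, v) \<in> paths Q" "(w', p2, w) \<in> paths Q" "(u, p1, w') \<in> paths Q"
        by (auto simp: factorizations_def)
      then show "W \<in> ?\<theta> ` ?S"
        unfolding W by (intro image_eqI[where x = "(((w', p2 @ q, v), d), (a, c))"])
           (auto simp: factorizations_def paths_def intro: awalk_appendI)
    qed
    have "(\<Oplus>\<^bsub>A\<^esub>w\<in>?\<theta> ` ?S. ?v w) = (\<Oplus>\<^bsub>A\<^esub>w\<in>?S. ?v (?\<theta> w))"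
      apply (rule A.finsum_reindex[OF _ inj]) using im f g h by (auto dest!: pq)
    then show ?thesis unfolding im by simp
  qed
  also have "\<dots> = (\<Oplus>\<^bsub>A\<^esub>z\<in>?F r. \<Oplus>\<^bsub>A\<^esub>y\<in>?F (snd z). f (fst z) \<otimes>\<^bsub>A\<^esub> (g (fst y) \<otimes>\<^bsub>A\<^esub> h (snd y)))"
    by (rule A.finsum_Sigma[symmetric]) (use f g h in \<open>auto intro!: fin dest!: pq\<close>)
  also have "\<dots> = (f \<otimes>\<^bsub>L\<^esub> (g \<otimes>\<^bsub>L\<^esub> h)) r"
    unfolding mult_L[OF r]
  proof (rule A.finsum_cong'[OF refl])
    fix z assume z: "z \<in> ?F r"
    show "(\<Oplus>\<^bsub>A\<^esub>y\<in>?F (snd z). f (fst z) \<otimes>\<^bsub>A\<^esub> (g (fst y) \<otimes>\<^bsub>A\<^esub> h (snd y))) =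
       f (fst z) \<otimes>\<^bsub>A\<^esub> (g \<otimes>\<^bsub>L\<^esub> h) (snd z)"
      using pq[OF z] f g h
      by (subst mult_L) (auto intro!: A.finsum_rdistr[symmetric] fin A.m_closed dest: pq)
  qed (use f g h L_mult_closed in \<open>auto dest!: pq\<close>)
  finally show "((f \<otimes>\<^bsub>L\<^esub> g) \<otimes>\<^bsub>L\<^esub> h) r = (f \<otimes>\<^bsub>L\<^esub> (g \<otimes>\<^bsub>L\<^esub> h)) r" .
qed (use f g h in \<open>auto intro!: L_mult_closed\<close>)


lemma factorizations_left_unit:
  assumes "(y, x) \<in> factorizations Q r" "fst (snd y) = []" shows "y = trivial_path (snd (snd r)) \<and> x = r"
  using assms by (auto simp: factorizations_def trivial_path_def paths_def awalk_Nil_iff)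

lemma factorizations_right_unit:
  assumes "(y, x) \<in> factorizations Q r" "fst (snd x) = []" shows "x = trivial_path (fst r) \<and> y = r"
  using assms by (auto simp: factorizations_def trivial_path_def paths_def awalk_Nil_iff)

lemma trivial_factorizations:
  assumes "r \<in> paths Q"
  shows "(trivial_path (snd (snd r)), r) \<in> factorizations Q r" "(r, trivial_path (fst r)) \<in> factorizations Q r"
  using assms by (auto simp: factorizations_def trivial_path_def paths_def awalk_Nil_iff)

lemma one_L': "x \<in> paths Q \<Longrightarrow> \<one>\<^bsub>L\<^esub> x = (if fst (snd x) = [] then \<one>\<^bsub>A\<^esub> else \<zero>\<^bsub>A\<^esub>)"
  by (cases x) (simp add: one_L)

lemma L_one_left: assumes f: "f \<in> carrier L" shows "\<one>\<^bsub>L\<^esub> \<otimes>\<^bsub>L\<^esub> f = f"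
proof (rule L_eqI)
  fix r assume r: "r \<in> paths Q"
  have z: "\<one>\<^bsub>L\<^esub> (fst z) \<otimes>\<^bsub>A\<^esub> f (snd z) = \<zero>\<^bsub>A\<^esub>"
    if "z \<in> factorizations Q r" "z \<noteq> (trivial_path (snd (snd r)), r)" for z
    using that f factorizations_left_unit[of "fst z" "snd z" r]
      factorizations_paths[of "fst z" "snd z" r] by (cases z) (auto simp: one_L')
  have "(\<one>\<^bsub>L\<^esub> \<otimes>\<^bsub>L\<^esub> f) r = \<one>\<^bsub>L\<^esub> (trivial_path (snd (snd r))) \<otimes>\<^bsub>A\<^esub> f r"
    unfolding mult_L[OF r]
    by (subst A.finsum_delta[OF finite_factorizations trivial_factorizations(1)[OF r]])
      (use z f r factorizations_paths[OF trivial_factorizations(1)[OF r]] L_one_closed in auto)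
  also have "\<dots> = f r"
    using r f factorizations_paths[OF trivial_factorizations(1)[OF r]]
    by (simp add: one_L' trivial_path_def)
  finally show "(\<one>\<^bsub>L\<^esub> \<otimes>\<^bsub>L\<^esub> f) r = f r" .
qed (use f in \<open>auto simp: L_closeds\<close>)

lemma L_one_right: assumes f: "f \<in> carrier L" shows "f \<otimes>\<^bsub>L\<^esub> \<one>\<^bsub>L\<^esub> = f"
proof (rule L_eqI)
  fix r assume r: "r \<in> paths Q"
  have z: "f (fst z) \<otimes>\<^bsub>A\<^esub> \<one>\<^bsub>L\<^esub> (snd z) = \<zero>\<^bsub>A\<^esub>"
    if "z \<in> factorizations Q r" "z \<noteq> (r, trivial_path (fst r))" for z
    using that f factorizations_right_unit[of "fst z" "snd z" r]
      factorizations_paths[of "fst z" "snd z" r] by (cases z) (auto simp: one_L')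
  have "(f \<otimes>\<^bsub>L\<^esub> \<one>\<^bsub>L\<^esub>) r = f r \<otimes>\<^bsub>A\<^esub> \<one>\<^bsub>L\<^esub> (trivial_path (fst r))"
    unfolding mult_L[OF r]
    by (subst A.finsum_delta[OF finite_factorizations trivial_factorizations(2)[OF r]])
      (use z f r factorizations_paths[OF trivial_factorizations(2)[OF r]] L_one_closed in auto)
  also have "\<dots> = f r"
    using r f factorizations_paths[OF trivial_factorizations(2)[OF r]]
    by (simp add: one_L' trivial_path_def)
  finally show "(f \<otimes>\<^bsub>L\<^esub> \<one>\<^bsub>L\<^esub>) r = f r" .
qed (use f in \<open>auto simp: L_closeds\<close>)

lemma ring_L: "ring L"
proof (rule ringI)
  show "Group.monoid L"
    by (rule monoidI) (auto simp: L_closeds L_assoc L_one_left L_one_right)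
  have pq: "\<And>z x. z \<in> factorizations Q x \<Longrightarrow> fst z \<in> paths Q \<and> snd z \<in> paths Q"
    by (auto dest: factorizations_paths)
  fix f g h assume fgh: "f \<in> carrier L" "g \<in> carrier L" "h \<in> carrier L"
  show "(f \<oplus>\<^bsub>L\<^esub> g) \<otimes>\<^bsub>L\<^esub> h = f \<otimes>\<^bsub>L\<^esub> h \<oplus>\<^bsub>L\<^esub> g \<otimes>\<^bsub>L\<^esub> h"
  proof (rule L_eqI)
    fix r assume r: "r \<in> paths Q"
    have "((f \<oplus>\<^bsub>L\<^esub> g) \<otimes>\<^bsub>L\<^esub> h) r = (\<Oplus>\<^bsub>A\<^esub>z\<in>factorizations Q r.
        f (fst z) \<otimes>\<^bsub>A\<^esub> h (snd z) \<oplus>\<^bsub>A\<^esub> g (fst z) \<otimes>\<^bsub>A\<^esub> h (snd z))"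
      unfolding mult_L[OF r]
      by (rule A.finsum_cong') (use fgh pq in \<open>auto simp: add_L A.l_distr\<close>)
    also have "\<dots> = (f \<otimes>\<^bsub>L\<^esub> h \<oplus>\<^bsub>L\<^esub> g \<otimes>\<^bsub>L\<^esub> h) r"
      unfolding add_L[OF r] mult_L[OF r]
      by (rule A.finsum_addf) (use fgh pq in auto)
    finally show "((f \<oplus>\<^bsub>L\<^esub> g) \<otimes>\<^bsub>L\<^esub> h) r = (f \<otimes>\<^bsub>L\<^esub> h \<oplus>\<^bsub>L\<^esub> g \<otimes>\<^bsub>L\<^esub> h) r" .
  qed (use fgh in \<open>auto simp: L_closeds\<close>)
  show "h \<otimes>\<^bsub>L\<^esub> (f \<oplus>\<^bsub>L\<^esub> g) = h \<otimes>\<^bsub>L\<^esub> f \<oplus>\<^bsub>L\<^esub> h \<otimes>\<^bsub>L\<^esub> g"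
  proof (rule L_eqI)
    fix r assume r: "r \<in> paths Q"
    have "(h \<otimes>\<^bsub>L\<^esub> (f \<oplus>\<^bsub>L\<^esub> g)) r = (\<Oplus>\<^bsub>A\<^esub>z\<in>factorizations Q r.
        h (fst z) \<otimes>\<^bsub>A\<^esub> f (snd z) \<oplus>\<^bsub>A\<^esub> h (fst z) \<otimes>\<^bsub>A\<^esub> g (snd z))"
      unfolding mult_L[OF r]
      by (rule A.finsum_cong') (use fgh pq in \<open>auto simp: add_L A.r_distr\<close>)
    also have "\<dots> = (h \<otimes>\<^bsub>L\<^esub> f \<oplus>\<^bsub>L\<^esub> h \<otimes>\<^bsub>L\<^esub> g) r"
      unfolding add_L[OF r] mult_L[OF r]
      by (rule A.finsum_addf) (use fgh pq in auto)
    finally show "(h \<otimes>\<^bsub>L\<^esub> (f \<oplus>\<^bsub>L\<^esub> g)) r = (h \<otimes>\<^bsub>L\<^esub> f \<oplus>\<^bsub>L\<^esub> h \<otimes>\<^bsub>L\<^esub> g) r" .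
  qed (use fgh in \<open>auto simp: L_closeds\<close>)
qed (rule abelian_group_L)

lemma module_L: "Module.module K L"
  by (intro module.intro module_axioms.intro K.is_cring abelian_group_L)
    (auto intro!: L_eqI simp: L_closeds add_L smult_L smult_l_distr smult_r_distr smult_assoc1)


abbreviation "kQ \<equiv> path_algebra (regular_module K) Q"

lemma carrier_kQ: "carrier kQ = paths Q \<rightarrow>\<^sub>E carrier K"
  by (simp add: path_algebra_def regular_module_def)

lemma kQ_closed [simp]: "\<xi> \<in> carrier kQ \<Longrightarrow> x \<in> paths Q \<Longrightarrow> \<xi> x \<in> carrier K"
  by (auto simp: carrier_kQ)

lemma smult_finsum_left:
  assumes "finite S" "g \<in> S \<rightarrow> carrier K" "a \<in> carrier A"
  shows "(\<Oplus>s\<in>S. g s) \<odot>\<^bsub>A\<^esub> a = (\<Oplus>\<^bsub>A\<^esub>s\<in>S. g s \<odot>\<^bsub>A\<^esub> a)"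
  using assms by (induction S) (auto simp: smult_l_distr Pi_def)

lemma pure_tensor_closed [simp]:
  "a \<in> carrier A \<Longrightarrow> \<xi> \<in> carrier kQ \<Longrightarrow> pure_tensor A Q a \<xi> \<in> carrier L"
  by (auto simp: pure_tensor_def carrier_L)

lemma pure_tensor_apply [simp]: "x \<in> paths Q \<Longrightarrow> pure_tensor A Q a \<xi> x = \<xi> x \<odot>\<^bsub>A\<^esub> a"
  by (simp add: pure_tensor_def)

lemma path_basis_closed [simp]: "path_basis K Q x \<in> carrier kQ"
  by (auto simp: path_basis_def carrier_kQ)

lemma pure_tensor_one: "pure_tensor A Q \<one>\<^bsub>A\<^esub> \<one>\<^bsub>kQ\<^esub> = \<one>\<^bsub>L\<^esub>"
  by (auto simp: pure_tensor_def path_algebra_def regular_module_def)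

lemma pure_tensor_mult:
  assumes a: "a \<in> carrier A" and b: "b \<in> carrier A" and x: "\<xi> \<in> carrier kQ" and y: "\<eta> \<in> carrier kQ"
  shows "pure_tensor A Q a \<xi> \<otimes>\<^bsub>L\<^esub> pure_tensor A Q b \<eta> =
    pure_tensor A Q (a \<otimes>\<^bsub>A\<^esub> b) (\<xi> \<otimes>\<^bsub>kQ\<^esub> \<eta>)"
    (is "?l = ?r")
proof
  fix r
  have pq: "\<And>z x. z \<in> factorizations Q x \<Longrightarrow> fst z \<in> paths Q \<and> snd z \<in> paths Q"
    by (auto dest: factorizations_paths)
  show "?l r = ?r r"
  proof (cases "r \<in> paths Q")
    case r: True
    have "?l r = (\<Oplus>\<^bsub>A\<^esub>z\<in>factorizations Q r. (\<xi> (fst z) \<otimes> \<eta> (snd z)) \<odot>\<^bsub>A\<^esub> (a \<otimes>\<^bsub>A\<^esub> b))"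
      unfolding mult_L[OF r]
      by (rule A.finsum_cong')
         (use a b x y pq in \<open>auto simp: smult_mult_left smult_mult_right smult_assoc1[symmetric]
            K.m_comm\<close>)
    also have "\<dots> = (\<Oplus>z\<in>factorizations Q r. \<xi> (fst z) \<otimes> \<eta> (snd z)) \<odot>\<^bsub>A\<^esub> (a \<otimes>\<^bsub>A\<^esub> b)"
      by (rule smult_finsum_left[symmetric]) (use a b x y pq finite_factorizations in auto)
    also have "(\<Oplus>z\<in>factorizations Q r. \<xi> (fst z) \<otimes> \<eta> (snd z)) = (\<xi> \<otimes>\<^bsub>kQ\<^esub> \<eta>) r"
      using r by (simp add: path_algebra_def finsum_regular) (simp add: regular_module_def)
    finally show ?thesis using r by simp
  qed (simp add: path_algebra_def pure_tensor_def)
qed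

lemma finsum_L_apply:
  assumes "finite S" "g \<in> S \<rightarrow> carrier L" "x \<in> paths Q"
  shows "(\<Oplus>\<^bsub>L\<^esub>s\<in>S. g s) x = (\<Oplus>\<^bsub>A\<^esub>s\<in>S. g s x)"
proof -
  interpret L: ring L by (rule ring_L)
  show ?thesis using assms
    by (induction S) (auto simp: Pi_def zero_L add_L)
qed

lemma L_expansion:
  assumes f: "f \<in> carrier L"
  shows "f = (\<Oplus>\<^bsub>L\<^esub>x\<in>paths Q. pure_tensor A Q (f x) (path_basis K Q x))"
proof (rule L_eqI[OF f])
  interpret L: ring L by (rule ring_L)
  show "(\<Oplus>\<^bsub>L\<^esub>x\<in>paths Q. pure_tensor A Q (f x) (path_basis K Q x)) \<in> carrier L"
    by (rule L.finsum_closed) (use f in auto)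
  fix y assume y: "y \<in> paths Q"
  have "(\<Oplus>\<^bsub>L\<^esub>x\<in>paths Q. pure_tensor A Q (f x) (path_basis K Q x)) y =
      (\<Oplus>\<^bsub>A\<^esub>x\<in>paths Q. path_basis K Q x y \<odot>\<^bsub>A\<^esub> f x)"
    using f y finite_paths by (subst finsum_L_apply) auto
  also have "\<dots> = path_basis K Q y y \<odot>\<^bsub>A\<^esub> f y"
    by (rule A.finsum_delta[OF finite_paths y]) (use f y in \<open>auto simp: path_basis_def\<close>)
  also have "\<dots> = f y" using f y by (simp add: path_basis_def)
  finally show "f y = (\<Oplus>\<^bsub>L\<^esub>x\<in>paths Q. pure_tensor A Q (f x) (path_basis K Q x)) y" by simp
qed

lemma pure_tensor_bilinear:
  assumes "a \<in> carrier A" "a' \<in> carrier A" "\<xi> \<in> carrier kQ" "\<xi>' \<in> carrier kQ" "c \<in> carrier K"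
  shows "pure_tensor A Q (a \<oplus>\<^bsub>A\<^esub> a') \<xi> = pure_tensor A Q a \<xi> \<oplus>\<^bsub>L\<^esub> pure_tensor A Q a' \<xi>"
    and "pure_tensor A Q a (\<xi> \<oplus>\<^bsub>kQ\<^esub> \<xi>') = pure_tensor A Q a \<xi> \<oplus>\<^bsub>L\<^esub> pure_tensor A Q a \<xi>'"
    and "pure_tensor A Q (c \<odot>\<^bsub>A\<^esub> a) \<xi> = c \<odot>\<^bsub>L\<^esub> pure_tensor A Q a \<xi>"
    and "pure_tensor A Q a (c \<odot>\<^bsub>kQ\<^esub> \<xi>) = c \<odot>\<^bsub>L\<^esub> pure_tensor A Q a \<xi>"
  using assms
  by (auto simp: pure_tensor_def path_algebra_def regular_module_def smult_r_distr smult_l_distr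
      smult_assoc1[symmetric] K.m_comm[of c])

end

lemma mod_hom_finsum:
  assumes "abelian_group M" "abelian_group N" and h: "h \<in> mod_hom R M N"
    and "finite S" "g \<in> S \<rightarrow> carrier M"
  shows "h (\<Oplus>\<^bsub>M\<^esub>s\<in>S. g s) = (\<Oplus>\<^bsub>N\<^esub>s\<in>S. h (g s))"
proof -
  interpret M: abelian_group M by fact
  interpret N: abelian_group N by fact
  have h0: "h \<zero>\<^bsub>M\<^esub> = \<zero>\<^bsub>N\<^esub>"
  proof -
    have "h (\<zero>\<^bsub>M\<^esub> \<oplus>\<^bsub>M\<^esub> \<zero>\<^bsub>M\<^esub>) = h \<zero>\<^bsub>M\<^esub> \<oplus>\<^bsub>N\<^esub> h \<zero>\<^bsub>M\<^esub>"
      using h M.zero_closed unfolding mod_hom_def by blast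
    moreover have "h \<zero>\<^bsub>M\<^esub> \<in> carrier N"
      using h M.zero_closed unfolding mod_hom_def by blast
    ultimately show ?thesis by (simp add: N.add.l_cancel_one)
  qed
  show ?thesis using assms(4,5)
    by (induction S) (use h h0 in \<open>auto simp: Pi_def mod_hom_def\<close>)
qed

text \<open>The universal property of the tensor product.\<close>

lemma (in quiver_algebra) path_algebra_universal:
  assumes V: "Module.module K V"
    and b: "\<And>a \<xi>. \<lbrakk>a \<in> carrier A; \<xi> \<in> carrier kQ\<rbrakk> \<Longrightarrow> b a \<xi> \<in> carrier V"
    and b_add1: "\<And>a a' \<xi>. \<lbrakk>a \<in> carrier A; a' \<in> carrier A; \<xi> \<in> carrier kQ\<rbrakk> \<Longrightarrow>
      b (a \<oplus>\<^bsub>A\<^esub> a') \<xi> = b a \<xi> \<oplus>\<^bsub>V\<^esub> b a' \<xi>"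
    and b_add2: "\<And>a \<xi> \<xi>'. \<lbrakk>a \<in> carrier A; \<xi> \<in> carrier kQ; \<xi>' \<in> carrier kQ\<rbrakk> \<Longrightarrow>
      b a (\<xi> \<oplus>\<^bsub>kQ\<^esub> \<xi>') = b a \<xi> \<oplus>\<^bsub>V\<^esub> b a \<xi>'"
    and b_smult1: "\<And>c a \<xi>. \<lbrakk>c \<in> carrier K; a \<in> carrier A; \<xi> \<in> carrier kQ\<rbrakk> \<Longrightarrow>
      b (c \<odot>\<^bsub>A\<^esub> a) \<xi> = c \<odot>\<^bsub>V\<^esub> b a \<xi>"
    and b_smult2: "\<And>c a \<xi>. \<lbrakk>c \<in> carrier K; a \<in> carrier A; \<xi> \<in> carrier kQ\<rbrakk> \<Longrightarrow>
      b a (c \<odot>\<^bsub>kQ\<^esub> \<xi>) = c \<odot>\<^bsub>V\<^esub> b a \<xi>"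
  obtains h where "h \<in> mod_hom K L V"
    and "\<And>a \<xi>. \<lbrakk>a \<in> carrier A; \<xi> \<in> carrier kQ\<rbrakk> \<Longrightarrow> h (pure_tensor A Q a \<xi>) = b a \<xi>"
    and "\<And>h' f. \<lbrakk>h' \<in> mod_hom K L V;
        \<And>a \<xi>. \<lbrakk>a \<in> carrier A; \<xi> \<in> carrier kQ\<rbrakk> \<Longrightarrow> h' (pure_tensor A Q a \<xi>) = b a \<xi>;
        f \<in> carrier L\<rbrakk> \<Longrightarrow> h' f = h f"
proof
  interpret V: Module.module K V by fact
  interpret L: ring L by (rule ring_L)
  define h where "h = (\<lambda>f. \<Oplus>\<^bsub>V\<^esub>x\<in>paths Q. b (f x) (path_basis K Q x))"
  show h_hom: "h \<in> mod_hom K L V"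
    unfolding mod_hom_def
  proof (intro CollectI conjI ballI Pi_I)
    fix f g assume fg: "f \<in> carrier L" "g \<in> carrier L"
    show "h f \<in> carrier V" unfolding h_def by (rule V.finsum_closed) (use fg b in auto)
    have "h (f \<oplus>\<^bsub>L\<^esub> g) = (\<Oplus>\<^bsub>V\<^esub>x\<in>paths Q. b (f x) (path_basis K Q x) \<oplus>\<^bsub>V\<^esub> b (g x) (path_basis K Q x))"
      unfolding h_def by (rule V.finsum_cong') (use fg b b_add1 in \<open>auto simp: add_L\<close>)
    also have "\<dots> = h f \<oplus>\<^bsub>V\<^esub> h g"
      unfolding h_def by (rule V.finsum_addf) (use fg b in auto)
    finally show "h (f \<oplus>\<^bsub>L\<^esub> g) = h f \<oplus>\<^bsub>V\<^esub> h g" .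
  next
    fix c f assume cf: "c \<in> carrier K" "f \<in> carrier L"
    have "h (c \<odot>\<^bsub>L\<^esub> f) = (\<Oplus>\<^bsub>V\<^esub>x\<in>paths Q. c \<odot>\<^bsub>V\<^esub> b (f x) (path_basis K Q x))"
      unfolding h_def by (rule V.finsum_cong') (use cf b b_smult1 in \<open>auto simp: smult_L\<close>)
    also have "\<dots> = c \<odot>\<^bsub>V\<^esub> h f"
      unfolding h_def by (rule V.finsum_smult_ldistr[symmetric]) (use cf b finite_paths in auto)
    finally show "h (c \<odot>\<^bsub>L\<^esub> f) = c \<odot>\<^bsub>V\<^esub> h f" .
  qed
  have expand: "\<xi> = (\<lambda>y\<in>paths Q. \<Oplus>x\<in>paths Q. \<xi> x \<otimes> path_basis K Q x y)"
    if "\<xi> \<in> carrier kQ" for \<xi>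
  proof
    fix y
    show "\<xi> y = (\<lambda>y\<in>paths Q. \<Oplus>x\<in>paths Q. \<xi> x \<otimes> path_basis K Q x y) y"
    proof (cases "y \<in> paths Q")
      case True
      have "(\<Oplus>x\<in>paths Q. \<xi> x \<otimes> path_basis K Q x y) = \<xi> y \<otimes> path_basis K Q y y"
        by (rule K.finsum_delta[OF finite_paths True]) (use that True in \<open>auto simp: path_basis_def\<close>)
      then show ?thesis using True that by (simp add: path_basis_def)
    next
      case False
      then show ?thesis using that PiE_arb[of \<xi> "paths Q" "\<lambda>_. carrier K" y] by (simp add: carrier_kQ)
    qed
  qed
  have b_sum: "b a (\<lambda>y\<in>paths Q. \<Oplus>x\<in>S. \<xi> x \<otimes> path_basis K Q x y) =
      (\<Oplus>\<^bsub>V\<^esub>x\<in>S. b (\<xi> x \<odot>\<^bsub>A\<^esub> a) (path_basis K Q x))"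
    if "finite S" "S \<subseteq> paths Q" "a \<in> carrier A" "\<xi> \<in> carrier kQ" for a \<xi> S
    using that(1,2)
  proof (induction S)
    case empty
    have "b a (\<lambda>y\<in>paths Q. \<zero>) = b a (\<zero> \<odot>\<^bsub>kQ\<^esub> (\<lambda>y\<in>paths Q. \<zero>))"
      by (rule arg_cong[where f = "b a"]) (auto simp: path_algebra_def regular_module_def)
    also have "\<dots> = \<zero>\<^bsub>V\<^esub>"
      using that(3) b[of a "\<lambda>y\<in>paths Q. \<zero>"] b_smult2[of \<zero> a "\<lambda>y\<in>paths Q. \<zero>"]
      by (simp add: carrier_kQ)
    finally show ?case unfolding K.finsum_empty V.finsum_empty .
  next
    case (insert s S)
    let ?\<sigma> = "\<lambda>y\<in>paths Q. \<Oplus>x\<in>S. \<xi> x \<otimes> path_basis K Q x y"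
    have \<sigma>: "?\<sigma> \<in> carrier kQ"
      using insert.prems that by (auto simp: carrier_kQ path_basis_def intro!: K.finsum_closed)
    have s: "s \<in> paths Q" using insert.prems by simp
    have "(\<lambda>y\<in>paths Q. \<Oplus>x\<in>insert s S. \<xi> x \<otimes> path_basis K Q x y) =
        (\<xi> s \<odot>\<^bsub>kQ\<^esub> path_basis K Q s) \<oplus>\<^bsub>kQ\<^esub> ?\<sigma>"
    proof
      fix y show "(\<lambda>y\<in>paths Q. \<Oplus>x\<in>insert s S. \<xi> x \<otimes> path_basis K Q x y) y =
        ((\<xi> s \<odot>\<^bsub>kQ\<^esub> path_basis K Q s) \<oplus>\<^bsub>kQ\<^esub> ?\<sigma>) y"
      proof (cases "y \<in> paths Q")
        case True
        then have "(\<Oplus>x\<in>insert s S. \<xi> x \<otimes> path_basis K Q x y) =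
            \<xi> s \<otimes> path_basis K Q s y \<oplus> (\<Oplus>x\<in>S. \<xi> x \<otimes> path_basis K Q x y)"
          using insert that s by (subst K.finsum_insert) (auto simp: path_basis_def)
        then show ?thesis using True by (simp add: path_algebra_def regular_module_def)
      qed (simp add: path_algebra_def)
    qed
    then have "b a (\<lambda>y\<in>paths Q. \<Oplus>x\<in>insert s S. \<xi> x \<otimes> path_basis K Q x y) =
        b a (\<xi> s \<odot>\<^bsub>kQ\<^esub> path_basis K Q s) \<oplus>\<^bsub>V\<^esub> b a ?\<sigma>"
      using b_add2[OF that(3) _ \<sigma>, of "\<xi> s \<odot>\<^bsub>kQ\<^esub> path_basis K Q s"] that s
      by (simp add: carrier_kQ path_algebra_def regular_module_def path_basis_def)
    also have "b a (\<xi> s \<odot>\<^bsub>kQ\<^esub> path_basis K Q s) = b (\<xi> s \<odot>\<^bsub>A\<^esub> a) (path_basis K Q s)"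
      using b_smult1 b_smult2 that s by simp
    also have "b a ?\<sigma> = (\<Oplus>\<^bsub>V\<^esub>x\<in>S. b (\<xi> x \<odot>\<^bsub>A\<^esub> a) (path_basis K Q x))"
      by (rule insert.IH) (use insert.prems in simp)
    also have "b (\<xi> s \<odot>\<^bsub>A\<^esub> a) (path_basis K Q s) \<oplus>\<^bsub>V\<^esub>
        (\<Oplus>\<^bsub>V\<^esub>x\<in>S. b (\<xi> x \<odot>\<^bsub>A\<^esub> a) (path_basis K Q x)) =
        (\<Oplus>\<^bsub>V\<^esub>x\<in>insert s S. b (\<xi> x \<odot>\<^bsub>A\<^esub> a) (path_basis K Q x))"
    proof (rule V.finsum_insert[symmetric])
      show "(\<lambda>x. b (\<xi> x \<odot>\<^bsub>A\<^esub> a) (path_basis K Q x)) \<in> S \<rightarrow> carrier V"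
        using insert.prems that b by (auto simp del: split_paired_All)
      show "b (\<xi> s \<odot>\<^bsub>A\<^esub> a) (path_basis K Q s) \<in> carrier V"
        using s that b by simp
    qed (rule insert.hyps)+
    finally show ?case .
  qed
  show h_tensor: "h (pure_tensor A Q a \<xi>) = b a \<xi>" if "a \<in> carrier A" "\<xi> \<in> carrier kQ" for a \<xi>
  proof -
    have "h (pure_tensor A Q a \<xi>) = (\<Oplus>\<^bsub>V\<^esub>x\<in>paths Q. b (\<xi> x \<odot>\<^bsub>A\<^esub> a) (path_basis K Q x))"
      unfolding h_def by (rule V.finsum_cong') (use that b in auto)
    also have "\<dots> = b a \<xi>"
      using b_sum[OF finite_paths subset_refl that] expand[OF that(2)] by simp
    finally show ?thesis .
  qed
  show "h' f = h f"
    if h': "h' \<in> mod_hom K L V"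
      "\<And>a \<xi>. \<lbrakk>a \<in> carrier A; \<xi> \<in> carrier kQ\<rbrakk> \<Longrightarrow> h' (pure_tensor A Q a \<xi>) = b a \<xi>"
    and f: "f \<in> carrier L" for h' f
  proof -
    have *: "k f = (\<Oplus>\<^bsub>V\<^esub>x\<in>paths Q. k (pure_tensor A Q (f x) (path_basis K Q x)))"
      if "k \<in> mod_hom K L V" for k
      by (subst L_expansion[OF f], rule mod_hom_finsum[OF abelian_group_L V.abelian_group_axioms that finite_paths])
        (use f in auto)
    show ?thesis
      unfolding *[OF h'(1)] *[OF h_hom]
      by (rule V.finsum_cong') (use f b h' h_tensor in auto)
  qed
qed

text \<open>The spaces of the representation are modules over \<open>A\<close>.\<close>

lemma (in fd_algebra) fd_algebra_regular: "fd_algebra K (regular_module K)"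
proof -
  have ab: "abelian_group (regular_module K)"
    by (rule abelian_groupI) (auto simp: regular_module_def K.a_ac intro: K.l_neg)
  have "ring (regular_module K)"
    by (rule ringI[OF ab]) (auto simp: regular_module_def K.l_distr K.r_distr K.m_assoc
        intro!: Group.monoidI)
  moreover have "Module.module K (regular_module K)"
    by (intro module.intro module_axioms.intro K.is_cring ab)
       (auto simp: regular_module_def K.l_distr K.r_distr K.m_assoc)
  moreover have "finitely_generated K (regular_module K)"
    unfolding finitely_generated_def
  proof (intro exI[of _ "{\<one>}"] conjI ballI)
    fix x assume x: "x \<in> carrier (regular_module K)"
    show "\<exists>c\<in>{\<one>} \<rightarrow> carrier K.
        x = (\<Oplus>\<^bsub>regular_module K\<^esub>s\<in>{\<one>}. c s \<odot>\<^bsub>regular_module K\<^esub> s)"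
      using x unfolding finsum_regular by (intro bexI[of _ "\<lambda>_. x"]) (auto simp: regular_module_def)
  qed (auto simp: regular_module_def)
  ultimately show ?thesis
    by (intro fd_algebra.intro fd_algebra_axioms.intro K.field_axioms)
       (auto simp: regular_module_def K.m_ac)
qed

lemma (in quiver_algebra) rep_space_module:
  assumes X: "left_module L X" and i: "i \<in> verts Q"
  shows "left_module A (rep_space K A Q X i)"
proof -
  interpret X: left_module L X by (rule X)
  interpret k: quiver_algebra K "regular_module K" Q
    by (intro quiver_algebra.intro fd_algebra_regular acyclic_quiver_axioms)
  let ?V = "rep_space K A Q X i"
  define e where "e = pure_tensor A Q \<one>\<^bsub>A\<^esub> (path_basis K Q (trivial_path i))"
  define t where "t a = pure_tensor A Q a \<one>\<^bsub>kQ\<^esub>" for a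
  have e [simp]: "e \<in> carrier L" by (simp add: e_def)
  have t [simp]: "t a \<in> carrier L" if "a \<in> carrier A" for a
    using that k.L_one_closed by (simp add: t_def)
  have te: "t a \<otimes>\<^bsub>L\<^esub> e = e \<otimes>\<^bsub>L\<^esub> t a" if "a \<in> carrier A" for a
    unfolding t_def e_def
    using that k.L_one_closed by (simp add: pure_tensor_mult k.L_one_left k.L_one_right)
  have V: "carrier ?V = (\<lambda>x. e \<odot>\<^bsub>X\<^esub> x) ` carrier X" "\<zero>\<^bsub>?V\<^esub> = \<zero>\<^bsub>X\<^esub>"
      "x \<oplus>\<^bsub>?V\<^esub> y = x \<oplus>\<^bsub>X\<^esub> y" "a \<odot>\<^bsub>?V\<^esub> x = t a \<odot>\<^bsub>X\<^esub> x" for a x y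
    by (simp_all add: rep_space_def e_def t_def)
  have sub: "x \<in> carrier X" if "x \<in> carrier ?V" for x
    using that by (auto simp: V)
  have add: "x \<oplus>\<^bsub>X\<^esub> y \<in> carrier ?V" if "x \<in> carrier ?V" "y \<in> carrier ?V" for x y
    using that by (auto simp: V X.smult_r_distr[symmetric])
  have e0: "e \<odot>\<^bsub>X\<^esub> \<zero>\<^bsub>X\<^esub> = \<zero>\<^bsub>X\<^esub>"
  proof -
    have "e \<odot>\<^bsub>X\<^esub> \<zero>\<^bsub>X\<^esub> \<oplus>\<^bsub>X\<^esub> e \<odot>\<^bsub>X\<^esub> \<zero>\<^bsub>X\<^esub> = e \<odot>\<^bsub>X\<^esub> \<zero>\<^bsub>X\<^esub>"
      by (simp add: X.smult_r_distr[symmetric])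
    then show ?thesis by (simp add: X.M.add.l_cancel_one)
  qed
  have zero: "\<zero>\<^bsub>X\<^esub> \<in> carrier ?V"
    unfolding V using e0 by (intro image_eqI[of _ _ "\<zero>\<^bsub>X\<^esub>"]) auto
  have smult: "t a \<odot>\<^bsub>X\<^esub> x \<in> carrier ?V" if "a \<in> carrier A" "x \<in> carrier ?V" for a x
    using that by (auto simp: V X.smult_assoc1[symmetric] te) (auto simp: X.smult_assoc1)
  show ?thesis
  proof (intro left_module.intro left_module_axioms.intro A.ring_axioms abelian_groupI)
    fix x assume "x \<in> carrier ?V"
    then obtain y where y: "y \<in> carrier X" "x = e \<odot>\<^bsub>X\<^esub> y" by (auto simp: V)
    then have "e \<odot>\<^bsub>X\<^esub> (\<ominus>\<^bsub>X\<^esub> y) \<oplus>\<^bsub>X\<^esub> x = \<zero>\<^bsub>X\<^esub>"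
      by (simp add: X.smult_r_distr[symmetric] X.M.l_neg e0)
    then show "\<exists>z\<in>carrier ?V. z \<oplus>\<^bsub>?V\<^esub> x = \<zero>\<^bsub>?V\<^esub>"
      using y by (auto simp: V)
  next
    fix a b x assume abx: "a \<in> carrier A" "b \<in> carrier A" "x \<in> carrier ?V"
    have "t (a \<oplus>\<^bsub>A\<^esub> b) = t a \<oplus>\<^bsub>L\<^esub> t b"
      unfolding t_def using abx k.L_one_closed by (intro pure_tensor_bilinear(1)) auto
    then show "(a \<oplus>\<^bsub>A\<^esub> b) \<odot>\<^bsub>?V\<^esub> x = a \<odot>\<^bsub>?V\<^esub> x \<oplus>\<^bsub>?V\<^esub> b \<odot>\<^bsub>?V\<^esub> x"
      using abx sub by (simp add: V X.smult_l_distr)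
    have "t (a \<otimes>\<^bsub>A\<^esub> b) = t a \<otimes>\<^bsub>L\<^esub> t b"
      unfolding t_def using abx k.L_one_closed by (simp add: pure_tensor_mult k.L_one_left)
    then show "(a \<otimes>\<^bsub>A\<^esub> b) \<odot>\<^bsub>?V\<^esub> x = a \<odot>\<^bsub>?V\<^esub> (b \<odot>\<^bsub>?V\<^esub> x)"
      using abx sub by (simp add: V X.smult_assoc1)
  next
    fix x assume "x \<in> carrier ?V"
    then show "\<one>\<^bsub>A\<^esub> \<odot>\<^bsub>?V\<^esub> x = x"
      using sub by (simp add: V t_def pure_tensor_one)
  qed (use sub add zero smult in \<open>auto simp: V(2-4) X.M.add.m_ac X.smult_r_distr\<close>)
qed

lemma fg_projective_representative:
  fixes P :: "('r, 'm) module"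
  assumes "fg_projective R P"
  obtains P' :: "('r, nat \<Rightarrow> 'r) module" where "fg_projective R P'" "mod_iso R P P'"
proof -
  interpret P: left_module R P using assms by (simp add: fg_projective_def)
  obtain n i p where i: "i \<in> mod_hom R P (free_module R n)"
    and p: "p \<in> mod_hom R (free_module R n) P" and pi: "\<And>x. x \<in> carrier P \<Longrightarrow> p (i x) = x"
    using assms by (auto simp: fg_projective_def)
  define P' where "P' = restrict_carrier (free_module R n) (i ` carrier P)"
  have i_add: "i (x \<oplus>\<^bsub>P\<^esub> y) = i x \<oplus>\<^bsub>P'\<^esub> i y" if "x \<in> carrier P" "y \<in> carrier P" for x y
    using i that by (auto simp: mod_hom_def P'_def restrict_carrier_def)
  have i_smult: "i (a \<odot>\<^bsub>P\<^esub> x) = a \<odot>\<^bsub>P'\<^esub> i x" if "a \<in> carrier R" "x \<in> carrier P" for a x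
    using i that by (auto simp: mod_hom_def P'_def restrict_carrier_def)
  have i_zero: "i \<zero>\<^bsub>P\<^esub> = \<zero>\<^bsub>P'\<^esub>"
  proof -
    have *: "i \<zero>\<^bsub>P\<^esub> \<in> {..<n} \<rightarrow>\<^sub>E carrier R"
      using i by (auto simp: mod_hom_def free_module_def)
    have "i \<zero>\<^bsub>P\<^esub> = i (\<zero>\<^bsub>R\<^esub> \<odot>\<^bsub>P\<^esub> \<zero>\<^bsub>P\<^esub>)"
    proof -
      have "\<zero>\<^bsub>R\<^esub> \<odot>\<^bsub>P\<^esub> \<zero>\<^bsub>P\<^esub> \<oplus>\<^bsub>P\<^esub> \<zero>\<^bsub>R\<^esub> \<odot>\<^bsub>P\<^esub> \<zero>\<^bsub>P\<^esub> = \<zero>\<^bsub>R\<^esub> \<odot>\<^bsub>P\<^esub> \<zero>\<^bsub>P\<^esub>"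
        using P.smult_l_distr[of "\<zero>\<^bsub>R\<^esub>" "\<zero>\<^bsub>R\<^esub>" "\<zero>\<^bsub>P\<^esub>"] by simp
      then have "\<zero>\<^bsub>R\<^esub> \<odot>\<^bsub>P\<^esub> \<zero>\<^bsub>P\<^esub> = \<zero>\<^bsub>P\<^esub>"
        by (simp add: P.M.add.l_cancel_one)
      then show ?thesis by simp
    qed
    also have "\<dots> = \<zero>\<^bsub>R\<^esub> \<odot>\<^bsub>P'\<^esub> i \<zero>\<^bsub>P\<^esub>" by (rule i_smult) auto
    also have "\<dots> = (\<lambda>j\<in>{..<n}. \<zero>\<^bsub>R\<^esub> \<otimes>\<^bsub>R\<^esub> i \<zero>\<^bsub>P\<^esub> j)"
      by (simp add: P'_def restrict_carrier_def free_module_def)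
    also have "\<dots> = (\<lambda>j\<in>{..<n}. \<zero>\<^bsub>R\<^esub>)"
      by (rule restrict_ext, rule P.R.l_null, rule PiE_mem[OF *])
    also have "\<dots> = \<zero>\<^bsub>P'\<^esub>"
      by (simp add: P'_def restrict_carrier_def free_module_def)
    finally show ?thesis .
  qed
  have carr: "carrier P' = i ` carrier P" by (simp add: P'_def restrict_carrier_def)
  have "left_module R P'"
  proof (intro left_module.intro left_module_axioms.intro P.R.ring_axioms abelian_groupI)
    fix x assume "x \<in> carrier P'"
    then obtain y where "y \<in> carrier P" "x = i y" by (auto simp: carr)
    then show "\<exists>z\<in>carrier P'. z \<oplus>\<^bsub>P'\<^esub> x = \<zero>\<^bsub>P'\<^esub>"
      by (intro bexI[of _ "i (\<ominus>\<^bsub>P\<^esub> y)"])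
         (auto simp: carr i_add[symmetric] P.M.l_neg i_zero)
  qed (auto simp: carr i_add[symmetric] i_smult[symmetric] i_zero[symmetric] P.M.add.m_ac
      P.smult_l_distr P.smult_r_distr P.smult_assoc1)
  moreover have "inj_on i (carrier P)" by (rule inj_on_inverseI[of _ p]) (rule pi)
  then have "mod_iso R P P'"
    unfolding mod_iso_def
    by (intro bexI[of _ i]) (auto simp: bij_betw_def carr mod_hom_def i_add i_smult)
  moreover have "(\<lambda>x. x) \<in> mod_hom R P' (free_module R n)"
    using i by (auto simp: mod_hom_def carr) (auto simp: P'_def restrict_carrier_def)
  moreover have "(\<lambda>x. i (p x)) \<in> mod_hom R (free_module R n) P'"
    using p by (auto simp: mod_hom_def carr i_add i_smult Pi_def)
  ultimately show ?thesis
    using that[of P'] pi unfolding fg_projective_def by (force simp: carr)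
qed

end

theory Submission
  imports Defs
begin

text \<open>
  If the cokernels are Gorenstein-projective, a monic \<open>X\<close> is built up from them, adding the vertices in
  an order in which arrows point forward. For a set \<open>S\<close> of vertices closed under predecessors let
  \<open>X\<^sub>S\<close> be the submodule generated by the \<open>X\<^sub>j\<close>, \<open>j \<in> S\<close>. Since \<open>X\<close> is monic, adding a vertex
  \<open>i\<close> enlarges \<open>X\<^sub>S\<close> by the module induced from the cokernel at \<open>i\<close>. Inducing from \<open>A\<close> to the path
  algebra \<open>L\<close> preserves complete resolutions, and a complete resolution of an extension is obtained by
  twisting the differential on the sum of complete resolutions of its ends.

  Conversely, let \<open>P\<close> be a complete \<open>L\<close>-projective resolution with \<open>X = Ker d\<^sup>0\<close>. On a projective
  \<open>L\<close>-module the structure maps have \<open>A\<close>-linear retractions that separate the arrows, so that it is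
  monic, with projective spaces and projective cokernels; monicity passes to the submodule \<open>X\<close>. Taking
  the spaces and the cokernels at \<open>i\<close> gives complexes \<open>P\<^sub>i\<close> and \<open>K\<^sub>i\<close> of projective \<open>A\<close>-modules,
  whose exactness follows from that of \<open>P\<close> and the retractions. The point is the exactness of
  \<open>Hom(K\<^sub>i, A)\<close>. A cocycle \<open>f\<close> lifts to an \<open>L\<close>-linear map into \<open>L e\<^sub>i\<close>, whose composite with the
  differential has values in the arrow ideal and is therefore corrected by cochains with values in the
  \<open>L \<alpha>\<close>, \<open>\<alpha>\<close> starting at \<open>i\<close>; the corrected lift is a cocycle, hence a coboundary. The exactness of
  \<open>Hom(P\<^sub>i, A)\<close> follows by induction along the arrows.
\<close>

section \<open>Modules and their homomorphisms\<close>

text \<open>Behind both directions stands the fact that \<open>kQ\<close> is hereditary. The module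
  \<open>A\<close>, placed at the vertex i, is \<open>L e_i\<close> modulo its arrow ideal, and that
  ideal is a direct sum of copies of \<open>L e_j\<close>, one for each arrow from i to j. Since
  \<open>Hom_A(K_i, A)\<close> is \<open>Hom_L(P, -)\<close> of this module, its two-term projective
  resolution yields exactness. By contrast \<open>Hom_A(P_i, A)\<close> is
  \<open>Hom_L(P, -)\<close> of the A-dual of \<open>e_i L\<close>, which need not be projective; it
  is filtered by the modules \<open>A\<close> placed at vertices with a path to i, and this dictates
  the induction along arrows.

  Nothing is assumed about \<open>A\<close> that would describe Gorenstein-projectivity by vanishing
  of Ext groups, so every complete resolution has to be exhibited. For that reason projectivity is
  handled through dual bases: functionals and vectors can be carried explicitly through induction
  from \<open>A\<close> to \<open>L\<close>, restriction to a vertex and passage to a direct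
  summand. Quotients never occur as terms of a complex; the cokernels of a projective are realised
  as images of idempotents.\<close>

context left_module
begin

lemma smult_l_null [simp]:
  assumes "x \<in> carrier M" shows "\<zero> \<odot>\<^bsub>M\<^esub> x = \<zero>\<^bsub>M\<^esub>"
proof -
  have "\<zero> \<odot>\<^bsub>M\<^esub> x \<oplus>\<^bsub>M\<^esub> \<zero> \<odot>\<^bsub>M\<^esub> x = \<zero> \<odot>\<^bsub>M\<^esub> x"
    using smult_l_distr[of \<zero> \<zero> x] assms by simp
  then show ?thesis using assms by (simp add: M.add.l_cancel_one)
qed

lemma smult_r_null [simp]:
  assumes "a \<in> carrier R" shows "a \<odot>\<^bsub>M\<^esub> \<zero>\<^bsub>M\<^esub> = \<zero>\<^bsub>M\<^esub>"
proof -
  have "a \<odot>\<^bsub>M\<^esub> \<zero>\<^bsub>M\<^esub> \<oplus>\<^bsub>M\<^esub> a \<odot>\<^bsub>M\<^esub> \<zero>\<^bsub>M\<^esub> = a \<odot>\<^bsub>M\<^esub> \<zero>\<^bsub>M\<^esub>"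
    using smult_r_distr[of a "\<zero>\<^bsub>M\<^esub>" "\<zero>\<^bsub>M\<^esub>"] assms by simp
  then show ?thesis using assms by (simp add: M.add.l_cancel_one)
qed

lemma smult_r_minus:
  assumes "a \<in> carrier R" "x \<in> carrier M" shows "a \<odot>\<^bsub>M\<^esub> (\<ominus>\<^bsub>M\<^esub> x) = \<ominus>\<^bsub>M\<^esub> (a \<odot>\<^bsub>M\<^esub> x)"
proof (rule M.minus_equality[symmetric])
  show "a \<odot>\<^bsub>M\<^esub> \<ominus>\<^bsub>M\<^esub> x \<oplus>\<^bsub>M\<^esub> a \<odot>\<^bsub>M\<^esub> x = \<zero>\<^bsub>M\<^esub>"
    using assms by (simp add: smult_r_distr[symmetric] M.l_neg)
qed (use assms in auto)

lemma smult_l_minus: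
  assumes "a \<in> carrier R" "x \<in> carrier M" shows "(\<ominus> a) \<odot>\<^bsub>M\<^esub> x = \<ominus>\<^bsub>M\<^esub> (a \<odot>\<^bsub>M\<^esub> x)"
proof (rule M.minus_equality[symmetric])
  show "(\<ominus> a) \<odot>\<^bsub>M\<^esub> x \<oplus>\<^bsub>M\<^esub> a \<odot>\<^bsub>M\<^esub> x = \<zero>\<^bsub>M\<^esub>"
    using assms by (simp add: smult_l_distr[symmetric] R.l_neg)
qed (use assms in auto)

lemma smult_finsum_right:
  assumes "finite S" "g \<in> S \<rightarrow> carrier M" "a \<in> carrier R"
  shows "a \<odot>\<^bsub>M\<^esub> (\<Oplus>\<^bsub>M\<^esub>s\<in>S. g s) = (\<Oplus>\<^bsub>M\<^esub>s\<in>S. a \<odot>\<^bsub>M\<^esub> g s)"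
  using assms by (induction S) (auto simp: smult_r_distr Pi_def)

lemma smult_finsum_left:
  assumes "finite S" "g \<in> S \<rightarrow> carrier R" "x \<in> carrier M"
  shows "(\<Oplus>s\<in>S. g s) \<odot>\<^bsub>M\<^esub> x = (\<Oplus>\<^bsub>M\<^esub>s\<in>S. g s \<odot>\<^bsub>M\<^esub> x)"
  using assms by (induction S) (auto simp: smult_l_distr Pi_def)

lemma add_minus_cancel:
  assumes "x \<in> carrier M" "y \<in> carrier M"
  shows "x \<oplus>\<^bsub>M\<^esub> (y \<ominus>\<^bsub>M\<^esub> x) = y" "(x \<oplus>\<^bsub>M\<^esub> y) \<ominus>\<^bsub>M\<^esub> x = y" "(x \<oplus>\<^bsub>M\<^esub> y) \<ominus>\<^bsub>M\<^esub> y = x"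
proof -
  have a: "x \<oplus>\<^bsub>M\<^esub> (y \<oplus>\<^bsub>M\<^esub> \<ominus>\<^bsub>M\<^esub> x) = y"
    using assms by (subst M.add.m_lcomm) (auto simp: M.r_neg)
  then show "x \<oplus>\<^bsub>M\<^esub> (y \<ominus>\<^bsub>M\<^esub> x) = y" by (simp add: a_minus_def)
  show "(x \<oplus>\<^bsub>M\<^esub> y) \<ominus>\<^bsub>M\<^esub> x = y" using assms a by (simp add: a_minus_def M.a_assoc)
  show "(x \<oplus>\<^bsub>M\<^esub> y) \<ominus>\<^bsub>M\<^esub> y = x" using assms by (simp add: a_minus_def M.a_assoc M.r_neg)
qed

lemma minus_eq_zero_iff:
  assumes "x \<in> carrier M" "y \<in> carrier M"
  shows "x \<ominus>\<^bsub>M\<^esub> y = \<zero>\<^bsub>M\<^esub> \<longleftrightarrow> x = y"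
  using assms by (metis M.add.inv_closed M.minus_closed M.minus_eq M.r_neg M.r_zero add_minus_cancel(1))

end

section \<open>Homomorphisms and pointwise operations on them\<close>

lemma mod_homI:
  assumes "\<And>x. x \<in> carrier M \<Longrightarrow> f x \<in> carrier N"
    and "\<And>x y. x \<in> carrier M \<Longrightarrow> y \<in> carrier M \<Longrightarrow> f (x \<oplus>\<^bsub>M\<^esub> y) = f x \<oplus>\<^bsub>N\<^esub> f y"
    and "\<And>a x. a \<in> carrier R \<Longrightarrow> x \<in> carrier M \<Longrightarrow> f (a \<odot>\<^bsub>M\<^esub> x) = a \<odot>\<^bsub>N\<^esub> f x"
  shows "f \<in> mod_hom R M N"
  using assms by (auto simp: mod_hom_def)

lemma mod_homD:
  assumes "f \<in> mod_hom R M N"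
  shows "x \<in> carrier M \<Longrightarrow> f x \<in> carrier N"
    and "x \<in> carrier M \<Longrightarrow> y \<in> carrier M \<Longrightarrow> f (x \<oplus>\<^bsub>M\<^esub> y) = f x \<oplus>\<^bsub>N\<^esub> f y"
    and "a \<in> carrier R \<Longrightarrow> x \<in> carrier M \<Longrightarrow> f (a \<odot>\<^bsub>M\<^esub> x) = a \<odot>\<^bsub>N\<^esub> f x"
  using assms by (auto simp: mod_hom_def)

lemma mod_hom_zero:
  assumes "left_module R M" "left_module R N" and f: "f \<in> mod_hom R M N"
  shows "f \<zero>\<^bsub>M\<^esub> = \<zero>\<^bsub>N\<^esub>"
proof -
  interpret M: left_module R M by fact
  interpret N: left_module R N by fact
  have "f (\<zero>\<^bsub>R\<^esub> \<odot>\<^bsub>M\<^esub> \<zero>\<^bsub>M\<^esub>) = \<zero>\<^bsub>R\<^esub> \<odot>\<^bsub>N\<^esub> f \<zero>\<^bsub>M\<^esub>"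
    by (rule mod_homD(3)[OF f]) auto
  then show ?thesis using mod_homD(1)[OF f, of "\<zero>\<^bsub>M\<^esub>"] by simp
qed

lemma mod_hom_minus:
  assumes "left_module R M" "left_module R N" and f: "f \<in> mod_hom R M N"
  shows "x \<in> carrier M \<Longrightarrow> f (\<ominus>\<^bsub>M\<^esub> x) = \<ominus>\<^bsub>N\<^esub> f x"
    "x \<in> carrier M \<Longrightarrow> y \<in> carrier M \<Longrightarrow> f (x \<ominus>\<^bsub>M\<^esub> y) = f x \<ominus>\<^bsub>N\<^esub> f y"
proof -
  interpret M: left_module R M by fact
  interpret N: left_module R N by fact
  have m: "f (\<ominus>\<^bsub>M\<^esub> x) = \<ominus>\<^bsub>N\<^esub> f x" if "x \<in> carrier M" for x
    using that mod_homD(1)[OF f] mod_hom_zero[OF assms(1-3)]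
    by (intro N.M.minus_equality[symmetric]) (auto simp: M.M.l_neg mod_homD(2)[OF f, symmetric])
  then show "x \<in> carrier M \<Longrightarrow> f (\<ominus>\<^bsub>M\<^esub> x) = \<ominus>\<^bsub>N\<^esub> f x" .
  show "x \<in> carrier M \<Longrightarrow> y \<in> carrier M \<Longrightarrow> f (x \<ominus>\<^bsub>M\<^esub> y) = f x \<ominus>\<^bsub>N\<^esub> f y"
    using m[of y] mod_homD(2)[OF f, of x "\<ominus>\<^bsub>M\<^esub> y"] by (simp add: a_minus_def)
qed

lemma mod_hom_comp:
  "f \<in> mod_hom R M N \<Longrightarrow> g \<in> mod_hom R N P \<Longrightarrow> (\<lambda>x. g (f x)) \<in> mod_hom R M P"
  by (auto simp: mod_hom_def Pi_def)

lemma mod_hom_zero_fun: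
  assumes "left_module R N" shows "(\<lambda>x. \<zero>\<^bsub>N\<^esub>) \<in> mod_hom R M N"
proof -
  interpret N: left_module R N by fact
  show ?thesis by (auto simp: mod_hom_def)
qed

lemma mod_hom_add_fun:
  assumes "left_module R N" "f \<in> mod_hom R M N" "g \<in> mod_hom R M N"
  shows "(\<lambda>x. f x \<oplus>\<^bsub>N\<^esub> g x) \<in> mod_hom R M N"
proof -
  interpret N: left_module R N by fact
  show ?thesis using mod_homD[OF assms(2)] mod_homD[OF assms(3)]
    by (intro mod_homI) (auto simp: N.smult_r_distr N.M.add.m_ac)
qed

lemma mod_hom_uminus_fun:
  assumes "left_module R N" "f \<in> mod_hom R M N"
  shows "(\<lambda>x. \<ominus>\<^bsub>N\<^esub> f x) \<in> mod_hom R M N"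
proof -
  interpret N: left_module R N by fact
  show ?thesis using mod_homD[OF assms(2)]
    by (intro mod_homI) (auto simp: N.smult_r_minus N.M.minus_add)
qed

lemma mod_hom_minus_fun:
  assumes "left_module R N" "f \<in> mod_hom R M N" "g \<in> mod_hom R M N"
  shows "(\<lambda>x. f x \<ominus>\<^bsub>N\<^esub> g x) \<in> mod_hom R M N"
  unfolding a_minus_def by (intro mod_hom_add_fun mod_hom_uminus_fun assms)

lemma mod_hom_finsum_fun:
  assumes "left_module R N" "finite I" "\<And>k. k \<in> I \<Longrightarrow> f k \<in> mod_hom R M N"
  shows "(\<lambda>x. \<Oplus>\<^bsub>N\<^esub>k\<in>I. f k x) \<in> mod_hom R M N"
proof -
  interpret N: left_module R N by fact
  show ?thesis
  proof (rule mod_homI)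
    fix x y assume xy: "x \<in> carrier M" "y \<in> carrier M"
    have *: "(\<lambda>k. f k z) \<in> I \<rightarrow> carrier N" if "z \<in> carrier M" for z
      using that mod_homD(1)[OF assms(3)] by auto
    show "(\<Oplus>\<^bsub>N\<^esub>k\<in>I. f k x) \<in> carrier N" using *[OF xy(1)] by (rule N.M.finsum_closed)
    have "(\<Oplus>\<^bsub>N\<^esub>k\<in>I. f k (x \<oplus>\<^bsub>M\<^esub> y)) = (\<Oplus>\<^bsub>N\<^esub>k\<in>I. f k x \<oplus>\<^bsub>N\<^esub> f k y)"
      by (rule N.M.finsum_cong')
        (use xy in \<open>auto simp: mod_homD(2)[OF assms(3)] intro!: N.M.add.m_closed mod_homD(1)[OF assms(3)]\<close>)
    also have "\<dots> = (\<Oplus>\<^bsub>N\<^esub>k\<in>I. f k x) \<oplus>\<^bsub>N\<^esub> (\<Oplus>\<^bsub>N\<^esub>k\<in>I. f k y)"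
      by (rule N.M.finsum_addf) (use * xy in auto)
    finally show "(\<Oplus>\<^bsub>N\<^esub>k\<in>I. f k (x \<oplus>\<^bsub>M\<^esub> y)) = (\<Oplus>\<^bsub>N\<^esub>k\<in>I. f k x) \<oplus>\<^bsub>N\<^esub> (\<Oplus>\<^bsub>N\<^esub>k\<in>I. f k y)" .
  next
    fix a x assume ax: "a \<in> carrier R" "x \<in> carrier M"
    have *: "(\<lambda>k. f k x) \<in> I \<rightarrow> carrier N"
      using ax mod_homD(1)[OF assms(3)] by auto
    show "(\<Oplus>\<^bsub>N\<^esub>k\<in>I. f k (a \<odot>\<^bsub>M\<^esub> x)) = a \<odot>\<^bsub>N\<^esub> (\<Oplus>\<^bsub>N\<^esub>k\<in>I. f k x)"
      unfolding N.smult_finsum_right[OF assms(2) * ax(1)]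
      by (rule N.M.finsum_cong')
        (use ax in \<open>auto simp: mod_homD(3)[OF assms(3)] intro!: N.smult_closed mod_homD(1)[OF assms(3)]\<close>)
  qed
qed

lemma regular_module_simps [simp]:
  "carrier (regular_module R) = carrier R" "zero (regular_module R) = zero R"
  "add (regular_module R) = add R" "smult (regular_module R) = mult R"
  by (simp_all add: regular_module_def)

lemma left_module_regular: assumes "ring R" shows "left_module R (regular_module R)"
proof -
  interpret ring R by fact
  show ?thesis
  proof (intro left_module.intro left_module_axioms.intro assms abelian_groupI)
    fix x assume "x \<in> carrier (regular_module R)"
    then show "\<exists>y\<in>carrier (regular_module R). y \<oplus>\<^bsub>regular_module R\<^esub> x = \<zero>\<^bsub>regular_module R\<^esub>"
      by (intro bexI[of _ "\<ominus>\<^bsub>R\<^esub> x"]) (auto simp: l_neg)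
  qed (auto simp: add.m_ac l_distr r_distr m_assoc)
qed

text \<open>Rank-one maps: every homomorphism out of a module with a dual basis is a finite sum of
  these. The values of \<open>f\<close> act on \<open>b\<close> from the left, so linearity holds
  over a noncommutative ring.\<close>

lemma mod_hom_smult_vector:
  assumes "left_module R N" "f \<in> mod_hom R M (regular_module R)" "b \<in> carrier N"
  shows "(\<lambda>x. f x \<odot>\<^bsub>N\<^esub> b) \<in> mod_hom R M N"
proof -
  interpret N: left_module R N by fact
  show ?thesis using mod_homD[OF assms(2)] assms(3)
    by (intro mod_homI) (auto simp: N.smult_l_distr N.smult_assoc1)
qed

section \<open>Submodules, kernels and restricted carriers\<close>

definition left_submodule :: "('r, 'z) ring_scheme \<Rightarrow> ('r, 'm) module \<Rightarrow> 'm set \<Rightarrow> bool" where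
  "left_submodule R M N \<longleftrightarrow> N \<subseteq> carrier M \<and> \<zero>\<^bsub>M\<^esub> \<in> N \<and>
     (\<forall>x\<in>N. \<forall>y\<in>N. x \<oplus>\<^bsub>M\<^esub> y \<in> N) \<and> (\<forall>a\<in>carrier R. \<forall>x\<in>N. a \<odot>\<^bsub>M\<^esub> x \<in> N)"

lemma left_submoduleD:
  assumes "left_submodule R M N"
  shows "x \<in> N \<Longrightarrow> x \<in> carrier M" "\<zero>\<^bsub>M\<^esub> \<in> N" "x \<in> N \<Longrightarrow> y \<in> N \<Longrightarrow> x \<oplus>\<^bsub>M\<^esub> y \<in> N"
    "a \<in> carrier R \<Longrightarrow> x \<in> N \<Longrightarrow> a \<odot>\<^bsub>M\<^esub> x \<in> N"
  using assms by (auto simp: left_submodule_def)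

text \<open>Negation is the action of the scalar \<open>-1\<close>.\<close>

lemma left_submodule_minus:
  assumes "left_module R M" "left_submodule R M N"
  shows "x \<in> N \<Longrightarrow> \<ominus>\<^bsub>M\<^esub> x \<in> N" "x \<in> N \<Longrightarrow> y \<in> N \<Longrightarrow> x \<ominus>\<^bsub>M\<^esub> y \<in> N"
proof -
  interpret M: left_module R M by fact
  show *: "\<ominus>\<^bsub>M\<^esub> x \<in> N" if "x \<in> N" for x
    using left_submoduleD(4)[OF assms(2), of "\<ominus>\<^bsub>R\<^esub> \<one>\<^bsub>R\<^esub>" x] left_submoduleD(1)[OF assms(2) that] that
    by (simp add: M.smult_l_minus)
  show "x \<in> N \<Longrightarrow> y \<in> N \<Longrightarrow> x \<ominus>\<^bsub>M\<^esub> y \<in> N"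
    unfolding a_minus_def by (intro left_submoduleD(3)[OF assms(2)] *)
qed

lemma restrict_carrier_simps [simp]:
  "carrier (restrict_carrier M N) = N" "zero (restrict_carrier M N) = zero M"
  "add (restrict_carrier M N) = add M" "smult (restrict_carrier M N) = smult M"
  by (simp_all add: restrict_carrier_def)

lemma left_module_restrict:
  assumes "left_module R M" "left_submodule R M N"
  shows "left_module R (restrict_carrier M N)"
proof -
  interpret M: left_module R M by fact
  note D = left_submoduleD[OF assms(2)]
  show ?thesis
  proof (intro left_module.intro left_module_axioms.intro M.R.ring_axioms abelian_groupI)
    fix x assume "x \<in> carrier (restrict_carrier M N)"
    then show "\<exists>y\<in>carrier (restrict_carrier M N). y \<oplus>\<^bsub>restrict_carrier M N\<^esub> x = \<zero>\<^bsub>restrict_carrier M N\<^esub>"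
      using left_submodule_minus(1)[OF assms] D(1) by (auto intro!: bexI[of _ "\<ominus>\<^bsub>M\<^esub> x"] simp: M.M.l_neg)
  qed (use D in \<open>auto simp: M.M.add.m_ac M.smult_l_distr M.smult_r_distr M.smult_assoc1\<close>)
qed

lemma mod_hom_restrict_carrier:
  "f \<in> mod_hom R M N \<Longrightarrow> S \<subseteq> carrier M \<Longrightarrow> f \<in> mod_hom R (restrict_carrier M S) N"
  "f \<in> mod_hom R M N \<Longrightarrow> (\<And>x. x \<in> carrier M \<Longrightarrow> f x \<in> T) \<Longrightarrow> f \<in> mod_hom R M (restrict_carrier N T)"
  unfolding mod_hom_def by (auto simp: subset_iff)

text \<open>\<open>finsum\<close> is a fold inside the carrier, so a smaller carrier gives the same
  sum only while all summands stay in it.\<close>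

lemma finsum_restrict_carrier [simp]:
  "finsum (restrict_carrier M N) g S = finsum M g S" if "left_module R M" "left_submodule R M N" "g \<in> S \<rightarrow> N"
proof (cases "finite S")
  case True
  interpret M: left_module R M by fact
  interpret N: left_module R "restrict_carrier M N" by (rule left_module_restrict[OF that(1,2)])
  note D = left_submoduleD[OF that(2)]
  from True that(3) show ?thesis by (induction S) (use D in \<open>auto simp: Pi_def\<close>)
next
  case False
  interpret M: left_module R M by fact
  interpret N: left_module R "restrict_carrier M N" by (rule left_module_restrict[OF that(1,2)])
  show ?thesis using False by (simp add: M.M.finsum_infinite N.M.finsum_infinite)
qed

lemma left_submodule_kernel:
  assumes "left_module R M" "left_module R N" and f: "f \<in> mod_hom R M N"
  shows "left_submodule R M {x \<in> carrier M. f x = \<zero>\<^bsub>N\<^esub>}"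
proof -
  interpret M: left_module R M by fact
  interpret N: left_module R N by fact
  show ?thesis using mod_homD[OF f] mod_hom_zero[OF assms] by (auto simp: left_submodule_def)
qed

lemma left_submodule_finsum:
  assumes "left_module R M" "left_submodule R M N" "g \<in> S \<rightarrow> N"
  shows "(\<Oplus>\<^bsub>M\<^esub>s\<in>S. g s) \<in> N"
proof -
  interpret N: left_module R "restrict_carrier M N" by (rule left_module_restrict[OF assms(1,2)])
  have "(\<Oplus>\<^bsub>restrict_carrier M N\<^esub>s\<in>S. g s) \<in> carrier (restrict_carrier M N)"
    by (rule N.M.finsum_closed) (use assms(3) in auto)
  then show ?thesis using finsum_restrict_carrier[OF assms] by simp
qed

lemma mod_iso_inverse:
  assumes "left_module R M" and f: "f \<in> mod_hom R M N" and bij: "bij_betw f (carrier M) (carrier N)"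
  shows "inv_into (carrier M) f \<in> mod_hom R N M"
proof -
  interpret M: left_module R M by fact
  let ?g = "inv_into (carrier M) f"
  have g: "?g y \<in> carrier M" "f (?g y) = y" if "y \<in> carrier N" for y
    using bij that by (auto simp: bij_betw_def inv_into_into f_inv_into_f)
  have eq: "?g (f x) = x" if "x \<in> carrier M" for x
    using bij that by (auto simp: bij_betw_def)
  show ?thesis
  proof (rule mod_homI)
    fix x y assume "x \<in> carrier N" "y \<in> carrier N"
    then show "?g (x \<oplus>\<^bsub>N\<^esub> y) = ?g x \<oplus>\<^bsub>M\<^esub> ?g y"
      using g eq[of "?g x \<oplus>\<^bsub>M\<^esub> ?g y"] mod_homD(2)[OF f, of "?g x" "?g y"] by simp
  next
    fix a x assume "a \<in> carrier R" "x \<in> carrier N"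
    then show "?g (a \<odot>\<^bsub>N\<^esub> x) = a \<odot>\<^bsub>M\<^esub> ?g x"
      using g eq[of "a \<odot>\<^bsub>M\<^esub> ?g x"] mod_homD(3)[OF f, of a "?g x"] by simp
  qed (use g in auto)
qed

section \<open>Dual bases\<close>

text \<open>The data of the dual basis lemma. No free module is mentioned, and the index type is
  arbitrary: direct sums use tagged indices, spaces at a vertex use pairs of an index and a
  path.\<close>

definition dual_basis ::
  "('r, 'z) ring_scheme \<Rightarrow> ('r, 'm) module \<Rightarrow> 'i set \<Rightarrow> ('i \<Rightarrow> 'm \<Rightarrow> 'r) \<Rightarrow> ('i \<Rightarrow> 'm) \<Rightarrow> bool" where
  "dual_basis R P I f b \<longleftrightarrow> finite I \<and> (\<forall>k\<in>I. f k \<in> mod_hom R P (regular_module R)) \<and>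
     (\<forall>k\<in>I. b k \<in> carrier P) \<and> (\<forall>x\<in>carrier P. x = (\<Oplus>\<^bsub>P\<^esub>k\<in>I. f k x \<odot>\<^bsub>P\<^esub> b k))"

lemma dual_basisD:
  assumes "dual_basis R P I f b"
  shows "finite I" "k \<in> I \<Longrightarrow> f k \<in> mod_hom R P (regular_module R)" "k \<in> I \<Longrightarrow> b k \<in> carrier P"
    "x \<in> carrier P \<Longrightarrow> (\<Oplus>\<^bsub>P\<^esub>k\<in>I. f k x \<odot>\<^bsub>P\<^esub> b k) = x"
    "k \<in> I \<Longrightarrow> x \<in> carrier P \<Longrightarrow> f k x \<in> carrier R"
proof -
  note * = assms[unfolded dual_basis_def]
  show "finite I" using * by blast
  show f: "k \<in> I \<Longrightarrow> f k \<in> mod_hom R P (regular_module R)" using * by blast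
  show "k \<in> I \<Longrightarrow> b k \<in> carrier P" using * by blast
  show "x \<in> carrier P \<Longrightarrow> (\<Oplus>\<^bsub>P\<^esub>k\<in>I. f k x \<odot>\<^bsub>P\<^esub> b k) = x" using * by metis
  show "k \<in> I \<Longrightarrow> x \<in> carrier P \<Longrightarrow> f k x \<in> carrier R" using mod_homD(1)[OF f] by simp
qed

lemma free_module_simps:
  "carrier (free_module R n) = {..<n} \<rightarrow>\<^sub>E carrier R"
  "zero (free_module R n) = (\<lambda>i\<in>{..<n}. \<zero>\<^bsub>R\<^esub>)"
  "add (free_module R n) x y = (\<lambda>i\<in>{..<n}. x i \<oplus>\<^bsub>R\<^esub> y i)"
  "smult (free_module R n) a x = (\<lambda>i\<in>{..<n}. a \<otimes>\<^bsub>R\<^esub> x i)"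
  by (simp_all add: free_module_def)

lemma PiE_mem_lessThan: "x \<in> {..<n::nat} \<rightarrow>\<^sub>E S \<Longrightarrow> i < n \<Longrightarrow> x i \<in> S"
  by auto

lemma free_module_closed: "x \<in> carrier (free_module R n) \<Longrightarrow> i < n \<Longrightarrow> x i \<in> carrier R"
  by (auto simp: free_module_def)

lemma free_module_eqI: 
   "x \<in> carrier (free_module R n) \<Longrightarrow> y \<in> carrier (free_module R n) \<Longrightarrow> (\<And>i. i < n \<Longrightarrow> x i = y i) \<Longrightarrow> x = y"
  unfolding free_module_simps by (rule PiE_ext) auto


lemma left_module_free: assumes "ring R" shows "left_module R (free_module R n)"
proof -
  interpret ring R by fact
  let ?F = "free_module R n"
  have add: "x \<oplus>\<^bsub>?F\<^esub> y \<in> carrier ?F" if "x \<in> carrier ?F" "y \<in> carrier ?F" for x y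
    unfolding free_module_simps using that[THEN free_module_closed] by simp
  have zero: "\<zero>\<^bsub>?F\<^esub> \<in> carrier ?F" by (simp add: free_module_simps)
  have smult: "a \<odot>\<^bsub>?F\<^esub> x \<in> carrier ?F" if "a \<in> carrier R" "x \<in> carrier ?F" for a x
    unfolding free_module_simps using that(1) free_module_closed[OF that(2)] by simp
  have app [simp]: "(x \<oplus>\<^bsub>?F\<^esub> y) i = x i \<oplus>\<^bsub>R\<^esub> y i" "(a \<odot>\<^bsub>?F\<^esub> x) i = a \<otimes>\<^bsub>R\<^esub> x i" "\<zero>\<^bsub>?F\<^esub> i = \<zero>\<^bsub>R\<^esub>"
    if "i < n" for x y a i using that by (simp_all add: free_module_simps)
  show ?thesis
  proof (intro left_module.intro left_module_axioms.intro assms abelian_groupI)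
    fix x assume x: "x \<in> carrier ?F"
    have "(\<lambda>i\<in>{..<n}. \<ominus>\<^bsub>R\<^esub> x i) \<oplus>\<^bsub>?F\<^esub> x = \<zero>\<^bsub>?F\<^esub>"
      using free_module_closed[OF x] by (auto simp: free_module_simps l_neg intro!: restrict_ext)
    moreover have "(\<lambda>i\<in>{..<n}. \<ominus>\<^bsub>R\<^esub> x i) \<in> carrier ?F"
      using free_module_closed[OF x] by (auto simp: free_module_simps(1))
    ultimately show "\<exists>y\<in>carrier ?F. y \<oplus>\<^bsub>?F\<^esub> x = \<zero>\<^bsub>?F\<^esub>" by blast
  qed (rule free_module_eqI[of _ R n] | simp add: add zero smult free_module_closed add.m_ac l_distr r_distr m_assoc)+
qed
lemma finsum_free_apply:
  assumes "ring R" "finite S" "g \<in> S \<rightarrow> carrier (free_module R n)" "i < n"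
  shows "(\<Oplus>\<^bsub>free_module R n\<^esub>s\<in>S. g s) i = (\<Oplus>\<^bsub>R\<^esub>s\<in>S. g s i)"
proof -
  interpret ring R by fact
  interpret F: left_module R "free_module R n" by (rule left_module_free) fact
  from assms(2,3) show ?thesis using assms(4)
  proof (induction S)
    case (insert s S)
    then have "(\<lambda>s. g s i) \<in> S \<rightarrow> carrier R" "g s i \<in> carrier R"
      by (auto simp: free_module_simps Pi_def PiE_def)
    with insert show ?case by (simp add: free_module_simps)
  qed (simp add: free_module_simps)
qed

text \<open>The coordinates of the embedding into \<open>R^n\<close> serve as functionals, and the
  retraction sends the unit vectors \<open>u k\<close> to the vectors of the dual basis.\<close>

lemma fg_projectiveE:
  assumes "fg_projective R P"
  obtains n :: nat and f b where "dual_basis R P {..<n} f b"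
proof -
  interpret P: left_module R P using assms by (simp add: fg_projective_def)
  obtain n i p where i: "i \<in> mod_hom R P (free_module R n)"
    and p: "p \<in> mod_hom R (free_module R n) P" and pi: "\<And>x. x \<in> carrier P \<Longrightarrow> p (i x) = x"
    using assms by (auto simp: fg_projective_def)
  interpret F: left_module R "free_module R n" by (rule left_module_free) (rule P.R.ring_axioms)
  define u where "u k = (\<lambda>j\<in>{..<n}. if j = k then \<one>\<^bsub>R\<^esub> else \<zero>\<^bsub>R\<^esub>)" for k
  have u: "u k \<in> carrier (free_module R n)" for k by (auto simp: u_def free_module_simps)
  have ix: "i x \<in> {..<n} \<rightarrow>\<^sub>E carrier R" if "x \<in> carrier P" for x
    using mod_homD(1)[OF i that] by (simp add: free_module_simps)
  have exp: "y = (\<Oplus>\<^bsub>free_module R n\<^esub>k\<in>{..<n}. y k \<odot>\<^bsub>free_module R n\<^esub> u k)"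
    if y: "y \<in> {..<n} \<rightarrow>\<^sub>E carrier R" for y
  proof -
    have c: "(\<lambda>k. y k \<odot>\<^bsub>free_module R n\<^esub> u k) \<in> {..<n} \<rightarrow> carrier (free_module R n)"
      using y u by (intro Pi_I F.smult_closed) (auto simp: PiE_def)
    show ?thesis
    proof (rule PiE_ext[OF y])
      show "(\<Oplus>\<^bsub>free_module R n\<^esub>k\<in>{..<n}. y k \<odot>\<^bsub>free_module R n\<^esub> u k) \<in> {..<n} \<rightarrow>\<^sub>E carrier R"
        using F.M.finsum_closed[OF c] by (simp add: free_module_simps)
      fix j assume j: "j \<in> {..<n}"
      have "(\<Oplus>\<^bsub>R\<^esub>k\<in>{..<n}. (y k \<odot>\<^bsub>free_module R n\<^esub> u k) j) = y j"
        by (subst P.R.finsum_delta[of _ j])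
          (use j y in \<open>auto simp: free_module_simps u_def PiE_mem_lessThan\<close>)
      then show "y j = (\<Oplus>\<^bsub>free_module R n\<^esub>k\<in>{..<n}. y k \<odot>\<^bsub>free_module R n\<^esub> u k) j"
        using j c by (subst finsum_free_apply[OF P.R.ring_axioms]) auto
    qed
  qed
  have "dual_basis R P {..<n} (\<lambda>k x. i x k) (\<lambda>k. p (u k))"
    unfolding dual_basis_def
  proof (intro conjI ballI)
    fix k assume k: "k \<in> {..<n}"
    show "(\<lambda>x. i x k) \<in> mod_hom R P (regular_module R)"
      using k mod_homD[OF i] by (intro mod_homI) (auto simp: free_module_simps PiE_mem_lessThan)
    show "p (u k) \<in> carrier P" using mod_homD(1)[OF p u] .
  next
    fix x assume x: "x \<in> carrier P"
    have "x = p (\<Oplus>\<^bsub>free_module R n\<^esub>k\<in>{..<n}. i x k \<odot>\<^bsub>free_module R n\<^esub> u k)"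
      using exp[OF ix[OF x]] pi[OF x] by simp
    also have "\<dots> = (\<Oplus>\<^bsub>P\<^esub>k\<in>{..<n}. p (i x k \<odot>\<^bsub>free_module R n\<^esub> u k))"
      using ix[OF x] u
      by (intro mod_hom_finsum[OF F.M.abelian_group_axioms P.M.abelian_group_axioms p])
         (auto simp: PiE_mem_lessThan)
    also have "\<dots> = (\<Oplus>\<^bsub>P\<^esub>k\<in>{..<n}. i x k \<odot>\<^bsub>P\<^esub> p (u k))"
      using ix[OF x] u mod_homD[OF p] by (intro P.M.finsum_cong') (auto simp: PiE_mem_lessThan)
    finally show "x = (\<Oplus>\<^bsub>P\<^esub>k\<in>{..<n}. i x k \<odot>\<^bsub>P\<^esub> p (u k))" .
  qed simp
  then show thesis by (rule that)
qed

lemma fg_projectiveI: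
  assumes "left_module R P" and db: "dual_basis R P I f b"
  shows "fg_projective R P"
proof -
  interpret P: left_module R P by fact
  note db = dual_basisD[OF db]
  \<comment> \<open>\<open>free_module\<close> is indexed by an initial segment of the naturals, so
    the index set is enumerated first.\<close>
  obtain h where h: "bij_betw h {..<card I} I"
    using ex_bij_betw_nat_finite[OF db(1)] by (auto simp: atLeast0LessThan)
  let ?n = "card I"
  have hI: "k < ?n \<Longrightarrow> h k \<in> I" for k using h by (auto simp: bij_betw_def)
  interpret F: left_module R "free_module R ?n" by (rule left_module_free) (rule P.R.ring_axioms)
  let ?i = "\<lambda>x. \<lambda>k\<in>{..<?n}. f (h k) x" and ?p = "\<lambda>y. \<Oplus>\<^bsub>P\<^esub>k\<in>{..<?n}. y k \<odot>\<^bsub>P\<^esub> b (h k)"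
  have i: "?i \<in> mod_hom R P (free_module R ?n)"
    using mod_homD[OF db(2)] hI by (intro mod_homI) (auto simp: free_module_simps intro!: restrict_ext)
  have p: "?p \<in> mod_hom R (free_module R ?n) P"
  proof (rule mod_hom_finsum_fun[OF assms(1)])
    fix k assume k: "k \<in> {..<?n}"
    show "(\<lambda>y. y k \<odot>\<^bsub>P\<^esub> b (h k)) \<in> mod_hom R (free_module R ?n) P"
      by (rule mod_hom_smult_vector[OF assms(1)])
        (use k db(3) hI in \<open>auto intro!: mod_homI simp: free_module_simps PiE_mem_lessThan\<close>)
  qed simp
  have "?p (?i x) = x" if x: "x \<in> carrier P" for x
  proof -
    have "?p (?i x) = (\<Oplus>\<^bsub>P\<^esub>k\<in>{..<?n}. f (h k) x \<odot>\<^bsub>P\<^esub> b (h k))"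
      by (rule P.M.finsum_cong') (use x db hI in auto)
    also have "\<dots> = (\<Oplus>\<^bsub>P\<^esub>k\<in>h ` {..<?n}. f k x \<odot>\<^bsub>P\<^esub> b k)"
      by (rule P.M.finsum_reindex[symmetric]) (use x db h in \<open>auto simp: bij_betw_def\<close>)
    also have "\<dots> = x" using db(4)[OF x] h by (simp add: bij_betw_def)
    finally show ?thesis .
  qed
  then have "\<forall>x\<in>carrier P. ?p (?i x) = x" by blast
  then show ?thesis
    unfolding fg_projective_def by (intro conjI assms(1) exI[of _ ?n] bexI[OF bexI[OF _ p] i])
qed

section \<open>Injectivity, lifting and gluing of homomorphisms\<close>

lemma mod_hom_lincomb:
  assumes "left_module R M" "left_module R N" and f: "f \<in> mod_hom R M N"
    and "finite I" "\<And>k. k \<in> I \<Longrightarrow> c k \<in> carrier R" "\<And>k. k \<in> I \<Longrightarrow> b k \<in> carrier M"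
  shows "f (\<Oplus>\<^bsub>M\<^esub>k\<in>I. c k \<odot>\<^bsub>M\<^esub> b k) = (\<Oplus>\<^bsub>N\<^esub>k\<in>I. c k \<odot>\<^bsub>N\<^esub> f (b k))"
proof -
  interpret M: left_module R M by fact
  interpret N: left_module R N by fact
  have "f (\<Oplus>\<^bsub>M\<^esub>k\<in>I. c k \<odot>\<^bsub>M\<^esub> b k) = (\<Oplus>\<^bsub>N\<^esub>k\<in>I. f (c k \<odot>\<^bsub>M\<^esub> b k))"
    by (rule mod_hom_finsum[OF M.M.abelian_group_axioms N.M.abelian_group_axioms f]) (use assms in auto)
  also have "\<dots> = (\<Oplus>\<^bsub>N\<^esub>k\<in>I. c k \<odot>\<^bsub>N\<^esub> f (b k))"
    by (rule N.M.finsum_cong') (use assms in \<open>auto simp: mod_homD(1,3)[OF f]\<close>)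
  finally show ?thesis .
qed

lemma mod_hom_injI:
  assumes "left_module R M" "left_module R N" and f: "f \<in> mod_hom R M N"
    and "\<And>x. x \<in> carrier M \<Longrightarrow> f x = \<zero>\<^bsub>N\<^esub> \<Longrightarrow> x = \<zero>\<^bsub>M\<^esub>"
  shows "inj_on f (carrier M)"
proof (rule inj_onI)
  interpret M: left_module R M by fact
  interpret N: left_module R N by fact
  fix x y assume xy: "x \<in> carrier M" "y \<in> carrier M" "f x = f y"
  then have "f (x \<ominus>\<^bsub>M\<^esub> y) = \<zero>\<^bsub>N\<^esub>"
    using mod_homD(1)[OF f] by (simp add: mod_hom_minus(2)[OF assms(1-3)] N.minus_eq_zero_iff)
  then show "x = y" using assms(4)[of "x \<ominus>\<^bsub>M\<^esub> y"] xy by (simp add: M.minus_eq_zero_iff)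
qed

lemma mod_hom_inj_zero:
  assumes "left_module R M" "left_module R N" "f \<in> mod_hom R M N" "inj_on f (carrier M)"
    and "x \<in> carrier M" "f x = \<zero>\<^bsub>N\<^esub>"
  shows "x = \<zero>\<^bsub>M\<^esub>"
proof -
  interpret M: left_module R M by fact
  show ?thesis using mod_hom_zero[OF assms(1-3)] assms(4-6) by (metis M.M.zero_closed inj_onD)
qed

text \<open>Only the finitely many vectors of a dual basis have to be lifted. The hypothesis
  compares images because \<open>g\<close> is typically a differential and not surjective.\<close>

lemma fg_projective_lift:
  assumes P: "fg_projective R P" and N: "left_module R N" "left_module R N'"
    and g: "g \<in> mod_hom R N N'" and f: "f \<in> mod_hom R P N'"
    and im: "\<And>x. x \<in> carrier P \<Longrightarrow> f x \<in> g ` carrier N"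
  obtains h where "h \<in> mod_hom R P N" "\<And>x. x \<in> carrier P \<Longrightarrow> g (h x) = f x"
proof -
  have PM: "left_module R P" using P by (simp add: fg_projective_def)
  obtain n :: nat and \<phi> b where "dual_basis R P {..<n} \<phi> b" using fg_projectiveE[OF P] .
  note db = dual_basisD[OF this]
  have "\<exists>y. k < n \<longrightarrow> y \<in> carrier N \<and> g y = f (b k)" for k
    using im[OF db(3)[of k]] by fastforce
  then obtain y where y: "\<And>k. k < n \<Longrightarrow> y k \<in> carrier N" "\<And>k. k < n \<Longrightarrow> g (y k) = f (b k)" by metis
  let ?h = "\<lambda>x. \<Oplus>\<^bsub>N\<^esub>k\<in>{..<n}. \<phi> k x \<odot>\<^bsub>N\<^esub> y k"
  show thesis
  proof (rule that[of ?h])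
    show "?h \<in> mod_hom R P N"
      by (intro mod_hom_finsum_fun mod_hom_smult_vector N db(2) finite_lessThan) (auto simp: y)
    fix x assume x: "x \<in> carrier P"
    interpret N': left_module R N' by fact
    have "g (?h x) = (\<Oplus>\<^bsub>N'\<^esub>k\<in>{..<n}. \<phi> k x \<odot>\<^bsub>N'\<^esub> g (y k))"
      by (rule mod_hom_lincomb[OF N g]) (use db(5) x y in auto)
    also have "\<dots> = (\<Oplus>\<^bsub>N'\<^esub>k\<in>{..<n}. \<phi> k x \<odot>\<^bsub>N'\<^esub> f (b k))"
      by (rule N'.M.finsum_cong') (use db(3,5) x y mod_homD(1)[OF f] in auto)
    also have "\<dots> = f (\<Oplus>\<^bsub>P\<^esub>k\<in>{..<n}. \<phi> k x \<odot>\<^bsub>P\<^esub> b k)"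
      by (rule mod_hom_lincomb[OF PM N(2) f, symmetric]) (use db(3,5) x in auto)
    also have "\<dots> = f x" using db(4)[OF x] by simp
    finally show "g (?h x) = f x" .
  qed
qed

text \<open>\<open>M\<close> is the sum of \<open>M1\<close> and the image of
  \<open>\<Gamma>\<close>, so it is a pushout over the elements of \<open>U\<close> that
  \<open>\<Gamma>\<close> sends into \<open>M1\<close>; compatible maps on the two parts combine.
  \<open>\<Gamma>\<close> may have a kernel: \<open>compat\<close>, applied with value zero, takes
  care of it.\<close>

lemma mod_hom_glue:
  assumes M: "left_module R M" and N: "left_module R N" and U: "left_module R U"
    and M1: "left_submodule R M M1"
    and \<Gamma>: "\<Gamma> \<in> mod_hom R U M" and \<eta>: "\<eta> \<in> mod_hom R U N"
    and \<theta>: "\<theta> \<in> mod_hom R (restrict_carrier M M1) N"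
    and gen: "\<And>z. z \<in> carrier M \<Longrightarrow> \<exists>x\<in>M1. \<exists>u\<in>carrier U. z = x \<oplus>\<^bsub>M\<^esub> \<Gamma> u"
    and compat: "\<And>u. u \<in> carrier U \<Longrightarrow> \<Gamma> u \<in> M1 \<Longrightarrow> \<eta> u = \<theta> (\<Gamma> u)"
  obtains w where "w \<in> mod_hom R M N"
    "\<forall>x\<in>M1. \<forall>u\<in>carrier U. w (x \<oplus>\<^bsub>M\<^esub> \<Gamma> u) = \<theta> x \<oplus>\<^bsub>N\<^esub> \<eta> u"
proof -
  interpret M: left_module R M by fact
  interpret N: left_module R N by fact
  interpret U: left_module R U by fact
  have RM: "left_module R (restrict_carrier M M1)" by (rule left_module_restrict[OF M M1])
  note M1D = left_submoduleD[OF M1]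
  note \<Gamma>D = mod_homD[OF \<Gamma>] and \<eta>D = mod_homD[OF \<eta>] and \<theta>D = mod_homD[OF \<theta>, simplified]
  \<comment> \<open>Two decompositions differ within the overlap: \<open>\<Gamma> (u - u')\<close>
    equals \<open>x' - x\<close>, hence lies in \<open>M1\<close>, where \<open>compat\<close>
    applies.\<close>
  have wd: "\<theta> x \<oplus>\<^bsub>N\<^esub> \<eta> u = \<theta> x' \<oplus>\<^bsub>N\<^esub> \<eta> u'"
    if "x \<in> M1" "x' \<in> M1" "u \<in> carrier U" "u' \<in> carrier U" and eq: "x \<oplus>\<^bsub>M\<^esub> \<Gamma> u = x' \<oplus>\<^bsub>M\<^esub> \<Gamma> u'"
    for x x' u u'
  proof -
    have x: "x \<in> carrier M" "x' \<in> carrier M" using that M1D by auto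
    have \<Gamma>': "\<Gamma> u = \<Gamma> (u \<ominus>\<^bsub>U\<^esub> u') \<oplus>\<^bsub>M\<^esub> \<Gamma> u'" "\<eta> u = \<eta> (u \<ominus>\<^bsub>U\<^esub> u') \<oplus>\<^bsub>N\<^esub> \<eta> u'"
      using that \<Gamma>D(2)[of "u \<ominus>\<^bsub>U\<^esub> u'" u'] \<eta>D(2)[of "u \<ominus>\<^bsub>U\<^esub> u'" u']
      by (simp_all add: a_minus_def U.M.a_assoc U.M.l_neg)
    let ?v = "\<Gamma> (u \<ominus>\<^bsub>U\<^esub> u')"
    have v: "?v \<in> carrier M" using that \<Gamma>D(1) by simp
    have "(x \<oplus>\<^bsub>M\<^esub> ?v) \<oplus>\<^bsub>M\<^esub> \<Gamma> u' = x' \<oplus>\<^bsub>M\<^esub> \<Gamma> u'"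
      using eq \<Gamma>'(1) x v \<Gamma>D(1) that by (simp add: M.M.a_assoc)
    then have x': "x \<oplus>\<^bsub>M\<^esub> ?v = x'" using x v \<Gamma>D(1)[of u'] that by simp
    have "?v = x' \<ominus>\<^bsub>M\<^esub> x" using M.add_minus_cancel(2)[OF x(1) v] x' by simp
    then have vM: "?v \<in> M1" using left_submodule_minus(2)[OF M M1] that by simp
    have "\<theta> x' = \<theta> x \<oplus>\<^bsub>N\<^esub> \<theta> ?v" using x' \<theta>D(2)[OF that(1) vM] by simp
    also have "\<theta> ?v = \<eta> (u \<ominus>\<^bsub>U\<^esub> u')" using compat[OF _ vM] that by simp
    finally show ?thesis
      using \<Gamma>'(2) \<theta>D(1)[OF that(1)] \<eta>D(1) that by (simp add: N.M.a_assoc)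
  qed
  \<comment> \<open>A decomposition of \<open>z\<close> has to be chosen; by \<open>wd\<close> the
    choice does not influence the value.\<close>
  define w where "w z = (SOME y. \<exists>x\<in>M1. \<exists>u\<in>carrier U. z = x \<oplus>\<^bsub>M\<^esub> \<Gamma> u \<and> y = \<theta> x \<oplus>\<^bsub>N\<^esub> \<eta> u)" for z
  have w: "w (x \<oplus>\<^bsub>M\<^esub> \<Gamma> u) = \<theta> x \<oplus>\<^bsub>N\<^esub> \<eta> u" if "x \<in> M1" "u \<in> carrier U" for x u
    unfolding w_def
  proof (rule some_equality)
    show "\<exists>xa\<in>M1. \<exists>ua\<in>carrier U. x \<oplus>\<^bsub>M\<^esub> \<Gamma> u = xa \<oplus>\<^bsub>M\<^esub> \<Gamma> ua \<and> \<theta> x \<oplus>\<^bsub>N\<^esub> \<eta> u = \<theta> xa \<oplus>\<^bsub>N\<^esub> \<eta> ua"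
      using that by blast
  next
    fix y assume "\<exists>xa\<in>M1. \<exists>ua\<in>carrier U. x \<oplus>\<^bsub>M\<^esub> \<Gamma> u = xa \<oplus>\<^bsub>M\<^esub> \<Gamma> ua \<and> y = \<theta> xa \<oplus>\<^bsub>N\<^esub> \<eta> ua"
    then obtain xa ua where "xa \<in> M1" "ua \<in> carrier U" "x \<oplus>\<^bsub>M\<^esub> \<Gamma> u = xa \<oplus>\<^bsub>M\<^esub> \<Gamma> ua"
      "y = \<theta> xa \<oplus>\<^bsub>N\<^esub> \<eta> ua" by blast
    then show "y = \<theta> x \<oplus>\<^bsub>N\<^esub> \<eta> u" using wd[of x xa u ua] that by simp
  qed
  have "w \<in> mod_hom R M N"
  proof (rule mod_homI)
    fix z assume "z \<in> carrier M"
    then obtain x u where xu: "x \<in> M1" "u \<in> carrier U" "z = x \<oplus>\<^bsub>M\<^esub> \<Gamma> u" using gen by blast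
    then show "w z \<in> carrier N" using w \<theta>D(1) \<eta>D(1) by simp
    fix z' assume "z' \<in> carrier M"
    then obtain x' u' where xu': "x' \<in> M1" "u' \<in> carrier U" "z' = x' \<oplus>\<^bsub>M\<^esub> \<Gamma> u'" using gen by blast
    have "z \<oplus>\<^bsub>M\<^esub> z' = (x \<oplus>\<^bsub>M\<^esub> x') \<oplus>\<^bsub>M\<^esub> \<Gamma> (u \<oplus>\<^bsub>U\<^esub> u')"
      using xu xu' M1D(1) \<Gamma>D by (simp add: M.M.add.m_ac)
    moreover have "w \<dots> = \<theta> (x \<oplus>\<^bsub>M\<^esub> x') \<oplus>\<^bsub>N\<^esub> \<eta> (u \<oplus>\<^bsub>U\<^esub> u')"
      using w[of "x \<oplus>\<^bsub>M\<^esub> x'" "u \<oplus>\<^bsub>U\<^esub> u'"] xu xu' M1D(3) by simp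
    ultimately show "w (z \<oplus>\<^bsub>M\<^esub> z') = w z \<oplus>\<^bsub>N\<^esub> w z'"
      using xu xu' w \<theta>D \<eta>D by (simp add: N.M.add.m_ac)
  next
    fix a z assume a: "a \<in> carrier R" "z \<in> carrier M"
    then obtain x u where xu: "x \<in> M1" "u \<in> carrier U" "z = x \<oplus>\<^bsub>M\<^esub> \<Gamma> u" using gen by blast
    then have "a \<odot>\<^bsub>M\<^esub> z = a \<odot>\<^bsub>M\<^esub> x \<oplus>\<^bsub>M\<^esub> \<Gamma> (a \<odot>\<^bsub>U\<^esub> u)"
      using a M1D(1) \<Gamma>D by (simp add: M.smult_r_distr)
    then show "w (a \<odot>\<^bsub>M\<^esub> z) = a \<odot>\<^bsub>N\<^esub> w z"
      using a xu w[of "a \<odot>\<^bsub>M\<^esub> x" "a \<odot>\<^bsub>U\<^esub> u"] w[of x u] M1D(4) \<theta>D \<eta>D by (simp add: N.smult_r_distr)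
  qed
  moreover have "\<forall>x\<in>M1. \<forall>u\<in>carrier U. w (x \<oplus>\<^bsub>M\<^esub> \<Gamma> u) = \<theta> x \<oplus>\<^bsub>N\<^esub> \<eta> u" using w by blast
  ultimately show thesis by (rule that)
qed

section \<open>Complete resolutions\<close>

locale complete_resolution =
  fixes R :: "('r, 'z) ring_scheme" and P :: "int \<Rightarrow> ('r, 'm) module" and d :: "int \<Rightarrow> 'm \<Rightarrow> 'm"
  assumes complete: "complete_projective_resolution R P d"
begin

lemma fg_projective_terms: "fg_projective R (P n)"
  using complete by (simp add: complete_projective_resolution_def)

lemma left_module_terms: "left_module R (P n)"
  using fg_projective_terms by (simp add: fg_projective_def)

lemma d_hom: "d n \<in> mod_hom R (P n) (P (n + 1))"
  using complete by (simp add: complete_projective_resolution_def)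

text \<open>The codomain of \<open>d (n - 1)\<close> reads \<open>P (n - 1 + 1)\<close>; the primed
  facts have this index normalised to \<open>n\<close>.\<close>

lemma d_hom': "d (n - 1) \<in> mod_hom R (P (n - 1)) (P n)"
  using d_hom[of "n - 1"] by simp

lemmas d_closed = mod_homD(1)[OF d_hom] and d_closed' = mod_homD(1)[OF d_hom']

lemma kernel_eq: "{x \<in> carrier (P n). d n x = \<zero>\<^bsub>P (n + 1)\<^esub>} = d (n - 1) ` carrier (P (n - 1))"
  using complete by (simp add: complete_projective_resolution_def a_kernel_def')

lemma d_d: "x \<in> carrier (P (n - 1)) \<Longrightarrow> d n (d (n - 1) x) = \<zero>\<^bsub>P (n + 1)\<^esub>"
  using kernel_eq[of n] by blast

lemma exact:
  assumes "x \<in> carrier (P n)" "d n x = \<zero>\<^bsub>P (n + 1)\<^esub>"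
  obtains y where "y \<in> carrier (P (n - 1))" "x = d (n - 1) y"
  using kernel_eq[of n] assms by blast

lemma hom_exact_regular:
  assumes "f \<in> mod_hom R (P n) (regular_module R)"
    and "\<And>x. x \<in> carrier (P (n - 1)) \<Longrightarrow> f (d (n - 1) x) = \<zero>\<^bsub>R\<^esub>"
  shows "\<exists>g. g \<in> mod_hom R (P (n + 1)) (regular_module R) \<and> (\<forall>x\<in>carrier (P n). f x = g (d n x))"
proof -
  have "(\<forall>x\<in>carrier (P (n - 1)). f (d (n - 1) x) = \<zero>\<^bsub>R\<^esub>) \<longleftrightarrow>
      (\<exists>g\<in>mod_hom R (P (n + 1)) (regular_module R). \<forall>x\<in>carrier (P n). f x = g (d n x))"
    using complete assms(1) unfolding complete_projective_resolution_def by blast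
  then show ?thesis using assms(2) by blast
qed

text \<open>The coordinates of \<open>f\<close> with respect to a dual basis of \<open>Z\<close> are
  cocycles with values in \<open>R\<close>; their extensions are reassembled along the vectors
  \<open>b k\<close>.\<close>

lemma hom_exact:
  assumes Z: "fg_projective R Z" and f: "f \<in> mod_hom R (P n) Z"
    and f0: "\<And>x. x \<in> carrier (P (n - 1)) \<Longrightarrow> f (d (n - 1) x) = \<zero>\<^bsub>Z\<^esub>"
  obtains g where "g \<in> mod_hom R (P (n + 1)) Z" "\<And>x. x \<in> carrier (P n) \<Longrightarrow> g (d n x) = f x"
proof -
  have ZM: "left_module R Z" using Z by (simp add: fg_projective_def)
  interpret Z: left_module R Z by (rule ZM)
  obtain m :: nat and \<phi> b where "dual_basis R Z {..<m} \<phi> b" using fg_projectiveE[OF Z] .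
  note db = dual_basisD[OF this]
  have "\<exists>g. k < m \<longrightarrow> g \<in> mod_hom R (P (n + 1)) (regular_module R) \<and>
      (\<forall>x\<in>carrier (P n). \<phi> k (f x) = g (d n x))" for k
  proof (cases "k < m")
    case True
    then have \<phi>: "\<phi> k \<in> mod_hom R Z (regular_module R)" using db(2) by simp
    have "\<phi> k (f (d (n - 1) x)) = \<zero>\<^bsub>R\<^esub>" if "x \<in> carrier (P (n - 1))" for x
      using f0[OF that] mod_hom_zero[OF ZM left_module_regular[OF Z.R.ring_axioms] \<phi>] by simp
    then show ?thesis using hom_exact_regular[OF mod_hom_comp[OF f \<phi>]] by blast
  qed auto
  then obtain g where g: "\<And>k. k < m \<Longrightarrow> g k \<in> mod_hom R (P (n + 1)) (regular_module R)"
    "\<And>k x. k < m \<Longrightarrow> x \<in> carrier (P n) \<Longrightarrow> g k (d n x) = \<phi> k (f x)" by metis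
  show thesis
  proof (rule that[of "\<lambda>y. \<Oplus>\<^bsub>Z\<^esub>k\<in>{..<m}. g k y \<odot>\<^bsub>Z\<^esub> b k"])
    show "(\<lambda>y. \<Oplus>\<^bsub>Z\<^esub>k\<in>{..<m}. g k y \<odot>\<^bsub>Z\<^esub> b k) \<in> mod_hom R (P (n + 1)) Z"
      by (intro mod_hom_finsum_fun mod_hom_smult_vector ZM g(1) finite_lessThan) (auto simp: db)
    fix x assume x: "x \<in> carrier (P n)"
    have "(\<Oplus>\<^bsub>Z\<^esub>k\<in>{..<m}. g k (d n x) \<odot>\<^bsub>Z\<^esub> b k) = (\<Oplus>\<^bsub>Z\<^esub>k\<in>{..<m}. \<phi> k (f x) \<odot>\<^bsub>Z\<^esub> b k)"
      by (rule Z.M.finsum_cong') (use x g(2) db(3,5) mod_homD(1)[OF f x] in auto)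
    then show "(\<Oplus>\<^bsub>Z\<^esub>k\<in>{..<m}. g k (d n x) \<odot>\<^bsub>Z\<^esub> b k) = f x"
      using db(4)[OF mod_homD(1)[OF f x]] by simp
  qed
qed

end

text \<open>Of the dual exactness only the passage from cocycles to coboundaries has to be supplied;
  the converse is \<open>d o d = 0\<close>.\<close>

lemma complete_resolutionI:
  assumes proj: "\<And>n. fg_projective R (P n)"
    and hom: "\<And>n. d n \<in> mod_hom R (P n) (P (n + 1))"
    and dd: "\<And>n x. x \<in> carrier (P (n - 1)) \<Longrightarrow> d n (d (n - 1) x) = \<zero>\<^bsub>P (n + 1)\<^esub>"
    and exact: "\<And>n x. x \<in> carrier (P n) \<Longrightarrow> d n x = \<zero>\<^bsub>P (n + 1)\<^esub> \<Longrightarrow> x \<in> d (n - 1) ` carrier (P (n - 1))"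
    and hom_exact: "\<And>n f. f \<in> mod_hom R (P n) (regular_module R) \<Longrightarrow>
      (\<And>x. x \<in> carrier (P (n - 1)) \<Longrightarrow> f (d (n - 1) x) = \<zero>\<^bsub>R\<^esub>) \<Longrightarrow>
      \<exists>g\<in>mod_hom R (P (n + 1)) (regular_module R). \<forall>x\<in>carrier (P n). f x = g (d n x)"
  shows "complete_resolution R P d"
  unfolding complete_resolution_def complete_projective_resolution_def
proof (intro conjI allI ballI)
  fix n
  have m: "left_module R (P n)" for n using proj by (simp add: fg_projective_def)
  interpret left_module R "P 0" by (rule m)
  have closed: "d (n - 1) x \<in> carrier (P n)" if "x \<in> carrier (P (n - 1))" for x
    using mod_homD(1)[OF hom that] by simp
  show "a_kernel (P n) (P (n + 1)) (d n) = d (n - 1) ` carrier (P (n - 1))"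
    unfolding a_kernel_def' using exact dd closed by blast
  fix f assume f: "f \<in> mod_hom R (P n) (regular_module R)"
  show "(\<forall>x\<in>carrier (P (n - 1)). f (d (n - 1) x) = \<zero>\<^bsub>R\<^esub>) \<longleftrightarrow>
      (\<exists>g\<in>mod_hom R (P (n + 1)) (regular_module R). \<forall>x\<in>carrier (P n). f x = g (d n x))"
  proof
    assume "\<exists>g\<in>mod_hom R (P (n + 1)) (regular_module R). \<forall>x\<in>carrier (P n). f x = g (d n x)"
    then obtain g where g: "g \<in> mod_hom R (P (n + 1)) (regular_module R)"
      "\<And>x. x \<in> carrier (P n) \<Longrightarrow> f x = g (d n x)" by blast
    show "\<forall>x\<in>carrier (P (n - 1)). f (d (n - 1) x) = \<zero>\<^bsub>R\<^esub>"
      using g(2) closed dd mod_hom_zero[OF m left_module_regular[OF R.ring_axioms] g(1)] by simp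
  qed (rule hom_exact[OF f], blast)
qed (rule proj hom)+

text \<open>The complexes constructed below consist of pairs, of families over paths or of subsets
  of other modules, whereas the definition wants elements of type \<open>nat => 'r\<close>. Each
  term is replaced by an isomorphic representative and the differential is conjugated. The module
  enters through an embedding onto the kernel, the form in which it is always found.\<close>

lemma gorenstein_projectiveI:
  fixes P :: "int \<Rightarrow> ('r, 'x) module"
  assumes "complete_resolution R P d" and M: "left_module R M"
    and \<iota>: "\<iota> \<in> mod_hom R M (P 0)" and inj: "inj_on \<iota> (carrier M)"
    and im: "\<iota> ` carrier M = {x \<in> carrier (P 0). d 0 x = \<zero>\<^bsub>P 1\<^esub>}"
  shows "gorenstein_projective R M"
proof -
  interpret complete_resolution R P d by fact
  have "\<exists>(P' :: ('r, nat \<Rightarrow> 'r) module) \<phi>. fg_projective R P' \<and> \<phi> \<in> mod_hom R (P n) P' \<and>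
      bij_betw \<phi> (carrier (P n)) (carrier P')" for n
    using fg_projective_representative[OF fg_projective_terms[of n]] unfolding mod_iso_def by metis
  then obtain P' :: "int \<Rightarrow> ('r, nat \<Rightarrow> 'r) module" and \<phi> where
    P': "\<And>n. fg_projective R (P' n)" and \<phi>: "\<And>n. \<phi> n \<in> mod_hom R (P n) (P' n)"
    and bij: "\<And>n. bij_betw (\<phi> n) (carrier (P n)) (carrier (P' n))" by metis
  define \<psi> where "\<psi> n = inv_into (carrier (P n)) (\<phi> n)" for n
  have \<psi>: "\<psi> n \<in> mod_hom R (P' n) (P n)" for n
    unfolding \<psi>_def by (rule mod_iso_inverse[OF left_module_terms \<phi> bij])
  have \<psi>\<phi> [simp]: "\<psi> n (\<phi> n x) = x" if "x \<in> carrier (P n)" for n x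
    using bij[of n] that by (simp add: \<psi>_def bij_betw_def)
  have \<phi>\<psi> [simp]: "\<phi> n (\<psi> n y) = y" if "y \<in> carrier (P' n)" for n y
    using bij[of n] that by (simp add: \<psi>_def bij_betw_def f_inv_into_f)
  have P'm: "left_module R (P' n)" for n using P' by (simp add: fg_projective_def)
  note c = mod_homD(1)[OF \<phi>] mod_homD(1)[OF \<psi>] d_closed d_closed'
  note z = mod_hom_zero[OF left_module_terms P'm \<phi>] mod_hom_zero[OF P'm left_module_terms \<psi>]
  define d' where "d' n y = \<phi> (n + 1) (d n (\<psi> n y))" for n y
  have d'1: "d' (n - 1) y = \<phi> n (d (n - 1) (\<psi> (n - 1) y))" for n y by (simp add: d'_def)
  have res: "complete_resolution R P' d'"
  proof (rule complete_resolutionI)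
    show "d' n \<in> mod_hom R (P' n) (P' (n + 1))" for n
      unfolding d'_def by (intro mod_hom_comp[OF _ \<phi>] mod_hom_comp[OF \<psi> d_hom])
    show "d' n (d' (n - 1) x) = \<zero>\<^bsub>P' (n + 1)\<^esub>" if "x \<in> carrier (P' (n - 1))" for n x
      using that by (simp add: d'1) (simp add: d'_def c d_d z)
  next
    fix n x assume x: "x \<in> carrier (P' n)" "d' n x = \<zero>\<^bsub>P' (n + 1)\<^esub>"
    have "d n (\<psi> n x) = \<psi> (n + 1) (d' n x)" using x(1) by (simp add: d'_def c)
    also have "\<dots> = \<zero>\<^bsub>P (n + 1)\<^esub>" by (simp add: x z)
    finally obtain y where y: "y \<in> carrier (P (n - 1))" "\<psi> n x = d (n - 1) y"
      using exact[OF c(2)[OF x(1)]] by metis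
    then have "x = d' (n - 1) (\<phi> (n - 1) y)" using x(1) \<phi>\<psi>[of x n] by (simp add: d'1)
    then show "x \<in> d' (n - 1) ` carrier (P' (n - 1))" using c(1)[OF y(1)] by blast
  next
    fix n f assume f: "f \<in> mod_hom R (P' n) (regular_module R)"
      and f0: "\<And>x. x \<in> carrier (P' (n - 1)) \<Longrightarrow> f (d' (n - 1) x) = \<zero>\<^bsub>R\<^esub>"
    have "f (\<phi> n (d (n - 1) x)) = \<zero>\<^bsub>R\<^esub>" if "x \<in> carrier (P (n - 1))" for x
      using f0[OF c(1)[OF that]] that by (simp add: d'1)
    then obtain g where g: "g \<in> mod_hom R (P (n + 1)) (regular_module R)"
      "\<And>x. x \<in> carrier (P n) \<Longrightarrow> f (\<phi> n x) = g (d n x)"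
      using hom_exact_regular[OF mod_hom_comp[OF \<phi> f]] by blast
    have "f x = g (\<psi> (n + 1) (d' n x))" if "x \<in> carrier (P' n)" for x
      using g(2)[OF c(2)[OF that]] that by (simp add: d'_def c)
    then show "\<exists>g\<in>mod_hom R (P' (n + 1)) (regular_module R). \<forall>x\<in>carrier (P' n). f x = g (d' n x)"
      using mod_hom_comp[OF \<psi> g(1)] by (intro bexI[of _ "\<lambda>y. g (\<psi> (n + 1) y)"]) auto
  qed (rule P')
  have i: "(\<lambda>x. \<phi> 0 (\<iota> x)) \<in> mod_hom R M (P' 0)" by (rule mod_hom_comp[OF \<iota> \<phi>])
  have im': "(\<lambda>x. \<phi> 0 (\<iota> x)) ` carrier M = a_kernel (P' 0) (P' 1) (d' 0)" (is "?l = ?r")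
  proof
    have "\<phi> 0 y \<in> ?r" if "y \<in> carrier (P 0)" "d 0 y = \<zero>\<^bsub>P 1\<^esub>" for y
      using that z(1)[of 1] by (simp add: a_kernel_def' c d'_def)
    then show "?l \<subseteq> ?r" using im by blast
    show "?r \<subseteq> ?l"
    proof
      fix y assume "y \<in> ?r"
      then have y: "y \<in> carrier (P' 0)" "d' 0 y = \<zero>\<^bsub>P' 1\<^esub>" by (auto simp: a_kernel_def')
      have "d 0 (\<psi> 0 y) = \<psi> 1 (d' 0 y)" using y(1) d_closed[of "\<psi> 0 y" 0] by (simp add: d'_def c)
      then have "\<psi> 0 y \<in> \<iota> ` carrier M" unfolding im using y z(2)[of 1] c(2)[of y 0] by simp
      then obtain x where "x \<in> carrier M" "\<psi> 0 y = \<iota> x" by blast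
      then show "y \<in> ?l" using \<phi>\<psi>[OF y(1)] by (metis imageI)
    qed
  qed
  have "inj_on (\<lambda>x. \<phi> 0 (\<iota> x)) (carrier M)"
  proof (rule inj_onI)
    fix x y assume xy: "x \<in> carrier M" "y \<in> carrier M" "\<phi> 0 (\<iota> x) = \<phi> 0 (\<iota> y)"
    then have "\<iota> x = \<iota> y" using \<psi>\<phi> mod_homD(1)[OF \<iota>] by metis
    then show "x = y" using inj xy by (simp add: inj_on_def)
  qed
  then have "mod_iso R M (restrict_carrier (P' 0) (a_kernel (P' 0) (P' 1) (d' 0)))"
    unfolding mod_iso_def
  proof (intro bexI)
    show "(\<lambda>x. \<phi> 0 (\<iota> x)) \<in> mod_hom R M (restrict_carrier (P' 0) (a_kernel (P' 0) (P' 1) (d' 0)))"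
      using im' by (intro mod_hom_restrict_carrier(2)[OF i]) blast
  qed (simp add: bij_betw_def im')
  then show ?thesis
    unfolding gorenstein_projective_def
    by (intro conjI M exI[of _ P'] exI[of _ d'] complete_resolution.complete[OF res])
qed

lemma gorenstein_projectiveE:
  fixes M :: "('r, 'm) module"
  assumes "gorenstein_projective R M"
  obtains P :: "int \<Rightarrow> ('r, nat \<Rightarrow> 'r) module" and d \<iota> where
    "complete_resolution R P d" "\<iota> \<in> mod_hom R M (P 0)" "inj_on \<iota> (carrier M)"
    "\<iota> ` carrier M = {x \<in> carrier (P 0). d 0 x = \<zero>\<^bsub>P 1\<^esub>}"
proof -
  obtain P :: "int \<Rightarrow> ('r, nat \<Rightarrow> 'r) module" and d where res: "complete_projective_resolution R P d"
    and iso: "mod_iso R M (restrict_carrier (P 0) (a_kernel (P 0) (P 1) (d 0)))"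
    using assms by (auto simp: gorenstein_projective_def)
  then obtain \<iota> where i: "\<iota> \<in> mod_hom R M (restrict_carrier (P 0) (a_kernel (P 0) (P 1) (d 0)))"
    "bij_betw \<iota> (carrier M) (a_kernel (P 0) (P 1) (d 0))" by (auto simp: mod_iso_def)
  have "\<iota> \<in> mod_hom R M (P 0)"
    using mod_homD[OF i(1)] by (intro mod_homI) (auto simp: a_kernel_def')
  then show thesis using that[of P d \<iota>] res i(2)
    by (auto simp: complete_resolution_def bij_betw_def a_kernel_def')
qed

text \<open>Start of the induction over the vertices. The constant complex with identity
  differentials is exact because there is only one element, and the empty dual basis shows
  projectivity.\<close>

lemma gorenstein_projective_trivial:
  assumes M: "left_module R M" and 0: "carrier M = {\<zero>\<^bsub>M\<^esub>}"
  shows "gorenstein_projective R M"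
proof -
  interpret left_module R M by (rule M)
  have reg: "left_module R (regular_module R)" by (rule left_module_regular) (rule R.ring_axioms)
  have id: "(\<lambda>x. x) \<in> mod_hom R M M" by (simp add: mod_hom_def)
  have "complete_resolution R (\<lambda>n. M) (\<lambda>n x. x)"
  proof (rule complete_resolutionI)
    have "dual_basis R M ({} :: nat set) (\<lambda>_ _. \<zero>\<^bsub>R\<^esub>) (\<lambda>_. \<zero>\<^bsub>M\<^esub>)" by (simp add: dual_basis_def 0)
    then show "fg_projective R M" by (rule fg_projectiveI[OF M])
    fix f assume "f \<in> mod_hom R M (regular_module R)"
    then show "\<exists>g\<in>mod_hom R M (regular_module R). \<forall>x\<in>carrier M. f x = g x" by blast
  qed (use id 0 in auto)
  then show ?thesis
    by (rule gorenstein_projectiveI[OF _ M id]) (use 0 in auto)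
qed

section \<open>Extensions of Gorenstein-projective modules\<close>

definition direct_sum :: "('r, 'm) module \<Rightarrow> ('r, 'n) module \<Rightarrow> ('r, 'm \<times> 'n) module" where
  "direct_sum M N = \<lparr>carrier = carrier M \<times> carrier N, mult = undefined, one = undefined,
     zero = (\<zero>\<^bsub>M\<^esub>, \<zero>\<^bsub>N\<^esub>), add = (\<lambda>x y. (fst x \<oplus>\<^bsub>M\<^esub> fst y, snd x \<oplus>\<^bsub>N\<^esub> snd y)),
     smult = (\<lambda>a x. (a \<odot>\<^bsub>M\<^esub> fst x, a \<odot>\<^bsub>N\<^esub> snd x))\<rparr>"

lemma direct_sum_simps [simp]:
  "carrier (direct_sum M N) = carrier M \<times> carrier N"
  "\<zero>\<^bsub>direct_sum M N\<^esub> = (\<zero>\<^bsub>M\<^esub>, \<zero>\<^bsub>N\<^esub>)"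
  "x \<oplus>\<^bsub>direct_sum M N\<^esub> y = (fst x \<oplus>\<^bsub>M\<^esub> fst y, snd x \<oplus>\<^bsub>N\<^esub> snd y)"
  "a \<odot>\<^bsub>direct_sum M N\<^esub> x = (a \<odot>\<^bsub>M\<^esub> fst x, a \<odot>\<^bsub>N\<^esub> snd x)"
  by (simp_all add: direct_sum_def)

lemma left_module_direct_sum:
  assumes "left_module R M" "left_module R N"
  shows "left_module R (direct_sum M N)"
proof -
  interpret M: left_module R M by fact
  interpret N: left_module R N by fact
  show ?thesis
  proof (intro left_module.intro left_module_axioms.intro M.R.ring_axioms abelian_groupI)
    fix x assume "x \<in> carrier (direct_sum M N)"
    then show "\<exists>y\<in>carrier (direct_sum M N). y \<oplus>\<^bsub>direct_sum M N\<^esub> x = \<zero>\<^bsub>direct_sum M N\<^esub>"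
      by (intro bexI[of _ "(\<ominus>\<^bsub>M\<^esub> fst x, \<ominus>\<^bsub>N\<^esub> snd x)"]) (auto simp: M.M.l_neg N.M.l_neg)
  qed (auto simp: M.M.add.m_ac N.M.add.m_ac M.smult_l_distr N.smult_l_distr
      M.smult_r_distr N.smult_r_distr M.smult_assoc1 N.smult_assoc1)
qed

lemma direct_sum_homs:
  assumes "left_module R M" "left_module R N"
  shows "(\<lambda>x. (x, \<zero>\<^bsub>N\<^esub>)) \<in> mod_hom R M (direct_sum M N)"
    "(\<lambda>y. (\<zero>\<^bsub>M\<^esub>, y)) \<in> mod_hom R N (direct_sum M N)"
    "fst \<in> mod_hom R (direct_sum M N) M" "snd \<in> mod_hom R (direct_sum M N) N"
    "\<And>f g. f \<in> mod_hom R K M \<Longrightarrow> g \<in> mod_hom R K N \<Longrightarrow> (\<lambda>x. (f x, g x)) \<in> mod_hom R K (direct_sum M N)"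
proof -
  interpret M: left_module R M by fact
  interpret N: left_module R N by fact
  show "(\<lambda>x. (x, \<zero>\<^bsub>N\<^esub>)) \<in> mod_hom R M (direct_sum M N)"
    "(\<lambda>y. (\<zero>\<^bsub>M\<^esub>, y)) \<in> mod_hom R N (direct_sum M N)"
    "fst \<in> mod_hom R (direct_sum M N) M" "snd \<in> mod_hom R (direct_sum M N) N"
    "\<And>f g. f \<in> mod_hom R K M \<Longrightarrow> g \<in> mod_hom R K N \<Longrightarrow> (\<lambda>x. (f x, g x)) \<in> mod_hom R K (direct_sum M N)"
    unfolding mod_hom_def by auto
qed

lemma fg_projective_direct_sum:
  assumes "fg_projective R M" "fg_projective R N"
  shows "fg_projective R (direct_sum M N)"
proof -
  have MN: "left_module R M" "left_module R N" using assms by (auto simp: fg_projective_def)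
  interpret M: left_module R M by fact
  interpret N: left_module R N by fact
  interpret S: left_module R "direct_sum M N" by (rule left_module_direct_sum[OF MN])
  note S = left_module_direct_sum[OF MN]
  note h = direct_sum_homs[OF MN]
  obtain m :: nat and f b where "dual_basis R M {..<m} f b" using fg_projectiveE[OF assms(1)] .
  note f = dual_basisD[OF this]
  obtain n :: nat and g c where "dual_basis R N {..<n} g c" using fg_projectiveE[OF assms(2)] .
  note g = dual_basisD[OF this]
  \<comment> \<open>The two dual bases side by side; the tag of the index records the
    summand.\<close>
  define F where "F = case_sum (\<lambda>k x. f k (fst x)) (\<lambda>k x. g k (snd x))"
  define B where "B = case_sum (\<lambda>k. (b k, \<zero>\<^bsub>N\<^esub>)) (\<lambda>k. (\<zero>\<^bsub>M\<^esub>, c k))"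
  let ?I = "Inl ` {..<m} \<union> Inr ` {..<n}"
  have F: "F k \<in> mod_hom R (direct_sum M N) (regular_module R)" if "k \<in> ?I" for k
    using that unfolding F_def
    by (auto intro!: mod_hom_comp[OF h(3)] mod_hom_comp[OF h(4)] f(2) g(2))
  have B: "B k \<in> carrier (direct_sum M N)" if "k \<in> ?I" for k
    using that f(3) g(3) by (auto simp: B_def)
  have "dual_basis R (direct_sum M N) ?I F B"
    unfolding dual_basis_def
  proof (intro conjI ballI F B)
    fix x assume x: "x \<in> carrier (direct_sum M N)"
    then have x': "fst x \<in> carrier M" "snd x \<in> carrier N" by auto
    have c: "F k x \<odot>\<^bsub>direct_sum M N\<^esub> B k \<in> carrier (direct_sum M N)" if "k \<in> ?I" for k
      using mod_homD(1)[OF F[OF that] x] B[OF that] by (intro S.smult_closed) auto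
    have "(\<Oplus>\<^bsub>direct_sum M N\<^esub>k\<in>?I. F k x \<odot>\<^bsub>direct_sum M N\<^esub> B k) =
        (\<Oplus>\<^bsub>direct_sum M N\<^esub>k\<in>Inl ` {..<m}. F k x \<odot>\<^bsub>direct_sum M N\<^esub> B k) \<oplus>\<^bsub>direct_sum M N\<^esub>
        (\<Oplus>\<^bsub>direct_sum M N\<^esub>k\<in>Inr ` {..<n}. F k x \<odot>\<^bsub>direct_sum M N\<^esub> B k)"
      by (rule S.M.finsum_Un_disjoint) (use c in blast)+
    also have "(\<Oplus>\<^bsub>direct_sum M N\<^esub>k\<in>Inl ` {..<m}. F k x \<odot>\<^bsub>direct_sum M N\<^esub> B k) =
        (\<Oplus>\<^bsub>direct_sum M N\<^esub>k\<in>{..<m}. F (Inl k) x \<odot>\<^bsub>direct_sum M N\<^esub> B (Inl k))"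
      by (rule S.M.finsum_reindex) (use c in blast, simp)
    also have "\<dots> = (\<Oplus>\<^bsub>direct_sum M N\<^esub>k\<in>{..<m}. f k (fst x) \<odot>\<^bsub>direct_sum M N\<^esub> (b k, \<zero>\<^bsub>N\<^esub>))"
      by (simp only: F_def B_def sum.case)
    also have "\<dots> = (\<Oplus>\<^bsub>M\<^esub>k\<in>{..<m}. f k (fst x) \<odot>\<^bsub>M\<^esub> b k, \<zero>\<^bsub>N\<^esub>)"
      by (rule mod_hom_lincomb[OF MN(1) S h(1), symmetric]) (use f(3,5) x' in auto)
    also have "\<dots> = (fst x, \<zero>\<^bsub>N\<^esub>)" using f(4)[OF x'(1)] by simp
    also have "(\<Oplus>\<^bsub>direct_sum M N\<^esub>k\<in>Inr ` {..<n}. F k x \<odot>\<^bsub>direct_sum M N\<^esub> B k) =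
        (\<Oplus>\<^bsub>direct_sum M N\<^esub>k\<in>{..<n}. F (Inr k) x \<odot>\<^bsub>direct_sum M N\<^esub> B (Inr k))"
      by (rule S.M.finsum_reindex) (use c in blast, simp)
    also have "\<dots> = (\<Oplus>\<^bsub>direct_sum M N\<^esub>k\<in>{..<n}. g k (snd x) \<odot>\<^bsub>direct_sum M N\<^esub> (\<zero>\<^bsub>M\<^esub>, c k))"
      by (simp only: F_def B_def sum.case)
    also have "\<dots> = (\<zero>\<^bsub>M\<^esub>, \<Oplus>\<^bsub>N\<^esub>k\<in>{..<n}. g k (snd x) \<odot>\<^bsub>N\<^esub> c k)"
      by (rule mod_hom_lincomb[OF MN(2) S h(2), symmetric]) (use g(3,5) x' in auto)
    also have "\<dots> = (\<zero>\<^bsub>M\<^esub>, snd x)" using g(4)[OF x'(2)] by simp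
    finally show "x = (\<Oplus>\<^bsub>direct_sum M N\<^esub>k\<in>?I. F k x \<odot>\<^bsub>direct_sum M N\<^esub> B k)"
      using x' by simp
  qed simp
  then show ?thesis by (rule fg_projectiveI[OF S])
qed

section \<open>Twisted sums of complete resolutions\<close>

lemma (in complete_resolution) d_d_next:
  "x \<in> carrier (P n) \<Longrightarrow> d (n + 1) (d n x) = \<zero>\<^bsub>P (n + 1 + 1)\<^esub>"
  using d_d[of x "n + 1"] by simp

text \<open>Dependent choice in both directions from degree \<open>a\<close>. \<open>Q\<close> is
  the invariant that permits the next choice; \<open>S\<close> links a degree to the one above it,
  so the downward choice has to produce its first argument.\<close>

lemma int_dependent_choice:
  fixes a :: int
  assumes start: "Q a h0"
    and up: "\<And>n h. Q n h \<Longrightarrow> \<exists>h'. Q (n + 1) h' \<and> S n h h'"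
    and down: "\<And>n h. Q n h \<Longrightarrow> \<exists>h'. Q (n - 1) h' \<and> S (n - 1) h' h"
  shows "\<exists>H. H a = h0 \<and> (\<forall>n. Q n (H n)) \<and> (\<forall>n. S n (H n) (H (n + 1)))"
proof -
  define U where "U = rec_nat h0 (\<lambda>k h. SOME h'. Q (a + int k + 1) h' \<and> S (a + int k) h h')"
  define D where "D = rec_nat h0 (\<lambda>k h. SOME h'. Q (a - int k - 1) h' \<and> S (a - int k - 1) h' h)"
  have step_U: "Q (a + int k) (U k) \<Longrightarrow> Q (a + int k + 1) (U (Suc k)) \<and> S (a + int k) (U k) (U (Suc k))" for k
    using someI_ex[OF up[of "a + int k" "U k"]] by (simp add: U_def)
  have step_D: "Q (a - int k) (D k) \<Longrightarrow> Q (a - int k - 1) (D (Suc k)) \<and> S (a - int k - 1) (D (Suc k)) (D k)" for k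
    using someI_ex[OF down[of "a - int k" "D k"]] by (simp add: D_def)
  have U: "Q (a + int k) (U k)" for k
  proof (induction k)
    case (Suc k) then show ?case using step_U[of k] by (simp add: algebra_simps)
  qed (use start in \<open>simp add: U_def\<close>)
  have D: "Q (a - int k) (D k)" for k
  proof (induction k)
    case (Suc k) then show ?case using step_D[of k] by (simp add: algebra_simps)
  qed (use start in \<open>simp add: D_def\<close>)
  have UD: "U 0 = D 0" by (simp add: U_def D_def)
  \<comment> \<open>Both recursions start from \<open>h0\<close>, so the halves agree in degree
    \<open>a\<close>.\<close>
  define H where "H n = (if n \<ge> a then U (nat (n - a)) else D (nat (a - n)))" for n
  have HD: "H (a - int k) = D k" for k
  proof (cases "k = 0")
    case False
    then have "\<not> a - int k \<ge> a" "nat (a - (a - int k)) = k" by auto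
    then show ?thesis by (simp only: H_def if_False)
  qed (simp add: H_def UD)
  have HU: "H (a + int k) = U k" for k by (simp add: H_def)
  show ?thesis
  proof (intro exI[of _ H] conjI allI)
    show "H a = h0" using HU[of 0] by (simp add: U_def)
    have dec: "(\<exists>k. n = a + int k) \<or> (\<exists>k. n = a - int (Suc k))" for n
    proof (cases "n \<ge> a")
      case True then show ?thesis by (intro disjI1 exI[of _ "nat (n - a)"]) simp
    next
      case False then show ?thesis by (intro disjI2 exI[of _ "nat (a - n - 1)"]) simp
    qed
    show "Q n (H n)" for n
      using dec[of n] U D HU HD by metis
    show "S n (H n) (H (n + 1))" for n
      using dec[of n]
    proof
      assume "\<exists>k. n = a + int k"
      then obtain k where k: "n = a + int k" by blast
      then have "n + 1 = a + int (Suc k)" by simp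
      then show ?thesis using step_U[OF U[of k]] HU k by metis
    next
      assume "\<exists>k. n = a - int (Suc k)"
      then obtain k where k: "n = a - int (Suc k)" by blast
      then have "n + 1 = a - int k" "n = a - int k - 1" by simp_all
      then show ?thesis using step_D[OF D[of k]] HD k by metis
    qed
  qed
qed

lemma (in left_module) minus_zero [simp]: "\<ominus>\<^bsub>M\<^esub> \<zero>\<^bsub>M\<^esub> = \<zero>\<^bsub>M\<^esub>"
  by (rule M.minus_equality) auto

lemma (in left_module) add_eq_zero_unique:
  assumes "x \<in> carrier M" "y \<in> carrier M" "z \<in> carrier M"
    and "x \<oplus>\<^bsub>M\<^esub> z = \<zero>\<^bsub>M\<^esub>" "y \<oplus>\<^bsub>M\<^esub> z = \<zero>\<^bsub>M\<^esub>"
  shows "x = y"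
  using assms M.minus_equality by metis

text \<open>The differential is triangular with diagonal entries \<open>d1\<close>,
  \<open>d2\<close> and corner entry \<open>H\<close>; \<open>anti\<close> says that the corner
  entry of its square vanishes. \<open>P1\<close> is a subcomplex with quotient \<open>P2\<close>,
  split in each degree, so exactness of the complex and of its dual is inherited from the two
  ends.\<close>

lemma complete_resolution_twisted_sum:
  assumes "complete_resolution R P1 d1" "complete_resolution R P2 d2"
    and H: "\<And>n. H n \<in> mod_hom R (P2 n) (P1 (n + 1))"
    and anti: "\<And>n y. y \<in> carrier (P2 n) \<Longrightarrow>
      d1 (n + 1) (H n y) \<oplus>\<^bsub>P1 (n + 1 + 1)\<^esub> H (n + 1) (d2 n y) = \<zero>\<^bsub>P1 (n + 1 + 1)\<^esub>"
  shows "complete_resolution R (\<lambda>n. direct_sum (P1 n) (P2 n))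
    (\<lambda>n z. (d1 n (fst z) \<oplus>\<^bsub>P1 (n + 1)\<^esub> H n (snd z), d2 n (snd z)))"
proof -
  interpret P1: complete_resolution R P1 d1 by fact
  interpret P2: complete_resolution R P2 d2 by fact
  note m1 = P1.left_module_terms and m2 = P2.left_module_terms
  note ds = direct_sum_homs[OF m1 m2]
  interpret M1: left_module R "P1 n" for n by (rule m1)
  interpret M2: left_module R "P2 n" for n by (rule m2)
  have H': "H (n - 1) \<in> mod_hom R (P2 (n - 1)) (P1 n)" for n using H[of "n - 1"] by simp
  note Hc = mod_homD(1)[OF H] and Hc' = mod_homD(1)[OF H']
  have anti': "d1 n (H (n - 1) y) \<oplus>\<^bsub>P1 (n + 1)\<^esub> H n (d2 (n - 1) y) = \<zero>\<^bsub>P1 (n + 1)\<^esub>"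
    if "y \<in> carrier (P2 (n - 1))" for n y using anti[OF that] by simp
  note cl = P1.d_closed P1.d_closed' P2.d_closed P2.d_closed' Hc Hc'
  let ?T = "\<lambda>n. direct_sum (P1 n) (P2 n)"
  let ?D = "\<lambda>n z. (d1 n (fst z) \<oplus>\<^bsub>P1 (n + 1)\<^esub> H n (snd z), d2 n (snd z))"
  show ?thesis
  proof (rule complete_resolutionI)
    show "fg_projective R (?T n)" for n
      by (intro fg_projective_direct_sum P1.fg_projective_terms P2.fg_projective_terms)
    show "?D n \<in> mod_hom R (?T n) (?T (n + 1))" for n
      by (intro direct_sum_homs(5)[OF m1 m2] mod_hom_add_fun[OF m1] mod_hom_comp[OF ds(3) P1.d_hom]
          mod_hom_comp[OF ds(4) H] mod_hom_comp[OF ds(4) P2.d_hom])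
    show "?D n (?D (n - 1) z) = \<zero>\<^bsub>?T (n + 1)\<^esub>" if "z \<in> carrier (?T (n - 1))" for n z
      using that anti'[of "snd z" n]
      by (auto simp: cl mod_homD(2)[OF P1.d_hom] P1.d_d P2.d_d)
  next
    fix n z assume z: "z \<in> carrier (?T n)" and Dz: "?D n z = \<zero>\<^bsub>?T (n + 1)\<^esub>"
    then have xy: "fst z \<in> carrier (P1 n)" "snd z \<in> carrier (P2 n)"
      and eq: "d1 n (fst z) \<oplus>\<^bsub>P1 (n + 1)\<^esub> H n (snd z) = \<zero>\<^bsub>P1 (n + 1)\<^esub>"
        "d2 n (snd z) = \<zero>\<^bsub>P2 (n + 1)\<^esub>" by auto
    obtain y' where y': "y' \<in> carrier (P2 (n - 1))" "snd z = d2 (n - 1) y'"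
      using P2.exact[OF xy(2) eq(2)] by metis
    \<comment> \<open>Once the second component is a boundary \<open>d2 y'\<close>, subtracting
      \<open>H y'\<close> from the first removes the twist and leaves a cycle of
      \<open>P1\<close>.\<close>
    let ?x = "fst z \<ominus>\<^bsub>P1 n\<^esub> H (n - 1) y'"
    have "d1 n (fst z) = d1 n (H (n - 1) y')"
      by (rule M1.add_eq_zero_unique[of _ "n + 1" _ "H n (snd z)"])
        (use eq(1) anti'[OF y'(1)] y' xy in \<open>auto simp: cl\<close>)
    then have "d1 n ?x = \<zero>\<^bsub>P1 (n + 1)\<^esub>"
      using xy y' by (simp add: mod_hom_minus(2)[OF m1 m1 P1.d_hom] cl M1.minus_eq_zero_iff)
    moreover have "?x \<in> carrier (P1 n)" using xy y' by (simp add: cl)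
    ultimately obtain x' where x': "x' \<in> carrier (P1 (n - 1))" "?x = d1 (n - 1) x'"
      using P1.exact by metis
    have "fst z = d1 (n - 1) x' \<oplus>\<^bsub>P1 n\<^esub> H (n - 1) y'"
      using x'(2)[symmetric] M1.add_minus_cancel(1)[OF Hc'[OF y'(1)] xy(1)] xy y'
      by (simp add: M1.M.add.m_comm cl)
    then have "z = ?D (n - 1) (x', y')" using y'(2) by (simp add: prod_eq_iff)
    then show "z \<in> ?D (n - 1) ` carrier (?T (n - 1))" using x' y' by (intro image_eqI[of _ _ "(x', y')"]) auto
  next
    fix n F assume F: "F \<in> mod_hom R (?T n) (regular_module R)"
      and F0: "\<And>z. z \<in> carrier (?T (n - 1)) \<Longrightarrow> F (?D (n - 1) z) = \<zero>\<^bsub>R\<^esub>"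
    note reg = left_module_regular[OF M1.R.ring_axioms]
    interpret R: left_module R "regular_module R" by (rule reg)
    let ?f1 = "\<lambda>x. F (x, \<zero>\<^bsub>P2 n\<^esub>)"
    have f1: "?f1 \<in> mod_hom R (P1 n) (regular_module R)" by (rule mod_hom_comp[OF ds(1) F])
    have f2: "(\<lambda>y. F (\<zero>\<^bsub>P1 n\<^esub>, y)) \<in> mod_hom R (P2 n) (regular_module R)"
      by (rule mod_hom_comp[OF ds(2) F])
    have Fsplit: "F (x, y) = F (x, \<zero>\<^bsub>P2 n\<^esub>) \<oplus>\<^bsub>R\<^esub> F (\<zero>\<^bsub>P1 n\<^esub>, y)"
      if "x \<in> carrier (P1 n)" "y \<in> carrier (P2 n)" for x y
      using that mod_homD(2)[OF F, of "(x, \<zero>\<^bsub>P2 n\<^esub>)" "(\<zero>\<^bsub>P1 n\<^esub>, y)"] by simp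
    have "?f1 (d1 (n - 1) x) = \<zero>\<^bsub>R\<^esub>" if "x \<in> carrier (P1 (n - 1))" for x
      using F0[of "(x, \<zero>\<^bsub>P2 (n - 1)\<^esub>)"] that
      by (simp add: mod_hom_zero[OF m2 m1 H'] mod_hom_zero[OF m2 m2 P2.d_hom'] cl)
    then obtain g1 where g1: "g1 \<in> mod_hom R (P1 (n + 1)) (regular_module R)"
      "\<And>x. x \<in> carrier (P1 n) \<Longrightarrow> ?f1 x = g1 (d1 n x)"
      using P1.hom_exact_regular[OF f1] by blast
    \<comment> \<open>\<open>g1\<close> extends the restriction of \<open>F\<close> to
      \<open>P1\<close>, but it also contributes \<open>g1 o H\<close> on \<open>P2\<close>. After
      this is subtracted, \<open>anti\<close> makes the remainder a cocycle of
      \<open>P2\<close>.\<close>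
    let ?f2 = "\<lambda>y. F (\<zero>\<^bsub>P1 n\<^esub>, y) \<ominus>\<^bsub>regular_module R\<^esub> g1 (H n y)"
    have f2': "?f2 \<in> mod_hom R (P2 n) (regular_module R)"
      by (intro mod_hom_minus_fun[OF reg f2] mod_hom_comp[OF H g1(1)])
    have "?f2 (d2 (n - 1) y) = \<zero>\<^bsub>R\<^esub>" if y: "y \<in> carrier (P2 (n - 1))" for y
    proof -
      have c: "F (\<zero>\<^bsub>P1 n\<^esub>, d2 (n - 1) y) \<in> carrier R" "g1 (H n (d2 (n - 1) y)) \<in> carrier R"
        "F (H (n - 1) y, \<zero>\<^bsub>P2 n\<^esub>) \<in> carrier R"
        using mod_homD(1)[OF f1] mod_homD(1)[OF f2] mod_homD(1)[OF g1(1)] y by (simp_all add: cl)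
      have 1: "F (\<zero>\<^bsub>P1 n\<^esub>, d2 (n - 1) y) \<oplus>\<^bsub>R\<^esub> F (H (n - 1) y, \<zero>\<^bsub>P2 n\<^esub>) = \<zero>\<^bsub>R\<^esub>"
        using F0[of "(\<zero>\<^bsub>P1 (n - 1)\<^esub>, y)"] y Fsplit[of "H (n - 1) y" "d2 (n - 1) y"] c
        by (simp add: mod_hom_zero[OF m1 m1 P1.d_hom'] cl M1.R.add.m_comm)
      have 2: "g1 (H n (d2 (n - 1) y)) \<oplus>\<^bsub>R\<^esub> F (H (n - 1) y, \<zero>\<^bsub>P2 n\<^esub>) = \<zero>\<^bsub>R\<^esub>"
      proof -
        have "g1 (d1 n (H (n - 1) y)) \<oplus>\<^bsub>R\<^esub> g1 (H n (d2 (n - 1) y)) =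
            g1 (d1 n (H (n - 1) y) \<oplus>\<^bsub>P1 (n + 1)\<^esub> H n (d2 (n - 1) y))"
          using y mod_homD(2)[OF g1(1)] by (simp add: cl)
        also have "\<dots> = \<zero>\<^bsub>R\<^esub>" using anti'[OF y] mod_hom_zero[OF m1 reg g1(1)] by simp
        finally show ?thesis using g1(2)[of "H (n - 1) y"] c y by (simp add: cl M1.R.add.m_comm)
      qed
      have "F (\<zero>\<^bsub>P1 n\<^esub>, d2 (n - 1) y) = g1 (H n (d2 (n - 1) y))"
        by (rule R.add_eq_zero_unique[simplified, OF c 1 2])
      then show ?thesis using c R.minus_eq_zero_iff by simp
    qed
    then obtain g2 where g2: "g2 \<in> mod_hom R (P2 (n + 1)) (regular_module R)"
      "\<And>y. y \<in> carrier (P2 n) \<Longrightarrow> ?f2 y = g2 (d2 n y)"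
      using P2.hom_exact_regular[OF f2'] by blast
    show "\<exists>G\<in>mod_hom R (?T (n + 1)) (regular_module R). \<forall>z\<in>carrier (?T n). F z = G (?D n z)"
    proof (intro bexI ballI)
      show "(\<lambda>z. g1 (fst z) \<oplus>\<^bsub>regular_module R\<^esub> g2 (snd z)) \<in> mod_hom R (?T (n + 1)) (regular_module R)"
        by (intro mod_hom_add_fun[OF reg] mod_hom_comp[OF ds(3) g1(1)] mod_hom_comp[OF ds(4) g2(1)])
      fix z assume "z \<in> carrier (?T n)"
      then obtain x y where z: "z = (x, y)" "x \<in> carrier (P1 n)" "y \<in> carrier (P2 n)" by auto
      have c: "F (\<zero>\<^bsub>P1 n\<^esub>, y) \<in> carrier R" "g1 (H n y) \<in> carrier R" "g1 (d1 n x) \<in> carrier R"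
        using mod_homD(1)[OF f2] mod_homD(1)[OF g1(1)] z by (simp_all add: cl)
      have f2y: "?f2 y \<in> carrier R" using mod_homD(1)[OF f2' z(3)] by simp
      have "g1 (d1 n x \<oplus>\<^bsub>P1 (n + 1)\<^esub> H n y) = g1 (d1 n x) \<oplus>\<^bsub>R\<^esub> g1 (H n y)"
        using mod_homD(2)[OF g1(1) P1.d_closed[OF z(2)] Hc[OF z(3)]] by simp
      then have "g1 (d1 n x \<oplus>\<^bsub>P1 (n + 1)\<^esub> H n y) \<oplus>\<^bsub>R\<^esub> g2 (d2 n y) =
          g1 (d1 n x) \<oplus>\<^bsub>R\<^esub> (g1 (H n y) \<oplus>\<^bsub>R\<^esub> ?f2 y)"
        unfolding g2(2)[OF z(3), symmetric] using M1.R.a_assoc[OF c(3,2) f2y] by simp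
      also have "g1 (H n y) \<oplus>\<^bsub>R\<^esub> ?f2 y = F (\<zero>\<^bsub>P1 n\<^esub>, y)"
        using R.add_minus_cancel(1)[of "g1 (H n y)" "F (\<zero>\<^bsub>P1 n\<^esub>, y)"] c(1,2)
        unfolding regular_module_simps by blast
      also have "g1 (d1 n x) \<oplus>\<^bsub>R\<^esub> F (\<zero>\<^bsub>P1 n\<^esub>, y) = F z"
        unfolding z(1) Fsplit[OF z(2,3)] g1(2)[OF z(2)] ..
      finally show "F z = g1 (fst (?D n z)) \<oplus>\<^bsub>regular_module R\<^esub> g2 (snd (?D n z))"
        using z by simp
    qed
  qed
qed

text \<open>
  The twist \<open>H\<close> of the differential is built outwards from degree \<open>-1\<close>: upwards by exactness
  of \<open>Hom(P\<^sub>2, P\<^sub>1)\<close>, downwards by projectivity of the terms of \<open>P\<^sub>2\<close>.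
\<close>

lemma complete_resolution_twist:
  assumes "complete_resolution R P1 d1" "complete_resolution R P2 d2"
    and g: "g \<in> mod_hom R (P2 (- 1)) (P1 0)"
    and g0: "\<And>y. y \<in> carrier (P2 (- 2)) \<Longrightarrow> d1 0 (g (d2 (- 2) y)) = \<zero>\<^bsub>P1 1\<^esub>"
  obtains H where "H (- 1) = g" "\<forall>n. H n \<in> mod_hom R (P2 n) (P1 (n + 1))"
    "\<forall>n. \<forall>y\<in>carrier (P2 n).
      d1 (n + 1) (H n y) \<oplus>\<^bsub>P1 (n + 1 + 1)\<^esub> H (n + 1) (d2 n y) = \<zero>\<^bsub>P1 (n + 1 + 1)\<^esub>"
proof -
  interpret P1: complete_resolution R P1 d1 by fact
  interpret P2: complete_resolution R P2 d2 by fact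
  note m1 = P1.left_module_terms and m2 = P2.left_module_terms
  interpret M1: left_module R "P1 n" for n by (rule m1)
  interpret M2: left_module R "P2 n" for n by (rule m2)
  note cl = P1.d_closed P1.d_closed' P2.d_closed P2.d_closed'
  \<comment> \<open>One invariant serves both directions. Upwards, it says that
    \<open>d1 o h\<close> vanishes on boundaries of \<open>P2\<close> and hence factors through
    \<open>d2\<close>. Downwards, it says that \<open>h o d2\<close> takes values in the cycles of
    \<open>P1\<close>, which are boundaries and can be lifted.\<close>
  define Q where "Q n h \<longleftrightarrow> h \<in> mod_hom R (P2 n) (P1 (n + 1)) \<and>
    (\<forall>y\<in>carrier (P2 (n - 1)). d1 (n + 1) (h (d2 (n - 1) y)) = \<zero>\<^bsub>P1 (n + 1 + 1)\<^esub>)" for n h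
  define S where "S n h h' \<longleftrightarrow> (\<forall>y\<in>carrier (P2 n).
    d1 (n + 1) (h y) \<oplus>\<^bsub>P1 (n + 1 + 1)\<^esub> h' (d2 n y) = \<zero>\<^bsub>P1 (n + 1 + 1)\<^esub>)" for n h h'
  have "Q (- 1) g" using g g0 by (simp add: Q_def)
  moreover have "\<exists>h'. Q (n + 1) h' \<and> S n h h'" if Q: "Q n h" for n h
  proof -
    have h: "h \<in> mod_hom R (P2 n) (P1 (n + 1))" using Q by (simp add: Q_def)
    let ?f = "\<lambda>y. \<ominus>\<^bsub>P1 (n + 1 + 1)\<^esub> d1 (n + 1) (h y)"
    have f: "?f \<in> mod_hom R (P2 n) (P1 (n + 1 + 1))"
      by (intro mod_hom_uminus_fun m1 mod_hom_comp[OF h P1.d_hom])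
    obtain h' where h': "h' \<in> mod_hom R (P2 (n + 1)) (P1 (n + 1 + 1))"
      "\<And>y. y \<in> carrier (P2 n) \<Longrightarrow> h' (d2 n y) = ?f y"
    proof (rule P2.hom_exact[OF P1.fg_projective_terms f])
      show "?f (d2 (n - 1) y) = \<zero>\<^bsub>P1 (n + 1 + 1)\<^esub>" if "y \<in> carrier (P2 (n - 1))" for y
        using Q that by (simp add: Q_def)
    qed blast
    have hc: "h y \<in> carrier (P1 (n + 1))" if "y \<in> carrier (P2 n)" for y using mod_homD(1)[OF h that] .
    have "d1 (n + 1 + 1) (h' (d2 n y)) = \<zero>\<^bsub>P1 (n + 1 + 1 + 1)\<^esub>" if y: "y \<in> carrier (P2 n)" for y
    proof -
      have "d1 (n + 1 + 1) (h' (d2 n y)) =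
          \<ominus>\<^bsub>P1 (n + 1 + 1 + 1)\<^esub> d1 (n + 1 + 1) (d1 (n + 1) (h y))"
        unfolding h'(2)[OF y] by (rule mod_hom_minus(1)[OF m1 m1 P1.d_hom cl(1)]) (rule hc[OF y])
      also have "d1 (n + 1 + 1) (d1 (n + 1) (h y)) = \<zero>\<^bsub>P1 (n + 1 + 1 + 1)\<^esub>"
        by (rule P1.d_d_next[OF hc[OF y]])
      finally show ?thesis by (simp only: M1.minus_zero)
    qed
    then have "Q (n + 1) h'" using h'(1) by (simp add: Q_def)
    moreover have "S n h h'"
      unfolding S_def
    proof
      fix y assume y: "y \<in> carrier (P2 n)"
      show "d1 (n + 1) (h y) \<oplus>\<^bsub>P1 (n + 1 + 1)\<^esub> h' (d2 n y) = \<zero>\<^bsub>P1 (n + 1 + 1)\<^esub>"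
        unfolding h'(2)[OF y] by (rule M1.M.r_neg[OF cl(1)[OF hc[OF y]]])
    qed
    ultimately show ?thesis by blast
  qed
  moreover have "\<exists>h'. Q (n - 1) h' \<and> S (n - 1) h' h" if Q: "Q n h" for n h
  proof -
    have h: "h \<in> mod_hom R (P2 n) (P1 (n + 1))" using Q by (simp add: Q_def)
    let ?f = "\<lambda>y. \<ominus>\<^bsub>P1 (n + 1)\<^esub> h (d2 (n - 1) y)"
    have f: "?f \<in> mod_hom R (P2 (n - 1)) (P1 (n + 1))"
      by (intro mod_hom_uminus_fun m1 mod_hom_comp[OF P2.d_hom' h])
    have hd: "h (d2 (n - 1) y) \<in> carrier (P1 (n + 1))" if "y \<in> carrier (P2 (n - 1))" for y
      using that mod_homD(1)[OF h] by (simp add: cl)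
    obtain h' where h': "h' \<in> mod_hom R (P2 (n - 1)) (P1 n)"
      "\<And>y. y \<in> carrier (P2 (n - 1)) \<Longrightarrow> d1 n (h' y) = ?f y"
    proof (rule fg_projective_lift[OF P2.fg_projective_terms m1 m1 P1.d_hom f])
      fix y assume y: "y \<in> carrier (P2 (n - 1))"
      then have "d1 (n + 1) (?f y) = \<zero>\<^bsub>P1 (n + 1 + 1)\<^esub>"
        using Q hd by (simp add: Q_def mod_hom_minus(1)[OF m1 m1 P1.d_hom])
      then show "?f y \<in> d1 n ` carrier (P1 n)"
        using P1.exact[of "?f y" "n + 1"] hd[OF y] by auto
    qed blast
    have "d1 n (h' (d2 (n - 1 - 1) y)) = \<zero>\<^bsub>P1 (n + 1)\<^esub>" if y: "y \<in> carrier (P2 (n - 1 - 1))" for y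
      using h'(2)[OF P2.d_closed'[OF y]] P2.d_d[OF y] mod_hom_zero[OF m2 m1 h] by simp
    then have "Q (n - 1) h'" using h'(1) by (simp add: Q_def)
    moreover have "S (n - 1) h' h"
      unfolding S_def using h'(2) hd by (simp add: M1.M.l_neg)
    ultimately show ?thesis by blast
  qed
  ultimately have "\<exists>H. H (- 1) = g \<and> (\<forall>n. Q n (H n)) \<and> (\<forall>n. S n (H n) (H (n + 1)))"
    by (rule int_dependent_choice[of Q "- 1" g S])
  then obtain H where "H (- 1) = g" "\<And>n. Q n (H n)" "\<And>n. S n (H n) (H (n + 1))" by blast
  then show thesis using that[of H] unfolding Q_def S_def by blast
qed

text \<open>A horseshoe argument for complete resolutions. The quotient of \<open>M\<close> by
  \<open>M1\<close> is present only implicitly: \<open>\<Gamma>\<close> maps \<open>U\<close> onto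
  it, and \<open>ker\<close> and \<open>im\<close> let \<open>\<eta>\<close> identify it with the
  cycles of \<open>P2\<close> in degree 0. Thus an induced module can be used as \<open>U\<close>
  without computing cosets.\<close>

theorem gorenstein_projective_extension:
  fixes M :: "('r, 'm) module" and U :: "('r, 'u) module" and P2 :: "int \<Rightarrow> ('r, 'b) module"
  assumes M: "left_module R M" and M1: "left_submodule R M M1"
    and G1: "gorenstein_projective R (restrict_carrier M M1)"
    and res2: "complete_resolution R P2 d2"
    and U: "left_module R U" and \<Gamma>: "\<Gamma> \<in> mod_hom R U M" and \<eta>: "\<eta> \<in> mod_hom R U (P2 0)"
    and gen: "\<And>z. z \<in> carrier M \<Longrightarrow> \<exists>x\<in>M1. \<exists>u\<in>carrier U. z = x \<oplus>\<^bsub>M\<^esub> \<Gamma> u"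
    and ker: "\<And>u. u \<in> carrier U \<Longrightarrow> \<Gamma> u \<in> M1 \<longleftrightarrow> \<eta> u = \<zero>\<^bsub>P2 0\<^esub>"
    and im: "\<eta> ` carrier U = {y \<in> carrier (P2 0). d2 0 y = \<zero>\<^bsub>P2 1\<^esub>}"
  shows "gorenstein_projective R M"
proof -
  obtain P1 :: "int \<Rightarrow> ('r, nat \<Rightarrow> 'r) module" and d1 \<iota> where res1: "complete_resolution R P1 d1"
    and \<iota>: "\<iota> \<in> mod_hom R (restrict_carrier M M1) (P1 0)" "inj_on \<iota> M1"
      "\<iota> ` M1 = {x \<in> carrier (P1 0). d1 0 x = \<zero>\<^bsub>P1 1\<^esub>}"
    using gorenstein_projectiveE[OF G1] unfolding restrict_carrier_simps .
  interpret P1: complete_resolution R P1 d1 by fact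
  interpret P2: complete_resolution R P2 d2 by fact
  note m1 = P1.left_module_terms and m2 = P2.left_module_terms
  interpret M: left_module R M by fact
  interpret U: left_module R U by fact
  interpret M1: left_module R "P1 n" for n by (rule m1)
  interpret M2: left_module R "P2 n" for n by (rule m2)
  have RM: "left_module R (restrict_carrier M M1)" by (rule left_module_restrict[OF M M1])
  note M1D = left_submoduleD[OF M1]
  have \<eta>0: "\<eta> u = \<zero>\<^bsub>P2 0\<^esub>" if "u \<in> carrier U" "\<Gamma> u \<in> M1" for u using that ker by simp
  \<comment> \<open>The projection modulo \<open>M1\<close>, read as a map into \<open>P2 0\<close>:
    zero on \<open>M1\<close> and \<open>\<eta>\<close> on the rest.\<close>
  obtain \<pi> where \<pi>: "\<pi> \<in> mod_hom R M (P2 0)"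
    and "\<forall>x\<in>M1. \<forall>u\<in>carrier U. \<pi> (x \<oplus>\<^bsub>M\<^esub> \<Gamma> u) = \<zero>\<^bsub>P2 0\<^esub> \<oplus>\<^bsub>P2 0\<^esub> \<eta> u"
    using mod_hom_glue[OF M m2 U M1 \<Gamma> \<eta> mod_hom_zero_fun[OF m2] gen \<eta>0] .
  then have \<pi>': "\<pi> (x \<oplus>\<^bsub>M\<^esub> \<Gamma> u) = \<zero>\<^bsub>P2 0\<^esub> \<oplus>\<^bsub>P2 0\<^esub> \<eta> u" if "x \<in> M1" "u \<in> carrier U" for x u
    using that by blast
  note \<Gamma>c = mod_homD(1)[OF \<Gamma>] and \<eta>c = mod_homD(1)[OF \<eta>] and \<pi>c = mod_homD(1)[OF \<pi>]
  have \<pi>_ker: "\<pi> z = \<zero>\<^bsub>P2 0\<^esub> \<longleftrightarrow> z \<in> M1" if z: "z \<in> carrier M" for z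
  proof -
    obtain x u where xu: "x \<in> M1" "u \<in> carrier U" "z = x \<oplus>\<^bsub>M\<^esub> \<Gamma> u" using gen[OF z] by blast
    have "\<pi> z = \<eta> u" using \<pi>'[OF xu(1,2)] \<eta>c[OF xu(2)] xu(3) by simp
    moreover have "z \<in> M1 \<longleftrightarrow> \<Gamma> u \<in> M1"
    proof
      assume "z \<in> M1"
      then have "z \<ominus>\<^bsub>M\<^esub> x \<in> M1" using left_submodule_minus(2)[OF M M1] xu by simp
      then show "\<Gamma> u \<in> M1" using M.add_minus_cancel(2)[OF M1D(1)[OF xu(1)] \<Gamma>c[OF xu(2)]] xu(3) by simp
    qed (use xu M1D(3) in simp)
    ultimately show ?thesis using ker[OF xu(2)] by simp
  qed
  have \<Gamma>\<pi>: "\<pi> (\<Gamma> u) = \<eta> u" if "u \<in> carrier U" for u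
    using \<pi>'[OF M1D(2) that] that \<Gamma>c \<eta>c by simp
  have \<pi>_im: "\<pi> ` carrier M = {y \<in> carrier (P2 0). d2 0 y = \<zero>\<^bsub>P2 1\<^esub>}" (is "_ = ?Z")
  proof
    show "\<pi> ` carrier M \<subseteq> ?Z"
    proof
      fix y assume "y \<in> \<pi> ` carrier M"
      then obtain z where z: "z \<in> carrier M" "y = \<pi> z" by blast
      obtain x u where xu: "x \<in> M1" "u \<in> carrier U" "z = x \<oplus>\<^bsub>M\<^esub> \<Gamma> u" using gen[OF z(1)] by blast
      have "y = \<eta> u" using \<pi>'[OF xu(1,2)] \<eta>c[OF xu(2)] xu(3) z by simp
      then show "y \<in> ?Z" using im xu by blast
    qed
    show "?Z \<subseteq> \<pi> ` carrier M" unfolding im[symmetric] using \<Gamma>\<pi> \<Gamma>c by (metis image_subsetI imageI)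
  qed
  \<comment> \<open>\<open>d2 (- 1)\<close> covers the cycles in \<open>P2 0\<close>. Its lift
    \<open>u\<close> through \<open>\<pi>\<close> sends the boundaries of \<open>P2 (- 1)\<close>
    into the kernel of \<open>\<pi>\<close>, which is \<open>M1\<close>.\<close>
  obtain u where u: "u \<in> mod_hom R (P2 (- 1)) M" "\<And>p. p \<in> carrier (P2 (- 1)) \<Longrightarrow> \<pi> (u p) = d2 (- 1) p"
  proof (rule fg_projective_lift[OF P2.fg_projective_terms M m2 \<pi>])
    show "d2 (- 1) \<in> mod_hom R (P2 (- 1)) (P2 0)" using P2.d_hom[of "- 1"] by simp
    show "d2 (- 1) p \<in> \<pi> ` carrier M" if "p \<in> carrier (P2 (- 1))" for p
      unfolding \<pi>_im using P2.d_d[of p 0] P2.d_closed'[of p 0] that by simp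
  qed blast
  note uc = mod_homD(1)[OF u(1)]
  have d2c: "d2 (- 2) y \<in> carrier (P2 (- 1))" if "y \<in> carrier (P2 (- 2))" for y
    using P2.d_closed[OF that] by simp
  have ud: "u (d2 (- 2) y) \<in> M1" if "y \<in> carrier (P2 (- 2))" for y
    using \<pi>_ker[OF uc[OF d2c[OF that]]] u(2)[OF d2c[OF that]] P2.d_d[of y "- 1"] that by simp
  \<comment> \<open>On boundaries \<open>\<iota> o u\<close> is defined; exactness of
    \<open>Hom(P2, P1 0)\<close> extends it to all of \<open>P2 (- 1)\<close>. This is the vanishing
    of Ext^1 from the quotient into a projective module.\<close>
  obtain g where g: "g \<in> mod_hom R (P2 (- 1)) (P1 0)"
    "\<And>y. y \<in> carrier (P2 (- 2)) \<Longrightarrow> g (d2 (- 2) y) = \<iota> (u (d2 (- 2) y))"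
  proof (rule P2.hom_exact[OF P1.fg_projective_terms, of "\<lambda>y. \<iota> (u (d2 (- 2) y))" "- 2"])
    have "(\<lambda>y. u (d2 (- 2) y)) \<in> mod_hom R (P2 (- 2)) M"
      using mod_hom_comp[OF P2.d_hom[of "- 2"], of u M] u(1) by simp
    then show "(\<lambda>y. \<iota> (u (d2 (- 2) y))) \<in> mod_hom R (P2 (- 2)) (P1 0)"
      by (intro mod_hom_comp[OF mod_hom_restrict_carrier(2) \<iota>(1)] ud)
    show "\<iota> (u (d2 (- 2) (d2 (- 2 - 1) y))) = \<zero>\<^bsub>P1 0\<^esub>" if "y \<in> carrier (P2 (- 2 - 1))" for y
      using P2.d_d[OF that] mod_hom_zero[OF m2 M u(1)] mod_hom_zero[OF RM m1 \<iota>(1)] by simp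
  qed auto
  have ker_d2: "\<exists>p\<in>carrier (P2 (- 1)). z = d2 (- 1) p"
    if "z \<in> carrier (P2 0)" "d2 0 z = \<zero>\<^bsub>P2 1\<^esub>" for z
    using P2.exact[of z 0] that by (metis add_0 diff_0)
  have gen': "\<exists>x\<in>M1. \<exists>p\<in>carrier (P2 (- 1)). z = x \<oplus>\<^bsub>M\<^esub> u p" if z: "z \<in> carrier M" for z
  proof -
    obtain p where p: "p \<in> carrier (P2 (- 1))" "\<pi> z = d2 (- 1) p"
      using ker_d2[of "\<pi> z"] \<pi>_im z by blast
    have "\<pi> (z \<ominus>\<^bsub>M\<^esub> u p) = \<zero>\<^bsub>P2 0\<^esub>"
      using z p u(2) uc \<pi>c[OF z] by (simp add: mod_hom_minus(2)[OF M m2 \<pi>] M2.minus_eq_zero_iff)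
    then have "z \<ominus>\<^bsub>M\<^esub> u p \<in> M1" using \<pi>_ker[of "z \<ominus>\<^bsub>M\<^esub> u p"] z uc[OF p(1)] by simp
    moreover have "z = (z \<ominus>\<^bsub>M\<^esub> u p) \<oplus>\<^bsub>M\<^esub> u p"
      using M.add_minus_cancel(1)[OF uc[OF p(1)] z] z uc[OF p(1)] by (simp add: M.M.add.m_comm)
    ultimately show ?thesis using p by blast
  qed
  have g\<iota>: "g p = \<iota> (u p)" if p: "p \<in> carrier (P2 (- 1))" "u p \<in> M1" for p
  proof -
    have "d2 (- 1) p = \<zero>\<^bsub>P2 0\<^esub>" using u(2) \<pi>_ker uc p by metis
    then obtain y where "y \<in> carrier (P2 (- 2))" "p = d2 (- 2) y"
      using P2.exact[of p "- 1"] p by auto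
    then show ?thesis using g(2) by simp
  qed
  \<comment> \<open>\<open>w\<close> extends the embedding \<open>\<iota>\<close> from
    \<open>M1\<close> to \<open>M\<close>. The choice of \<open>g\<close> makes both prescriptions
    agree whenever \<open>u p\<close> lies in \<open>M1\<close>.\<close>
  obtain w where w: "w \<in> mod_hom R M (P1 0)"
    and "\<forall>x\<in>M1. \<forall>p\<in>carrier (P2 (- 1)). w (x \<oplus>\<^bsub>M\<^esub> u p) = \<iota> x \<oplus>\<^bsub>P1 0\<^esub> g p"
    using mod_hom_glue[OF M m1 m2 M1 u(1) g(1) \<iota>(1) gen' g\<iota>] .
  then have w': "w (x \<oplus>\<^bsub>M\<^esub> u p) = \<iota> x \<oplus>\<^bsub>P1 0\<^esub> g p" if "x \<in> M1" "p \<in> carrier (P2 (- 1))" for x p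
    using that by blast
  note wc = mod_homD(1)[OF w] and gc = mod_homD(1)[OF g(1)]
  have \<iota>c: "\<iota> x \<in> carrier (P1 0)" "d1 0 (\<iota> x) = \<zero>\<^bsub>P1 1\<^esub>" if "x \<in> M1" for x using that \<iota>(3) by auto
  have w\<iota>: "w x = \<iota> x" if "x \<in> M1" for x
    using w'[OF that M2.M.zero_closed] that mod_hom_zero[OF m2 M u(1)] mod_hom_zero[OF m2 m1 g(1)]
      M1D(1)[OF that] \<iota>c by simp
  have g0: "d1 0 (g (d2 (- 2) y)) = \<zero>\<^bsub>P1 1\<^esub>" if "y \<in> carrier (P2 (- 2))" for y
    using that g(2) \<iota>c(2) ud by simp
  \<comment> \<open>The prescription \<open>H (- 1) = g\<close> ties the twist to \<open>w\<close>:
    it is what makes the pairs \<open>(w z, \<pi> z)\<close> cycles of the twisted sum.\<close>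
  obtain H where H1: "H (- 1) = g" "\<forall>n. H n \<in> mod_hom R (P2 n) (P1 (n + 1))"
    and "\<forall>n. \<forall>y\<in>carrier (P2 n).
      d1 (n + 1) (H n y) \<oplus>\<^bsub>P1 (n + 1 + 1)\<^esub> H (n + 1) (d2 n y) = \<zero>\<^bsub>P1 (n + 1 + 1)\<^esub>"
    using complete_resolution_twist[OF res1 res2 g(1) g0] .
  then have anti: "d1 (n + 1) (H n y) \<oplus>\<^bsub>P1 (n + 1 + 1)\<^esub> H (n + 1) (d2 n y) = \<zero>\<^bsub>P1 (n + 1 + 1)\<^esub>"
    if "y \<in> carrier (P2 n)" for n y using that by blast
  have H: "H n \<in> mod_hom R (P2 n) (P1 (n + 1))" for n using H1(2) by blast
  have anti0: "d1 0 (g p) \<oplus>\<^bsub>P1 1\<^esub> H 0 (d2 (- 1) p) = \<zero>\<^bsub>P1 1\<^esub>" if "p \<in> carrier (P2 (- 1))" for p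
    using anti[OF that] by (simp add: H1(1))
  let ?T = "\<lambda>n. direct_sum (P1 n) (P2 n)"
  let ?D = "\<lambda>n z. (d1 n (fst z) \<oplus>\<^bsub>P1 (n + 1)\<^esub> H n (snd z), d2 n (snd z))"
  let ?\<epsilon> = "\<lambda>z. (w z, \<pi> z)"
  have T: "left_module R (?T 0)" by (rule left_module_direct_sum[OF m1 m2])
  have \<epsilon>: "?\<epsilon> \<in> mod_hom R M (?T 0)" by (rule direct_sum_homs(5)[OF m1 m2 w \<pi>])
  have d1_0: "d1 0 \<in> mod_hom R (P1 0) (P1 1)" using P1.d_hom[of 0] by simp
  have H0: "H 0 \<in> mod_hom R (P2 0) (P1 1)" using H[of 0] by simp
  have cocycle: "d1 0 (w z) \<oplus>\<^bsub>P1 1\<^esub> H 0 (\<pi> z) = \<zero>\<^bsub>P1 1\<^esub>" if z: "z \<in> carrier M" for z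
  proof -
    obtain x p where xp: "x \<in> M1" "p \<in> carrier (P2 (- 1))" "z = x \<oplus>\<^bsub>M\<^esub> u p" using gen'[OF z] by blast
    have "\<pi> z = d2 (- 1) p"
      using mod_homD(2)[OF \<pi> M1D(1)[OF xp(1)] uc[OF xp(2)]] \<pi>_ker[OF M1D(1)[OF xp(1)]] xp u(2)
        \<pi>c[OF uc[OF xp(2)]] by simp
    moreover have "d1 0 (w z) = d1 0 (g p)"
      using w'[OF xp(1,2)] xp mod_homD(2)[OF d1_0 \<iota>c(1) gc, of x p] \<iota>c(2) mod_homD(1)[OF d1_0 gc[OF xp(2)]]
      by simp
    ultimately show ?thesis using anti0[OF xp(2)] by simp
  qed
  show ?thesis
  proof (rule gorenstein_projectiveI[OF complete_resolution_twisted_sum[OF res1 res2 H anti] M \<epsilon>])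
    show "inj_on ?\<epsilon> (carrier M)"
    proof (rule mod_hom_injI[OF M T \<epsilon>])
      fix z assume z: "z \<in> carrier M" "?\<epsilon> z = \<zero>\<^bsub>?T 0\<^esub>"
      then have zM: "z \<in> M1" using \<pi>_ker by simp
      have "\<iota> z = \<zero>\<^bsub>P1 0\<^esub>" using z w\<iota>[OF zM] by simp
      then show "z = \<zero>\<^bsub>M\<^esub>"
        using mod_hom_inj_zero[OF RM m1 \<iota>(1), of z] \<iota>(2) zM by simp
    qed
    show "?\<epsilon> ` carrier M = {z \<in> carrier (?T 0). ?D 0 z = \<zero>\<^bsub>?T 1\<^esub>}" (is "_ = ?K")
    proof
      show "?\<epsilon> ` carrier M \<subseteq> ?K" using cocycle wc \<pi>c \<pi>_im by auto
      show "?K \<subseteq> ?\<epsilon> ` carrier M"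
      proof
        fix v assume v: "v \<in> ?K"
        obtain x y where xy: "v = (x, y)" by (cases v)
        with v have c: "x \<in> carrier (P1 0)" "y \<in> carrier (P2 0)" and
          eq: "d1 0 x \<oplus>\<^bsub>P1 1\<^esub> H 0 y = \<zero>\<^bsub>P1 1\<^esub>" "d2 0 y = \<zero>\<^bsub>P2 1\<^esub>" by auto
        then obtain z where z: "z \<in> carrier M" "y = \<pi> z" using \<pi>_im by blast
        \<comment> \<open>Both sides are the negative of \<open>H 0 y\<close>. Hence
          \<open>x\<close> and \<open>w z\<close> differ by a cycle of \<open>P1\<close>, which
          comes from an element \<open>z1\<close> of \<open>M1\<close> and can be absorbed into
          \<open>z\<close>.\<close>
        have "d1 0 x = d1 0 (w z)"
          by (rule M1.add_eq_zero_unique[of _ 1 _ "H 0 y"])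
            (use eq(1) cocycle[OF z(1)] z c mod_homD(1)[OF d1_0] wc mod_homD(1)[OF H0] in auto)
        then have "d1 0 (x \<ominus>\<^bsub>P1 0\<^esub> w z) = \<zero>\<^bsub>P1 1\<^esub>"
          using c z wc mod_homD(1)[OF d1_0]
          by (simp add: mod_hom_minus(2)[OF m1 m1 d1_0] M1.minus_eq_zero_iff)
        then have "x \<ominus>\<^bsub>P1 0\<^esub> w z \<in> \<iota> ` M1" unfolding \<iota>(3) using c wc[OF z(1)] by simp
        then obtain z1 where z1: "z1 \<in> M1" "x \<ominus>\<^bsub>P1 0\<^esub> w z = \<iota> z1" by blast
        have z1c: "z1 \<in> carrier M" using z1 M1D(1) by simp
        have "w (z \<oplus>\<^bsub>M\<^esub> z1) = w z \<oplus>\<^bsub>P1 0\<^esub> (x \<ominus>\<^bsub>P1 0\<^esub> w z)"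
          using mod_homD(2)[OF w z(1) z1c] w\<iota>[OF z1(1)] z1(2) by simp
        also have "\<dots> = x" by (rule M1.add_minus_cancel(1)[OF wc[OF z(1)] c(1)])
        finally have 1: "w (z \<oplus>\<^bsub>M\<^esub> z1) = x" .
        have 2: "\<pi> (z \<oplus>\<^bsub>M\<^esub> z1) = y"
          using mod_homD(2)[OF \<pi> z(1) z1c] \<pi>_ker[OF z1c] z1(1) z c by simp
        show "v \<in> ?\<epsilon> ` carrier M"
          unfolding xy by (rule image_eqI[of _ _ "z \<oplus>\<^bsub>M\<^esub> z1"]) (use 1 2 z z1c in auto)
      qed
    qed
  qed
qed

section \<open>Quotient modules\<close>

lemma left_submodule_abelian_subgroup:
  assumes M: "left_module R M" and N: "left_submodule R M N"
  shows "abelian_subgroup N M"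
proof -
  interpret M: left_module R M by fact
  have "subgroup N (add_monoid M)"
    by (rule subgroup.intro)
      (use left_submoduleD[OF N] left_submodule_minus(1)[OF M N] in \<open>auto simp flip: a_inv_def\<close>)
  then show ?thesis
    by (intro abelian_subgroupI3 additive_subgroup.intro M.M.abelian_group_axioms)
qed

lemma quotient_module_facts:
  assumes M: "left_module R M" and N: "left_submodule R M N"
  shows "carrier (quotient_module M N) = (\<lambda>x. N +>\<^bsub>M\<^esub> x) ` carrier M"
    and "(\<lambda>x. N +>\<^bsub>M\<^esub> x) \<in> mod_hom R M (quotient_module M N)"
    and "\<zero>\<^bsub>quotient_module M N\<^esub> = N"
    and "x \<in> carrier M \<Longrightarrow> y \<in> carrier M \<Longrightarrow> N +>\<^bsub>M\<^esub> x = N +>\<^bsub>M\<^esub> y \<longleftrightarrow> x \<ominus>\<^bsub>M\<^esub> y \<in> N"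
    and "x \<in> carrier M \<Longrightarrow> N +>\<^bsub>M\<^esub> x = N \<longleftrightarrow> x \<in> N"
proof -
  interpret M: left_module R M by fact
  interpret N: abelian_subgroup N M by (rule left_submodule_abelian_subgroup[OF M N])
  show car: "carrier (quotient_module M N) = (\<lambda>x. N +>\<^bsub>M\<^esub> x) ` carrier M"
    by (auto simp: quotient_module_def A_RCOSETS_def')
  show "\<zero>\<^bsub>quotient_module M N\<^esub> = N" by (simp add: quotient_module_def)
  show eq: "N +>\<^bsub>M\<^esub> x = N +>\<^bsub>M\<^esub> y \<longleftrightarrow> x \<ominus>\<^bsub>M\<^esub> y \<in> N" if "x \<in> carrier M" "y \<in> carrier M" for x y
    using that N.a_repr_independence'[of x y] N.a_repr_independenceD[of x y] N.a_rcos_module[of y x]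
    unfolding a_minus_def by metis
  show "N +>\<^bsub>M\<^esub> x = N \<longleftrightarrow> x \<in> N" if "x \<in> carrier M"
    using that N.a_rcos_const[of x] N.a_rcos_self[of x] by auto
  show "(\<lambda>x. N +>\<^bsub>M\<^esub> x) \<in> mod_hom R M (quotient_module M N)"
  proof (rule mod_homI)
    fix x y assume xy: "x \<in> carrier M" "y \<in> carrier M"
    then show "N +>\<^bsub>M\<^esub> (x \<oplus>\<^bsub>M\<^esub> y) = (N +>\<^bsub>M\<^esub> x) \<oplus>\<^bsub>quotient_module M N\<^esub> (N +>\<^bsub>M\<^esub> y)"
      by (simp add: quotient_module_def N.a_rcos_sum)
  next
    fix a x assume ax: "a \<in> carrier R" "x \<in> carrier M"
    \<comment> \<open>The scalar action on the quotient is a union over all representatives of the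
      coset; it collapses because each of them gives the same coset.\<close>
    have "N +>\<^bsub>M\<^esub> (a \<odot>\<^bsub>M\<^esub> z) = N +>\<^bsub>M\<^esub> (a \<odot>\<^bsub>M\<^esub> x)" if z: "z \<in> N +>\<^bsub>M\<^esub> x" for z
    proof -
      have zc: "z \<in> carrier M" using N.a_elemrcos_carrier[OF ax(2) z] .
      have "z \<ominus>\<^bsub>M\<^esub> x \<in> N" using N.a_rcos_module_imp[OF ax(2) z] by (simp add: a_minus_def)
      then have "a \<odot>\<^bsub>M\<^esub> (z \<ominus>\<^bsub>M\<^esub> x) \<in> N" using left_submoduleD(4)[OF N ax(1)] by blast
      then show ?thesis
        using ax zc by (subst eq) (auto simp: a_minus_def M.smult_r_distr M.smult_r_minus)
    qed
    moreover have "x \<in> N +>\<^bsub>M\<^esub> x" using ax N.a_rcos_self by blast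
    ultimately show "N +>\<^bsub>M\<^esub> (a \<odot>\<^bsub>M\<^esub> x) = a \<odot>\<^bsub>quotient_module M N\<^esub> (N +>\<^bsub>M\<^esub> x)"
      unfolding quotient_module_def module.simps by blast
  qed (simp add: car)
qed

lemma left_module_quotient:
  assumes M: "left_module R M" and N: "left_submodule R M N"
  shows "left_module R (quotient_module M N)"
proof -
  interpret M: left_module R M by fact
  note q = quotient_module_facts[OF M N]
  note h = mod_homD(2,3)[OF q(2), symmetric]
  have z: "\<zero>\<^bsub>quotient_module M N\<^esub> = N +>\<^bsub>M\<^esub> \<zero>\<^bsub>M\<^esub>"
    using q(5)[of "\<zero>\<^bsub>M\<^esub>"] q(3) left_submoduleD(2)[OF N] by simp
  show ?thesis
  proof (intro left_module.intro left_module_axioms.intro M.R.ring_axioms abelian_groupI)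
    fix C assume "C \<in> carrier (quotient_module M N)"
    then obtain x where x: "x \<in> carrier M" "C = N +>\<^bsub>M\<^esub> x" by (auto simp: q(1))
    have "(N +>\<^bsub>M\<^esub> (\<ominus>\<^bsub>M\<^esub> x)) \<oplus>\<^bsub>quotient_module M N\<^esub> C = \<zero>\<^bsub>quotient_module M N\<^esub>"
      unfolding z x(2) using x(1) by (subst h) (auto simp: M.M.l_neg)
    then show "\<exists>y\<in>carrier (quotient_module M N). y \<oplus>\<^bsub>quotient_module M N\<^esub> C = \<zero>\<^bsub>quotient_module M N\<^esub>"
      using x by (auto simp: q(1))
  qed (auto simp: q(1) z h M.M.add.m_ac M.smult_l_distr M.smult_r_distr M.smult_assoc1)
qed

text \<open>The first isomorphism theorem, phrased as an embedding with prescribed image, as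
  \<open>gorenstein_projectiveI\<close> expects it.\<close>

lemma quotient_module_embedding:
  assumes M: "left_module R M" and N: "left_submodule R M N" and M': "left_module R M'"
    and f: "f \<in> mod_hom R M M'"
    and ker: "\<And>x. x \<in> carrier M \<Longrightarrow> f x = \<zero>\<^bsub>M'\<^esub> \<longleftrightarrow> x \<in> N"
  obtains f' where "f' \<in> mod_hom R (quotient_module M N) M'" "inj_on f' (carrier (quotient_module M N))"
    "f' ` carrier (quotient_module M N) = f ` carrier M"
proof -
  interpret M: left_module R M by fact
  interpret M': left_module R M' by fact
  note q = quotient_module_facts[OF M N]
  have f_eq: "f x = f y \<longleftrightarrow> N +>\<^bsub>M\<^esub> x = N +>\<^bsub>M\<^esub> y" if "x \<in> carrier M" "y \<in> carrier M" for x y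
    using that ker[of "x \<ominus>\<^bsub>M\<^esub> y"] q(4)[of x y] M'.minus_eq_zero_iff[of "f x" "f y"] mod_homD(1)[OF f]
    by (simp add: mod_hom_minus(2)[OF M M' f])
  define f' where "f' C = f (SOME x. x \<in> carrier M \<and> C = N +>\<^bsub>M\<^esub> x)" for C
  have f': "f' (N +>\<^bsub>M\<^esub> x) = f x" if x: "x \<in> carrier M" for x
  proof -
    define y where "y = (SOME y. y \<in> carrier M \<and> N +>\<^bsub>M\<^esub> x = N +>\<^bsub>M\<^esub> y)"
    have "y \<in> carrier M \<and> N +>\<^bsub>M\<^esub> x = N +>\<^bsub>M\<^esub> y"
      unfolding y_def by (rule someI[of _ x]) (simp add: x)
    moreover have "f' (N +>\<^bsub>M\<^esub> x) = f y" by (simp add: f'_def y_def)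
    ultimately show ?thesis using f_eq[of y x] x by simp
  qed
  note h = mod_homD(2,3)[OF q(2), symmetric]
  show thesis
  proof (rule that[of f'])
    show "f' \<in> mod_hom R (quotient_module M N) M'"
      using mod_homD[OF f] by (intro mod_homI) (auto simp: q(1) f' h)
    show "inj_on f' (carrier (quotient_module M N))"
      unfolding q(1) by (intro inj_onI) (auto simp: f' f_eq)
    show "f' ` carrier (quotient_module M N) = f ` carrier M"
      unfolding q(1) by (auto simp: f' image_image)
  qed
qed

section \<open>Paths and generators of the path algebra\<close>

abbreviation path_end :: "('v, 'e) path \<Rightarrow> 'v" where
  "path_end r \<equiv> snd (snd r)"

text \<open>Lists record the order of traversal while products traverse the right factor first; so
  left multiplication by an arrow appends it at the end.\<close>

definition path_snoc :: "('v, 'e) pre_digraph \<Rightarrow> ('v, 'e) path \<Rightarrow> 'e \<Rightarrow> ('v, 'e) path" where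
  "path_snoc Q p \<alpha> = (fst p, fst (snd p) @ [\<alpha>], head Q \<alpha>)"

text \<open>For \<open>T = {i}\<close> these paths form a basis of \<open>L e_i\<close>; for all
  vertices they form a basis of \<open>L\<close>, so that \<open>L\<close> becomes an instance of
  the induced modules.\<close>

definition paths_from :: "('v, 'e) pre_digraph \<Rightarrow> 'v set \<Rightarrow> ('v, 'e) path set" where
  "paths_from Q T = {x \<in> paths Q. fst x \<in> T}"

lemma path_snoc_simps [simp]:
  "fst (path_snoc Q p \<alpha>) = fst p" "path_end (path_snoc Q p \<alpha>) = head Q \<alpha>"
  "path_snoc Q p \<alpha> \<noteq> trivial_path j" "trivial_path j \<noteq> path_snoc Q p \<alpha>"
  by (auto simp: path_snoc_def trivial_path_def)

lemma trivial_path_simps [simp]: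
  "fst (trivial_path j) = j" "path_end (trivial_path j) = j" "trivial_path i = trivial_path j \<longleftrightarrow> i = j"
  by (auto simp: trivial_path_def)

lemma arrow_path_simps [simp]:
  "fst (arrow_path Q \<alpha>) = tail Q \<alpha>" "path_end (arrow_path Q \<alpha>) = head Q \<alpha>"
  by (auto simp: arrow_path_def)

context acyclic_quiver
begin

lemma path_snoc_in_paths:
  assumes "p \<in> paths Q" "\<alpha> \<in> arcs Q" "path_end p = tail Q \<alpha>"
  shows "path_snoc Q p \<alpha> \<in> paths Q"
proof -
  obtain u q v where p: "p = (u, q, v)" by (metis surj_pair)
  then have "awalk u q (tail Q \<alpha>)" using assms by (simp add: paths_def)
  then have "awalk u (q @ [\<alpha>]) (head Q \<alpha>)"
    by (rule awalk_appendI) (use assms in \<open>auto simp: awalk_simps\<close>)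
  then show ?thesis by (simp add: paths_def path_snoc_def p)
qed

lemma path_snoc_inj:
  assumes "path_snoc Q p \<alpha> = path_snoc Q p' \<beta>" "path_end p = tail Q \<alpha>" "path_end p' = tail Q \<beta>"
  shows "\<alpha> = \<beta>" "p = p'"
  using assms by (auto simp: path_snoc_def prod_eq_iff)

lemma path_cases [consumes 1, case_names trivial snoc]:
  assumes "r \<in> paths Q"
  obtains j where "j \<in> verts Q" "r = trivial_path j"
  | p \<alpha> where "p \<in> paths Q" "\<alpha> \<in> arcs Q" "path_end p = tail Q \<alpha>" "r = path_snoc Q p \<alpha>"
proof -
  obtain u q v where r: "r = (u, q, v)" by (metis surj_pair)
  then have q: "awalk u q v" using assms by (simp add: paths_def)
  show thesis
  proof (cases q rule: rev_cases)
    case Nil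
    have "u = v" "u \<in> verts Q" using q unfolding Nil awalk_Nil_iff by blast+
    then show thesis using that(1)[of u] r Nil by (simp add: trivial_path_def)
  next
    case (snoc q' \<alpha>)
    have "awalk u q' (awlast u q')" "awalk (awlast u q') [\<alpha>] v"
      using q unfolding snoc awalk_append_iff by blast+
    then have "awalk u q' (tail Q \<alpha>)" "\<alpha> \<in> arcs Q" "v = head Q \<alpha>"
      unfolding awalk_Cons_iff awalk_Nil_iff by metis+
    then show thesis using that(2)[of "(u, q', tail Q \<alpha>)" \<alpha>] r snoc by (simp add: paths_def path_snoc_def)
  qed
qed

lemma path_induct [consumes 1, case_names trivial snoc]:
  assumes "r \<in> paths Q"
    and "\<And>j. j \<in> verts Q \<Longrightarrow> S (trivial_path j)"
    and "\<And>p \<alpha>. p \<in> paths Q \<Longrightarrow> \<alpha> \<in> arcs Q \<Longrightarrow> path_end p = tail Q \<alpha> \<Longrightarrow> S p \<Longrightarrow> S (path_snoc Q p \<alpha>)"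
  shows "S r"
proof -
  have "\<forall>r. r \<in> paths Q \<longrightarrow> length (fst (snd r)) = n \<longrightarrow> S r" for n
  proof (induction n)
    case 0
    show ?case
    proof (intro allI impI)
      fix r assume "r \<in> paths Q" "length (fst (snd r)) = 0"
      then show "S r" by (cases r rule: path_cases) (auto simp: path_snoc_def intro: assms(2))
    qed
  next
    case (Suc n)
    show ?case
    proof (intro allI impI)
      fix r assume "r \<in> paths Q" "length (fst (snd r)) = Suc n"
      then show "S r"
      proof (cases r rule: path_cases)
        case (snoc p \<alpha>)
        then have "length (fst (snd p)) = n"
          using \<open>length (fst (snd r)) = Suc n\<close> by (simp add: path_snoc_def)
        then show ?thesis using Suc snoc assms(3) by blast
      qed (use assms(2) in blast)
    qed
  qed
  then show ?thesis using assms(1) by blast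
qed

lemma path_ends_in_verts: "r \<in> paths Q \<Longrightarrow> fst r \<in> verts Q" "r \<in> paths Q \<Longrightarrow> path_end r \<in> verts Q"
  by (auto simp: paths_def)

lemma paths_from_subset: "paths_from Q T \<subseteq> paths Q" "r \<in> paths_from Q T \<Longrightarrow> r \<in> paths Q"
  by (auto simp: paths_from_def)

lemma finite_paths_from: "finite (paths_from Q T)"
  by (rule finite_subset[OF paths_from_subset(1) finite_paths])

lemma paths_from_verts: "paths_from Q (verts Q) = paths Q"
  by (auto simp: paths_from_def dest: path_ends_in_verts)

lemma path_snoc_in_paths_from:
  "p \<in> paths_from Q T \<Longrightarrow> \<alpha> \<in> arcs Q \<Longrightarrow> path_end p = tail Q \<alpha> \<Longrightarrow> path_snoc Q p \<alpha> \<in> paths_from Q T"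
  by (auto simp: paths_from_def intro: path_snoc_in_paths)

text \<open>The first component of a factorization is the part traversed last. Prescribing it as a
  trivial path or an arrow determines the rest, so products with generators have at most one nonzero
  term.\<close>

lemma factorizations_trivial:
  "(trivial_path j, p) \<in> factorizations Q r \<longleftrightarrow> p = r \<and> r \<in> paths Q \<and> path_end r = j"
  by (cases r, cases p) (auto simp: factorizations_def trivial_path_def paths_def awalk_Nil_iff)

lemma factorizations_arrow:
  "\<alpha> \<in> arcs Q \<Longrightarrow> (arrow_path Q \<alpha>, p) \<in> factorizations Q r \<longleftrightarrow>
    p \<in> paths Q \<and> path_end p = tail Q \<alpha> \<and> r = path_snoc Q p \<alpha>"
  by (cases r, cases p) (auto simp: factorizations_def arrow_path_def path_snoc_def paths_def awalk_simps)

lemma factorizations_paths_from: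
  assumes "z \<in> factorizations Q r" "r \<in> paths_from Q T"
  shows "fst z \<in> paths Q" "snd z \<in> paths_from Q T"
  using assms by (auto simp: factorizations_def paths_from_def)

end

section \<open>The elements \<open>1 \<otimes> p\<close> and \<open>a \<otimes> 1\<close> of the
  path algebra\<close>

context quiver_algebra
begin

definition path_el where
  "path_el x = pure_tensor A Q \<one>\<^bsub>A\<^esub> (path_basis K Q x)"

definition scal_el where
  "scal_el a = pure_tensor A Q a \<one>\<^bsub>kQ\<^esub>"

lemma kQ_one: "\<one>\<^bsub>kQ\<^esub> \<in> carrier kQ"
  "x \<in> paths Q \<Longrightarrow> \<one>\<^bsub>kQ\<^esub> x = (if fst (snd x) = [] then \<one> else \<zero>)"
  "\<xi> \<in> carrier kQ \<Longrightarrow> \<one>\<^bsub>kQ\<^esub> \<otimes>\<^bsub>kQ\<^esub> \<xi> = \<xi>" "\<xi> \<in> carrier kQ \<Longrightarrow> \<xi> \<otimes>\<^bsub>kQ\<^esub> \<one>\<^bsub>kQ\<^esub> = \<xi>"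
proof -
  interpret k: quiver_algebra K "regular_module K" Q
    by (intro quiver_algebra.intro fd_algebra_regular acyclic_quiver_axioms)
  show "\<one>\<^bsub>kQ\<^esub> \<in> carrier kQ" by (rule k.L_one_closed)
  show "x \<in> paths Q \<Longrightarrow> \<one>\<^bsub>kQ\<^esub> x = (if fst (snd x) = [] then \<one> else \<zero>)"
    by (cases x) (simp add: path_algebra_def regular_module_def)
  show "\<xi> \<in> carrier kQ \<Longrightarrow> \<one>\<^bsub>kQ\<^esub> \<otimes>\<^bsub>kQ\<^esub> \<xi> = \<xi>" by (rule k.L_one_left)
  show "\<xi> \<in> carrier kQ \<Longrightarrow> \<xi> \<otimes>\<^bsub>kQ\<^esub> \<one>\<^bsub>kQ\<^esub> = \<xi>" by (rule k.L_one_right)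
qed

lemma path_el_closed [simp]: "path_el x \<in> carrier L"
  by (simp add: path_el_def)

lemma scal_el_closed [simp]: "a \<in> carrier A \<Longrightarrow> scal_el a \<in> carrier L"
  by (simp add: scal_el_def kQ_one(1))

lemma path_el_apply: "y \<in> paths Q \<Longrightarrow> path_el x y = (if y = x then \<one>\<^bsub>A\<^esub> else \<zero>\<^bsub>A\<^esub>)"
  by (simp add: path_el_def path_basis_def)

lemma scal_el_apply:
  "y \<in> paths Q \<Longrightarrow> a \<in> carrier A \<Longrightarrow> scal_el a y = (if fst (snd y) = [] then a else \<zero>\<^bsub>A\<^esub>)"
  by (simp add: scal_el_def kQ_one(2))

text \<open>Scalars from \<open>A\<close> commute with paths. This makes the structure maps of a
  representation \<open>A\<close>-linear.\<close>

lemma scal_el_path_el: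
  assumes "a \<in> carrier A"
  shows "scal_el a \<otimes>\<^bsub>L\<^esub> path_el x = pure_tensor A Q a (path_basis K Q x)"
    "path_el x \<otimes>\<^bsub>L\<^esub> scal_el a = pure_tensor A Q a (path_basis K Q x)"
  using assms by (simp_all add: scal_el_def path_el_def pure_tensor_mult kQ_one)

lemma scal_el_hom:
  "a \<in> carrier A \<Longrightarrow> b \<in> carrier A \<Longrightarrow> scal_el (a \<oplus>\<^bsub>A\<^esub> b) = scal_el a \<oplus>\<^bsub>L\<^esub> scal_el b"
  "a \<in> carrier A \<Longrightarrow> b \<in> carrier A \<Longrightarrow> scal_el (a \<otimes>\<^bsub>A\<^esub> b) = scal_el a \<otimes>\<^bsub>L\<^esub> scal_el b"
  "scal_el \<one>\<^bsub>A\<^esub> = \<one>\<^bsub>L\<^esub>" "scal_el \<zero>\<^bsub>A\<^esub> = \<zero>\<^bsub>L\<^esub>"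
proof -
  show "a \<in> carrier A \<Longrightarrow> b \<in> carrier A \<Longrightarrow> scal_el (a \<oplus>\<^bsub>A\<^esub> b) = scal_el a \<oplus>\<^bsub>L\<^esub> scal_el b"
    unfolding scal_el_def using pure_tensor_bilinear(1)[of a b "\<one>\<^bsub>kQ\<^esub>" "\<one>\<^bsub>kQ\<^esub>" \<zero>] kQ_one(1) by simp
  show "a \<in> carrier A \<Longrightarrow> b \<in> carrier A \<Longrightarrow> scal_el (a \<otimes>\<^bsub>A\<^esub> b) = scal_el a \<otimes>\<^bsub>L\<^esub> scal_el b"
    unfolding scal_el_def by (simp add: pure_tensor_mult kQ_one)
  show "scal_el \<one>\<^bsub>A\<^esub> = \<one>\<^bsub>L\<^esub>" unfolding scal_el_def by (rule pure_tensor_one)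
  show "scal_el \<zero>\<^bsub>A\<^esub> = \<zero>\<^bsub>L\<^esub>"
    by (rule L_eqI) (auto simp: L_zero_closed scal_el_apply zero_L)
qed

end

section \<open>Induced modules\<close>

text \<open>
  For \<open>T = {i}\<close> this is the module \<open>(A \<otimes> kQ e\<^sub>i) \<otimes>\<^sub>A M\<close>: the family \<open>c\<close> stands for the sum of the
  \<open>p \<otimes> c p\<close> over all paths \<open>p\<close> starting at \<open>i\<close>.
\<close>

definition induced_module :: "('k, 'a) module \<Rightarrow> ('v, 'e) pre_digraph \<Rightarrow> 'v set \<Rightarrow> ('a, 'm) module \<Rightarrow>
    (('v, 'e) path \<Rightarrow> 'a, ('v, 'e) path \<Rightarrow> 'm) module" where
  "induced_module A Q T M = \<lparr>carrier = paths_from Q T \<rightarrow>\<^sub>E carrier M, mult = undefined, one = undefined,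
     zero = (\<lambda>x\<in>paths_from Q T. \<zero>\<^bsub>M\<^esub>), add = (\<lambda>f g. \<lambda>x\<in>paths_from Q T. f x \<oplus>\<^bsub>M\<^esub> g x),
     smult = (\<lambda>l c. \<lambda>r\<in>paths_from Q T.
       \<Oplus>\<^bsub>M\<^esub>z\<in>factorizations Q r. l (fst z) \<odot>\<^bsub>M\<^esub> c (snd z))\<rparr>"

context quiver_algebra
begin

abbreviation "Ind T M \<equiv> induced_module A Q T M"

lemma induced_closed [simp]: "c \<in> carrier (Ind T M) \<Longrightarrow> r \<in> paths_from Q T \<Longrightarrow> c r \<in> carrier M"
  by (auto simp: induced_module_def)

lemma induced_memI: "(\<And>r. r \<in> paths_from Q T \<Longrightarrow> c r \<in> carrier M) \<Longrightarrow> restrict c (paths_from Q T) \<in> carrier (Ind T M)"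
  by (auto simp: induced_module_def)

lemma induced_eqI:
  "f \<in> carrier (Ind T M) \<Longrightarrow> g \<in> carrier (Ind T M) \<Longrightarrow> (\<And>x. x \<in> paths_from Q T \<Longrightarrow> f x = g x) \<Longrightarrow> f = g"
  unfolding induced_module_def module.simps partial_object.simps by (rule PiE_ext)

lemma induced_apply:
  "r \<in> paths_from Q T \<Longrightarrow> \<zero>\<^bsub>Ind T M\<^esub> r = \<zero>\<^bsub>M\<^esub>"
  "r \<in> paths_from Q T \<Longrightarrow> (c \<oplus>\<^bsub>Ind T M\<^esub> c') r = c r \<oplus>\<^bsub>M\<^esub> c' r"
  "r \<in> paths_from Q T \<Longrightarrow> (l \<odot>\<^bsub>Ind T M\<^esub> c) r = (\<Oplus>\<^bsub>M\<^esub>z\<in>factorizations Q r. l (fst z) \<odot>\<^bsub>M\<^esub> c (snd z))"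
  by (simp_all add: induced_module_def)

section \<open>Action of the generators on an induced module\<close>

context
  fixes M :: "('c, 'm) module" and T :: "'d set"
  assumes M: "left_module A M"
begin

interpretation M: left_module A M by (rule M)

lemma induced_term_closed:
  assumes "l \<in> carrier L" "c \<in> carrier (Ind T M)" "r \<in> paths_from Q T" "z \<in> factorizations Q r"
  shows "l (fst z) \<odot>\<^bsub>M\<^esub> c (snd z) \<in> carrier M"
  using assms factorizations_paths_from[OF assms(4,3)] by simp

lemma induced_smult_closed:
  assumes "l \<in> carrier L" "c \<in> carrier (Ind T M)"
  shows "l \<odot>\<^bsub>Ind T M\<^esub> c \<in> carrier (Ind T M)"
  using induced_term_closed[OF assms] by (auto simp: induced_module_def intro!: M.M.finsum_closed)

lemma induced_add_closed:
  "c \<in> carrier (Ind T M) \<Longrightarrow> c' \<in> carrier (Ind T M) \<Longrightarrow> c \<oplus>\<^bsub>Ind T M\<^esub> c' \<in> carrier (Ind T M)"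
  by (auto simp: induced_module_def)

lemma induced_zero_closed: "\<zero>\<^bsub>Ind T M\<^esub> \<in> carrier (Ind T M)"
  by (auto simp: induced_module_def)

text \<open>The action is a convolution over factorizations. For a scalar, a vertex idempotent or an
  arrow at most one factorization of \<open>r\<close> contributes, and the formulas for these
  generators are read off from it.\<close>

lemma induced_smult_single:
  assumes l: "l \<in> carrier L" and c: "c \<in> carrier (Ind T M)" and r: "r \<in> paths_from Q T"
    and z: "z \<in> factorizations Q r" and 0: "\<And>z'. z' \<in> factorizations Q r \<Longrightarrow> z' \<noteq> z \<Longrightarrow> l (fst z') = \<zero>\<^bsub>A\<^esub>"
  shows "(l \<odot>\<^bsub>Ind T M\<^esub> c) r = l (fst z) \<odot>\<^bsub>M\<^esub> c (snd z)"
  unfolding induced_apply(3)[OF r]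
proof (rule M.M.finsum_delta[OF finite_factorizations z])
  fix z' assume z': "z' \<in> factorizations Q r" "z' \<noteq> z"
  then show "l (fst z') \<odot>\<^bsub>M\<^esub> c (snd z') = \<zero>\<^bsub>M\<^esub>"
    using 0[OF z'] factorizations_paths_from(2)[OF z'(1) r] c by simp
qed (rule induced_term_closed[OF l c r z])

lemma induced_smult_none:
  assumes c: "c \<in> carrier (Ind T M)" and r: "r \<in> paths_from Q T"
    and 0: "\<And>z'. z' \<in> factorizations Q r \<Longrightarrow> l (fst z') = \<zero>\<^bsub>A\<^esub>"
  shows "(l \<odot>\<^bsub>Ind T M\<^esub> c) r = \<zero>\<^bsub>M\<^esub>"
proof -
  have "(\<Oplus>\<^bsub>M\<^esub>z\<in>factorizations Q r. l (fst z) \<odot>\<^bsub>M\<^esub> c (snd z)) = (\<Oplus>\<^bsub>M\<^esub>z\<in>factorizations Q r. \<zero>\<^bsub>M\<^esub>)"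
  proof (rule M.M.finsum_cong')
    fix z' assume z': "z' \<in> factorizations Q r"
    show "l (fst z') \<odot>\<^bsub>M\<^esub> c (snd z') = \<zero>\<^bsub>M\<^esub>"
      using 0[OF z'] factorizations_paths_from(2)[OF z' r] c by simp
  qed auto
  then show ?thesis by (simp add: induced_apply(3)[OF r])
qed

lemma induced_scal:
  assumes a: "a \<in> carrier A" and c: "c \<in> carrier (Ind T M)" and r: "r \<in> paths_from Q T"
  shows "(scal_el a \<odot>\<^bsub>Ind T M\<^esub> c) r = a \<odot>\<^bsub>M\<^esub> c r"
proof -
  have rp: "r \<in> paths Q" using paths_from_subset(2)[OF r] .
  have tp: "trivial_path (path_end r) \<in> paths Q" using path_ends_in_verts(2)[OF rp] by simp
  have 0: "scal_el a (fst z') = \<zero>\<^bsub>A\<^esub>"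
    if z': "z' \<in> factorizations Q r" "z' \<noteq> (trivial_path (path_end r), r)" for z'
  proof -
    have "fst (snd (fst z')) \<noteq> []"
      using z' factorizations_left_unit[of "fst z'" "snd z'" r] by (cases z') auto
    then show ?thesis
      using factorizations_paths_from(1)[OF z'(1) r] a by (simp add: scal_el_apply)
  qed
  have "scal_el a (trivial_path (path_end r)) = a"
    using scal_el_apply[OF tp a] by (simp add: trivial_path_def)
  then show ?thesis
    using induced_smult_single[OF scal_el_closed[OF a] c r trivial_factorizations(1)[OF rp] 0] by simp
qed

lemma induced_vert:
  assumes c: "c \<in> carrier (Ind T M)" and r: "r \<in> paths_from Q T"
  shows "(path_el (trivial_path j) \<odot>\<^bsub>Ind T M\<^esub> c) r = (if path_end r = j then c r else \<zero>\<^bsub>M\<^esub>)"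
proof -
  have rp: "r \<in> paths Q" using paths_from_subset(2)[OF r] .
  have 0: "path_el (trivial_path j) (fst z') = \<zero>\<^bsub>A\<^esub>"
    if "z' \<in> factorizations Q r" "fst z' \<noteq> trivial_path j" for z'
    using that factorizations_paths_from(1)[OF that(1) r] by (simp add: path_el_apply)
  show ?thesis
  proof (cases "path_end r = j")
    case True
    have z: "(trivial_path j, r) \<in> factorizations Q r" using True rp by (simp add: factorizations_trivial)
    have z0: "path_el (trivial_path j) (fst z') = \<zero>\<^bsub>A\<^esub>"
      if z': "z' \<in> factorizations Q r" "z' \<noteq> (trivial_path j, r)" for z'
    proof -
      have "fst z' \<noteq> trivial_path j"
        using z' factorizations_trivial[of j "snd z'" r] by (cases z') auto
      then show ?thesis using 0 z' by blast
    qed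
    show ?thesis
      using induced_smult_single[OF path_el_closed c r z z0] True c r factorizations_paths_from(1)[OF z r]
      by (simp add: path_el_apply)
  next
    case False
    have "(path_el (trivial_path j) \<odot>\<^bsub>Ind T M\<^esub> c) r = \<zero>\<^bsub>M\<^esub>"
    proof (rule induced_smult_none[OF c r])
      fix z' assume z': "z' \<in> factorizations Q r"
      then have "fst z' \<noteq> trivial_path j"
        using False factorizations_trivial[of j "snd z'" r] by (cases z') auto
      then show "path_el (trivial_path j) (fst z') = \<zero>\<^bsub>A\<^esub>" using 0 z' by blast
    qed
    then show ?thesis using False by simp
  qed
qed

lemma induced_arrow:
  assumes c: "c \<in> carrier (Ind T M)" and \<alpha>: "\<alpha> \<in> arcs Q"
  shows "p \<in> paths_from Q T \<Longrightarrow> path_end p = tail Q \<alpha> \<Longrightarrow>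
      (path_el (arrow_path Q \<alpha>) \<odot>\<^bsub>Ind T M\<^esub> c) (path_snoc Q p \<alpha>) = c p"
    and "r \<in> paths_from Q T \<Longrightarrow> (\<And>p. p \<in> paths_from Q T \<Longrightarrow> path_end p = tail Q \<alpha> \<Longrightarrow> r \<noteq> path_snoc Q p \<alpha>) \<Longrightarrow>
      (path_el (arrow_path Q \<alpha>) \<odot>\<^bsub>Ind T M\<^esub> c) r = \<zero>\<^bsub>M\<^esub>"
proof -
  have 0: "path_el (arrow_path Q \<alpha>) (fst z') = \<zero>\<^bsub>A\<^esub>"
    if "r \<in> paths_from Q T" "z' \<in> factorizations Q r" "fst z' \<noteq> arrow_path Q \<alpha>" for r z'
    using that factorizations_paths_from(1)[OF that(2,1)] by (simp add: path_el_apply)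
  show "(path_el (arrow_path Q \<alpha>) \<odot>\<^bsub>Ind T M\<^esub> c) (path_snoc Q p \<alpha>) = c p"
    if p: "p \<in> paths_from Q T" "path_end p = tail Q \<alpha>"
  proof -
    have r: "path_snoc Q p \<alpha> \<in> paths_from Q T" by (rule path_snoc_in_paths_from[OF p(1) \<alpha> p(2)])
    have z: "(arrow_path Q \<alpha>, p) \<in> factorizations Q (path_snoc Q p \<alpha>)"
      using p \<alpha> paths_from_subset(2)[OF p(1)] by (simp add: factorizations_arrow)
    have z0: "path_el (arrow_path Q \<alpha>) (fst z') = \<zero>\<^bsub>A\<^esub>"
      if z': "z' \<in> factorizations Q (path_snoc Q p \<alpha>)" "z' \<noteq> (arrow_path Q \<alpha>, p)" for z'
    proof -
      have "fst z' \<noteq> arrow_path Q \<alpha>"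
      proof
        assume e: "fst z' = arrow_path Q \<alpha>"
        then have "path_end (snd z') = tail Q \<alpha>" "path_snoc Q p \<alpha> = path_snoc Q (snd z') \<alpha>"
          using z'(1) factorizations_arrow[OF \<alpha>, of "snd z'" "path_snoc Q p \<alpha>"] by (metis prod.collapse)+
        then have "p = snd z'" using path_snoc_inj(2)[of p \<alpha> "snd z'" \<alpha>] p(2) by simp
        then show False using z'(2) e by (metis prod.collapse)
      qed
      then show ?thesis using 0[OF r z'(1)] by blast
    qed
    show ?thesis
      using induced_smult_single[OF path_el_closed c r z z0] c p factorizations_paths_from(1)[OF z r]
      by (simp add: path_el_apply)
  qed
  assume r: "r \<in> paths_from Q T"
    and n: "\<And>p. p \<in> paths_from Q T \<Longrightarrow> path_end p = tail Q \<alpha> \<Longrightarrow> r \<noteq> path_snoc Q p \<alpha>"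
  show "(path_el (arrow_path Q \<alpha>) \<odot>\<^bsub>Ind T M\<^esub> c) r = \<zero>\<^bsub>M\<^esub>"
  proof (rule induced_smult_none[OF c r])
    fix z' assume z': "z' \<in> factorizations Q r"
    have "fst z' \<noteq> arrow_path Q \<alpha>"
    proof
      assume "fst z' = arrow_path Q \<alpha>"
      then have "path_end (snd z') = tail Q \<alpha>" "r = path_snoc Q (snd z') \<alpha>"
        using z' factorizations_arrow[OF \<alpha>, of "snd z'" r] by (metis prod.collapse)+
      then show False using n[OF factorizations_paths_from(2)[OF z' r]] by blast
    qed
    then show "path_el (arrow_path Q \<alpha>) (fst z') = \<zero>\<^bsub>A\<^esub>" using 0[OF r z'] by blast
  qed
qed

end

end

section \<open>Module axioms, and the path algebra as an induced module\<close>

context quiver_algebra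
begin

text \<open>Both sides parametrise the ways to cut \<open>r\<close> into three consecutive paths;
  \<open>\<theta>\<close> passes from one bracketing to the other by joining the two pieces
  traversed first.\<close>

lemma factorizations_assoc:
  defines "\<theta> \<equiv> \<lambda>w. ((fst (snd w), (fst (snd (fst w)), fst (snd (snd (fst w))) @ fst (snd (snd (snd w))),
      snd (snd (snd (snd w))))), (snd (snd w), snd (fst w)))"
  shows "inj_on \<theta> (Sigma (factorizations Q r) (\<lambda>z. factorizations Q (fst z)))"
    "\<theta> ` Sigma (factorizations Q r) (\<lambda>z. factorizations Q (fst z)) =
      Sigma (factorizations Q r) (\<lambda>z. factorizations Q (snd z))"
proof -
  let ?S = "Sigma (factorizations Q r) (\<lambda>z. factorizations Q (fst z))"
  let ?T = "Sigma (factorizations Q r) (\<lambda>z. factorizations Q (snd z))"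
  show "inj_on \<theta> ?S" unfolding \<theta>_def by (auto simp: inj_on_def factorizations_def)
  show "\<theta> ` ?S = ?T"
  proof (intro equalityI subsetI)
    fix w assume "w \<in> \<theta> ` ?S"
    then show "w \<in> ?T" unfolding \<theta>_def by (force simp: factorizations_def paths_def awalk_appendI)
  next
    fix W assume "W \<in> ?T"
    moreover obtain a b c d where W: "W = ((a, b), (c, d))" by (metis surj_pair)
    ultimately have "((a, b), (c, d)) \<in> ?T" by simp
    then obtain u v w w' p1 p2 q where
        "a = (w, q, v)" "b = (u, p1 @ p2, w)" "c = (w', p2, w)" "d = (u, p1, w')"
        "r = (u, (p1 @ p2) @ q, v)"
        "(w, q, v) \<in> paths Q" "(w', p2, w) \<in> paths Q" "(u, p1, w') \<in> paths Q"
      by (auto simp: factorizations_def)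
    then show "W \<in> \<theta> ` ?S"
      unfolding W \<theta>_def by (intro image_eqI[where x = "(((w', p2 @ q, v), d), (a, c))"])
         (auto simp: factorizations_def paths_def intro: awalk_appendI)
  qed
qed

text \<open>Both sides expand to the same sum over the ways to cut \<open>r\<close> into three
  pieces.\<close>

lemma induced_assoc:
  assumes M: "left_module A M"
    and f: "f \<in> carrier L" and g: "g \<in> carrier L" and c: "c \<in> carrier (Ind T M)"
  shows "(f \<otimes>\<^bsub>L\<^esub> g) \<odot>\<^bsub>Ind T M\<^esub> c = f \<odot>\<^bsub>Ind T M\<^esub> (g \<odot>\<^bsub>Ind T M\<^esub> c)"
proof (rule induced_eqI)
  interpret M: left_module A M by (rule M)
  note cl = induced_smult_closed[OF M]
  show "(f \<otimes>\<^bsub>L\<^esub> g) \<odot>\<^bsub>Ind T M\<^esub> c \<in> carrier (Ind T M)"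
    "f \<odot>\<^bsub>Ind T M\<^esub> (g \<odot>\<^bsub>Ind T M\<^esub> c) \<in> carrier (Ind T M)"
    by (intro cl L_mult_closed f g c)+
  fix r assume r: "r \<in> paths_from Q T"
  let ?F = "factorizations Q"
  note pf = factorizations_paths_from
  have rv: "x \<in> paths_from Q (verts Q)" if "x \<in> paths Q" for x using that by (simp add: paths_from_verts)
  have fin: "finite (?F x)" for x by (rule finite_factorizations)
  let ?S = "Sigma (?F r) (\<lambda>z. ?F (fst z))" and ?T = "Sigma (?F r) (\<lambda>z. ?F (snd z))"
  let ?u = "\<lambda>w. f (fst (snd w)) \<odot>\<^bsub>M\<^esub> (g (snd (snd w)) \<odot>\<^bsub>M\<^esub> c (snd (fst w)))"
  let ?v = "\<lambda>w. f (fst (fst w)) \<odot>\<^bsub>M\<^esub> (g (fst (snd w)) \<odot>\<^bsub>M\<^esub> c (snd (snd w)))"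
  have fgS: "f (fst y) \<in> carrier A" "g (snd y) \<in> carrier A" "c (snd z) \<in> carrier M"
    if "z \<in> ?F r" "y \<in> ?F (fst z)" for z y
    using pf[OF that(1) r] pf[OF that(2) rv] that f g c paths_from_subset(2) by auto
  have fgT: "f (fst z) \<in> carrier A" "g (fst y) \<in> carrier A" "c (snd y) \<in> carrier M"
    if "z \<in> ?F r" "y \<in> ?F (snd z)" for z y
    using pf[OF that(1) r] pf[OF that(2) pf(2)[OF that(1) r]] f g c by auto
  have vT: "?v w \<in> carrier M" if "w \<in> ?T" for w using fgT that by auto
  have "((f \<otimes>\<^bsub>L\<^esub> g) \<odot>\<^bsub>Ind T M\<^esub> c) r =
      (\<Oplus>\<^bsub>M\<^esub>z\<in>?F r. \<Oplus>\<^bsub>M\<^esub>y\<in>?F (fst z). f (fst y) \<odot>\<^bsub>M\<^esub> (g (snd y) \<odot>\<^bsub>M\<^esub> c (snd z)))"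
    unfolding induced_apply(3)[OF r]
  proof (rule M.M.finsum_cong'[OF refl])
    fix z assume z: "z \<in> ?F r"
    have "(f \<otimes>\<^bsub>L\<^esub> g) (fst z) \<odot>\<^bsub>M\<^esub> c (snd z) =
        (\<Oplus>\<^bsub>M\<^esub>y\<in>?F (fst z). (f (fst y) \<otimes>\<^bsub>A\<^esub> g (snd y)) \<odot>\<^bsub>M\<^esub> c (snd z))"
      unfolding mult_L[OF pf(1)[OF z r]]
      by (rule M.smult_finsum_left[OF fin]) (use fgS[OF z] pf(2)[OF z r] c in auto)
    also have "\<dots> = (\<Oplus>\<^bsub>M\<^esub>y\<in>?F (fst z). f (fst y) \<odot>\<^bsub>M\<^esub> (g (snd y) \<odot>\<^bsub>M\<^esub> c (snd z)))"
      by (rule M.M.finsum_cong') (use fgS[OF z] in \<open>auto simp: M.smult_assoc1\<close>)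
    finally show "(f \<otimes>\<^bsub>L\<^esub> g) (fst z) \<odot>\<^bsub>M\<^esub> c (snd z) =
        (\<Oplus>\<^bsub>M\<^esub>y\<in>?F (fst z). f (fst y) \<odot>\<^bsub>M\<^esub> (g (snd y) \<odot>\<^bsub>M\<^esub> c (snd z)))" .
  qed (use fgS in \<open>auto intro!: M.M.finsum_closed\<close>)
  also have "\<dots> = (\<Oplus>\<^bsub>M\<^esub>w\<in>?S. ?u w)"
    by (rule M.M.finsum_Sigma) (use fgS in \<open>auto intro!: fin\<close>)
  also have "\<dots> = (\<Oplus>\<^bsub>M\<^esub>w\<in>?T. ?v w)"
    unfolding factorizations_assoc(2)[symmetric]
    by (subst M.M.finsum_reindex[OF _ factorizations_assoc(1)])
      (use vT in \<open>auto simp: factorizations_assoc(2)\<close>)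
  also have "\<dots> = (\<Oplus>\<^bsub>M\<^esub>z\<in>?F r. \<Oplus>\<^bsub>M\<^esub>y\<in>?F (snd z). f (fst z) \<odot>\<^bsub>M\<^esub> (g (fst y) \<odot>\<^bsub>M\<^esub> c (snd y)))"
    by (rule M.M.finsum_Sigma[symmetric]) (use fgT in \<open>auto intro!: fin\<close>)
  also have "\<dots> = (f \<odot>\<^bsub>Ind T M\<^esub> (g \<odot>\<^bsub>Ind T M\<^esub> c)) r"
    unfolding induced_apply(3)[OF r]
  proof (rule M.M.finsum_cong'[OF refl])
    fix z assume z: "z \<in> ?F r"
    show "(\<Oplus>\<^bsub>M\<^esub>y\<in>?F (snd z). f (fst z) \<odot>\<^bsub>M\<^esub> (g (fst y) \<odot>\<^bsub>M\<^esub> c (snd y))) =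
       f (fst z) \<odot>\<^bsub>M\<^esub> (g \<odot>\<^bsub>Ind T M\<^esub> c) (snd z)"
      unfolding induced_apply(3)[OF pf(2)[OF z r]]
      by (rule M.smult_finsum_right[OF fin, symmetric]) (use fgT[OF z] pf(1)[OF z r] f in auto)
  next
    show "(\<lambda>z. f (fst z) \<odot>\<^bsub>M\<^esub> (g \<odot>\<^bsub>Ind T M\<^esub> c) (snd z)) \<in> ?F r \<rightarrow> carrier M"
      using pf[OF _ r] f induced_closed[OF cl[OF g c]] by auto
  qed
  finally show "((f \<otimes>\<^bsub>L\<^esub> g) \<odot>\<^bsub>Ind T M\<^esub> c) r = (f \<odot>\<^bsub>Ind T M\<^esub> (g \<odot>\<^bsub>Ind T M\<^esub> c)) r" .
qed

lemma left_module_induced: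
  assumes M: "left_module A M"
  shows "left_module L (Ind T M)"
proof -
  interpret M: left_module A M by (rule M)
  note cl = induced_smult_closed[OF M] induced_add_closed[OF M] induced_zero_closed[OF M]
  note pf = factorizations_paths_from
  have "abelian_group (Ind T M)"
  proof (rule abelian_groupI)
    fix c assume c: "c \<in> carrier (Ind T M)"
    have n: "(\<lambda>r\<in>paths_from Q T. \<ominus>\<^bsub>M\<^esub> c r) \<in> carrier (Ind T M)"
      by (rule induced_memI) (use c in simp)
    have "(\<lambda>r\<in>paths_from Q T. \<ominus>\<^bsub>M\<^esub> c r) \<oplus>\<^bsub>Ind T M\<^esub> c = \<zero>\<^bsub>Ind T M\<^esub>"
      by (rule induced_eqI[of _ T M]) (use c n cl in \<open>auto simp: induced_apply M.M.l_neg\<close>)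
    then show "\<exists>y\<in>carrier (Ind T M). y \<oplus>\<^bsub>Ind T M\<^esub> c = \<zero>\<^bsub>Ind T M\<^esub>" using n by blast
  qed (auto intro!: induced_eqI[of _ T M] simp: cl induced_apply M.M.add.m_ac)
  moreover have "(f \<oplus>\<^bsub>L\<^esub> g) \<odot>\<^bsub>Ind T M\<^esub> c = f \<odot>\<^bsub>Ind T M\<^esub> c \<oplus>\<^bsub>Ind T M\<^esub> g \<odot>\<^bsub>Ind T M\<^esub> c"
    if fg: "f \<in> carrier L" "g \<in> carrier L" "c \<in> carrier (Ind T M)" for f g c
  proof (rule induced_eqI[of _ T M])
    fix r assume r: "r \<in> paths_from Q T"
    have "(\<Oplus>\<^bsub>M\<^esub>z\<in>factorizations Q r. (f \<oplus>\<^bsub>L\<^esub> g) (fst z) \<odot>\<^bsub>M\<^esub> c (snd z)) =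
        (\<Oplus>\<^bsub>M\<^esub>z\<in>factorizations Q r. f (fst z) \<odot>\<^bsub>M\<^esub> c (snd z) \<oplus>\<^bsub>M\<^esub> g (fst z) \<odot>\<^bsub>M\<^esub> c (snd z))"
      by (rule M.M.finsum_cong') (use pf[OF _ r] fg in \<open>auto simp: add_L M.smult_l_distr\<close>)
    also have "\<dots> = (\<Oplus>\<^bsub>M\<^esub>z\<in>factorizations Q r. f (fst z) \<odot>\<^bsub>M\<^esub> c (snd z)) \<oplus>\<^bsub>M\<^esub>
        (\<Oplus>\<^bsub>M\<^esub>z\<in>factorizations Q r. g (fst z) \<odot>\<^bsub>M\<^esub> c (snd z))"
      by (rule M.M.finsum_addf) (use induced_term_closed[OF M _ fg(3) r] fg in auto)
    finally show "((f \<oplus>\<^bsub>L\<^esub> g) \<odot>\<^bsub>Ind T M\<^esub> c) r = (f \<odot>\<^bsub>Ind T M\<^esub> c \<oplus>\<^bsub>Ind T M\<^esub> g \<odot>\<^bsub>Ind T M\<^esub> c) r"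
      by (simp add: induced_apply r)
  qed (use fg cl L_add_closed in auto)
  moreover have "f \<odot>\<^bsub>Ind T M\<^esub> (c \<oplus>\<^bsub>Ind T M\<^esub> c') = f \<odot>\<^bsub>Ind T M\<^esub> c \<oplus>\<^bsub>Ind T M\<^esub> f \<odot>\<^bsub>Ind T M\<^esub> c'"
    if fg: "f \<in> carrier L" "c \<in> carrier (Ind T M)" "c' \<in> carrier (Ind T M)" for f c c'
  proof (rule induced_eqI[of _ T M])
    fix r assume r: "r \<in> paths_from Q T"
    have "(\<Oplus>\<^bsub>M\<^esub>z\<in>factorizations Q r. f (fst z) \<odot>\<^bsub>M\<^esub> (c \<oplus>\<^bsub>Ind T M\<^esub> c') (snd z)) =
        (\<Oplus>\<^bsub>M\<^esub>z\<in>factorizations Q r. f (fst z) \<odot>\<^bsub>M\<^esub> c (snd z) \<oplus>\<^bsub>M\<^esub> f (fst z) \<odot>\<^bsub>M\<^esub> c' (snd z))"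
      by (rule M.M.finsum_cong') (use pf[OF _ r] fg in \<open>auto simp: induced_apply M.smult_r_distr\<close>)
    also have "\<dots> = (\<Oplus>\<^bsub>M\<^esub>z\<in>factorizations Q r. f (fst z) \<odot>\<^bsub>M\<^esub> c (snd z)) \<oplus>\<^bsub>M\<^esub>
        (\<Oplus>\<^bsub>M\<^esub>z\<in>factorizations Q r. f (fst z) \<odot>\<^bsub>M\<^esub> c' (snd z))"
      by (rule M.M.finsum_addf) (use induced_term_closed[OF M fg(1) _ r] fg in auto)
    finally show "(f \<odot>\<^bsub>Ind T M\<^esub> (c \<oplus>\<^bsub>Ind T M\<^esub> c')) r = (f \<odot>\<^bsub>Ind T M\<^esub> c \<oplus>\<^bsub>Ind T M\<^esub> f \<odot>\<^bsub>Ind T M\<^esub> c') r"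
      by (simp add: induced_apply r)
  qed (use fg cl in auto)
  moreover have "\<one>\<^bsub>L\<^esub> \<odot>\<^bsub>Ind T M\<^esub> c = c" if c: "c \<in> carrier (Ind T M)" for c
    by (rule induced_eqI[of _ T M])
      (use c cl L_one_closed induced_scal[OF M A.one_closed c] in \<open>auto simp: scal_el_hom(3)\<close>)
  ultimately show ?thesis
    using induced_assoc[OF M] cl
    by (intro left_module.intro left_module_axioms.intro ring_L) auto
qed

text \<open>With coefficients in \<open>A\<close> and all starting vertices allowed, the convolution
  is the product of \<open>L\<close>. Formulas for generators acting on induced modules thereby
  become formulas for products in \<open>L\<close>.\<close>

lemma L_as_induced:
  "carrier (Ind (verts Q) (regular_module A)) = carrier L"
  "f \<odot>\<^bsub>Ind (verts Q) (regular_module A)\<^esub> g = f \<otimes>\<^bsub>L\<^esub> g"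
  by (simp_all add: carrier_L induced_module_def paths_from_verts finsum_regular path_algebra_def)

lemma L_left_mult:
  assumes f: "f \<in> carrier L"
  shows "a \<in> carrier A \<Longrightarrow> r \<in> paths Q \<Longrightarrow> (scal_el a \<otimes>\<^bsub>L\<^esub> f) r = a \<otimes>\<^bsub>A\<^esub> f r"
    "r \<in> paths Q \<Longrightarrow> (path_el (trivial_path j) \<otimes>\<^bsub>L\<^esub> f) r = (if path_end r = j then f r else \<zero>\<^bsub>A\<^esub>)"
    "\<alpha> \<in> arcs Q \<Longrightarrow> p \<in> paths Q \<Longrightarrow> path_end p = tail Q \<alpha> \<Longrightarrow>
      (path_el (arrow_path Q \<alpha>) \<otimes>\<^bsub>L\<^esub> f) (path_snoc Q p \<alpha>) = f p"
    "\<alpha> \<in> arcs Q \<Longrightarrow> r \<in> paths Q \<Longrightarrow> (\<And>p. p \<in> paths Q \<Longrightarrow> path_end p = tail Q \<alpha> \<Longrightarrow> r \<noteq> path_snoc Q p \<alpha>) \<Longrightarrow>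
      (path_el (arrow_path Q \<alpha>) \<otimes>\<^bsub>L\<^esub> f) r = \<zero>\<^bsub>A\<^esub>"
proof -
  have reg: "left_module A (regular_module A)" by (rule left_module_regular) (rule A.ring_axioms)
  have f': "f \<in> carrier (Ind (verts Q) (regular_module A))" using f by (simp add: L_as_induced)
  show "a \<in> carrier A \<Longrightarrow> r \<in> paths Q \<Longrightarrow> (scal_el a \<otimes>\<^bsub>L\<^esub> f) r = a \<otimes>\<^bsub>A\<^esub> f r"
    using induced_scal[OF reg _ f', of a r] by (simp add: L_as_induced paths_from_verts)
  show "r \<in> paths Q \<Longrightarrow> (path_el (trivial_path j) \<otimes>\<^bsub>L\<^esub> f) r = (if path_end r = j then f r else \<zero>\<^bsub>A\<^esub>)"
    using induced_vert[OF reg f', of r j] by (simp add: L_as_induced paths_from_verts)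
  show "\<alpha> \<in> arcs Q \<Longrightarrow> p \<in> paths Q \<Longrightarrow> path_end p = tail Q \<alpha> \<Longrightarrow>
      (path_el (arrow_path Q \<alpha>) \<otimes>\<^bsub>L\<^esub> f) (path_snoc Q p \<alpha>) = f p"
    using induced_arrow(1)[OF reg f', of \<alpha> p] by (simp add: L_as_induced paths_from_verts)
  show "\<alpha> \<in> arcs Q \<Longrightarrow> r \<in> paths Q \<Longrightarrow> (\<And>p. p \<in> paths Q \<Longrightarrow> path_end p = tail Q \<alpha> \<Longrightarrow> r \<noteq> path_snoc Q p \<alpha>) \<Longrightarrow>
      (path_el (arrow_path Q \<alpha>) \<otimes>\<^bsub>L\<^esub> f) r = \<zero>\<^bsub>A\<^esub>"
    using induced_arrow(2)[OF reg f', of \<alpha> r] by (simp add: L_as_induced paths_from_verts)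
qed

lemma path_el_mult:
  assumes p: "p \<in> paths Q"
  shows "path_el (trivial_path j) \<otimes>\<^bsub>L\<^esub> path_el p = (if path_end p = j then path_el p else \<zero>\<^bsub>L\<^esub>)"
    "\<alpha> \<in> arcs Q \<Longrightarrow> path_el (arrow_path Q \<alpha>) \<otimes>\<^bsub>L\<^esub> path_el p =
      (if path_end p = tail Q \<alpha> then path_el (path_snoc Q p \<alpha>) else \<zero>\<^bsub>L\<^esub>)"
proof -
  show "path_el (trivial_path j) \<otimes>\<^bsub>L\<^esub> path_el p = (if path_end p = j then path_el p else \<zero>\<^bsub>L\<^esub>)"
  proof (rule L_eqI)
    fix r assume r: "r \<in> paths Q"
    show "(path_el (trivial_path j) \<otimes>\<^bsub>L\<^esub> path_el p) r = (if path_end p = j then path_el p else \<zero>\<^bsub>L\<^esub>) r"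
      using r by (simp add: L_left_mult path_el_apply zero_L)
  qed (auto simp: L_mult_closed L_zero_closed)
  assume \<alpha>: "\<alpha> \<in> arcs Q"
  show "path_el (arrow_path Q \<alpha>) \<otimes>\<^bsub>L\<^esub> path_el p =
      (if path_end p = tail Q \<alpha> then path_el (path_snoc Q p \<alpha>) else \<zero>\<^bsub>L\<^esub>)"
  proof (rule L_eqI)
    fix r assume r: "r \<in> paths Q"
    show "(path_el (arrow_path Q \<alpha>) \<otimes>\<^bsub>L\<^esub> path_el p) r =
        (if path_end p = tail Q \<alpha> then path_el (path_snoc Q p \<alpha>) else \<zero>\<^bsub>L\<^esub>) r"
    proof (cases "\<exists>q. q \<in> paths Q \<and> path_end q = tail Q \<alpha> \<and> r = path_snoc Q q \<alpha>")
      case True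
      then obtain q where q: "q \<in> paths Q" "path_end q = tail Q \<alpha>" "r = path_snoc Q q \<alpha>" by blast
      have "(path_el (arrow_path Q \<alpha>) \<otimes>\<^bsub>L\<^esub> path_el p) r = (if q = p then \<one>\<^bsub>A\<^esub> else \<zero>\<^bsub>A\<^esub>)"
        using q \<alpha> by (simp add: L_left_mult(3) path_el_apply)
      moreover have "q = p \<longleftrightarrow> path_end p = tail Q \<alpha> \<and> r = path_snoc Q p \<alpha>"
        using q path_snoc_inj(2)[of q \<alpha> p \<alpha>] by auto
      ultimately show ?thesis using r by (simp add: path_el_apply zero_L)
    next
      case False
      then have "(path_el (arrow_path Q \<alpha>) \<otimes>\<^bsub>L\<^esub> path_el p) r = \<zero>\<^bsub>A\<^esub>"
        using L_left_mult(4)[OF path_el_closed \<alpha> r] by blast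
      moreover have "path_end p = tail Q \<alpha> \<Longrightarrow> r \<noteq> path_snoc Q p \<alpha>" using False p by blast
      ultimately show ?thesis using r by (simp add: path_el_apply zero_L)
    qed
  qed (auto simp: L_mult_closed L_zero_closed)
qed

section \<open>Reduction to the generators of the path algebra\<close>

lemma arrow_path_eq_snoc: "arrow_path Q \<alpha> = path_snoc Q (trivial_path (tail Q \<alpha>)) \<alpha>"
  by (simp add: arrow_path_def path_snoc_def trivial_path_def)

lemma arrow_el_mult:
  assumes "\<alpha> \<in> arcs Q"
  shows "path_el (arrow_path Q \<alpha>) \<otimes>\<^bsub>L\<^esub> path_el (trivial_path (tail Q \<alpha>)) = path_el (arrow_path Q \<alpha>)"
    "path_el (trivial_path (head Q \<alpha>)) \<otimes>\<^bsub>L\<^esub> path_el (arrow_path Q \<alpha>) = path_el (arrow_path Q \<alpha>)"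
    "j \<noteq> head Q \<alpha> \<Longrightarrow> path_el (trivial_path j) \<otimes>\<^bsub>L\<^esub> path_el (arrow_path Q \<alpha>) = \<zero>\<^bsub>L\<^esub>"
    "j \<in> verts Q \<Longrightarrow> j \<noteq> tail Q \<alpha> \<Longrightarrow> path_el (arrow_path Q \<alpha>) \<otimes>\<^bsub>L\<^esub> path_el (trivial_path j) = \<zero>\<^bsub>L\<^esub>"
  using assms path_el_mult(2)[of "trivial_path (tail Q \<alpha>)" \<alpha>] path_el_mult(2)[of "trivial_path j" \<alpha>]
    path_el_mult(1)[of "arrow_path Q \<alpha>"]
  by (simp_all add: arrow_path_eq_snoc[symmetric])

text \<open>\<open>L\<close> is generated as a ring by the scalars of \<open>A\<close>, the vertex
  idempotents and the arrows: every element is a sum of terms \<open>a \<otimes> p\<close>, and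
  every path is a product of arrows and a trivial path.\<close>

lemma L_induct [consumes 1, case_names scal vert arrow add mult]:
  assumes f: "f \<in> carrier L"
    and scal: "\<And>a. a \<in> carrier A \<Longrightarrow> S (scal_el a)"
    and vert: "\<And>j. j \<in> verts Q \<Longrightarrow> S (path_el (trivial_path j))"
    and arrow: "\<And>\<alpha>. \<alpha> \<in> arcs Q \<Longrightarrow> S (path_el (arrow_path Q \<alpha>))"
    and add: "\<And>f g. f \<in> carrier L \<Longrightarrow> g \<in> carrier L \<Longrightarrow> S f \<Longrightarrow> S g \<Longrightarrow> S (f \<oplus>\<^bsub>L\<^esub> g)"
    and mult: "\<And>f g. f \<in> carrier L \<Longrightarrow> g \<in> carrier L \<Longrightarrow> S f \<Longrightarrow> S g \<Longrightarrow> S (f \<otimes>\<^bsub>L\<^esub> g)"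
  shows "S f"
proof -
  interpret L: ring L by (rule ring_L)
  \<comment> \<open>The last arrow of a path is a left factor of it.\<close>
  have path: "S (path_el p)" if "p \<in> paths Q" for p
    using that
  proof (induction p rule: path_induct)
    case (snoc p \<alpha>)
    then have "path_el (path_snoc Q p \<alpha>) = path_el (arrow_path Q \<alpha>) \<otimes>\<^bsub>L\<^esub> path_el p"
      by (simp add: path_el_mult(2))
    then show ?case using snoc mult[OF path_el_closed path_el_closed arrow] by simp
  qed (rule vert)
  have "S (\<Oplus>\<^bsub>L\<^esub>x\<in>B. pure_tensor A Q (f x) (path_basis K Q x))" if "finite B" "B \<subseteq> paths Q" for B
    using that
  proof (induction B)
    case empty
    then show ?case using scal[of "\<zero>\<^bsub>A\<^esub>"] by (simp add: scal_el_hom)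
  next
    case (insert x B)
    have cx: "pure_tensor A Q (f x) (path_basis K Q x) \<in> carrier L"
      using insert.prems f by simp
    have cB: "(\<lambda>x. pure_tensor A Q (f x) (path_basis K Q x)) \<in> B \<rightarrow> carrier L"
      using insert.prems f by (intro Pi_I pure_tensor_closed L_closed[OF f]) auto
    have "S (pure_tensor A Q (f x) (path_basis K Q x))"
      using insert.prems f path[of x] scal[of "f x"] mult[OF scal_el_closed path_el_closed, of "f x" x]
      by (simp add: scal_el_path_el(1)[symmetric])
    then have "S (pure_tensor A Q (f x) (path_basis K Q x) \<oplus>\<^bsub>L\<^esub>
        (\<Oplus>\<^bsub>L\<^esub>x\<in>B. pure_tensor A Q (f x) (path_basis K Q x)))"
      using insert.IH insert.prems by (intro add cx L.finsum_closed[OF cB]) auto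
    then show ?case by (simp only: L.finsum_insert[OF insert.hyps cB cx])
  qed
  from this[OF finite_paths subset_refl] show ?thesis using L_expansion[OF f] by simp
qed

text \<open>Over \<open>L\<close> it is enough to respect addition and the generators; in other
  words, the morphisms of representations are the \<open>L\<close>-linear maps.\<close>

lemma L_homI:
  assumes M: "left_module L M" and N: "left_module L N"
    and closed: "\<And>x. x \<in> carrier M \<Longrightarrow> f x \<in> carrier N"
    and add: "\<And>x y. x \<in> carrier M \<Longrightarrow> y \<in> carrier M \<Longrightarrow> f (x \<oplus>\<^bsub>M\<^esub> y) = f x \<oplus>\<^bsub>N\<^esub> f y"
    and scal: "\<And>a x. a \<in> carrier A \<Longrightarrow> x \<in> carrier M \<Longrightarrow> f (scal_el a \<odot>\<^bsub>M\<^esub> x) = scal_el a \<odot>\<^bsub>N\<^esub> f x"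
    and vert: "\<And>j x. j \<in> verts Q \<Longrightarrow> x \<in> carrier M \<Longrightarrow>
      f (path_el (trivial_path j) \<odot>\<^bsub>M\<^esub> x) = path_el (trivial_path j) \<odot>\<^bsub>N\<^esub> f x"
    and arrow: "\<And>\<alpha> x. \<alpha> \<in> arcs Q \<Longrightarrow> x \<in> carrier M \<Longrightarrow>
      f (path_el (arrow_path Q \<alpha>) \<odot>\<^bsub>M\<^esub> x) = path_el (arrow_path Q \<alpha>) \<odot>\<^bsub>N\<^esub> f x"
  shows "f \<in> mod_hom L M N"
proof (rule mod_homI)
  interpret M: left_module L M by (rule M)
  interpret N: left_module L N by (rule N)
  fix l x assume "l \<in> carrier L" and x: "x \<in> carrier M"
  from this(1) have "\<forall>x\<in>carrier M. f (l \<odot>\<^bsub>M\<^esub> x) = l \<odot>\<^bsub>N\<^esub> f x"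
  proof (induction l rule: L_induct)
    case (add l l')
    then show ?case using closed assms(4) by (simp add: M.smult_l_distr N.smult_l_distr)
  next
    case (mult l l')
    then show ?case using closed by (simp add: M.smult_assoc1 N.smult_assoc1)
  qed (use scal vert arrow in auto)
  then show "f (l \<odot>\<^bsub>M\<^esub> x) = l \<odot>\<^bsub>N\<^esub> f x" using x by blast
qed (rule closed add; assumption)+

lemma L_submoduleI:
  assumes X: "left_module L X" and sub: "N \<subseteq> carrier X" and zero: "\<zero>\<^bsub>X\<^esub> \<in> N"
    and add: "\<And>x y. x \<in> N \<Longrightarrow> y \<in> N \<Longrightarrow> x \<oplus>\<^bsub>X\<^esub> y \<in> N"
    and scal: "\<And>a x. a \<in> carrier A \<Longrightarrow> x \<in> N \<Longrightarrow> scal_el a \<odot>\<^bsub>X\<^esub> x \<in> N"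
    and vert: "\<And>j x. j \<in> verts Q \<Longrightarrow> x \<in> N \<Longrightarrow> path_el (trivial_path j) \<odot>\<^bsub>X\<^esub> x \<in> N"
    and arrow: "\<And>\<alpha> x. \<alpha> \<in> arcs Q \<Longrightarrow> x \<in> N \<Longrightarrow> path_el (arrow_path Q \<alpha>) \<odot>\<^bsub>X\<^esub> x \<in> N"
  shows "left_submodule L X N"
proof -
  interpret X: left_module L X by (rule X)
  have xc: "x \<in> carrier X" if "x \<in> N" for x using that sub by blast
  have "\<forall>x\<in>N. l \<odot>\<^bsub>X\<^esub> x \<in> N" if "l \<in> carrier L" for l
    using that
  proof (induction l rule: L_induct)
    case (add l l')
    then show ?case using assms(4) xc by (simp add: X.smult_l_distr)
  next
    case (mult l l')
    then show ?case using xc by (simp add: X.smult_assoc1)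
  qed (use scal vert arrow in auto)
  then show ?thesis unfolding left_submodule_def using sub zero add by blast
qed

end

section \<open>Modules over the path algebra as representations\<close>

context quiver_algebra
begin

abbreviation "Rep X i \<equiv> rep_space K A Q X i"
abbreviation "vert_el j \<equiv> path_el (trivial_path j)"
abbreviation "arrow_el \<alpha> \<equiv> path_el (arrow_path Q \<alpha>)"
abbreviation "Incoming X i \<equiv> incoming_image Q (rep_space K A Q X) (rep_map K A Q X) i"

lemma rep_space_simps:
  "carrier (Rep X i) = (\<lambda>x. vert_el i \<odot>\<^bsub>X\<^esub> x) ` carrier X"
  "\<zero>\<^bsub>Rep X i\<^esub> = \<zero>\<^bsub>X\<^esub>" "x \<oplus>\<^bsub>Rep X i\<^esub> y = x \<oplus>\<^bsub>X\<^esub> y" "a \<odot>\<^bsub>Rep X i\<^esub> x = scal_el a \<odot>\<^bsub>X\<^esub> x"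
  by (simp_all add: rep_space_def path_el_def scal_el_def)

lemma rep_map_eq: "rep_map K A Q X \<alpha> x = arrow_el \<alpha> \<odot>\<^bsub>X\<^esub> x"
  by (simp add: rep_map_def path_el_def)

lemma in_arcsD: "\<alpha> \<in> in_arcs Q i \<Longrightarrow> \<alpha> \<in> arcs Q" "\<alpha> \<in> in_arcs Q i \<Longrightarrow> head Q \<alpha> = i"
  "\<alpha> \<in> in_arcs Q i \<Longrightarrow> tail Q \<alpha> \<in> verts Q"
  by auto

lemma finite_in_arcs: "finite (in_arcs Q i)"
  by (rule finite_subset[OF _ finite_arcs]) auto

text \<open>The vertex idempotents are complete, so each module is the sum of its spaces.\<close>

lemma L_one_sum: "\<one>\<^bsub>L\<^esub> = (\<Oplus>\<^bsub>L\<^esub>j\<in>verts Q. vert_el j)"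
proof (rule L_eqI)
  interpret L: ring L by (rule ring_L)
  show "(\<Oplus>\<^bsub>L\<^esub>j\<in>verts Q. vert_el j) \<in> carrier L" by (rule L.finsum_closed) simp
  fix x assume x: "x \<in> paths Q"
  have s: "(\<Oplus>\<^bsub>L\<^esub>j\<in>verts Q. vert_el j) x = (\<Oplus>\<^bsub>A\<^esub>j\<in>verts Q. vert_el j x)"
    by (rule finsum_L_apply) (use x in auto)
  show "\<one>\<^bsub>L\<^esub> x = (\<Oplus>\<^bsub>L\<^esub>j\<in>verts Q. vert_el j) x"
    using x
  proof (cases rule: path_cases)
    case (trivial j)
    have "(\<Oplus>\<^bsub>A\<^esub>i\<in>verts Q. vert_el i x) = vert_el j x"
      by (rule A.finsum_delta) (use trivial x in \<open>auto simp: path_el_apply\<close>)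
    then show ?thesis using s x trivial by (simp add: one_L' path_el_apply) (simp add: trivial_path_def)
  next
    case (snoc p \<alpha>)
    have "(\<Oplus>\<^bsub>A\<^esub>i\<in>verts Q. vert_el i x) = (\<Oplus>\<^bsub>A\<^esub>i\<in>verts Q. \<zero>\<^bsub>A\<^esub>)"
      by (rule A.finsum_cong') (use snoc x in \<open>auto simp: path_el_apply\<close>)
    then show ?thesis using s x snoc by (simp add: one_L' path_snoc_def)
  qed
qed (rule L_one_closed)

section \<open>The spaces, arrows and incoming sums of a fixed module\<close>

context
  fixes X :: "('d \<times> 'e list \<times> 'd \<Rightarrow> 'c, 'm) module"
  assumes X: "left_module L X"
begin

interpretation X: left_module L X by (rule X)

lemma el_assoc:
  "l \<in> carrier L \<Longrightarrow> l' \<in> carrier L \<Longrightarrow> x \<in> carrier X \<Longrightarrow> l \<odot>\<^bsub>X\<^esub> (l' \<odot>\<^bsub>X\<^esub> x) = (l \<otimes>\<^bsub>L\<^esub> l') \<odot>\<^bsub>X\<^esub> x"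
  by (simp add: X.smult_assoc1)

lemma vert_vert:
  assumes "j \<in> verts Q" "x \<in> carrier X"
  shows "vert_el i \<odot>\<^bsub>X\<^esub> (vert_el j \<odot>\<^bsub>X\<^esub> x) = (if i = j then vert_el j \<odot>\<^bsub>X\<^esub> x else \<zero>\<^bsub>X\<^esub>)"
  using assms by (auto simp: el_assoc path_el_mult)

lemma vert_arrow:
  assumes "\<alpha> \<in> arcs Q" "x \<in> carrier X"
  shows "vert_el j \<odot>\<^bsub>X\<^esub> (arrow_el \<alpha> \<odot>\<^bsub>X\<^esub> x) = (if j = head Q \<alpha> then arrow_el \<alpha> \<odot>\<^bsub>X\<^esub> x else \<zero>\<^bsub>X\<^esub>)"
  using assms by (auto simp: el_assoc arrow_el_mult)

lemma arrow_vert: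
  assumes "\<alpha> \<in> arcs Q" "j \<in> verts Q" "x \<in> carrier X"
  shows "arrow_el \<alpha> \<odot>\<^bsub>X\<^esub> (vert_el j \<odot>\<^bsub>X\<^esub> x) = (if j = tail Q \<alpha> then arrow_el \<alpha> \<odot>\<^bsub>X\<^esub> x else \<zero>\<^bsub>X\<^esub>)"
  using assms by (auto simp: el_assoc arrow_el_mult)

lemma scal_path:
  assumes "a \<in> carrier A" "x \<in> carrier X"
  shows "scal_el a \<odot>\<^bsub>X\<^esub> (path_el p \<odot>\<^bsub>X\<^esub> x) = path_el p \<odot>\<^bsub>X\<^esub> (scal_el a \<odot>\<^bsub>X\<^esub> x)"
  using assms by (simp add: el_assoc scal_el_path_el)

lemma rep_carrier: "x \<in> carrier (Rep X i) \<Longrightarrow> x \<in> carrier X"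
  by (auto simp: rep_space_simps)

lemma rep_memI: "x \<in> carrier X \<Longrightarrow> vert_el i \<odot>\<^bsub>X\<^esub> x \<in> carrier (Rep X i)"
  by (simp add: rep_space_simps)

lemma rep_vert: "j \<in> verts Q \<Longrightarrow> x \<in> carrier (Rep X j) \<Longrightarrow> vert_el i \<odot>\<^bsub>X\<^esub> x = (if i = j then x else \<zero>\<^bsub>X\<^esub>)"
  by (auto simp: rep_space_simps vert_vert)

lemma rep_arrow:
  assumes "\<alpha> \<in> arcs Q" "x \<in> carrier X" shows "arrow_el \<alpha> \<odot>\<^bsub>X\<^esub> x \<in> carrier (Rep X (head Q \<alpha>))"
  using rep_memI[of "arrow_el \<alpha> \<odot>\<^bsub>X\<^esub> x" "head Q \<alpha>"] assms vert_arrow[OF assms, of "head Q \<alpha>"] by simp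

lemma left_module_rep: "i \<in> verts Q \<Longrightarrow> left_module A (Rep X i)"
  by (rule rep_space_module[OF X])

lemma rep_zero: "i \<in> verts Q \<Longrightarrow> \<zero>\<^bsub>X\<^esub> \<in> carrier (Rep X i)"
  using rep_memI[of "\<zero>\<^bsub>X\<^esub>" i] by simp

lemma rep_add: "x \<in> carrier (Rep X i) \<Longrightarrow> y \<in> carrier (Rep X i) \<Longrightarrow> x \<oplus>\<^bsub>X\<^esub> y \<in> carrier (Rep X i)"
  by (auto simp: rep_space_simps X.smult_r_distr[symmetric])

lemma rep_scal: "a \<in> carrier A \<Longrightarrow> x \<in> carrier (Rep X i) \<Longrightarrow> scal_el a \<odot>\<^bsub>X\<^esub> x \<in> carrier (Rep X i)"
  by (auto simp: rep_space_simps scal_path)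

text \<open>\<open>Rep X i\<close> shares zero and addition with \<open>X\<close> but has a smaller
  carrier, on which \<open>finsum\<close> depends; for terms inside that carrier the sums
  agree.\<close>

lemma finsum_rep:
  assumes i: "i \<in> verts Q" and g: "g \<in> S \<rightarrow> carrier (Rep X i)"
  shows "(\<Oplus>\<^bsub>Rep X i\<^esub>s\<in>S. g s) = (\<Oplus>\<^bsub>X\<^esub>s\<in>S. g s)"
proof -
  interpret V: left_module A "Rep X i" by (rule left_module_rep[OF i])
  show ?thesis
  proof (cases "finite S")
    case True
    then show ?thesis using g
    proof (induction S)
      case (insert x F)
      then have "g \<in> F \<rightarrow> carrier (Rep X i)" "g x \<in> carrier (Rep X i)"
        "g \<in> F \<rightarrow> carrier X" "g x \<in> carrier X" using rep_carrier by auto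
      with insert show ?case by (simp add: rep_space_simps(3))
    qed (simp add: rep_space_simps(2))
  next
    case False
    then show ?thesis by (simp add: X.M.finsum_infinite V.M.finsum_infinite rep_space_simps(2))
  qed
qed

lemma vert_decomposition:
  assumes x: "x \<in> carrier X" shows "x = (\<Oplus>\<^bsub>X\<^esub>j\<in>verts Q. vert_el j \<odot>\<^bsub>X\<^esub> x)"
proof -
  have "x = (\<Oplus>\<^bsub>L\<^esub>j\<in>verts Q. vert_el j) \<odot>\<^bsub>X\<^esub> x"
    using x by (simp add: L_one_sum[symmetric])
  also have "\<dots> = (\<Oplus>\<^bsub>X\<^esub>j\<in>verts Q. vert_el j \<odot>\<^bsub>X\<^esub> x)"
    by (rule X.smult_finsum_left) (use x in auto)
  finally show ?thesis .
qed

lemma arrow_tail: "\<alpha> \<in> arcs Q \<Longrightarrow> x \<in> carrier X \<Longrightarrow>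
    arrow_el \<alpha> \<odot>\<^bsub>X\<^esub> x = arrow_el \<alpha> \<odot>\<^bsub>X\<^esub> (vert_el (tail Q \<alpha>) \<odot>\<^bsub>X\<^esub> x)"
  by (simp add: arrow_vert)

lemma arrow_sum_terms:
  assumes "\<And>\<alpha>. \<alpha> \<in> in_arcs Q i \<Longrightarrow> y \<alpha> \<in> carrier X"
  shows "(\<lambda>\<alpha>. arrow_el \<alpha> \<odot>\<^bsub>X\<^esub> y \<alpha>) \<in> in_arcs Q i \<rightarrow> carrier (Rep X i)"
    "(\<lambda>\<alpha>. arrow_el \<alpha> \<odot>\<^bsub>X\<^esub> y \<alpha>) \<in> in_arcs Q i \<rightarrow> carrier X"
proof
  fix \<alpha> assume \<alpha>: "\<alpha> \<in> in_arcs Q i"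
  show "arrow_el \<alpha> \<odot>\<^bsub>X\<^esub> y \<alpha> \<in> carrier (Rep X i)"
    using rep_arrow[OF in_arcsD(1)[OF \<alpha>] assms[OF \<alpha>]] in_arcsD(2)[OF \<alpha>] by simp
next
  show "(\<lambda>\<alpha>. arrow_el \<alpha> \<odot>\<^bsub>X\<^esub> y \<alpha>) \<in> in_arcs Q i \<rightarrow> carrier X"
    using assms by auto
qed

text \<open>Preimages under the structure maps are chosen and the sum is moved from
  \<open>X_i\<close> to \<open>X\<close>, where \<open>L\<close>-linear maps can be applied to
  it.\<close>

lemma Incoming_iff:
  assumes i: "i \<in> verts Q"
  shows "x \<in> Incoming X i \<longleftrightarrow> (\<exists>y. (\<forall>\<alpha>\<in>in_arcs Q i. y \<alpha> \<in> carrier (Rep X (tail Q \<alpha>))) \<and>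
    x = (\<Oplus>\<^bsub>X\<^esub>\<alpha>\<in>in_arcs Q i. arrow_el \<alpha> \<odot>\<^bsub>X\<^esub> y \<alpha>))"
proof
  assume "x \<in> Incoming X i"
  then obtain z where z: "\<forall>\<alpha>\<in>in_arcs Q i. z \<alpha> \<in> rep_map K A Q X \<alpha> ` carrier (Rep X (tail Q \<alpha>))"
    "x = (\<Oplus>\<^bsub>Rep X i\<^esub>\<alpha>\<in>in_arcs Q i. z \<alpha>)" by (auto simp: incoming_image_def)
  then have "\<forall>\<alpha>. \<exists>y. \<alpha> \<in> in_arcs Q i \<longrightarrow> y \<in> carrier (Rep X (tail Q \<alpha>)) \<and> z \<alpha> = arrow_el \<alpha> \<odot>\<^bsub>X\<^esub> y"
    by (auto simp: rep_map_eq image_iff)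
  then obtain y where y: "\<And>\<alpha>. \<alpha> \<in> in_arcs Q i \<Longrightarrow> y \<alpha> \<in> carrier (Rep X (tail Q \<alpha>))"
    "\<And>\<alpha>. \<alpha> \<in> in_arcs Q i \<Longrightarrow> z \<alpha> = arrow_el \<alpha> \<odot>\<^bsub>X\<^esub> y \<alpha>" by metis
  have t: "(\<lambda>\<alpha>. arrow_el \<alpha> \<odot>\<^bsub>X\<^esub> y \<alpha>) \<in> in_arcs Q i \<rightarrow> carrier (Rep X i)"
    by (rule arrow_sum_terms(1)) (rule rep_carrier[OF y(1)])
  have "z \<in> in_arcs Q i \<rightarrow> carrier (Rep X i)" using t y(2) by auto
  then have "x = (\<Oplus>\<^bsub>X\<^esub>\<alpha>\<in>in_arcs Q i. z \<alpha>)" using z(2) finsum_rep[OF i] by simp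
  also have "\<dots> = (\<Oplus>\<^bsub>X\<^esub>\<alpha>\<in>in_arcs Q i. arrow_el \<alpha> \<odot>\<^bsub>X\<^esub> y \<alpha>)"
    by (rule X.M.finsum_cong') (use y(2) rep_carrier[OF y(1)] in auto)
  finally show "\<exists>y. (\<forall>\<alpha>\<in>in_arcs Q i. y \<alpha> \<in> carrier (Rep X (tail Q \<alpha>))) \<and>
    x = (\<Oplus>\<^bsub>X\<^esub>\<alpha>\<in>in_arcs Q i. arrow_el \<alpha> \<odot>\<^bsub>X\<^esub> y \<alpha>)" using y(1) by blast
next
  assume "\<exists>y. (\<forall>\<alpha>\<in>in_arcs Q i. y \<alpha> \<in> carrier (Rep X (tail Q \<alpha>))) \<and>
    x = (\<Oplus>\<^bsub>X\<^esub>\<alpha>\<in>in_arcs Q i. arrow_el \<alpha> \<odot>\<^bsub>X\<^esub> y \<alpha>)"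
  then obtain y where y: "\<forall>\<alpha>\<in>in_arcs Q i. y \<alpha> \<in> carrier (Rep X (tail Q \<alpha>))"
    "x = (\<Oplus>\<^bsub>X\<^esub>\<alpha>\<in>in_arcs Q i. arrow_el \<alpha> \<odot>\<^bsub>X\<^esub> y \<alpha>)" by blast
  have "(\<lambda>\<alpha>. arrow_el \<alpha> \<odot>\<^bsub>X\<^esub> y \<alpha>) \<in> in_arcs Q i \<rightarrow> carrier (Rep X i)"
    by (rule arrow_sum_terms(1)) (rule rep_carrier[OF bspec[OF y(1)]])
  then have "x = (\<Oplus>\<^bsub>Rep X i\<^esub>\<alpha>\<in>in_arcs Q i. arrow_el \<alpha> \<odot>\<^bsub>X\<^esub> y \<alpha>)"
    unfolding y(2) by (rule finsum_rep[OF i, symmetric])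
  moreover have "\<forall>\<alpha>\<in>in_arcs Q i. arrow_el \<alpha> \<odot>\<^bsub>X\<^esub> y \<alpha> \<in> rep_map K A Q X \<alpha> ` carrier (Rep X (tail Q \<alpha>))"
    using y(1) by (auto simp: rep_map_eq)
  ultimately show "x \<in> Incoming X i"
    unfolding incoming_image_def by (intro CollectI exI[of _ "\<lambda>\<alpha>. arrow_el \<alpha> \<odot>\<^bsub>X\<^esub> y \<alpha>"]) blast
qed

lemma arrow_sum_add:
  assumes "\<And>\<alpha>. \<alpha> \<in> in_arcs Q i \<Longrightarrow> y \<alpha> \<in> carrier X" "\<And>\<alpha>. \<alpha> \<in> in_arcs Q i \<Longrightarrow> z \<alpha> \<in> carrier X"
  shows "(\<Oplus>\<^bsub>X\<^esub>\<alpha>\<in>in_arcs Q i. arrow_el \<alpha> \<odot>\<^bsub>X\<^esub> (y \<alpha> \<oplus>\<^bsub>X\<^esub> z \<alpha>)) =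
    (\<Oplus>\<^bsub>X\<^esub>\<alpha>\<in>in_arcs Q i. arrow_el \<alpha> \<odot>\<^bsub>X\<^esub> y \<alpha>) \<oplus>\<^bsub>X\<^esub> (\<Oplus>\<^bsub>X\<^esub>\<alpha>\<in>in_arcs Q i. arrow_el \<alpha> \<odot>\<^bsub>X\<^esub> z \<alpha>)"
proof -
  have "(\<Oplus>\<^bsub>X\<^esub>\<alpha>\<in>in_arcs Q i. arrow_el \<alpha> \<odot>\<^bsub>X\<^esub> (y \<alpha> \<oplus>\<^bsub>X\<^esub> z \<alpha>)) =
      (\<Oplus>\<^bsub>X\<^esub>\<alpha>\<in>in_arcs Q i. arrow_el \<alpha> \<odot>\<^bsub>X\<^esub> y \<alpha> \<oplus>\<^bsub>X\<^esub> arrow_el \<alpha> \<odot>\<^bsub>X\<^esub> z \<alpha>)"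
    by (rule X.M.finsum_cong') (use assms in \<open>auto simp: X.smult_r_distr\<close>)
  also have "\<dots> = (\<Oplus>\<^bsub>X\<^esub>\<alpha>\<in>in_arcs Q i. arrow_el \<alpha> \<odot>\<^bsub>X\<^esub> y \<alpha>) \<oplus>\<^bsub>X\<^esub>
      (\<Oplus>\<^bsub>X\<^esub>\<alpha>\<in>in_arcs Q i. arrow_el \<alpha> \<odot>\<^bsub>X\<^esub> z \<alpha>)"
    by (rule X.M.finsum_addf) (use assms in auto)
  finally show ?thesis .
qed

lemma arrow_sum_scal:
  assumes "\<And>\<alpha>. \<alpha> \<in> in_arcs Q i \<Longrightarrow> y \<alpha> \<in> carrier X" "a \<in> carrier A"
  shows "scal_el a \<odot>\<^bsub>X\<^esub> (\<Oplus>\<^bsub>X\<^esub>\<alpha>\<in>in_arcs Q i. arrow_el \<alpha> \<odot>\<^bsub>X\<^esub> y \<alpha>) =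
    (\<Oplus>\<^bsub>X\<^esub>\<alpha>\<in>in_arcs Q i. arrow_el \<alpha> \<odot>\<^bsub>X\<^esub> (scal_el a \<odot>\<^bsub>X\<^esub> y \<alpha>))"
proof -
  have "scal_el a \<odot>\<^bsub>X\<^esub> (\<Oplus>\<^bsub>X\<^esub>\<alpha>\<in>in_arcs Q i. arrow_el \<alpha> \<odot>\<^bsub>X\<^esub> y \<alpha>) =
      (\<Oplus>\<^bsub>X\<^esub>\<alpha>\<in>in_arcs Q i. scal_el a \<odot>\<^bsub>X\<^esub> (arrow_el \<alpha> \<odot>\<^bsub>X\<^esub> y \<alpha>))"
    by (rule X.smult_finsum_right[OF finite_in_arcs]) (use assms in auto)
  also have "\<dots> = (\<Oplus>\<^bsub>X\<^esub>\<alpha>\<in>in_arcs Q i. arrow_el \<alpha> \<odot>\<^bsub>X\<^esub> (scal_el a \<odot>\<^bsub>X\<^esub> y \<alpha>))"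
    by (rule X.M.finsum_cong') (use assms in \<open>auto simp: scal_path\<close>)
  finally show ?thesis .
qed

lemma arrow_sum_zero: "(\<Oplus>\<^bsub>X\<^esub>\<alpha>\<in>in_arcs Q i. arrow_el \<alpha> \<odot>\<^bsub>X\<^esub> \<zero>\<^bsub>X\<^esub>) = \<zero>\<^bsub>X\<^esub>"
  by simp

lemma IncomingE:
  assumes "i \<in> verts Q" "x \<in> Incoming X i"
  obtains y where "\<And>\<alpha>. \<alpha> \<in> in_arcs Q i \<Longrightarrow> y \<alpha> \<in> carrier (Rep X (tail Q \<alpha>))"
    "x = (\<Oplus>\<^bsub>X\<^esub>\<alpha>\<in>in_arcs Q i. arrow_el \<alpha> \<odot>\<^bsub>X\<^esub> y \<alpha>)"
  using assms(2) unfolding Incoming_iff[OF assms(1)] by blast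

lemma IncomingI:
  assumes "i \<in> verts Q" "\<And>\<alpha>. \<alpha> \<in> in_arcs Q i \<Longrightarrow> y \<alpha> \<in> carrier (Rep X (tail Q \<alpha>))"
  shows "(\<Oplus>\<^bsub>X\<^esub>\<alpha>\<in>in_arcs Q i. arrow_el \<alpha> \<odot>\<^bsub>X\<^esub> y \<alpha>) \<in> Incoming X i"
  unfolding Incoming_iff[OF assms(1)] by (intro exI[of _ y] conjI ballI assms(2) refl)

lemma Incoming_submodule:
  assumes i: "i \<in> verts Q"
  shows "left_submodule A (Rep X i) (Incoming X i)"
proof -
  note rc = rep_carrier
  have sub: "x \<in> carrier (Rep X i)" if x: "x \<in> Incoming X i" for x
  proof -
    obtain y where y: "\<And>\<alpha>. \<alpha> \<in> in_arcs Q i \<Longrightarrow> y \<alpha> \<in> carrier (Rep X (tail Q \<alpha>))"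
      "x = (\<Oplus>\<^bsub>X\<^esub>\<alpha>\<in>in_arcs Q i. arrow_el \<alpha> \<odot>\<^bsub>X\<^esub> y \<alpha>)" by (rule IncomingE[OF i x]) blast
    have t: "(\<lambda>\<alpha>. arrow_el \<alpha> \<odot>\<^bsub>X\<^esub> y \<alpha>) \<in> in_arcs Q i \<rightarrow> carrier (Rep X i)"
      by (rule arrow_sum_terms(1)[OF rc[OF y(1)]])
    interpret V: left_module A "Rep X i" by (rule left_module_rep[OF i])
    show ?thesis unfolding y(2) finsum_rep[OF i t, symmetric] by (rule V.M.finsum_closed[OF t])
  qed
  have "(\<Oplus>\<^bsub>X\<^esub>\<alpha>\<in>in_arcs Q i. arrow_el \<alpha> \<odot>\<^bsub>X\<^esub> \<zero>\<^bsub>X\<^esub>) \<in> Incoming X i"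
    by (rule IncomingI[OF i rep_zero[OF in_arcsD(3)]])
  then have zero: "\<zero>\<^bsub>X\<^esub> \<in> Incoming X i" by (simp only: arrow_sum_zero)
  have add: "x \<oplus>\<^bsub>X\<^esub> x' \<in> Incoming X i" if x: "x \<in> Incoming X i" and x': "x' \<in> Incoming X i" for x x'
  proof -
    obtain y where y: "\<And>\<alpha>. \<alpha> \<in> in_arcs Q i \<Longrightarrow> y \<alpha> \<in> carrier (Rep X (tail Q \<alpha>))"
      "x = (\<Oplus>\<^bsub>X\<^esub>\<alpha>\<in>in_arcs Q i. arrow_el \<alpha> \<odot>\<^bsub>X\<^esub> y \<alpha>)" by (rule IncomingE[OF i x]) blast
    obtain y' where y': "\<And>\<alpha>. \<alpha> \<in> in_arcs Q i \<Longrightarrow> y' \<alpha> \<in> carrier (Rep X (tail Q \<alpha>))"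
      "x' = (\<Oplus>\<^bsub>X\<^esub>\<alpha>\<in>in_arcs Q i. arrow_el \<alpha> \<odot>\<^bsub>X\<^esub> y' \<alpha>)" by (rule IncomingE[OF i x']) blast
    have "x \<oplus>\<^bsub>X\<^esub> x' = (\<Oplus>\<^bsub>X\<^esub>\<alpha>\<in>in_arcs Q i. arrow_el \<alpha> \<odot>\<^bsub>X\<^esub> (y \<alpha> \<oplus>\<^bsub>X\<^esub> y' \<alpha>))"
      unfolding y(2) y'(2) by (rule arrow_sum_add[OF rc[OF y(1)] rc[OF y'(1)], symmetric])
    then show ?thesis using IncomingI[OF i, of "\<lambda>\<alpha>. y \<alpha> \<oplus>\<^bsub>X\<^esub> y' \<alpha>"] rep_add[OF y(1) y'(1)] by simp
  qed
  have scal: "scal_el a \<odot>\<^bsub>X\<^esub> x \<in> Incoming X i" if a: "a \<in> carrier A" and x: "x \<in> Incoming X i" for a x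
  proof -
    obtain y where y: "\<And>\<alpha>. \<alpha> \<in> in_arcs Q i \<Longrightarrow> y \<alpha> \<in> carrier (Rep X (tail Q \<alpha>))"
      "x = (\<Oplus>\<^bsub>X\<^esub>\<alpha>\<in>in_arcs Q i. arrow_el \<alpha> \<odot>\<^bsub>X\<^esub> y \<alpha>)" by (rule IncomingE[OF i x]) blast
    have "scal_el a \<odot>\<^bsub>X\<^esub> x = (\<Oplus>\<^bsub>X\<^esub>\<alpha>\<in>in_arcs Q i. arrow_el \<alpha> \<odot>\<^bsub>X\<^esub> (scal_el a \<odot>\<^bsub>X\<^esub> y \<alpha>))"
      unfolding y(2) by (rule arrow_sum_scal[OF rc[OF y(1)] a])
    then show ?thesis using IncomingI[OF i, of "\<lambda>\<alpha>. scal_el a \<odot>\<^bsub>X\<^esub> y \<alpha>"] rep_scal[OF a y(1)] by simp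
  qed
  show ?thesis
    unfolding left_submodule_def rep_space_simps(2-4)
    by (intro conjI subsetI ballI sub zero add scal)
qed

lemma Incoming_arrow:
  assumes \<alpha>: "\<alpha> \<in> arcs Q" and y: "y \<in> carrier X"
  shows "arrow_el \<alpha> \<odot>\<^bsub>X\<^esub> y \<in> Incoming X (head Q \<alpha>)"
proof -
  \<comment> \<open>A family concentrated at \<alpha>. Projecting to the tail of \<alpha> does not
    change the product with the arrow.\<close>
  let ?y = "\<lambda>\<beta>. if \<beta> = \<alpha> then vert_el (tail Q \<alpha>) \<odot>\<^bsub>X\<^esub> y else \<zero>\<^bsub>X\<^esub>"
  have i: "head Q \<alpha> \<in> verts Q" using \<alpha> by simp
  have y': "vert_el (tail Q \<alpha>) \<odot>\<^bsub>X\<^esub> y \<in> carrier X" using y by simp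
  have "(\<Oplus>\<^bsub>X\<^esub>\<beta>\<in>in_arcs Q (head Q \<alpha>). arrow_el \<beta> \<odot>\<^bsub>X\<^esub> ?y \<beta>) = arrow_el \<alpha> \<odot>\<^bsub>X\<^esub> ?y \<alpha>"
    by (rule X.M.finsum_delta[OF finite_in_arcs]) (use \<alpha> y' in auto)
  then have "arrow_el \<alpha> \<odot>\<^bsub>X\<^esub> y = (\<Oplus>\<^bsub>X\<^esub>\<beta>\<in>in_arcs Q (head Q \<alpha>). arrow_el \<beta> \<odot>\<^bsub>X\<^esub> ?y \<beta>)"
    using arrow_tail[OF \<alpha> y] by simp
  moreover have "\<forall>\<beta>\<in>in_arcs Q (head Q \<alpha>). ?y \<beta> \<in> carrier (Rep X (tail Q \<beta>))"
    using rep_memI[OF y] rep_zero in_arcsD(3) by simp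
  ultimately show ?thesis using IncomingI[OF i, of ?y] by simp
qed

text \<open>Monicity in working form: the families are arbitrary functions compared on the incoming
  arrows, and the sums are taken in \<open>X\<close>.\<close>

lemma monic_rep_iff:
  "monic_rep Q (rep_space K A Q X) (rep_map K A Q X) \<longleftrightarrow>
    (\<forall>i\<in>verts Q. \<forall>y z. (\<forall>\<alpha>\<in>in_arcs Q i. y \<alpha> \<in> carrier (Rep X (tail Q \<alpha>))) \<longrightarrow>
      (\<forall>\<alpha>\<in>in_arcs Q i. z \<alpha> \<in> carrier (Rep X (tail Q \<alpha>))) \<longrightarrow>
      (\<Oplus>\<^bsub>X\<^esub>\<alpha>\<in>in_arcs Q i. arrow_el \<alpha> \<odot>\<^bsub>X\<^esub> y \<alpha>) = (\<Oplus>\<^bsub>X\<^esub>\<alpha>\<in>in_arcs Q i. arrow_el \<alpha> \<odot>\<^bsub>X\<^esub> z \<alpha>) \<longrightarrow>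
      (\<forall>\<alpha>\<in>in_arcs Q i. y \<alpha> = z \<alpha>))"
  (is "?l \<longleftrightarrow> (\<forall>i\<in>verts Q. ?r i)")
proof -
  have "inj_on (\<lambda>x. \<Oplus>\<^bsub>Rep X i\<^esub>\<alpha>\<in>in_arcs Q i. rep_map K A Q X \<alpha> (x \<alpha>))
       (\<Pi>\<^sub>E \<alpha>\<in>in_arcs Q i. carrier (Rep X (tail Q \<alpha>))) \<longleftrightarrow> ?r i" (is "inj_on ?f ?P \<longleftrightarrow> _") if i: "i \<in> verts Q" for i
  proof -
    have f: "?f x = (\<Oplus>\<^bsub>X\<^esub>\<alpha>\<in>in_arcs Q i. arrow_el \<alpha> \<odot>\<^bsub>X\<^esub> x \<alpha>)"
      if "\<And>\<alpha>. \<alpha> \<in> in_arcs Q i \<Longrightarrow> x \<alpha> \<in> carrier (Rep X (tail Q \<alpha>))" for x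
      unfolding rep_map_eq by (rule finsum_rep[OF i arrow_sum_terms(1)]) (rule rep_carrier[OF that])
    have fr: "?f (restrict y (in_arcs Q i)) = (\<Oplus>\<^bsub>X\<^esub>\<alpha>\<in>in_arcs Q i. arrow_el \<alpha> \<odot>\<^bsub>X\<^esub> y \<alpha>)"
      if y: "\<forall>\<alpha>\<in>in_arcs Q i. y \<alpha> \<in> carrier (Rep X (tail Q \<alpha>))" for y
    proof -
      have "?f (restrict y (in_arcs Q i)) = (\<Oplus>\<^bsub>X\<^esub>\<alpha>\<in>in_arcs Q i. arrow_el \<alpha> \<odot>\<^bsub>X\<^esub> restrict y (in_arcs Q i) \<alpha>)"
        by (rule f) (use y in simp)
      also have "\<dots> = (\<Oplus>\<^bsub>X\<^esub>\<alpha>\<in>in_arcs Q i. arrow_el \<alpha> \<odot>\<^bsub>X\<^esub> y \<alpha>)"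
        by (rule X.M.finsum_cong') (use y rep_carrier in auto)
      finally show ?thesis .
    qed
    show ?thesis
    proof (intro iffI allI impI ballI)
      fix y z \<alpha> assume inj: "inj_on ?f ?P" and y: "\<forall>\<alpha>\<in>in_arcs Q i. y \<alpha> \<in> carrier (Rep X (tail Q \<alpha>))"
        and z: "\<forall>\<alpha>\<in>in_arcs Q i. z \<alpha> \<in> carrier (Rep X (tail Q \<alpha>))"
        and eq: "(\<Oplus>\<^bsub>X\<^esub>\<alpha>\<in>in_arcs Q i. arrow_el \<alpha> \<odot>\<^bsub>X\<^esub> y \<alpha>) = (\<Oplus>\<^bsub>X\<^esub>\<alpha>\<in>in_arcs Q i. arrow_el \<alpha> \<odot>\<^bsub>X\<^esub> z \<alpha>)"
        and \<alpha>: "\<alpha> \<in> in_arcs Q i"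
      let ?y = "\<lambda>\<alpha>\<in>in_arcs Q i. y \<alpha>" and ?z = "\<lambda>\<alpha>\<in>in_arcs Q i. z \<alpha>"
      have "?f ?y = ?f ?z" unfolding fr[OF y] fr[OF z] by (rule eq)
      then have "?y = ?z" by (rule inj_onD[OF inj]) (use y z in auto)
      then have "?y \<alpha> = ?z \<alpha>" by (rule fun_cong)
      then show "y \<alpha> = z \<alpha>" using \<alpha> by simp
    next
      assume r: "?r i"
      show "inj_on ?f ?P"
      proof (rule inj_onI)
        fix x y assume xy: "x \<in> ?P" "y \<in> ?P" "?f x = ?f y"
        have x: "\<forall>\<alpha>\<in>in_arcs Q i. x \<alpha> \<in> carrier (Rep X (tail Q \<alpha>))" using xy(1) by (auto simp: PiE_def Pi_def)
        have y: "\<forall>\<alpha>\<in>in_arcs Q i. y \<alpha> \<in> carrier (Rep X (tail Q \<alpha>))" using xy(2) by (auto simp: PiE_def Pi_def)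
        have eq: "(\<Oplus>\<^bsub>X\<^esub>\<alpha>\<in>in_arcs Q i. arrow_el \<alpha> \<odot>\<^bsub>X\<^esub> x \<alpha>) = (\<Oplus>\<^bsub>X\<^esub>\<alpha>\<in>in_arcs Q i. arrow_el \<alpha> \<odot>\<^bsub>X\<^esub> y \<alpha>)"
          using xy(3) f[OF bspec[OF x]] f[OF bspec[OF y]] by simp
        have "x \<alpha> = y \<alpha>" if "\<alpha> \<in> in_arcs Q i" for \<alpha>
          using r x y eq that by blast
        then show "x = y" by (rule PiE_ext[OF xy(1,2)])
      qed
    qed
  qed
  then show ?thesis unfolding monic_rep_def by blast
qed

end

text \<open>The length of a longest path ending at \<open>j\<close>, which exists because an acyclic
  finite quiver has only finitely many paths. Arrows strictly increase it, so it orders the vertices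
  for both inductions.\<close>

definition vert_rank :: "'d \<Rightarrow> nat" where
  "vert_rank j = Max ((\<lambda>r. length (fst (snd r))) ` {r \<in> paths Q. path_end r = j})"

lemma vert_rank_less:
  assumes \<alpha>: "\<alpha> \<in> arcs Q" shows "vert_rank (tail Q \<alpha>) < vert_rank (head Q \<alpha>)"
proof -
  let ?P = "\<lambda>j. {r \<in> paths Q. path_end r = j}"
  let ?len = "\<lambda>r :: 'd \<times> 'e list \<times> 'd. length (fst (snd r))"
  have fin: "finite (?len ` ?P j)" for j using finite_paths by simp
  \<comment> \<open>The trivial path makes the set nonempty, so that its maximum is
    attained.\<close>
  have "trivial_path (tail Q \<alpha>) \<in> ?P (tail Q \<alpha>)" using \<alpha> by simp
  then have "vert_rank (tail Q \<alpha>) \<in> ?len ` ?P (tail Q \<alpha>)"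
    unfolding vert_rank_def by (intro Max_in fin) blast
  then obtain r where r: "r \<in> ?P (tail Q \<alpha>)" "?len r = vert_rank (tail Q \<alpha>)" by auto
  then have "path_snoc Q r \<alpha> \<in> ?P (head Q \<alpha>)" using path_snoc_in_paths[OF _ \<alpha>] by simp
  then have "?len (path_snoc Q r \<alpha>) \<le> vert_rank (head Q \<alpha>)"
    unfolding vert_rank_def by (intro Max_ge fin) blast
  moreover have "?len (path_snoc Q r \<alpha>) = Suc (?len r)" by (simp add: path_snoc_def)
  ultimately show ?thesis using r(2) by simp
qed

end

section \<open>Homomorphisms from induced modules\<close>

context quiver_algebra
begin

text \<open>The element \<open>p \<otimes> x\<close>.\<close>

definition ind_single where
  "ind_single T M p x = (\<lambda>r\<in>paths_from Q T. if r = p then x else \<zero>\<^bsub>M\<^esub>)"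

text \<open>A one-sided inverse of left multiplication by \<alpha>: the last arrow is cut off, and
  paths with a different last arrow are discarded. It is compatible with scalars of \<open>A\<close>
  but not with all of \<open>L\<close>.\<close>

definition ind_strip where
  "ind_strip T M \<alpha> c = (\<lambda>r\<in>paths_from Q T. if path_end r = tail Q \<alpha> then c (path_snoc Q r \<alpha>) else \<zero>\<^bsub>M\<^esub>)"

definition ind_map where
  "ind_map T f c = (\<lambda>r\<in>paths_from Q T. f (c r))"

text \<open>The \<open>L\<close>-linear map \<open>p \<otimes> x \<mapsto> p \<gamma>(x)\<close>
  adjoint to \<gamma>: induction from the vertex i is left adjoint to the functor taking
  \<open>X\<close> to \<open>X_i\<close>.\<close>

definition ind_hom where
  "ind_hom X i \<gamma> c = (\<Oplus>\<^bsub>X\<^esub>p\<in>paths_from Q {i}. path_el p \<odot>\<^bsub>X\<^esub> \<gamma> (c p))"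

lemma trivial_in_paths_from: "i \<in> verts Q \<Longrightarrow> trivial_path i \<in> paths_from Q {i}"
  by (simp add: paths_from_def)

section \<open>Cutting off last arrows in an induced module\<close>

context
  fixes M :: "('c, 'm) module" and T :: "'d set"
  assumes M: "left_module A M"
begin

interpretation M: left_module A M by (rule M)
interpretation I: left_module L "Ind T M" by (rule left_module_induced[OF M])

lemma ind_single_closed: "x \<in> carrier M \<Longrightarrow> ind_single T M p x \<in> carrier (Ind T M)"
  unfolding ind_single_def by (rule induced_memI) simp

lemma ind_strip_closed:
  assumes "c \<in> carrier (Ind T M)" "\<alpha> \<in> arcs Q" shows "ind_strip T M \<alpha> c \<in> carrier (Ind T M)"
  unfolding ind_strip_def
  by (rule induced_memI) (use assms path_snoc_in_paths_from[of _ T \<alpha>] in simp)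

lemma ind_strip_add:
  assumes "c \<in> carrier (Ind T M)" "c' \<in> carrier (Ind T M)" "\<alpha> \<in> arcs Q"
  shows "ind_strip T M \<alpha> (c \<oplus>\<^bsub>Ind T M\<^esub> c') = ind_strip T M \<alpha> c \<oplus>\<^bsub>Ind T M\<^esub> ind_strip T M \<alpha> c'"
proof (rule induced_eqI[of _ T M])
  fix r assume r: "r \<in> paths_from Q T"
  show "ind_strip T M \<alpha> (c \<oplus>\<^bsub>Ind T M\<^esub> c') r = (ind_strip T M \<alpha> c \<oplus>\<^bsub>Ind T M\<^esub> ind_strip T M \<alpha> c') r"
    using r path_snoc_in_paths_from[OF r assms(3)] by (simp add: ind_strip_def induced_apply(2))
qed (intro I.M.add.m_closed ind_strip_closed assms)+

lemma ind_strip_scal: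
  assumes "c \<in> carrier (Ind T M)" "a \<in> carrier A" "\<alpha> \<in> arcs Q"
  shows "ind_strip T M \<alpha> (scal_el a \<odot>\<^bsub>Ind T M\<^esub> c) = scal_el a \<odot>\<^bsub>Ind T M\<^esub> ind_strip T M \<alpha> c"
proof (rule induced_eqI[of _ T M])
  fix r assume r: "r \<in> paths_from Q T"
  show "ind_strip T M \<alpha> (scal_el a \<odot>\<^bsub>Ind T M\<^esub> c) r = (scal_el a \<odot>\<^bsub>Ind T M\<^esub> ind_strip T M \<alpha> c) r"
    unfolding induced_scal[OF M assms(2) ind_strip_closed[OF assms(1,3)] r]
    using r path_snoc_in_paths_from[OF r assms(3)] assms
    by (simp add: ind_strip_def induced_scal[OF M])
qed (intro I.smult_closed scal_el_closed ind_strip_closed assms)+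

text \<open>A path has at most one last arrow. For coefficients in \<open>A\<close> this is the
  prototype of the retractions on projective modules.\<close>

lemma ind_strip_arrow:
  assumes c: "c \<in> carrier (Ind T M)" and \<alpha>: "\<alpha> \<in> arcs Q" and \<beta>: "\<beta> \<in> arcs Q"
  shows "ind_strip T M \<beta> (arrow_el \<alpha> \<odot>\<^bsub>Ind T M\<^esub> c) =
    (if \<beta> = \<alpha> then vert_el (tail Q \<alpha>) \<odot>\<^bsub>Ind T M\<^esub> c else \<zero>\<^bsub>Ind T M\<^esub>)"
proof (rule induced_eqI[of _ T M])
  have ac: "arrow_el \<alpha> \<odot>\<^bsub>Ind T M\<^esub> c \<in> carrier (Ind T M)" using c by simp
  show "ind_strip T M \<beta> (arrow_el \<alpha> \<odot>\<^bsub>Ind T M\<^esub> c) \<in> carrier (Ind T M)" by (rule ind_strip_closed[OF ac \<beta>])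
  show "(if \<beta> = \<alpha> then vert_el (tail Q \<alpha>) \<odot>\<^bsub>Ind T M\<^esub> c else \<zero>\<^bsub>Ind T M\<^esub>) \<in> carrier (Ind T M)"
    using c by simp
  fix r assume r: "r \<in> paths_from Q T"
  show "ind_strip T M \<beta> (arrow_el \<alpha> \<odot>\<^bsub>Ind T M\<^esub> c) r =
      (if \<beta> = \<alpha> then vert_el (tail Q \<alpha>) \<odot>\<^bsub>Ind T M\<^esub> c else \<zero>\<^bsub>Ind T M\<^esub>) r"
  proof (cases "\<beta> = \<alpha>")
    case True
    then show ?thesis using r induced_arrow(1)[OF M c \<alpha> r] induced_vert[OF M c r]
      by (simp add: ind_strip_def)
  next
    case False
    have "(arrow_el \<alpha> \<odot>\<^bsub>Ind T M\<^esub> c) (path_snoc Q r \<beta>) = \<zero>\<^bsub>M\<^esub>" if "path_end r = tail Q \<beta>"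
    proof (rule induced_arrow(2)[OF M c \<alpha> path_snoc_in_paths_from[OF r \<beta> that]])
      fix p :: "'d \<times> 'e list \<times> 'd" assume "path_end p = tail Q \<alpha>"
      then show "path_snoc Q r \<beta> \<noteq> path_snoc Q p \<alpha>" using path_snoc_inj(1)[of r \<beta> p \<alpha>] that False by blast
    qed
    then show ?thesis using r False by (simp add: ind_strip_def induced_apply(1))
  qed
qed

lemma finsum_induced_apply:
  assumes "finite S" "g \<in> S \<rightarrow> carrier (Ind T M)" "r \<in> paths_from Q T"
  shows "(\<Oplus>\<^bsub>Ind T M\<^esub>s\<in>S. g s) r = (\<Oplus>\<^bsub>M\<^esub>s\<in>S. g s r)"
  using assms(1,2)
proof (induction S)
  case (insert s S)
  then have "(\<lambda>s. g s r) \<in> S \<rightarrow> carrier M" "g s r \<in> carrier M" "g \<in> S \<rightarrow> carrier (Ind T M)"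
    "g s \<in> carrier (Ind T M)"
    using assms(3) by (auto simp: Pi_def)
  with insert show ?case using assms(3) by (simp add: induced_apply(2))
qed (simp add: induced_apply(1) assms(3))

text \<open>A path ending at \<open>j\<close> is either trivial or has a unique last arrow, which is
  an arrow into \<open>j\<close>; the coefficients are sorted accordingly. The case distinction on
  \<open>T\<close> is needed because the trivial path at \<open>j\<close> is an index only if
  \<open>j\<close> belongs to \<open>T\<close>.\<close>

lemma ind_expansion:
  assumes c: "c \<in> carrier (Ind T M)" and j: "j \<in> verts Q"
  shows "vert_el j \<odot>\<^bsub>Ind T M\<^esub> c =
    ind_single T M (trivial_path j) (if j \<in> T then c (trivial_path j) else \<zero>\<^bsub>M\<^esub>) \<oplus>\<^bsub>Ind T M\<^esub>
    (\<Oplus>\<^bsub>Ind T M\<^esub>\<beta>\<in>in_arcs Q j. arrow_el \<beta> \<odot>\<^bsub>Ind T M\<^esub> ind_strip T M \<beta> c)"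
    (is "_ = ?s \<oplus>\<^bsub>_\<^esub> ?S")
proof (rule induced_eqI[of _ T M])
  have tj: "trivial_path j \<in> paths_from Q T \<longleftrightarrow> j \<in> T" using j by (simp add: paths_from_def)
  have g: "(\<lambda>\<beta>. arrow_el \<beta> \<odot>\<^bsub>Ind T M\<^esub> ind_strip T M \<beta> c) \<in> in_arcs Q j \<rightarrow> carrier (Ind T M)"
    by (intro Pi_I I.smult_closed path_el_closed ind_strip_closed[OF c] in_arcsD(1))
  have s: "?s \<in> carrier (Ind T M)" by (rule ind_single_closed) (use tj c in auto)
  show "vert_el j \<odot>\<^bsub>Ind T M\<^esub> c \<in> carrier (Ind T M)" using c by simp
  show "?s \<oplus>\<^bsub>Ind T M\<^esub> ?S \<in> carrier (Ind T M)"
    by (intro I.M.add.m_closed s I.M.finsum_closed g)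
  fix r assume r: "r \<in> paths_from Q T"
  have rp: "r \<in> paths Q" by (rule paths_from_subset(2)[OF r])
  have S: "?S r = (\<Oplus>\<^bsub>M\<^esub>\<beta>\<in>in_arcs Q j. (arrow_el \<beta> \<odot>\<^bsub>Ind T M\<^esub> ind_strip T M \<beta> c) r)"
    by (rule finsum_induced_apply[OF finite_in_arcs g r])
  have zero: "(arrow_el \<beta> \<odot>\<^bsub>Ind T M\<^esub> ind_strip T M \<beta> c) r = \<zero>\<^bsub>M\<^esub>"
    if "\<beta> \<in> in_arcs Q j" "\<And>p. path_end p = tail Q \<beta> \<Longrightarrow> r \<noteq> path_snoc Q p \<beta>" for \<beta>
    by (rule induced_arrow(2)[OF M ind_strip_closed[OF c in_arcsD(1)[OF that(1)]] in_arcsD(1)[OF that(1)] r])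
      (rule that(2))
  have Sz: "?S r = \<zero>\<^bsub>M\<^esub>"
    if "\<And>\<beta> p. \<beta> \<in> in_arcs Q j \<Longrightarrow> path_end p = tail Q \<beta> \<Longrightarrow> r \<noteq> path_snoc Q p \<beta>"
  proof -
    have "(\<Oplus>\<^bsub>M\<^esub>\<beta>\<in>in_arcs Q j. (arrow_el \<beta> \<odot>\<^bsub>Ind T M\<^esub> ind_strip T M \<beta> c) r) = (\<Oplus>\<^bsub>M\<^esub>\<beta>\<in>in_arcs Q j. \<zero>\<^bsub>M\<^esub>)"
      by (rule M.M.finsum_cong'[OF refl]) (use zero that in simp_all)
    then show ?thesis using S by simp
  qed
  have "(?s \<oplus>\<^bsub>Ind T M\<^esub> ?S) r = (if path_end r = j then c r else \<zero>\<^bsub>M\<^esub>)"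
    using rp
  proof (cases rule: path_cases)
    case (trivial i)
    have "?S r = \<zero>\<^bsub>M\<^esub>" by (rule Sz) (simp add: trivial)
    then show ?thesis using r trivial c tj by (auto simp: induced_apply(2) ind_single_def)
  next
    case (snoc p \<alpha>)
    have p: "p \<in> paths_from Q T" using r snoc by (simp add: paths_from_def)
    have s0: "?s r = \<zero>\<^bsub>M\<^esub>" using r snoc by (simp add: ind_single_def)
    show ?thesis
    proof (cases "head Q \<alpha> = j")
      case True
      then have \<alpha>: "\<alpha> \<in> in_arcs Q j" using snoc by simp
      have "?S r = (arrow_el \<alpha> \<odot>\<^bsub>Ind T M\<^esub> ind_strip T M \<alpha> c) r"
        unfolding S
      proof (rule M.M.finsum_delta[OF finite_in_arcs \<alpha>])
        show "(arrow_el \<alpha> \<odot>\<^bsub>Ind T M\<^esub> ind_strip T M \<alpha> c) r \<in> carrier M"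
          by (rule induced_closed[OF _ r]) (use g \<alpha> in blast)
        fix \<beta> assume \<beta>: "\<beta> \<in> in_arcs Q j" "\<beta> \<noteq> \<alpha>"
        show "(arrow_el \<beta> \<odot>\<^bsub>Ind T M\<^esub> ind_strip T M \<beta> c) r = \<zero>\<^bsub>M\<^esub>"
          by (rule zero[OF \<beta>(1)]) (use \<beta>(2) snoc path_snoc_inj(1) in metis)
      qed
      also have "\<dots> = ind_strip T M \<alpha> c p"
        unfolding snoc(4) by (rule induced_arrow(1)[OF M ind_strip_closed[OF c snoc(2)] snoc(2) p snoc(3)])
      also have "\<dots> = c r" using p snoc by (simp add: ind_strip_def)
      finally show ?thesis using s0 True snoc r c by (simp add: induced_apply(2))
    next
      case False
      have "?S r = \<zero>\<^bsub>M\<^esub>"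
      proof (rule Sz)
        fix \<beta> and q :: "'d \<times> 'e list \<times> 'd" assume \<beta>: "\<beta> \<in> in_arcs Q j" "path_end q = tail Q \<beta>"
        show "r \<noteq> path_snoc Q q \<beta>" using \<beta> snoc False path_snoc_inj(1)[of p \<alpha> q \<beta>] in_arcsD(2)[OF \<beta>(1)] by auto
      qed
      then show ?thesis using s0 r snoc False by (simp add: induced_apply(2))
    qed
  qed
  then show "(vert_el j \<odot>\<^bsub>Ind T M\<^esub> c) r = (?s \<oplus>\<^bsub>Ind T M\<^esub> ?S) r"
    by (simp add: induced_vert[OF M c r])
qed

end

text \<open>A factorization with the trivial path at i on the right is unique, so multiplying
  \<open>e_i \<otimes> x\<close> by \<open>l\<close> spreads the coefficients of \<open>l\<close>
  over \<open>x\<close>.\<close>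

lemma ind_smult_single:
  assumes M: "left_module A M" and x: "x \<in> carrier M" and l: "l \<in> carrier L"
    and r: "r \<in> paths_from Q {i}"
  shows "(l \<odot>\<^bsub>Ind {i} M\<^esub> ind_single {i} M (trivial_path i) x) r = l r \<odot>\<^bsub>M\<^esub> x"
proof -
  interpret M: left_module A M by (rule M)
  have rp: "r \<in> paths Q" "fst r = i" using r by (auto simp: paths_from_def)
  have i: "i \<in> verts Q" using path_ends_in_verts(1)[OF rp(1)] rp(2) by simp
  let ?z = "(r, trivial_path i :: 'd \<times> 'e list \<times> 'd)"
  let ?d = "ind_single {i} M (trivial_path i) x"
  have d: "?d \<in> carrier (Ind {i} M)" by (rule ind_single_closed[OF M x])
  have z: "?z \<in> factorizations Q r" using trivial_factorizations(2)[OF rp(1)] rp(2) by simp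
  have dt: "?d (trivial_path i) = x" using trivial_in_paths_from[OF i] by (simp add: ind_single_def)
  have "(l \<odot>\<^bsub>Ind {i} M\<^esub> ?d) r = l (fst ?z) \<odot>\<^bsub>M\<^esub> ?d (snd ?z)"
    unfolding induced_apply(3)[OF r]
  proof (rule M.M.finsum_delta[of _ _ "\<lambda>z. l (fst z) \<odot>\<^bsub>M\<^esub> ?d (snd z)", OF finite_factorizations z])
    show "l (fst ?z) \<odot>\<^bsub>M\<^esub> ?d (snd ?z) \<in> carrier M"
      using l rp x dt by simp
    fix z' assume z': "z' \<in> factorizations Q r" "z' \<noteq> ?z"
    note pf = factorizations_paths_from[OF z'(1) r]
    have "snd z' \<noteq> trivial_path i"
    proof
      assume "snd z' = trivial_path i"
      then have "fst z' = r"
        using factorizations_right_unit[of "fst z'" "snd z'" r] z'(1)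
        by (cases z') (simp add: trivial_path_def)
      then show False using z'(2) \<open>snd z' = trivial_path i\<close> by (metis prod.collapse)
    qed
    then show "l (fst z') \<odot>\<^bsub>M\<^esub> ?d (snd z') = \<zero>\<^bsub>M\<^esub>"
      using pf l by (simp add: ind_single_def)
  qed
  then show ?thesis using dt by simp
qed

lemma ind_sum_singles:
  assumes M: "left_module A M" and c: "c \<in> carrier (Ind {i} M)"
  shows "c = (\<Oplus>\<^bsub>Ind {i} M\<^esub>p\<in>paths_from Q {i}. path_el p \<odot>\<^bsub>Ind {i} M\<^esub> ind_single {i} M (trivial_path i) (c p))"
proof (rule induced_eqI[OF c])
  interpret M: left_module A M by (rule M)
  interpret I: left_module L "Ind {i} M" by (rule left_module_induced[OF M])
  have g: "(\<lambda>p. path_el p \<odot>\<^bsub>Ind {i} M\<^esub> ind_single {i} M (trivial_path i) (c p)) \<in> paths_from Q {i} \<rightarrow> carrier (Ind {i} M)"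
    using c by (intro Pi_I I.smult_closed path_el_closed ind_single_closed[OF M] induced_closed)
  then show "(\<Oplus>\<^bsub>Ind {i} M\<^esub>p\<in>paths_from Q {i}. path_el p \<odot>\<^bsub>Ind {i} M\<^esub> ind_single {i} M (trivial_path i) (c p))
      \<in> carrier (Ind {i} M)" by (rule I.M.finsum_closed)
  fix r assume r: "r \<in> paths_from Q {i}"
  have e: "(path_el p \<odot>\<^bsub>Ind {i} M\<^esub> ind_single {i} M (trivial_path i) (c p)) r = (if r = p then c p else \<zero>\<^bsub>M\<^esub>)"
    if "p \<in> paths_from Q {i}" for p
    using ind_smult_single[OF M induced_closed[OF c that] path_el_closed r] paths_from_subset(2)[OF r]
      induced_closed[OF c that] by (simp add: path_el_apply)
  have "(\<Oplus>\<^bsub>M\<^esub>p\<in>paths_from Q {i}. (path_el p \<odot>\<^bsub>Ind {i} M\<^esub> ind_single {i} M (trivial_path i) (c p)) r) =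
      (path_el r \<odot>\<^bsub>Ind {i} M\<^esub> ind_single {i} M (trivial_path i) (c r)) r"
    by (rule M.M.finsum_delta[OF finite_paths_from r]) (use e r c in \<open>auto simp del: split_paired_All\<close>)
  then show "c r = (\<Oplus>\<^bsub>Ind {i} M\<^esub>p\<in>paths_from Q {i}. path_el p \<odot>\<^bsub>Ind {i} M\<^esub> ind_single {i} M (trivial_path i) (c p)) r"
    using finsum_induced_apply[OF M finite_paths_from g r] e[OF r] by simp
qed

text \<open>Uniqueness in the adjunction: the elements \<open>e_i \<otimes> x\<close> generate the
  induced module, since \<open>p \<otimes> x\<close> is \<open>p\<close> times such an
  element.\<close>

lemma ind_hom_unique:
  assumes M: "left_module A M" and N: "left_module L N"
    and F: "F \<in> mod_hom L (Ind {i} M) N" and G: "G \<in> mod_hom L (Ind {i} M) N"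
    and eq: "\<And>x. x \<in> carrier M \<Longrightarrow>
      F (ind_single {i} M (trivial_path i) x) = G (ind_single {i} M (trivial_path i) x)"
    and c: "c \<in> carrier (Ind {i} M)"
  shows "F c = G c"
proof -
  interpret N: left_module L N by (rule N)
  note I = left_module_induced[OF M]
  have lc: "H c = (\<Oplus>\<^bsub>N\<^esub>p\<in>paths_from Q {i}. path_el p \<odot>\<^bsub>N\<^esub> H (ind_single {i} M (trivial_path i) (c p)))"
    if H: "H \<in> mod_hom L (Ind {i} M) N" for H
    by (subst ind_sum_singles[OF M c], rule mod_hom_lincomb[OF I N H finite_paths_from])
      (rule path_el_closed ind_single_closed[OF M] induced_closed[OF c], assumption?)+
  show ?thesis
    unfolding lc[OF F] lc[OF G]
  proof (rule N.M.finsum_cong'[OF refl])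
    show "(\<lambda>p. path_el p \<odot>\<^bsub>N\<^esub> G (ind_single {i} M (trivial_path i) (c p))) \<in> paths_from Q {i} \<rightarrow> carrier N"
      by (intro Pi_I N.smult_closed path_el_closed mod_homD(1)[OF G] ind_single_closed[OF M] induced_closed[OF c])
    fix p assume "p \<in> paths_from Q {i}"
    then show "path_el p \<odot>\<^bsub>N\<^esub> F (ind_single {i} M (trivial_path i) (c p)) =
        path_el p \<odot>\<^bsub>N\<^esub> G (ind_single {i} M (trivial_path i) (c p))"
      using eq[OF induced_closed[OF c]] by simp
  qed
qed

lemma ind_map_hom:
  assumes M: "left_module A M" and N: "left_module A N" and f: "f \<in> mod_hom A M N"
  shows "ind_map T f \<in> mod_hom L (Ind T M) (Ind T N)"
proof (rule mod_homI)
  interpret N: left_module A N by (rule N)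
  have cl: "ind_map T f c \<in> carrier (Ind T N)" if "c \<in> carrier (Ind T M)" for c
    unfolding ind_map_def by (rule induced_memI) (rule mod_homD(1)[OF f induced_closed[OF that]])
  then show "\<And>c. c \<in> carrier (Ind T M) \<Longrightarrow> ind_map T f c \<in> carrier (Ind T N)" .
  fix c assume c: "c \<in> carrier (Ind T M)"
  show "ind_map T f (c \<oplus>\<^bsub>Ind T M\<^esub> c') = ind_map T f c \<oplus>\<^bsub>Ind T N\<^esub> ind_map T f c'"
    if c': "c' \<in> carrier (Ind T M)" for c'
    using mod_homD(2)[OF f induced_closed[OF c] induced_closed[OF c']]
    by (intro induced_eqI[of _ T N] cl induced_add_closed[OF M] induced_add_closed[OF N] c c')
      (simp add: ind_map_def induced_apply(2))
  fix l assume l: "l \<in> carrier L"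
  show "ind_map T f (l \<odot>\<^bsub>Ind T M\<^esub> c) = l \<odot>\<^bsub>Ind T N\<^esub> ind_map T f c"
  proof (rule induced_eqI[of _ T N])
    fix r assume r: "r \<in> paths_from Q T"
    note pf = factorizations_paths_from[OF _ r]
    have "f (\<Oplus>\<^bsub>M\<^esub>z\<in>factorizations Q r. l (fst z) \<odot>\<^bsub>M\<^esub> c (snd z)) =
        (\<Oplus>\<^bsub>N\<^esub>z\<in>factorizations Q r. l (fst z) \<odot>\<^bsub>N\<^esub> f (c (snd z)))"
      by (rule mod_hom_lincomb[OF M N f finite_factorizations L_closed[OF l pf(1)] induced_closed[OF c pf(2)]])
    also have "\<dots> = (\<Oplus>\<^bsub>N\<^esub>z\<in>factorizations Q r. l (fst z) \<odot>\<^bsub>N\<^esub> ind_map T f c (snd z))"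
    proof (rule N.M.finsum_cong'[OF refl])
      show "(\<lambda>z. l (fst z) \<odot>\<^bsub>N\<^esub> ind_map T f c (snd z)) \<in> factorizations Q r \<rightarrow> carrier N"
        by (intro Pi_I induced_term_closed[OF N l cl[OF c] r])
    qed (use pf(2) in \<open>simp add: ind_map_def\<close>)
    finally show "ind_map T f (l \<odot>\<^bsub>Ind T M\<^esub> c) r = (l \<odot>\<^bsub>Ind T N\<^esub> ind_map T f c) r"
      using r by (simp add: ind_map_def induced_apply(3))
  qed (intro cl induced_smult_closed[OF M] induced_smult_closed[OF N] l c)+
qed

lemma ind_map_single:
  assumes "left_module A M" "left_module A N" "f \<in> mod_hom A M N"
  shows "ind_map T f (ind_single T M p x) = ind_single T N p (f x)"
  using mod_hom_zero[OF assms] by (auto simp: ind_map_def ind_single_def fun_eq_iff)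

text \<open>Existence in the adjunction. Linearity is checked on generators; only the arrows change
  the index of a coefficient and require a reindexing of the sum.\<close>

lemma ind_hom:
  assumes X: "left_module L X" and M: "left_module A M" and i: "i \<in> verts Q"
    and \<gamma>: "\<gamma> \<in> mod_hom A M (Rep X i)"
  shows "ind_hom X i \<gamma> \<in> mod_hom L (Ind {i} M) X"
    and "x \<in> carrier M \<Longrightarrow> ind_hom X i \<gamma> (ind_single {i} M (trivial_path i) x) = \<gamma> x"
proof -
  interpret X: left_module L X by (rule X)
  interpret M: left_module A M by (rule M)
  note I = left_module_induced[OF M]
  let ?P = "paths_from Q {i}" and ?G = "ind_hom X i \<gamma>"
  note \<gamma>R = mod_homD(1)[OF \<gamma>]
  have \<gamma>c: "\<gamma> x \<in> carrier X" if "x \<in> carrier M" for x using rep_carrier[OF X \<gamma>R[OF that]] .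
  have \<gamma>0: "\<gamma> \<zero>\<^bsub>M\<^esub> = \<zero>\<^bsub>X\<^esub>"
    using mod_hom_zero[OF M left_module_rep[OF X i] \<gamma>] by (simp add: rep_space_simps(2))
  have t: "(\<lambda>p. path_el p \<odot>\<^bsub>X\<^esub> \<gamma> (c p)) \<in> ?P \<rightarrow> carrier X" if "c \<in> carrier (Ind {i} M)" for c
    by (intro Pi_I X.smult_closed path_el_closed \<gamma>c induced_closed[OF that])
  show "?G \<in> mod_hom L (Ind {i} M) X"
  proof (rule L_homI[OF I X])
    show "?G c \<in> carrier X" if "c \<in> carrier (Ind {i} M)" for c
      unfolding ind_hom_def by (rule X.M.finsum_closed[OF t[OF that]])
    show "?G (c \<oplus>\<^bsub>Ind {i} M\<^esub> c') = ?G c \<oplus>\<^bsub>X\<^esub> ?G c'"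
      if c: "c \<in> carrier (Ind {i} M)" and c': "c' \<in> carrier (Ind {i} M)" for c c'
    proof -
      have "?G (c \<oplus>\<^bsub>Ind {i} M\<^esub> c') = (\<Oplus>\<^bsub>X\<^esub>p\<in>?P. path_el p \<odot>\<^bsub>X\<^esub> \<gamma> (c p) \<oplus>\<^bsub>X\<^esub> path_el p \<odot>\<^bsub>X\<^esub> \<gamma> (c' p))"
        unfolding ind_hom_def
      proof (rule X.M.finsum_cong'[OF refl])
        fix p assume p: "p \<in> ?P"
        show "path_el p \<odot>\<^bsub>X\<^esub> \<gamma> ((c \<oplus>\<^bsub>Ind {i} M\<^esub> c') p) = path_el p \<odot>\<^bsub>X\<^esub> \<gamma> (c p) \<oplus>\<^bsub>X\<^esub> path_el p \<odot>\<^bsub>X\<^esub> \<gamma> (c' p)"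
          using p c c' \<gamma>c mod_homD(2)[OF \<gamma> induced_closed[OF c p] induced_closed[OF c' p]]
          by (simp add: induced_apply(2) rep_space_simps(3) X.smult_r_distr)
      qed (use t[OF c] t[OF c'] in \<open>auto simp del: split_paired_All\<close>)
      also have "\<dots> = ?G c \<oplus>\<^bsub>X\<^esub> ?G c'"
        unfolding ind_hom_def by (rule X.M.finsum_addf[OF t[OF c] t[OF c']])
      finally show ?thesis .
    qed
    show "?G (scal_el a \<odot>\<^bsub>Ind {i} M\<^esub> c) = scal_el a \<odot>\<^bsub>X\<^esub> ?G c"
      if a: "a \<in> carrier A" and c: "c \<in> carrier (Ind {i} M)" for a c
      unfolding ind_hom_def X.smult_finsum_right[OF finite_paths_from t[OF c] scal_el_closed[OF a]]
    proof (rule X.M.finsum_cong'[OF refl])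
      show "(\<lambda>p. scal_el a \<odot>\<^bsub>X\<^esub> (path_el p \<odot>\<^bsub>X\<^esub> \<gamma> (c p))) \<in> ?P \<rightarrow> carrier X"
        using t[OF c] a by (auto simp del: split_paired_All)
      fix p assume p: "p \<in> ?P"
      show "path_el p \<odot>\<^bsub>X\<^esub> \<gamma> ((scal_el a \<odot>\<^bsub>Ind {i} M\<^esub> c) p) = scal_el a \<odot>\<^bsub>X\<^esub> (path_el p \<odot>\<^bsub>X\<^esub> \<gamma> (c p))"
        using \<gamma>c[OF induced_closed[OF c p]] a mod_homD(3)[OF \<gamma> a induced_closed[OF c p]]
        by (simp add: induced_scal[OF M a c p] rep_space_simps(4) scal_path[OF X])
    qed
    show "?G (vert_el j \<odot>\<^bsub>Ind {i} M\<^esub> c) = vert_el j \<odot>\<^bsub>X\<^esub> ?G c"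
      if j: "j \<in> verts Q" and c: "c \<in> carrier (Ind {i} M)" for j c
      unfolding ind_hom_def X.smult_finsum_right[OF finite_paths_from t[OF c] path_el_closed]
    proof (rule X.M.finsum_cong'[OF refl])
      show "(\<lambda>p. vert_el j \<odot>\<^bsub>X\<^esub> (path_el p \<odot>\<^bsub>X\<^esub> \<gamma> (c p))) \<in> ?P \<rightarrow> carrier X"
        using t[OF c] by (auto simp del: split_paired_All)
      fix p assume p: "p \<in> ?P"
      show "path_el p \<odot>\<^bsub>X\<^esub> \<gamma> ((vert_el j \<odot>\<^bsub>Ind {i} M\<^esub> c) p) = vert_el j \<odot>\<^bsub>X\<^esub> (path_el p \<odot>\<^bsub>X\<^esub> \<gamma> (c p))"
        using \<gamma>c[OF induced_closed[OF c p]] \<gamma>0 paths_from_subset(2)[OF p]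
        by (simp add: induced_vert[OF M c p] el_assoc[OF X] path_el_mult(1))
    qed
    show "?G (arrow_el \<alpha> \<odot>\<^bsub>Ind {i} M\<^esub> c) = arrow_el \<alpha> \<odot>\<^bsub>X\<^esub> ?G c"
      if \<alpha>: "\<alpha> \<in> arcs Q" and c: "c \<in> carrier (Ind {i} M)" for \<alpha> c
    proof -
      \<comment> \<open>The coefficients of \<alpha> times \<open>c\<close> are supported on the
        paths with last arrow \<alpha>; these correspond to the paths ending at the tail of
        \<alpha>, and on the remaining paths \<alpha> acts as zero.\<close>
      let ?S = "{p \<in> ?P. path_end p = tail Q \<alpha>}"
      have ac: "arrow_el \<alpha> \<odot>\<^bsub>Ind {i} M\<^esub> c \<in> carrier (Ind {i} M)" by (rule induced_smult_closed[OF M path_el_closed c])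
      have inj: "inj_on (\<lambda>p. path_snoc Q p \<alpha>) ?S"
        by (rule inj_onI) (use path_snoc_inj(2)[of _ \<alpha> _ \<alpha>] in simp)
      have sub: "(\<lambda>p. path_snoc Q p \<alpha>) ` ?S \<subseteq> ?P" using path_snoc_in_paths_from[OF _ \<alpha>] by blast
      have tS: "(\<lambda>p. path_el (path_snoc Q p \<alpha>) \<odot>\<^bsub>X\<^esub> \<gamma> (c p)) \<in> ?S \<rightarrow> carrier X"
        by (intro Pi_I X.smult_closed path_el_closed \<gamma>c induced_closed[OF c]) simp
      have "?G (arrow_el \<alpha> \<odot>\<^bsub>Ind {i} M\<^esub> c) =
          (\<Oplus>\<^bsub>X\<^esub>r\<in>(\<lambda>p. path_snoc Q p \<alpha>) ` ?S. path_el r \<odot>\<^bsub>X\<^esub> \<gamma> ((arrow_el \<alpha> \<odot>\<^bsub>Ind {i} M\<^esub> c) r))"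
        unfolding ind_hom_def
      proof (rule X.M.add.finprod_mono_neutral_cong_right[OF finite_paths_from sub _ refl t[OF ac]])
        fix r assume r: "r \<in> ?P - (\<lambda>p. path_snoc Q p \<alpha>) ` ?S"
        have "(arrow_el \<alpha> \<odot>\<^bsub>Ind {i} M\<^esub> c) r = \<zero>\<^bsub>M\<^esub>"
          by (rule induced_arrow(2)[OF M c \<alpha>]) (use r in blast)+
        then show "path_el r \<odot>\<^bsub>X\<^esub> \<gamma> ((arrow_el \<alpha> \<odot>\<^bsub>Ind {i} M\<^esub> c) r) = \<zero>\<^bsub>X\<^esub>" using \<gamma>0 by simp
      qed
      also have "\<dots> = (\<Oplus>\<^bsub>X\<^esub>p\<in>?S. path_el (path_snoc Q p \<alpha>) \<odot>\<^bsub>X\<^esub> \<gamma> ((arrow_el \<alpha> \<odot>\<^bsub>Ind {i} M\<^esub> c) (path_snoc Q p \<alpha>)))"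
        by (rule X.M.finsum_reindex[OF _ inj]) (use t[OF ac] sub in blast)
      also have "\<dots> = (\<Oplus>\<^bsub>X\<^esub>p\<in>?S. path_el (path_snoc Q p \<alpha>) \<odot>\<^bsub>X\<^esub> \<gamma> (c p))"
        by (rule X.M.finsum_cong'[OF refl tS]) (simp add: induced_arrow(1)[OF M c \<alpha>])
      also have "\<dots> = (\<Oplus>\<^bsub>X\<^esub>p\<in>?P. arrow_el \<alpha> \<odot>\<^bsub>X\<^esub> (path_el p \<odot>\<^bsub>X\<^esub> \<gamma> (c p)))"
      proof (rule X.M.add.finprod_mono_neutral_cong_left[OF finite_paths_from])
        show "(\<lambda>p. arrow_el \<alpha> \<odot>\<^bsub>X\<^esub> (path_el p \<odot>\<^bsub>X\<^esub> \<gamma> (c p))) \<in> ?P \<rightarrow> carrier X"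
          by (intro Pi_I X.smult_closed path_el_closed \<gamma>c induced_closed[OF c])
        fix p assume p: "p \<in> ?P - ?S"
        then have p': "p \<in> paths Q" "path_end p \<noteq> tail Q \<alpha>" using p paths_from_subset(2)[of p "{i}"] by auto
        show "arrow_el \<alpha> \<odot>\<^bsub>X\<^esub> (path_el p \<odot>\<^bsub>X\<^esub> \<gamma> (c p)) = \<zero>\<^bsub>X\<^esub>"
          using p' \<alpha> \<gamma>c[OF induced_closed[OF c]] p by (simp add: el_assoc[OF X] path_el_mult(2))
      next
        fix p assume p: "p \<in> ?S"
        then have p': "p \<in> paths Q" "path_end p = tail Q \<alpha>" using p paths_from_subset(2)[of p "{i}"] by auto
        show "path_el (path_snoc Q p \<alpha>) \<odot>\<^bsub>X\<^esub> \<gamma> (c p) = arrow_el \<alpha> \<odot>\<^bsub>X\<^esub> (path_el p \<odot>\<^bsub>X\<^esub> \<gamma> (c p))"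
          using p' \<alpha> \<gamma>c[OF induced_closed[OF c]] p by (simp add: el_assoc[OF X] path_el_mult(2))
      qed blast
      also have "\<dots> = arrow_el \<alpha> \<odot>\<^bsub>X\<^esub> ?G c"
        unfolding ind_hom_def by (rule X.smult_finsum_right[OF finite_paths_from t[OF c] path_el_closed, symmetric])
      finally show ?thesis .
    qed
  qed
  assume x: "x \<in> carrier M"
  let ?d = "ind_single {i} M (trivial_path i) x"
  have ti: "trivial_path i \<in> ?P" by (rule trivial_in_paths_from[OF i])
  have "?G ?d = path_el (trivial_path i) \<odot>\<^bsub>X\<^esub> \<gamma> (?d (trivial_path i))"
    unfolding ind_hom_def
  proof (rule X.M.finsum_delta[of _ _ "\<lambda>p. path_el p \<odot>\<^bsub>X\<^esub> \<gamma> (?d p)", OF finite_paths_from ti])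
    show "path_el (trivial_path i) \<odot>\<^bsub>X\<^esub> \<gamma> (?d (trivial_path i)) \<in> carrier X"
      using t[OF ind_single_closed[OF M x]] ti by blast
    fix p assume "p \<in> ?P" "p \<noteq> trivial_path i"
    then show "path_el p \<odot>\<^bsub>X\<^esub> \<gamma> (?d p) = \<zero>\<^bsub>X\<^esub>" using \<gamma>0 by (simp add: ind_single_def)
  qed
  also have "\<dots> = \<gamma> x"
    using ti rep_vert[OF X i \<gamma>R[OF x], of i] by (simp add: ind_single_def)
  finally show "?G ?d = \<gamma> x" .
qed

end

section \<open>Induced complete resolutions\<close>

context quiver_algebra
begin

lemma left_module_L: "left_module L (regular_module L)"
  by (rule left_module_regular) (rule ring_L)

lemma left_module_A: "left_module A (regular_module A)"
  by (rule left_module_regular) (rule A.ring_axioms)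

lemma ind_single_hom:
  assumes M: "left_module A M" and x: "x \<in> carrier M" and y: "y \<in> carrier M"
  shows "ind_single T M p (x \<oplus>\<^bsub>M\<^esub> y) = ind_single T M p x \<oplus>\<^bsub>Ind T M\<^esub> ind_single T M p y"
    and "a \<in> carrier A \<Longrightarrow> ind_single T M p (a \<odot>\<^bsub>M\<^esub> x) = scal_el a \<odot>\<^bsub>Ind T M\<^esub> ind_single T M p x"
    and "vert_el (path_end p) \<odot>\<^bsub>Ind T M\<^esub> ind_single T M p x = ind_single T M p x"
    and "ind_single T M p \<zero>\<^bsub>M\<^esub> = \<zero>\<^bsub>Ind T M\<^esub>"
proof -
  interpret M: left_module A M by (rule M)
  note s = ind_single_closed[OF M]
  note cl = induced_add_closed[OF M] induced_smult_closed[OF M] induced_zero_closed[OF M] s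
  show "ind_single T M p (x \<oplus>\<^bsub>M\<^esub> y) = ind_single T M p x \<oplus>\<^bsub>Ind T M\<^esub> ind_single T M p y"
  proof (rule induced_eqI[of _ T M])
    fix r assume r: "r \<in> paths_from Q T"
    show "ind_single T M p (x \<oplus>\<^bsub>M\<^esub> y) r = (ind_single T M p x \<oplus>\<^bsub>Ind T M\<^esub> ind_single T M p y) r"
      using r by (simp add: ind_single_def induced_apply)
  qed (use x y in \<open>auto simp: cl\<close>)
  show "ind_single T M p (a \<odot>\<^bsub>M\<^esub> x) = scal_el a \<odot>\<^bsub>Ind T M\<^esub> ind_single T M p x" if a: "a \<in> carrier A"
  proof (rule induced_eqI[of _ T M])
    fix r assume r: "r \<in> paths_from Q T"
    show "ind_single T M p (a \<odot>\<^bsub>M\<^esub> x) r = (scal_el a \<odot>\<^bsub>Ind T M\<^esub> ind_single T M p x) r"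
      unfolding induced_scal[OF M a s[OF x] r] using r x a by (simp add: ind_single_def)
  qed (use x a in \<open>auto simp: cl\<close>)
  show "vert_el (path_end p) \<odot>\<^bsub>Ind T M\<^esub> ind_single T M p x = ind_single T M p x"
  proof (rule induced_eqI[of _ T M])
    fix r assume r: "r \<in> paths_from Q T"
    show "(vert_el (path_end p) \<odot>\<^bsub>Ind T M\<^esub> ind_single T M p x) r = ind_single T M p x r"
      unfolding induced_vert[OF M s[OF x] r] using r by (auto simp: ind_single_def)
  qed (use x in \<open>auto simp: cl\<close>)
  show "ind_single T M p \<zero>\<^bsub>M\<^esub> = \<zero>\<^bsub>Ind T M\<^esub>"
  proof (rule induced_eqI[of _ T M])
    fix r assume r: "r \<in> paths_from Q T"
    show "ind_single T M p \<zero>\<^bsub>M\<^esub> r = \<zero>\<^bsub>Ind T M\<^esub> r"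
      using r by (simp add: ind_single_def induced_apply)
  qed (auto simp: cl)
qed

text \<open>The inclusion of \<open>L e_i\<close> into \<open>L\<close>. Left multiplication never
  changes where a path starts, so the coefficients at paths from other vertices remain zero.\<close>

lemma extend_by_zero_hom:
  "(\<lambda>c. \<lambda>r\<in>paths Q. if fst r = i then c r else \<zero>\<^bsub>A\<^esub>) \<in> mod_hom L (Ind {i} (regular_module A)) (regular_module L)"
    (is "?E \<in> _")
proof (rule L_homI[OF left_module_induced[OF left_module_A] left_module_L])
  note M = left_module_A
  have PF: "r \<in> paths_from Q {i} \<longleftrightarrow> r \<in> paths Q \<and> fst r = i" for r by (auto simp: paths_from_def)
  have cA: "c r \<in> carrier A" if "c \<in> carrier (Ind {i} (regular_module A))" "r \<in> paths Q" "fst r = i" for c r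
    using induced_closed[OF that(1), of r] that PF by simp
  have E: "?E c \<in> carrier L" if "c \<in> carrier (Ind {i} (regular_module A))" for c
    using cA[OF that] by (auto simp: carrier_L simp del: split_paired_All)
  then show "?E c \<in> carrier (regular_module L)" if "c \<in> carrier (Ind {i} (regular_module A))" for c
    using that by simp
  fix c assume c: "c \<in> carrier (Ind {i} (regular_module A))"
  show "?E (c \<oplus>\<^bsub>Ind {i} (regular_module A)\<^esub> c') = ?E c \<oplus>\<^bsub>regular_module L\<^esub> ?E c'"
    if c': "c' \<in> carrier (Ind {i} (regular_module A))" for c'
  proof (rule L_eqI)
    show "?E (c \<oplus>\<^bsub>Ind {i} (regular_module A)\<^esub> c') \<in> carrier L"
      by (rule E[OF induced_add_closed[OF M c c']])
    show "?E c \<oplus>\<^bsub>regular_module L\<^esub> ?E c' \<in> carrier L" using E[OF c] E[OF c'] L_add_closed by simp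
    fix r assume "r \<in> paths Q"
    then show "?E (c \<oplus>\<^bsub>Ind {i} (regular_module A)\<^esub> c') r = (?E c \<oplus>\<^bsub>regular_module L\<^esub> ?E c') r"
      by (simp add: add_L induced_apply(2) PF)
  qed
  show "?E (scal_el a \<odot>\<^bsub>Ind {i} (regular_module A)\<^esub> c) = scal_el a \<odot>\<^bsub>regular_module L\<^esub> ?E c"
    if a: "a \<in> carrier A" for a
  proof (rule L_eqI)
    show "?E (scal_el a \<odot>\<^bsub>Ind {i} (regular_module A)\<^esub> c) \<in> carrier L"
      by (rule E[OF induced_smult_closed[OF M scal_el_closed[OF a] c]])
    show "scal_el a \<odot>\<^bsub>regular_module L\<^esub> ?E c \<in> carrier L" using E[OF c] a L_mult_closed by simp
    fix r assume r: "r \<in> paths Q"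
    show "?E (scal_el a \<odot>\<^bsub>Ind {i} (regular_module A)\<^esub> c) r = (scal_el a \<odot>\<^bsub>regular_module L\<^esub> ?E c) r"
      using L_left_mult(1)[OF E[OF c] a r] induced_scal[OF M a c, of r] r a by (simp add: PF)
  qed
  show "?E (vert_el j \<odot>\<^bsub>Ind {i} (regular_module A)\<^esub> c) = vert_el j \<odot>\<^bsub>regular_module L\<^esub> ?E c" for j
  proof (rule L_eqI)
    show "?E (vert_el j \<odot>\<^bsub>Ind {i} (regular_module A)\<^esub> c) \<in> carrier L"
      by (rule E[OF induced_smult_closed[OF M path_el_closed c]])
    show "vert_el j \<odot>\<^bsub>regular_module L\<^esub> ?E c \<in> carrier L" using E[OF c] L_mult_closed by simp
    fix r assume r: "r \<in> paths Q"
    show "?E (vert_el j \<odot>\<^bsub>Ind {i} (regular_module A)\<^esub> c) r = (vert_el j \<odot>\<^bsub>regular_module L\<^esub> ?E c) r"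
      using L_left_mult(2)[OF E[OF c] r, of j] induced_vert[OF M c, of r j] r by (simp add: PF)
  qed
  show "?E (arrow_el \<alpha> \<odot>\<^bsub>Ind {i} (regular_module A)\<^esub> c) = arrow_el \<alpha> \<odot>\<^bsub>regular_module L\<^esub> ?E c"
    if \<alpha>: "\<alpha> \<in> arcs Q" for \<alpha>
  proof (rule L_eqI)
    show "?E (arrow_el \<alpha> \<odot>\<^bsub>Ind {i} (regular_module A)\<^esub> c) \<in> carrier L"
      by (rule E[OF induced_smult_closed[OF M path_el_closed c]])
    show "arrow_el \<alpha> \<odot>\<^bsub>regular_module L\<^esub> ?E c \<in> carrier L" using E[OF c] L_mult_closed by simp
    fix r assume r: "r \<in> paths Q"
    show "?E (arrow_el \<alpha> \<odot>\<^bsub>Ind {i} (regular_module A)\<^esub> c) r = (arrow_el \<alpha> \<odot>\<^bsub>regular_module L\<^esub> ?E c) r"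
    proof (cases "\<exists>p. p \<in> paths Q \<and> path_end p = tail Q \<alpha> \<and> r = path_snoc Q p \<alpha>")
      case True
      then obtain p where p: "p \<in> paths Q" "path_end p = tail Q \<alpha>" "r = path_snoc Q p \<alpha>" by blast
      show ?thesis
        using L_left_mult(3)[OF E[OF c] \<alpha> p(1,2)] induced_arrow(1)[OF M c \<alpha> _ p(2)] p r by (simp add: PF)
    next
      case False
      have "(arrow_el \<alpha> \<otimes>\<^bsub>L\<^esub> ?E c) r = \<zero>\<^bsub>A\<^esub>"
        by (rule L_left_mult(4)[OF E[OF c] \<alpha> r]) (use False in blast)
      moreover have "(arrow_el \<alpha> \<odot>\<^bsub>Ind {i} (regular_module A)\<^esub> c) r = \<zero>\<^bsub>regular_module A\<^esub>" if "fst r = i"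
        by (rule induced_arrow(2)[OF M c \<alpha>]) (use False r that PF in blast)+
      ultimately show ?thesis using r by simp
    qed
  qed
qed

text \<open>A dual basis is induced along with the module: functionals act on each coefficient, and
  the vectors become \<open>e_i \<otimes> b k\<close>.\<close>

lemma fg_projective_induced:
  assumes P: "fg_projective A P"
  shows "fg_projective L (Ind {i} P)"
proof -
  have M: "left_module A P" using P by (simp add: fg_projective_def)
  interpret M: left_module A P by (rule M)
  interpret I: left_module L "Ind {i} P" by (rule left_module_induced[OF M])
  obtain n :: nat and f b where "dual_basis A P {..<n} f b" using fg_projectiveE[OF P] .
  note db = dual_basisD[OF this]
  \<comment> \<open>The coefficientwise functional takes values in \<open>L e_i\<close>; extension
    by zero makes it a functional with values in \<open>L\<close>.\<close>
  define F where "F k c = (\<lambda>r\<in>paths Q. if fst r = i then ind_map {i} (f k) c r else \<zero>\<^bsub>A\<^esub>)" for k c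
  define B where "B k = ind_single {i} P (trivial_path i) (b k)" for k
  have F: "F k \<in> mod_hom L (Ind {i} P) (regular_module L)" if "k \<in> {..<n}" for k
    unfolding F_def
    by (rule mod_hom_comp[OF ind_map_hom[OF M left_module_A db(2)[OF that]] extend_by_zero_hom])
  have B: "B k \<in> carrier (Ind {i} P)" if "k \<in> {..<n}" for k
    unfolding B_def by (rule ind_single_closed[OF M db(3)[OF that]])
  have Fr: "F k c r = f k (c r)" if "r \<in> paths_from Q {i}" for k c r
    using that by (auto simp: F_def ind_map_def paths_from_def)
  have "dual_basis L (Ind {i} P) {..<n} F B"
    unfolding dual_basis_def
  proof (intro conjI ballI F B)
    fix c assume c: "c \<in> carrier (Ind {i} P)"
    have FL: "F k c \<in> carrier L" if "k \<in> {..<n}" for k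
      using mod_homD(1)[OF F[OF that] c] by simp
    have t: "(\<lambda>k. F k c \<odot>\<^bsub>Ind {i} P\<^esub> B k) \<in> {..<n} \<rightarrow> carrier (Ind {i} P)"
      by (intro Pi_I I.smult_closed FL B)
    show "c = (\<Oplus>\<^bsub>Ind {i} P\<^esub>k\<in>{..<n}. F k c \<odot>\<^bsub>Ind {i} P\<^esub> B k)"
    proof (rule induced_eqI[OF c I.M.finsum_closed[OF t]])
      fix r assume r: "r \<in> paths_from Q {i}"
      have "(\<Oplus>\<^bsub>Ind {i} P\<^esub>k\<in>{..<n}. F k c \<odot>\<^bsub>Ind {i} P\<^esub> B k) r = (\<Oplus>\<^bsub>P\<^esub>k\<in>{..<n}. (F k c \<odot>\<^bsub>Ind {i} P\<^esub> B k) r)"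
        by (rule finsum_induced_apply[OF M _ t r]) simp
      also have "\<dots> = (\<Oplus>\<^bsub>P\<^esub>k\<in>{..<n}. f k (c r) \<odot>\<^bsub>P\<^esub> b k)"
      proof (rule M.M.finsum_cong'[OF refl])
        show "(\<lambda>k. f k (c r) \<odot>\<^bsub>P\<^esub> b k) \<in> {..<n} \<rightarrow> carrier P"
          by (intro Pi_I M.smult_closed db(3,5) induced_closed[OF c r])
        fix k assume k: "k \<in> {..<n}"
        show "(F k c \<odot>\<^bsub>Ind {i} P\<^esub> B k) r = f k (c r) \<odot>\<^bsub>P\<^esub> b k"
          unfolding B_def ind_smult_single[OF M db(3)[OF k] FL[OF k] r] Fr[OF r] ..
      qed
      also have "\<dots> = c r" by (rule db(4)[OF induced_closed[OF c r]])
      finally show "c r = (\<Oplus>\<^bsub>Ind {i} P\<^esub>k\<in>{..<n}. F k c \<odot>\<^bsub>Ind {i} P\<^esub> B k) r" by simp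
    qed
  qed simp
  then show ?thesis by (rule fg_projectiveI[OF left_module_induced[OF M]])
qed

lemma ind_map_apply: "r \<in> paths_from Q T \<Longrightarrow> ind_map T f c r = f (c r)"
  by (simp add: ind_map_def)

text \<open>As a complex of groups the induced complex is a finite power of the old one, indexed by
  paths, so it is exact. For the dual, \<open>Hom_L(Ind M, L)\<close> is
  \<open>Hom_A(M, e_i L)\<close>, and \<open>e_i L\<close> is a free left \<open>A\<close>-module on
  the paths ending at i; the dual complex is therefore a finite power of
  \<open>Hom(P, A)\<close>.\<close>

lemma complete_resolution_induced:
  assumes res: "complete_resolution A P d" and i: "i \<in> verts Q"
  shows "complete_resolution L (\<lambda>n. Ind {i} (P n)) (\<lambda>n. ind_map {i} (d n))"
proof -
  interpret P: complete_resolution A P d by (rule res)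
  note m = P.left_module_terms
  note I = left_module_induced[OF m]
  have dh: "ind_map {i} (d n) \<in> mod_hom L (Ind {i} (P n)) (Ind {i} (P (n + 1)))" for n
    by (rule ind_map_hom[OF m m P.d_hom])
  have dh': "ind_map {i} (d (n - 1)) \<in> mod_hom L (Ind {i} (P (n - 1))) (Ind {i} (P n))" for n
    by (rule ind_map_hom[OF m m P.d_hom'])
  show ?thesis
  proof (rule complete_resolutionI)
    show "fg_projective L (Ind {i} (P n))" for n by (rule fg_projective_induced[OF P.fg_projective_terms])
    show "ind_map {i} (d n) \<in> mod_hom L (Ind {i} (P n)) (Ind {i} (P (n + 1)))" for n by (rule dh)
    show "ind_map {i} (d n) (ind_map {i} (d (n - 1)) c) = \<zero>\<^bsub>Ind {i} (P (n + 1))\<^esub>"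
      if c: "c \<in> carrier (Ind {i} (P (n - 1)))" for n c
    proof (rule induced_eqI[of _ "{i}" "P (n + 1)"])
      show "ind_map {i} (d n) (ind_map {i} (d (n - 1)) c) \<in> carrier (Ind {i} (P (n + 1)))"
        by (rule mod_homD(1)[OF dh mod_homD(1)[OF dh' c]])
      fix r assume r: "r \<in> paths_from Q {i}"
      show "ind_map {i} (d n) (ind_map {i} (d (n - 1)) c) r = \<zero>\<^bsub>Ind {i} (P (n + 1))\<^esub> r"
        using r P.d_d[OF induced_closed[OF c r]] by (simp add: ind_map_apply induced_apply(1))
    qed (rule induced_zero_closed[OF m])
  next
    fix n c assume c: "c \<in> carrier (Ind {i} (P n))" and 0: "ind_map {i} (d n) c = \<zero>\<^bsub>Ind {i} (P (n + 1))\<^esub>"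
    have "\<exists>y. r \<in> paths_from Q {i} \<longrightarrow> y \<in> carrier (P (n - 1)) \<and> c r = d (n - 1) y" for r
    proof (cases "r \<in> paths_from Q {i}")
      case r: True
      have "d n (c r) = \<zero>\<^bsub>P (n + 1)\<^esub>"
        using fun_cong[OF 0, of r] r by (simp add: ind_map_apply induced_apply(1))
      then show ?thesis using P.exact[OF induced_closed[OF c r]] by blast
    qed simp
    then obtain y where y: "\<And>r. r \<in> paths_from Q {i} \<Longrightarrow> y r \<in> carrier (P (n - 1))"
      "\<And>r. r \<in> paths_from Q {i} \<Longrightarrow> c r = d (n - 1) (y r)" by metis
    have y': "restrict y (paths_from Q {i}) \<in> carrier (Ind {i} (P (n - 1)))"
      by (rule induced_memI) (rule y(1))
    have "c = ind_map {i} (d (n - 1)) (restrict y (paths_from Q {i}))"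
      by (rule induced_eqI[OF c mod_homD(1)[OF dh' y']]) (simp add: ind_map_apply y(2))
    then show "c \<in> ind_map {i} (d (n - 1)) ` carrier (Ind {i} (P (n - 1)))" using y' by blast
  next
    fix n \<Phi> assume \<Phi>: "\<Phi> \<in> mod_hom L (Ind {i} (P n)) (regular_module L)"
      and \<Phi>0: "\<And>c. c \<in> carrier (Ind {i} (P (n - 1))) \<Longrightarrow> \<Phi> (ind_map {i} (d (n - 1)) c) = \<zero>\<^bsub>L\<^esub>"
    let ?s = "\<lambda>n. ind_single {i} (P n) (trivial_path i)"
    note sc = ind_single_closed[OF m]
    note sh = ind_single_hom[OF m]
    \<comment> \<open>By adjunction \<Phi> is determined on the elements
      \<open>e_i \<otimes> x\<close>. Each coefficient of its values there is an
      \<open>A\<close>-functional on \<open>P n\<close> and a cocycle.\<close>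
    let ?\<phi> = "\<lambda>x. \<Phi> (?s n x)"
    have \<phi>L: "?\<phi> x \<in> carrier L" if "x \<in> carrier (P n)" for x
      using mod_homD(1)[OF \<Phi> sc[OF that]] by simp
    have \<phi>_add: "?\<phi> (x \<oplus>\<^bsub>P n\<^esub> y) = ?\<phi> x \<oplus>\<^bsub>L\<^esub> ?\<phi> y" if "x \<in> carrier (P n)" "y \<in> carrier (P n)" for x y
      using mod_homD(2)[OF \<Phi> sc[OF that(1)] sc[OF that(2)]] by (simp add: sh(1)[OF that])
    have \<phi>_scal: "?\<phi> (a \<odot>\<^bsub>P n\<^esub> x) = scal_el a \<otimes>\<^bsub>L\<^esub> ?\<phi> x" if "a \<in> carrier A" "x \<in> carrier (P n)" for a x
      using mod_homD(3)[OF \<Phi> scal_el_closed[OF that(1)] sc[OF that(2)]] by (simp add: sh(2)[OF that(2) that(2) that(1)])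
    have \<phi>_vert: "?\<phi> x p = \<zero>\<^bsub>A\<^esub>" if "x \<in> carrier (P n)" "p \<in> paths Q" "path_end p \<noteq> i" for x p
    proof -
      have "\<Phi> (vert_el i \<odot>\<^bsub>Ind {i} (P n)\<^esub> ?s n x) = vert_el i \<otimes>\<^bsub>L\<^esub> ?\<phi> x"
        using mod_homD(3)[OF \<Phi> path_el_closed sc[OF that(1)]] by simp
      moreover have "vert_el i \<odot>\<^bsub>Ind {i} (P n)\<^esub> ?s n x = ?s n x"
        using sh(3)[OF that(1) that(1), of "{i}" "trivial_path i"] by simp
      ultimately have "?\<phi> x = vert_el i \<otimes>\<^bsub>L\<^esub> ?\<phi> x" by simp
      then have "?\<phi> x p = (vert_el i \<otimes>\<^bsub>L\<^esub> ?\<phi> x) p" by simp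
      then show ?thesis using L_left_mult(2)[OF \<phi>L[OF that(1)] that(2), of i] that(3) by simp
    qed
    have f: "(\<lambda>x. ?\<phi> x p) \<in> mod_hom A (P n) (regular_module A)" if p: "p \<in> paths Q" for p
    proof (rule mod_homI)
      show "?\<phi> x p \<in> carrier (regular_module A)" if "x \<in> carrier (P n)" for x
        using L_closed[OF \<phi>L[OF that] p] by simp
      show "?\<phi> (x \<oplus>\<^bsub>P n\<^esub> y) p = ?\<phi> x p \<oplus>\<^bsub>regular_module A\<^esub> ?\<phi> y p"
        if "x \<in> carrier (P n)" "y \<in> carrier (P n)" for x y
        using \<phi>_add[OF that] p by (simp add: add_L)
      show "?\<phi> (a \<odot>\<^bsub>P n\<^esub> x) p = a \<odot>\<^bsub>regular_module A\<^esub> ?\<phi> x p"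
        if "a \<in> carrier A" "x \<in> carrier (P n)" for a x
        using \<phi>_scal[OF that] L_left_mult(1)[OF \<phi>L[OF that(2)] that(1) p] by simp
    qed
    have f0: "?\<phi> (d (n - 1) y) p = \<zero>\<^bsub>A\<^esub>" if p: "p \<in> paths Q" and y: "y \<in> carrier (P (n - 1))" for p y
    proof -
      have "?s n (d (n - 1) y) = ind_map {i} (d (n - 1)) (?s (n - 1) y)"
        by (rule ind_map_single[OF m m P.d_hom', symmetric])
      then show ?thesis using \<Phi>0[OF sc[OF y]] p by (simp add: zero_L)
    qed
    have "\<exists>g. p \<in> paths Q \<longrightarrow> g \<in> mod_hom A (P (n + 1)) (regular_module A) \<and>
        (\<forall>x\<in>carrier (P n). ?\<phi> x p = g (d n x))" for p
    proof (cases "p \<in> paths Q")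
      case True
      then show ?thesis using P.hom_exact_regular[OF f[OF True] f0[OF True]] by blast
    qed simp
    then obtain g where g: "\<And>p. p \<in> paths Q \<Longrightarrow> g p \<in> mod_hom A (P (n + 1)) (regular_module A)"
      "\<And>p x. p \<in> paths Q \<Longrightarrow> x \<in> carrier (P n) \<Longrightarrow> ?\<phi> x p = g p (d n x)" by metis
    \<comment> \<open>The extensions \<open>g p\<close> are arbitrary for paths not ending at i.
      There zero is taken instead, which agrees with \<Phi> by \<open>\<phi>_vert\<close> and keeps
      the values inside \<open>e_i L\<close>.\<close>
    define \<gamma> where "\<gamma> y = (\<lambda>p\<in>paths Q. if path_end p = i then g p y else \<zero>\<^bsub>A\<^esub>)" for y
    have gA: "g p y \<in> carrier A" if "p \<in> paths Q" "y \<in> carrier (P (n + 1))" for p y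
      using mod_homD(1)[OF g(1)[OF that(1)] that(2)] by simp
    have \<gamma>L: "\<gamma> y \<in> carrier L" if "y \<in> carrier (P (n + 1))" for y
      unfolding carrier_L \<gamma>_def using gA[OF _ that] by (auto simp del: split_paired_All)
    have \<gamma>: "\<gamma> \<in> mod_hom A (P (n + 1)) (Rep (regular_module L) i)"
    proof (rule mod_homI)
      fix y assume y: "y \<in> carrier (P (n + 1))"
      have "vert_el i \<otimes>\<^bsub>L\<^esub> \<gamma> y = \<gamma> y"
      proof (rule L_eqI)
        show "(vert_el i \<otimes>\<^bsub>L\<^esub> \<gamma> y) r = \<gamma> y r" if "r \<in> paths Q" for r
          unfolding L_left_mult(2)[OF \<gamma>L[OF y] that] using that by (simp add: \<gamma>_def)
      qed (use \<gamma>L[OF y] L_mult_closed in auto)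
      then show "\<gamma> y \<in> carrier (Rep (regular_module L) i)"
        using rep_memI[OF left_module_L, of "\<gamma> y" i] \<gamma>L[OF y] by simp
      show "\<gamma> (y \<oplus>\<^bsub>P (n + 1)\<^esub> y') = \<gamma> y \<oplus>\<^bsub>Rep (regular_module L) i\<^esub> \<gamma> y'"
        if y': "y' \<in> carrier (P (n + 1))" for y'
      proof (rule L_eqI)
        interpret M: left_module A "P (n + 1)" by (rule m)
        show "\<gamma> (y \<oplus>\<^bsub>P (n + 1)\<^esub> y') \<in> carrier L" by (rule \<gamma>L[OF M.M.add.m_closed[OF y y']])
        show "\<gamma> y \<oplus>\<^bsub>Rep (regular_module L) i\<^esub> \<gamma> y' \<in> carrier L"
          using L_add_closed[OF \<gamma>L[OF y] \<gamma>L[OF y']] by (simp add: rep_space_simps(3))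
        fix r assume r: "r \<in> paths Q"
        show "\<gamma> (y \<oplus>\<^bsub>P (n + 1)\<^esub> y') r = (\<gamma> y \<oplus>\<^bsub>Rep (regular_module L) i\<^esub> \<gamma> y') r"
          using r mod_homD(2)[OF g(1)[OF r] y y'] by (simp add: rep_space_simps(3) add_L \<gamma>_def)
      qed
      show "\<gamma> (a \<odot>\<^bsub>P (n + 1)\<^esub> y) = a \<odot>\<^bsub>Rep (regular_module L) i\<^esub> \<gamma> y" if a: "a \<in> carrier A" for a
      proof (rule L_eqI)
        interpret M: left_module A "P (n + 1)" by (rule m)
        show "\<gamma> (a \<odot>\<^bsub>P (n + 1)\<^esub> y) \<in> carrier L" by (rule \<gamma>L[OF M.smult_closed[OF a y]])
        show "a \<odot>\<^bsub>Rep (regular_module L) i\<^esub> \<gamma> y \<in> carrier L"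
          using L_mult_closed[OF scal_el_closed[OF a] \<gamma>L[OF y]] by (simp add: rep_space_simps(4))
        fix r assume r: "r \<in> paths Q"
        have "(a \<odot>\<^bsub>Rep (regular_module L) i\<^esub> \<gamma> y) r = a \<otimes>\<^bsub>A\<^esub> \<gamma> y r"
          using L_left_mult(1)[OF \<gamma>L[OF y] a r] by (simp add: rep_space_simps(4))
        then show "\<gamma> (a \<odot>\<^bsub>P (n + 1)\<^esub> y) r = (a \<odot>\<^bsub>Rep (regular_module L) i\<^esub> \<gamma> y) r"
          using r a mod_homD(3)[OF g(1)[OF r] a y] by (simp add: \<gamma>_def)
      qed
    qed
    let ?G = "ind_hom (regular_module L) i \<gamma>"
    note G = ind_hom[OF left_module_L m i \<gamma>]
    have GF: "(\<lambda>c. ?G (ind_map {i} (d n) c)) \<in> mod_hom L (Ind {i} (P n)) (regular_module L)"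
      by (rule mod_hom_comp[OF dh G(1)])
    have "\<Phi> c = ?G (ind_map {i} (d n) c)" if c: "c \<in> carrier (Ind {i} (P n))" for c
    proof (rule ind_hom_unique[OF m left_module_L \<Phi> GF _ c])
      fix x assume x: "x \<in> carrier (P n)"
      have "?\<phi> x = \<gamma> (d n x)"
        by (rule L_eqI[OF \<phi>L[OF x] \<gamma>L[OF P.d_closed[OF x]]])
          (simp add: \<gamma>_def g(2)[OF _ x, symmetric] \<phi>_vert[OF x])
      also have "\<dots> = ?G (?s (n + 1) (d n x))" by (rule G(2)[OF P.d_closed[OF x], symmetric])
      also have "?s (n + 1) (d n x) = ind_map {i} (d n) (?s n x)"
        by (rule ind_map_single[OF m m P.d_hom, symmetric])
      finally show "?\<phi> x = ?G (ind_map {i} (d n) (?s n x))" .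
    qed
    then show "\<exists>G\<in>mod_hom L (Ind {i} (P (n + 1))) (regular_module L).
        \<forall>c\<in>carrier (Ind {i} (P n)). \<Phi> c = G (ind_map {i} (d n) c)" using G(1) by blast
  qed
qed

end

section \<open>Monic representations with Gorenstein-projective cokernels\<close>

context quiver_algebra
begin

text \<open>As an intersection it supports arguments by exhibiting a single submodule that contains
  the generating spaces.\<close>

definition generated_submodule where
  "generated_submodule X S = \<Inter>{N. left_submodule L X N \<and> (\<forall>j\<in>S. carrier (Rep X j) \<subseteq> N)}"

definition predecessor_closed :: "'d set \<Rightarrow> bool" where
  "predecessor_closed S \<longleftrightarrow> (\<forall>\<alpha>\<in>arcs Q. head Q \<alpha> \<in> S \<longrightarrow> tail Q \<alpha> \<in> S)"

text \<open>Read contrapositively: a path that starts outside \<open>S\<close> never ends in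
  \<open>S\<close>.\<close>

lemma predecessor_closed_path:
  assumes "predecessor_closed S" "r \<in> paths Q" "path_end r \<in> S" shows "fst r \<in> S"
  using assms(2,3)
proof (induction r rule: path_induct)
  case (snoc p \<alpha>)
  then have "tail Q \<alpha> \<in> S" using assms(1) by (simp add: predecessor_closed_def)
  then show ?case using snoc by simp
qed simp

lemma vert_rank_path: "r \<in> paths Q \<Longrightarrow> vert_rank (fst r) \<le> vert_rank (path_end r)"
proof (induction r rule: path_induct)
  case (snoc p \<alpha>)
  then show ?case using vert_rank_less[of \<alpha>] by simp
qed simp

section \<open>Submodules generated by the spaces at a set of vertices\<close>

context
  fixes X :: "('d \<times> 'e list \<times> 'd \<Rightarrow> 'c, 'm) module"
  assumes X: "left_module L X"
begin

interpretation X: left_module L X by (rule X)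

lemma generated_submodule:
  shows "left_submodule L X (generated_submodule X S)"
    and "j \<in> S \<Longrightarrow> x \<in> carrier (Rep X j) \<Longrightarrow> x \<in> generated_submodule X S"
    and "left_submodule L X N \<Longrightarrow> (\<And>j x. j \<in> S \<Longrightarrow> x \<in> carrier (Rep X j) \<Longrightarrow> x \<in> N) \<Longrightarrow>
      x \<in> generated_submodule X S \<Longrightarrow> x \<in> N"
proof -
  let ?\<N> = "{N. left_submodule L X N \<and> (\<forall>j\<in>S. carrier (Rep X j) \<subseteq> N)}"
  have top: "carrier X \<in> ?\<N>"
    using rep_carrier[OF X] by (auto simp: left_submodule_def)
  show "left_submodule L X (generated_submodule X S)"
    unfolding generated_submodule_def
  proof (subst left_submodule_def, intro conjI ballI)
    show "\<Inter>?\<N> \<subseteq> carrier X" using top by blast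
  qed (auto dest: left_submoduleD)
  show "j \<in> S \<Longrightarrow> x \<in> carrier (Rep X j) \<Longrightarrow> x \<in> generated_submodule X S"
    unfolding generated_submodule_def by blast
  show "left_submodule L X N \<Longrightarrow> (\<And>j x. j \<in> S \<Longrightarrow> x \<in> carrier (Rep X j) \<Longrightarrow> x \<in> N) \<Longrightarrow>
      x \<in> generated_submodule X S \<Longrightarrow> x \<in> N"
    unfolding generated_submodule_def by blast
qed

lemma generated_submodule_mono:
  assumes "S \<subseteq> S'" "x \<in> generated_submodule X S" shows "x \<in> generated_submodule X S'"
  using generated_submodule(3)[OF generated_submodule(1)[of S'] _ assms(2)] generated_submodule(2) assms(1)
  by blast

lemma generated_submodule_empty: "generated_submodule X {} = {\<zero>\<^bsub>X\<^esub>}"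
proof -
  have "left_submodule L X {\<zero>\<^bsub>X\<^esub>}" by (simp add: left_submodule_def)
  then have "x \<in> {\<zero>\<^bsub>X\<^esub>}" if "x \<in> generated_submodule X {}" for x
    by (rule generated_submodule(3)[OF _ _ that]) simp
  then show ?thesis using left_submoduleD(2)[OF generated_submodule(1)] by blast
qed

lemma generated_submodule_verts: "generated_submodule X (verts Q) = carrier X"
proof
  note F = generated_submodule(1)[of "verts Q"]
  show "generated_submodule X (verts Q) \<subseteq> carrier X" using left_submoduleD(1)[OF F] by blast
  show "carrier X \<subseteq> generated_submodule X (verts Q)"
  proof
    fix x assume x: "x \<in> carrier X"
    have "(\<Oplus>\<^bsub>X\<^esub>j\<in>verts Q. vert_el j \<odot>\<^bsub>X\<^esub> x) \<in> generated_submodule X (verts Q)"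
      by (rule left_submodule_finsum[OF X F]) (use generated_submodule(2) rep_memI[OF X x] in blast)
    then show "x \<in> generated_submodule X (verts Q)" using vert_decomposition[OF X x] by simp
  qed
qed

text \<open>At a vertex outside \<open>S\<close> there are no generators, so whatever
  \<open>X_S\<close> contains there has arrived through an arrow. That the components
  \<open>y \<beta>\<close> can be taken in \<open>X_S\<close> again is what allows an induction
  along paths.\<close>

lemma generated_submodule_outside:
  assumes x: "x \<in> generated_submodule X S" and S: "S \<subseteq> verts Q" and j: "j \<in> verts Q" "j \<notin> S"
  obtains y where "\<And>\<beta>. \<beta> \<in> in_arcs Q j \<Longrightarrow> y \<beta> \<in> carrier (Rep X (tail Q \<beta>))"
    "\<And>\<beta>. \<beta> \<in> in_arcs Q j \<Longrightarrow> y \<beta> \<in> generated_submodule X S"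
    "vert_el j \<odot>\<^bsub>X\<^esub> x = (\<Oplus>\<^bsub>X\<^esub>\<beta>\<in>in_arcs Q j. arrow_el \<beta> \<odot>\<^bsub>X\<^esub> y \<beta>)"
proof -
  let ?F = "generated_submodule X S"
  let ?Y = "\<lambda>y. \<forall>\<beta>\<in>in_arcs Q j. y \<beta> \<in> carrier (Rep X (tail Q \<beta>)) \<and> y \<beta> \<in> ?F"
  let ?sum = "\<lambda>y. \<Oplus>\<^bsub>X\<^esub>\<beta>\<in>in_arcs Q j. arrow_el \<beta> \<odot>\<^bsub>X\<^esub> y \<beta>"
  note F = generated_submodule(1)[of S]
  note FD = left_submoduleD[OF F]
  \<comment> \<open>The arrow sums at \<open>j\<close> with components in
    \<open>X_S\<close>.\<close>
  define W where "W = {w. \<exists>y. ?Y y \<and> w = ?sum y}"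
  have Wz: "\<zero>\<^bsub>X\<^esub> \<in> W"
    unfolding W_def using arrow_sum_zero[OF X, of j] rep_zero[OF X in_arcsD(3)] FD(2)
    by (intro CollectI exI[of _ "\<lambda>_. \<zero>\<^bsub>X\<^esub>"]) auto
  have Wa: "w \<oplus>\<^bsub>X\<^esub> w' \<in> W" if w: "w \<in> W" and w': "w' \<in> W" for w w'
  proof -
    obtain y where y: "?Y y" "w = ?sum y" using w unfolding W_def by blast
    obtain y' where y': "?Y y'" "w' = ?sum y'" using w' unfolding W_def by blast
    have yc: "\<beta> \<in> in_arcs Q j \<Longrightarrow> y \<beta> \<in> carrier X" "\<beta> \<in> in_arcs Q j \<Longrightarrow> y' \<beta> \<in> carrier X" for \<beta>
      using y(1) y'(1) FD(1) by blast+
    have "w \<oplus>\<^bsub>X\<^esub> w' = ?sum (\<lambda>\<beta>. y \<beta> \<oplus>\<^bsub>X\<^esub> y' \<beta>)"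
      unfolding y(2) y'(2) by (rule arrow_sum_add[OF X yc, symmetric])
    moreover have "?Y (\<lambda>\<beta>. y \<beta> \<oplus>\<^bsub>X\<^esub> y' \<beta>)" using y(1) y'(1) rep_add[OF X] FD(3) by blast
    ultimately show ?thesis unfolding W_def by (intro CollectI exI[of _ "\<lambda>\<beta>. y \<beta> \<oplus>\<^bsub>X\<^esub> y' \<beta>"] conjI)
  qed
  have Ws: "scal_el a \<odot>\<^bsub>X\<^esub> w \<in> W" if a: "a \<in> carrier A" and w: "w \<in> W" for a w
  proof -
    obtain y where y: "?Y y" "w = ?sum y" using w unfolding W_def by blast
    have yc: "\<beta> \<in> in_arcs Q j \<Longrightarrow> y \<beta> \<in> carrier X" for \<beta> using y(1) FD(1) by blast
    have "scal_el a \<odot>\<^bsub>X\<^esub> w = ?sum (\<lambda>\<beta>. scal_el a \<odot>\<^bsub>X\<^esub> y \<beta>)"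
      unfolding y(2) by (rule arrow_sum_scal[OF X yc a])
    moreover have "?Y (\<lambda>\<beta>. scal_el a \<odot>\<^bsub>X\<^esub> y \<beta>)"
      using y(1) rep_scal[OF X a] FD(4)[OF scal_el_closed[OF a]] by blast
    ultimately show ?thesis unfolding W_def by (intro CollectI exI[of _ "\<lambda>\<beta>. scal_el a \<odot>\<^bsub>X\<^esub> y \<beta>"] conjI)
  qed
  have Wr: "arrow_el \<alpha> \<odot>\<^bsub>X\<^esub> x \<in> W" if \<alpha>: "\<alpha> \<in> in_arcs Q j" and x: "x \<in> ?F" for \<alpha> x
  proof -
    have xc: "x \<in> carrier X" using FD(1)[OF x] .
    let ?y = "\<lambda>\<beta>. if \<beta> = \<alpha> then vert_el (tail Q \<alpha>) \<odot>\<^bsub>X\<^esub> x else \<zero>\<^bsub>X\<^esub>"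
    have "?sum ?y = arrow_el \<alpha> \<odot>\<^bsub>X\<^esub> ?y \<alpha>"
      by (rule X.M.finsum_delta[OF finite_in_arcs \<alpha>]) (use xc in auto)
    then have "arrow_el \<alpha> \<odot>\<^bsub>X\<^esub> x = ?sum ?y" using arrow_tail[OF X in_arcsD(1)[OF \<alpha>] xc] by simp
    moreover have "?Y ?y" using rep_memI[OF X xc] rep_zero[OF X in_arcsD(3)] FD(2) FD(4)[OF path_el_closed x] by simp
    ultimately show ?thesis unfolding W_def by (intro CollectI exI[of _ ?y] conjI)
  qed
  \<comment> \<open>The elements whose component at \<open>j\<close> has the desired form are a
    submodule containing the generators, on which the idempotent at \<open>j\<close>
    vanishes.\<close>
  let ?N = "{x \<in> ?F. vert_el j \<odot>\<^bsub>X\<^esub> x \<in> W}"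
  have N: "left_submodule L X ?N"
  proof (rule L_submoduleI[OF X])
    show "?N \<subseteq> carrier X" using FD(1) by blast
    show "\<zero>\<^bsub>X\<^esub> \<in> ?N" using FD(2) Wz by simp
    show "x \<oplus>\<^bsub>X\<^esub> y \<in> ?N" if "x \<in> ?N" "y \<in> ?N" for x y
      using that FD(1,3) Wa by (simp add: X.smult_r_distr)
    show "scal_el a \<odot>\<^bsub>X\<^esub> x \<in> ?N" if "a \<in> carrier A" "x \<in> ?N" for a x
      using that FD(1) FD(4)[OF scal_el_closed] Ws[of a "vert_el j \<odot>\<^bsub>X\<^esub> x"] by (simp add: scal_path[OF X])
    show "vert_el k \<odot>\<^bsub>X\<^esub> x \<in> ?N" if "k \<in> verts Q" "x \<in> ?N" for k x
      using that FD(1) FD(4)[OF path_el_closed] Wz by (auto simp: vert_vert[OF X])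
    show "arrow_el \<alpha> \<odot>\<^bsub>X\<^esub> x \<in> ?N" if "\<alpha> \<in> arcs Q" "x \<in> ?N" for \<alpha> x
      using that FD(1) FD(4)[OF path_el_closed] Wz Wr[of \<alpha> x] by (auto simp: vert_arrow[OF X])
  qed
  have "x \<in> ?N"
  proof (rule generated_submodule(3)[OF N _ x])
    fix k z assume k: "k \<in> S" "z \<in> carrier (Rep X k)"
    have "vert_el j \<odot>\<^bsub>X\<^esub> z = \<zero>\<^bsub>X\<^esub>" using rep_vert[OF X _ k(2), of j] k(1) S j(2) by auto
    then show "z \<in> ?N" using generated_submodule(2)[OF k] Wz by simp
  qed
  then obtain y where "?Y y" "vert_el j \<odot>\<^bsub>X\<^esub> x = ?sum y" unfolding W_def by blast
  then show thesis using that[of y] by blast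
qed

lemma ind_hom_incl_generated:
  assumes i: "i \<in> verts Q" and N: "left_submodule L X N" and u: "u \<in> carrier (Ind {i} (Rep X i))"
    and uN: "\<And>p. p \<in> paths_from Q {i} \<Longrightarrow> u p \<in> N"
  shows "ind_hom X i (\<lambda>x. x) u \<in> N"
  unfolding ind_hom_def
  by (rule left_submodule_finsum[OF X N]) (use left_submoduleD(4)[OF N path_el_closed uN] in blast)

text \<open>This is the injectivity behind the identification of the layer added at i with the
  module induced from the cokernel. The coefficient at \<open>p\<close> is reached by peeling off
  last arrows: \<open>ind_expansion\<close> and \<open>generated_submodule_outside\<close> both
  write the component of \<open>\<Gamma> u\<close> at the end of \<open>p\<close> as a sum over
  incoming arrows, and monicity identifies the summands.\<close>

lemma ind_hom_mem_generated:
  assumes mon: "monic_rep Q (rep_space K A Q X) (rep_map K A Q X)"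
    and S: "S \<subseteq> verts Q" "predecessor_closed S" and i: "i \<in> verts Q" "i \<notin> S"
    and u: "u \<in> carrier (Ind {i} (Rep X i))" and mem: "ind_hom X i (\<lambda>x. x) u \<in> generated_submodule X S"
    and p: "p \<in> paths_from Q {i}"
  shows "u p \<in> Incoming X i"
proof -
  let ?M = "Rep X i" and ?\<Gamma> = "ind_hom X i (\<lambda>x. x)" and ?F = "generated_submodule X S"
  let ?I = "Ind {i} ?M"
  note M = left_module_rep[OF X i(1)]
  interpret I: left_module L ?I by (rule left_module_induced[OF M])
  interpret V: left_module A ?M by (rule M)
  have id: "(\<lambda>x. x) \<in> mod_hom A ?M ?M" by (simp add: mod_hom_def)
  note \<Gamma> = ind_hom[OF X M i(1) id]
  note \<Gamma>c = mod_homD(1)[OF \<Gamma>(1)]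
  note F = generated_submodule(1)[of S]
  note Inc = Incoming_submodule[OF X i(1)]
  have strip: "ind_strip {i} ?M \<beta> u \<in> carrier ?I" if "\<beta> \<in> in_arcs Q j" "u \<in> carrier ?I" for j \<beta> u
    by (rule ind_strip_closed[OF M that(2) in_arcsD(1)[OF that(1)]])
  \<comment> \<open>The expansion of \<open>u\<close> by last arrows, transported to
    \<open>X\<close>.\<close>
  have step: "vert_el j \<odot>\<^bsub>X\<^esub> ?\<Gamma> u = ?\<Gamma> (ind_single {i} ?M (trivial_path j) (if j \<in> {i} then u (trivial_path j) else \<zero>\<^bsub>?M\<^esub>))
      \<oplus>\<^bsub>X\<^esub> (\<Oplus>\<^bsub>X\<^esub>\<beta>\<in>in_arcs Q j. arrow_el \<beta> \<odot>\<^bsub>X\<^esub> ?\<Gamma> (ind_strip {i} ?M \<beta> u))"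
    if u: "u \<in> carrier ?I" and j: "j \<in> verts Q" for u j
  proof -
    let ?s = "ind_single {i} ?M (trivial_path j) (if j \<in> {i} then u (trivial_path j) else \<zero>\<^bsub>?M\<^esub>)"
    have s: "?s \<in> carrier ?I"
      by (rule ind_single_closed[OF M]) (use u trivial_in_paths_from[OF i(1)] in auto)
    have t: "(\<lambda>\<beta>. arrow_el \<beta> \<odot>\<^bsub>?I\<^esub> ind_strip {i} ?M \<beta> u) \<in> in_arcs Q j \<rightarrow> carrier ?I"
      by (intro Pi_I I.smult_closed path_el_closed strip[OF _ u])
    have "vert_el j \<odot>\<^bsub>X\<^esub> ?\<Gamma> u = ?\<Gamma> (vert_el j \<odot>\<^bsub>?I\<^esub> u)"
      by (rule mod_homD(3)[OF \<Gamma>(1) path_el_closed u, symmetric])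
    also have "\<dots> = ?\<Gamma> ?s \<oplus>\<^bsub>X\<^esub> ?\<Gamma> (\<Oplus>\<^bsub>?I\<^esub>\<beta>\<in>in_arcs Q j. arrow_el \<beta> \<odot>\<^bsub>?I\<^esub> ind_strip {i} ?M \<beta> u)"
      unfolding ind_expansion[OF M u j] by (rule mod_homD(2)[OF \<Gamma>(1) s I.M.finsum_closed[OF t]])
    also have "?\<Gamma> (\<Oplus>\<^bsub>?I\<^esub>\<beta>\<in>in_arcs Q j. arrow_el \<beta> \<odot>\<^bsub>?I\<^esub> ind_strip {i} ?M \<beta> u) =
        (\<Oplus>\<^bsub>X\<^esub>\<beta>\<in>in_arcs Q j. arrow_el \<beta> \<odot>\<^bsub>X\<^esub> ?\<Gamma> (ind_strip {i} ?M \<beta> u))"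
      by (rule mod_hom_lincomb[OF left_module_induced[OF M] X \<Gamma>(1) finite_in_arcs path_el_closed strip[OF _ u]])
    finally show ?thesis .
  qed
  have pp: "p \<in> paths Q" using paths_from_subset(2)[OF p] .
  \<comment> \<open>The family \<open>u\<close> has to vary, because the induction hypothesis is
    applied to the family left after stripping the last arrow.\<close>
  from pp have "\<forall>u\<in>carrier ?I. p \<in> paths_from Q {i} \<longrightarrow> ?\<Gamma> u \<in> ?F \<longrightarrow> u p \<in> Incoming X i"
  proof (induction p rule: path_induct)
    case (trivial j)
    show ?case
    proof (intro ballI impI)
      fix u assume u: "u \<in> carrier ?I" and tp: "trivial_path j \<in> paths_from Q {i}" and mem: "?\<Gamma> u \<in> ?F"
      have ji: "j = i" using tp by (simp add: paths_from_def)
      have ut: "u (trivial_path i) \<in> carrier ?M" using induced_closed[OF u] tp ji by blast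
      let ?s = "\<Oplus>\<^bsub>X\<^esub>\<beta>\<in>in_arcs Q i. arrow_el \<beta> \<odot>\<^bsub>X\<^esub> ?\<Gamma> (ind_strip {i} ?M \<beta> u)"
      have gs: "?\<Gamma> (ind_strip {i} ?M \<beta> u) \<in> carrier X" if "\<beta> \<in> in_arcs Q i" for \<beta>
        by (rule \<Gamma>c[OF strip[OF that u]])
      have t: "(\<lambda>\<beta>. arrow_el \<beta> \<odot>\<^bsub>X\<^esub> ?\<Gamma> (ind_strip {i} ?M \<beta> u)) \<in> in_arcs Q i \<rightarrow> Incoming X i"
      proof
        fix \<beta> assume \<beta>: "\<beta> \<in> in_arcs Q i"
        show "arrow_el \<beta> \<odot>\<^bsub>X\<^esub> ?\<Gamma> (ind_strip {i} ?M \<beta> u) \<in> Incoming X i"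
          using Incoming_arrow[OF X in_arcsD(1)[OF \<beta>] gs[OF \<beta>]] in_arcsD(2)[OF \<beta>] by simp
      qed
      have t': "(\<lambda>\<beta>. arrow_el \<beta> \<odot>\<^bsub>X\<^esub> ?\<Gamma> (ind_strip {i} ?M \<beta> u)) \<in> in_arcs Q i \<rightarrow> carrier ?M"
        by (rule arrow_sum_terms(1)[OF X gs])
      have sI: "?s \<in> Incoming X i"
        using left_submodule_finsum[OF M Inc t] unfolding finsum_rep[OF X i(1) t'] .
      obtain y where y: "\<And>\<beta>. \<beta> \<in> in_arcs Q i \<Longrightarrow> y \<beta> \<in> carrier (Rep X (tail Q \<beta>))"
        "vert_el i \<odot>\<^bsub>X\<^esub> ?\<Gamma> u = (\<Oplus>\<^bsub>X\<^esub>\<beta>\<in>in_arcs Q i. arrow_el \<beta> \<odot>\<^bsub>X\<^esub> y \<beta>)"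
        by (rule generated_submodule_outside[OF mem S(1) i]) blast
      have vI: "vert_el i \<odot>\<^bsub>X\<^esub> ?\<Gamma> u \<in> Incoming X i" unfolding y(2) by (rule IncomingI[OF X i(1) y(1)])
      have "vert_el i \<odot>\<^bsub>X\<^esub> ?\<Gamma> u = u (trivial_path i) \<oplus>\<^bsub>?M\<^esub> ?s"
        using step[OF u i(1)] \<Gamma>(2)[OF ut] by (simp add: rep_space_simps(3))
      then have "u (trivial_path i) = vert_el i \<odot>\<^bsub>X\<^esub> ?\<Gamma> u \<ominus>\<^bsub>?M\<^esub> ?s"
        using V.add_minus_cancel(3)[OF ut left_submoduleD(1)[OF Inc sI]] by simp
      then show "u (trivial_path j) \<in> Incoming X i"
        using left_submodule_minus(2)[OF M Inc vI sI] ji by simp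
    qed
  next
    case (snoc p \<alpha>)
    show ?case
    proof (intro ballI impI)
      fix u assume u: "u \<in> carrier ?I" and rp: "path_snoc Q p \<alpha> \<in> paths_from Q {i}" and mem: "?\<Gamma> u \<in> ?F"
      let ?j = "head Q \<alpha>"
      have pf: "p \<in> paths_from Q {i}" and fp: "fst p = i" using rp snoc.hyps by (auto simp: paths_from_def)
      have j: "?j \<in> verts Q" "\<alpha> \<in> in_arcs Q ?j" using snoc.hyps by auto
      have jS: "?j \<notin> S"
        using predecessor_closed_path[OF S(2) paths_from_subset(2)[OF rp]] fp i(2) by auto
      \<comment> \<open>Ranks increase along the arrows, so a nontrivial path does not return to i;
        hence the expansion at its end has no trivial term.\<close>
      have ji: "?j \<noteq> i"
        using vert_rank_path[OF snoc.hyps(1)] vert_rank_less[OF snoc.hyps(2)] snoc.hyps(3) fp by auto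
      obtain y where y: "\<And>\<beta>. \<beta> \<in> in_arcs Q ?j \<Longrightarrow> y \<beta> \<in> carrier (Rep X (tail Q \<beta>))"
        "\<And>\<beta>. \<beta> \<in> in_arcs Q ?j \<Longrightarrow> y \<beta> \<in> ?F"
        "vert_el ?j \<odot>\<^bsub>X\<^esub> ?\<Gamma> u = (\<Oplus>\<^bsub>X\<^esub>\<beta>\<in>in_arcs Q ?j. arrow_el \<beta> \<odot>\<^bsub>X\<^esub> y \<beta>)"
        by (rule generated_submodule_outside[OF mem S(1) j(1) jS]) blast
      \<comment> \<open>The projection to the tail of \<beta> places
        \<open>\<Gamma> (v \<beta>)\<close> in the space where monicity can compare it with
        \<open>y \<beta>\<close>.\<close>
      define v where "v \<beta> = vert_el (tail Q \<beta>) \<odot>\<^bsub>?I\<^esub> ind_strip {i} ?M \<beta> u" for \<beta>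
      have vI: "v \<beta> \<in> carrier ?I" if "\<beta> \<in> in_arcs Q ?j" for \<beta>
        unfolding v_def by (rule I.smult_closed[OF path_el_closed strip[OF that u]])
      have gv: "?\<Gamma> (v \<beta>) = vert_el (tail Q \<beta>) \<odot>\<^bsub>X\<^esub> ?\<Gamma> (ind_strip {i} ?M \<beta> u)" if "\<beta> \<in> in_arcs Q ?j" for \<beta>
        unfolding v_def by (rule mod_homD(3)[OF \<Gamma>(1) path_el_closed strip[OF that u]])
      have gvR: "?\<Gamma> (v \<beta>) \<in> carrier (Rep X (tail Q \<beta>))" if "\<beta> \<in> in_arcs Q ?j" for \<beta>
        unfolding gv[OF that] by (rule rep_memI[OF X \<Gamma>c[OF strip[OF that u]]])
      have z: "?\<Gamma> (ind_single {i} ?M (trivial_path ?j) \<zero>\<^bsub>?M\<^esub>) = \<zero>\<^bsub>X\<^esub>"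
        using ind_single_hom(4)[OF M V.M.zero_closed V.M.zero_closed]
          mod_hom_zero[OF left_module_induced[OF M] X \<Gamma>(1)] by simp
      have t: "(\<lambda>\<beta>. arrow_el \<beta> \<odot>\<^bsub>X\<^esub> ?\<Gamma> (ind_strip {i} ?M \<beta> u)) \<in> in_arcs Q ?j \<rightarrow> carrier X"
        by (rule arrow_sum_terms(2)[OF X \<Gamma>c[OF strip[OF _ u]]])
      have "vert_el ?j \<odot>\<^bsub>X\<^esub> ?\<Gamma> u = (\<Oplus>\<^bsub>X\<^esub>\<beta>\<in>in_arcs Q ?j. arrow_el \<beta> \<odot>\<^bsub>X\<^esub> ?\<Gamma> (ind_strip {i} ?M \<beta> u))"
        using step[OF u j(1)] ji z X.M.finsum_closed[OF t] by simp
      also have "\<dots> = (\<Oplus>\<^bsub>X\<^esub>\<beta>\<in>in_arcs Q ?j. arrow_el \<beta> \<odot>\<^bsub>X\<^esub> ?\<Gamma> (v \<beta>))"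
      proof (rule X.M.finsum_cong'[OF refl])
        show "(\<lambda>\<beta>. arrow_el \<beta> \<odot>\<^bsub>X\<^esub> ?\<Gamma> (v \<beta>)) \<in> in_arcs Q ?j \<rightarrow> carrier X"
          by (rule arrow_sum_terms(2)[OF X \<Gamma>c[OF vI]])
        fix \<beta> assume \<beta>: "\<beta> \<in> in_arcs Q ?j"
        show "arrow_el \<beta> \<odot>\<^bsub>X\<^esub> ?\<Gamma> (ind_strip {i} ?M \<beta> u) = arrow_el \<beta> \<odot>\<^bsub>X\<^esub> ?\<Gamma> (v \<beta>)"
          unfolding gv[OF \<beta>] by (rule arrow_tail[OF X in_arcsD(1)[OF \<beta>] \<Gamma>c[OF strip[OF \<beta> u]]])
      qed
      finally have eq: "(\<Oplus>\<^bsub>X\<^esub>\<beta>\<in>in_arcs Q ?j. arrow_el \<beta> \<odot>\<^bsub>X\<^esub> ?\<Gamma> (v \<beta>)) =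
          (\<Oplus>\<^bsub>X\<^esub>\<beta>\<in>in_arcs Q ?j. arrow_el \<beta> \<odot>\<^bsub>X\<^esub> y \<beta>)" using y(3) by simp
      have "?\<Gamma> (v \<alpha>) = y \<alpha>"
        by (rule mon[unfolded monic_rep_iff[OF X], rule_format, OF j(1) gvR y(1) eq j(2)])
      then have "?\<Gamma> (v \<alpha>) \<in> ?F" using y(2)[OF j(2)] by simp
      then have "v \<alpha> p \<in> Incoming X i" using snoc.IH vI[OF j(2)] pf by blast
      moreover have "v \<alpha> p = u (path_snoc Q p \<alpha>)"
        unfolding v_def induced_vert[OF M strip[OF j(2) u] pf]
        using snoc.hyps pf by (simp add: ind_strip_def)
      ultimately show "u (path_snoc Q p \<alpha>) \<in> Incoming X i" by simp
    qed
  qed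
  then show ?thesis using u p mem by blast
qed

text \<open>An instance of \<open>gorenstein_projective_extension\<close>: \<open>U\<close> is
  induced from the whole space \<open>X_i\<close>, \<Gamma> is the adjoint of its inclusion, and the
  map into the resolution is induced from \<open>X_i\<close> modulo the incoming images. The induced
  cokernel itself need not be formed.\<close>

lemma gorenstein_projective_generated_insert:
  assumes mon: "monic_rep Q (rep_space K A Q X) (rep_map K A Q X)"
    and S: "S \<subseteq> verts Q" "predecessor_closed S" and i: "i \<in> verts Q" "i \<notin> S"
    and pre: "\<And>\<alpha>. \<alpha> \<in> in_arcs Q i \<Longrightarrow> tail Q \<alpha> \<in> S"
    and G: "gorenstein_projective L (restrict_carrier X (generated_submodule X S))"
    and GQ: "gorenstein_projective A (quotient_module (Rep X i) (Incoming X i))"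
  shows "gorenstein_projective L (restrict_carrier X (generated_submodule X (insert i S)))"
proof -
  let ?M = "Rep X i" and ?\<Gamma> = "ind_hom X i (\<lambda>x. x)"
  let ?F = "generated_submodule X S" and ?F' = "generated_submodule X (insert i S)"
  let ?I = "Ind {i} ?M" and ?X' = "restrict_carrier X ?F'"
  note M = left_module_rep[OF X i(1)]
  note F = generated_submodule(1)[of S] and F' = generated_submodule(1)[of "insert i S"]
  note FD = left_submoduleD[OF F] and F'D = left_submoduleD[OF F']
  note Inc = Incoming_submodule[OF X i(1)]
  note I = left_module_induced[OF M]
  interpret I: left_module L ?I by (rule I)
  have id: "(\<lambda>x. x) \<in> mod_hom A ?M ?M" by (simp add: mod_hom_def)
  note \<Gamma> = ind_hom[OF X M i(1) id]
  have FF': "x \<in> ?F'" if "x \<in> ?F" for x by (rule generated_submodule_mono[OF _ that]) blast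
  have X': "left_module L ?X'" by (rule left_module_restrict[OF X F'])
  have F_X': "left_submodule L ?X' ?F" using FD FF' by (simp add: left_submodule_def subset_iff)
  have \<Gamma>F': "?\<Gamma> u \<in> ?F'" if u: "u \<in> carrier ?I" for u
    by (rule ind_hom_incl_generated[OF i(1) F' u]) (use generated_submodule(2)[of i "insert i S"] induced_closed[OF u] in blast)
  have \<Gamma>': "?\<Gamma> \<in> mod_hom L ?I ?X'" by (rule mod_hom_restrict_carrier(2)[OF \<Gamma>(1) \<Gamma>F'])
  obtain P :: "int \<Rightarrow> ('c, nat \<Rightarrow> 'c) module" and d \<iota> where res: "complete_resolution A P d"
    and \<iota>: "\<iota> \<in> mod_hom A (quotient_module ?M (Incoming X i)) (P 0)"
      "inj_on \<iota> (carrier (quotient_module ?M (Incoming X i)))"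
      "\<iota> ` carrier (quotient_module ?M (Incoming X i)) = {x \<in> carrier (P 0). d 0 x = \<zero>\<^bsub>P 1\<^esub>}"
    using gorenstein_projectiveE[OF GQ] .
  interpret P: complete_resolution A P d by (rule res)
  note m = P.left_module_terms
  note q = quotient_module_facts[OF M Inc]
  \<comment> \<open>The projection to the cokernel followed by its embedding into the complete
    \<open>A\<close>-resolution.\<close>
  define \<eta> where "\<eta> x = \<iota> (Incoming X i +>\<^bsub>?M\<^esub> x)" for x
  have \<eta>: "\<eta> \<in> mod_hom A ?M (P 0)" unfolding \<eta>_def by (rule mod_hom_comp[OF q(2) \<iota>(1)])
  have \<eta>0: "\<eta> x = \<zero>\<^bsub>P 0\<^esub> \<longleftrightarrow> x \<in> Incoming X i" if x: "x \<in> carrier ?M" for x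
  proof -
    have "\<eta> x = \<zero>\<^bsub>P 0\<^esub> \<longleftrightarrow> Incoming X i +>\<^bsub>?M\<^esub> x = \<zero>\<^bsub>quotient_module ?M (Incoming X i)\<^esub>"
      unfolding \<eta>_def
      using mod_hom_inj_zero[OF left_module_quotient[OF M Inc] m \<iota>(1,2) mod_homD(1)[OF q(2) x]]
        mod_hom_zero[OF left_module_quotient[OF M Inc] m \<iota>(1)] by auto
    then show ?thesis using q(3) q(5)[OF x] by simp
  qed
  have \<eta>_im: "\<eta> ` carrier ?M = {x \<in> carrier (P 0). d 0 x = \<zero>\<^bsub>P 1\<^esub>}"
    unfolding \<iota>(3)[symmetric] q(1) \<eta>_def by (simp add: image_image)
  have hom: "ind_map {i} \<eta> \<in> mod_hom L ?I (Ind {i} (P 0))" by (rule ind_map_hom[OF M m \<eta>])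
  have "gorenstein_projective L ?X'"
  proof (rule gorenstein_projective_extension[OF X' F_X' _ complete_resolution_induced[OF res i(1)] I \<Gamma>' hom])
    show "gorenstein_projective L (restrict_carrier ?X' ?F)" using G by (simp add: restrict_carrier_def)
    show "\<exists>x\<in>?F. \<exists>u\<in>carrier ?I. z = x \<oplus>\<^bsub>?X'\<^esub> ?\<Gamma> u" if "z \<in> carrier ?X'" for z
    proof -
      \<comment> \<open>These sums form an \<open>L\<close>-submodule containing every generating
        space: those at \<open>S\<close> lie in \<open>X_S\<close>, the one at i consists of the
        values of \<Gamma> on \<open>e_i \<otimes> x\<close>.\<close>
      let ?N = "{x \<oplus>\<^bsub>X\<^esub> ?\<Gamma> u | x u. x \<in> ?F \<and> u \<in> carrier ?I}"
      have \<Gamma>0: "?\<Gamma> \<zero>\<^bsub>?I\<^esub> = \<zero>\<^bsub>X\<^esub>" by (rule mod_hom_zero[OF I X \<Gamma>(1)])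
      note \<Gamma>c = mod_homD(1)[OF \<Gamma>(1)]
      have "left_submodule L X ?N"
        unfolding left_submodule_def
      proof (intro conjI ballI subsetI)
        fix z assume "z \<in> ?N"
        then obtain x u where z: "z = x \<oplus>\<^bsub>X\<^esub> ?\<Gamma> u" "x \<in> ?F" "u \<in> carrier ?I" by blast
        show "z \<in> carrier X" using z FD(1) \<Gamma>c by simp
        show "l \<odot>\<^bsub>X\<^esub> z \<in> ?N" if l: "l \<in> carrier L" for l
          using z FD(1)[OF z(2)] FD(4)[OF l z(2)] \<Gamma>c[OF z(3)] mod_homD(3)[OF \<Gamma>(1) l z(3)] l
          by (intro CollectI exI[of _ "l \<odot>\<^bsub>X\<^esub> x"] exI[of _ "l \<odot>\<^bsub>?I\<^esub> u"]) (simp add: X.smult_r_distr)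
        fix z' assume "z' \<in> ?N"
        then obtain x' u' where z': "z' = x' \<oplus>\<^bsub>X\<^esub> ?\<Gamma> u'" "x' \<in> ?F" "u' \<in> carrier ?I" by blast
        have "z \<oplus>\<^bsub>X\<^esub> z' = (x \<oplus>\<^bsub>X\<^esub> x') \<oplus>\<^bsub>X\<^esub> ?\<Gamma> (u \<oplus>\<^bsub>?I\<^esub> u')"
          using z z' FD(1)[OF z(2)] FD(1)[OF z'(2)] \<Gamma>c[OF z(3)] \<Gamma>c[OF z'(3)] mod_homD(2)[OF \<Gamma>(1) z(3) z'(3)]
          by (simp add: X.M.add.m_ac)
        then show "z \<oplus>\<^bsub>X\<^esub> z' \<in> ?N"
          using FD(3)[OF z(2) z'(2)] I.M.add.m_closed[OF z(3) z'(3)] by blast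
      next
        show "\<zero>\<^bsub>X\<^esub> \<in> ?N"
          using FD(2) \<Gamma>0 by (intro CollectI exI[of _ "\<zero>\<^bsub>X\<^esub>"] exI[of _ "\<zero>\<^bsub>?I\<^esub>"]) simp
      qed
      then have "z \<in> ?N"
      proof (rule generated_submodule(3))
        fix j x assume j: "j \<in> insert i S" and x: "x \<in> carrier (Rep X j)"
        show "x \<in> ?N"
        proof (cases "j = i")
          case True
          then have "x = \<zero>\<^bsub>X\<^esub> \<oplus>\<^bsub>X\<^esub> ?\<Gamma> (ind_single {i} ?M (trivial_path i) x)"
            using \<Gamma>(2)[of x] x rep_carrier[OF X x] by simp
          then show ?thesis using FD(2) ind_single_closed[OF M, of x] x True by blast
        next
          case False
          then have "x \<in> ?F" using generated_submodule(2)[of j S x] j x by blast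
          then show ?thesis using \<Gamma>0 FD(1)
            by (intro CollectI exI[of _ x] exI[of _ "\<zero>\<^bsub>?I\<^esub>"]) simp
        qed
      next
        show "z \<in> generated_submodule X (insert i S)" using that by simp
      qed
      then show ?thesis by auto
    qed
    \<comment> \<open>Monicity gives one direction. The other holds because all tails of arrows into
      i belong to \<open>S\<close>, so that the incoming images at i lie in
      \<open>X_S\<close>.\<close>
    show "?\<Gamma> u \<in> ?F \<longleftrightarrow> ind_map {i} \<eta> u = \<zero>\<^bsub>Ind {i} (P 0)\<^esub>" if u: "u \<in> carrier ?I" for u
    proof
      assume mem: "?\<Gamma> u \<in> ?F"
      show "ind_map {i} \<eta> u = \<zero>\<^bsub>Ind {i} (P 0)\<^esub>"
      proof (rule induced_eqI[OF mod_homD(1)[OF hom u] induced_zero_closed[OF m]])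
        fix p assume p: "p \<in> paths_from Q {i}"
        have "u p \<in> Incoming X i" by (rule ind_hom_mem_generated[OF mon S i u mem p])
        then show "ind_map {i} \<eta> u p = \<zero>\<^bsub>Ind {i} (P 0)\<^esub> p"
          using \<eta>0[OF induced_closed[OF u p]] p by (simp add: ind_map_apply induced_apply(1))
      qed
    next
      assume 0: "ind_map {i} \<eta> u = \<zero>\<^bsub>Ind {i} (P 0)\<^esub>"
      show "?\<Gamma> u \<in> ?F"
      proof (rule ind_hom_incl_generated[OF i(1) F u])
        fix p assume p: "p \<in> paths_from Q {i}"
        have "\<eta> (u p) = \<zero>\<^bsub>P 0\<^esub>" using fun_cong[OF 0, of p] p by (simp add: ind_map_apply induced_apply(1))
        then have "u p \<in> Incoming X i" using \<eta>0[OF induced_closed[OF u p]] by simp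
        then obtain y where y: "\<And>\<alpha>. \<alpha> \<in> in_arcs Q i \<Longrightarrow> y \<alpha> \<in> carrier (Rep X (tail Q \<alpha>))"
          "u p = (\<Oplus>\<^bsub>X\<^esub>\<alpha>\<in>in_arcs Q i. arrow_el \<alpha> \<odot>\<^bsub>X\<^esub> y \<alpha>)" by (rule IncomingE[OF X i(1)]) blast
        show "u p \<in> ?F"
          unfolding y(2)
        proof (rule left_submodule_finsum[OF X F], rule Pi_I)
          fix \<alpha> assume \<alpha>: "\<alpha> \<in> in_arcs Q i"
          show "arrow_el \<alpha> \<odot>\<^bsub>X\<^esub> y \<alpha> \<in> ?F"
            by (rule FD(4)[OF path_el_closed generated_submodule(2)[OF pre[OF \<alpha>] y(1)[OF \<alpha>]]])
        qed
      qed
    qed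
    show "ind_map {i} \<eta> ` carrier ?I =
        {c \<in> carrier (Ind {i} (P 0)). ind_map {i} (d 0) c = \<zero>\<^bsub>Ind {i} (P 1)\<^esub>}" (is "?l = ?r")
    proof
      show "?l \<subseteq> ?r"
      proof
        fix c assume "c \<in> ?l"
        then obtain u where u: "u \<in> carrier ?I" "c = ind_map {i} \<eta> u" by blast
        have c: "c \<in> carrier (Ind {i} (P 0))" unfolding u(2) by (rule mod_homD(1)[OF hom u(1)])
        have d0: "d 0 \<in> mod_hom A (P 0) (P 1)" using P.d_hom[of 0] by simp
        have "ind_map {i} (d 0) c = \<zero>\<^bsub>Ind {i} (P 1)\<^esub>"
        proof (rule induced_eqI[OF mod_homD(1)[OF ind_map_hom[OF m m d0] c] induced_zero_closed[OF m]])
          fix r assume r: "r \<in> paths_from Q {i}"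
          have "\<eta> (u r) \<in> {x \<in> carrier (P 0). d 0 x = \<zero>\<^bsub>P 1\<^esub>}"
            unfolding \<eta>_im[symmetric] using induced_closed[OF u(1) r] by blast
          then show "ind_map {i} (d 0) c r = \<zero>\<^bsub>Ind {i} (P 1)\<^esub> r"
            using r by (simp add: u(2) ind_map_apply induced_apply(1))
        qed
        then show "c \<in> ?r" using c by blast
      qed
      show "?r \<subseteq> ?l"
      proof
        fix c assume "c \<in> ?r"
        then have c: "c \<in> carrier (Ind {i} (P 0))" and 0: "ind_map {i} (d 0) c = \<zero>\<^bsub>Ind {i} (P 1)\<^esub>" by blast+
        have "\<exists>x. r \<in> paths_from Q {i} \<longrightarrow> x \<in> carrier ?M \<and> c r = \<eta> x" for r
        proof (cases "r \<in> paths_from Q {i}")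
          case r: True
          have "c r \<in> \<eta> ` carrier ?M"
            unfolding \<eta>_im using fun_cong[OF 0, of r] r induced_closed[OF c r]
            by (simp add: ind_map_apply induced_apply(1))
          then show ?thesis by blast
        qed simp
        then obtain x where x: "\<And>r. r \<in> paths_from Q {i} \<Longrightarrow> x r \<in> carrier ?M"
          "\<And>r. r \<in> paths_from Q {i} \<Longrightarrow> c r = \<eta> (x r)" by metis
        have u: "restrict x (paths_from Q {i}) \<in> carrier ?I" by (rule induced_memI) (rule x(1))
        have "c = ind_map {i} \<eta> (restrict x (paths_from Q {i}))"
          by (rule induced_eqI[OF c mod_homD(1)[OF hom u]]) (simp add: ind_map_apply x(2))
        then show "c \<in> ?l" using u by blast
      qed
    qed
  qed
  then show ?thesis .
qed

theorem monic_rep_gorenstein_projective: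
  assumes mon: "monic_rep Q (rep_space K A Q X) (rep_map K A Q X)"
    and G: "\<And>i. i \<in> verts Q \<Longrightarrow> gorenstein_projective A (quotient_module (Rep X i) (Incoming X i))"
  shows "gorenstein_projective L X"
proof -
  have "gorenstein_projective L (restrict_carrier X (generated_submodule X S))"
    if "S \<subseteq> verts Q" "predecessor_closed S" for S
    using finite_subset[OF that(1) finite_verts] that
  proof (induction "card S" arbitrary: S)
    case 0
    then have S: "S = {}" by simp
    note F = generated_submodule(1)[of "{}"]
    show ?case
      unfolding S by (rule gorenstein_projective_trivial[OF left_module_restrict[OF X F]])
        (simp add: generated_submodule_empty)
  next
    case (Suc n)
    note fin = Suc.prems(1) and sub = Suc.prems(2) and pc = Suc.prems(3)
    have ne: "S \<noteq> {}" using Suc.hyps(2) by auto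
    \<comment> \<open>A vertex of maximal rank in \<open>S\<close> is not the tail of an arrow with
      head in \<open>S\<close>; its removal keeps \<open>S\<close> closed under
      predecessors.\<close>
    have "Max (vert_rank ` S) \<in> vert_rank ` S" using fin ne by (intro Max_in) auto
    then obtain i where i: "i \<in> S" "vert_rank i = Max (vert_rank ` S)" by auto
    have max: "vert_rank j \<le> vert_rank i" if "j \<in> S" for j using that i(2) fin by simp
    have no: "tail Q \<alpha> \<noteq> i" if "\<alpha> \<in> arcs Q" "head Q \<alpha> \<in> S" for \<alpha>
      using vert_rank_less[OF that(1)] max[OF that(2)] by auto
    have pc': "predecessor_closed (S - {i})"
      using pc no by (auto simp: predecessor_closed_def)
    have G': "gorenstein_projective L (restrict_carrier X (generated_submodule X (S - {i})))"
      by (rule Suc.hyps(1)) (use Suc.hyps(2) i(1) fin sub pc' in auto)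
    have iQ: "i \<in> verts Q" "i \<notin> S - {i}" and sub': "S - {i} \<subseteq> verts Q" using sub i(1) by auto
    have pre: "tail Q \<alpha> \<in> S - {i}" if "\<alpha> \<in> in_arcs Q i" for \<alpha>
      using pc no[of \<alpha>] in_arcsD[OF that] i(1) by (auto simp: predecessor_closed_def)
    have "gorenstein_projective L (restrict_carrier X (generated_submodule X (insert i (S - {i}))))"
      by (rule gorenstein_projective_generated_insert[OF mon sub' pc' iQ pre G' G[OF iQ(1)]])
    then show ?case using i(1) by (simp add: insert_absorb)
  qed
  then have "gorenstein_projective L (restrict_carrier X (generated_submodule X (verts Q)))"
    by (simp add: predecessor_closed_def)
  then show ?thesis by (simp add: generated_submodule_verts restrict_carrier_def)
qed

end

end

section \<open>Stripping arrows in the path algebra\<close>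

text \<open>The mirror image of \<open>path_snoc\<close>: right multiplication by an arrow inserts
  it as the first one traversed.\<close>

definition path_cons :: "('v, 'e) pre_digraph \<Rightarrow> 'e \<Rightarrow> ('v, 'e) path \<Rightarrow> ('v, 'e) path" where
  "path_cons Q \<alpha> q = (tail Q \<alpha>, \<alpha> # fst (snd q), path_end q)"

context acyclic_quiver
begin

lemma path_cons_in_paths:
  "q \<in> paths Q \<Longrightarrow> \<alpha> \<in> arcs Q \<Longrightarrow> fst q = head Q \<alpha> \<Longrightarrow> path_cons Q \<alpha> q \<in> paths Q"
  by (cases q) (auto simp: path_cons_def paths_def awalk_Cons_iff)

lemma path_cons_cases [consumes 1, case_names trivial cons]:
  assumes "r \<in> paths Q"
  obtains j where "j \<in> verts Q" "r = trivial_path j"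
  | q \<alpha> where "q \<in> paths Q" "\<alpha> \<in> arcs Q" "fst q = head Q \<alpha>" "r = path_cons Q \<alpha> q"
proof -
  obtain u p v where r: "r = (u, p, v)" by (metis surj_pair)
  then have p: "awalk u p v" using assms by (simp add: paths_def)
  show thesis
  proof (cases p)
    case Nil
    have "u = v" "u \<in> verts Q" using p unfolding Nil awalk_Nil_iff by blast+
    then show thesis using that(1)[of u] r Nil by (simp add: trivial_path_def)
  next
    case (Cons \<alpha> p')
    have "\<alpha> \<in> arcs Q" "u = tail Q \<alpha>" "awalk (head Q \<alpha>) p' v" using p unfolding Cons awalk_Cons_iff by blast+
    then show thesis using that(2)[of "(head Q \<alpha>, p', v)" \<alpha>] r Cons by (simp add: paths_def path_cons_def)
  qed
qed

lemma path_cons_simps: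
  "fst (path_cons Q \<alpha> q) = tail Q \<alpha>" "path_end (path_cons Q \<alpha> q) = path_end q"
  "path_cons Q \<alpha> q \<noteq> trivial_path j"
  "path_cons Q \<alpha> (path_snoc Q q \<beta>) = path_snoc Q (path_cons Q \<alpha> q) \<beta>"
  "path_cons Q \<alpha> (trivial_path (head Q \<alpha>)) = path_snoc Q (trivial_path (tail Q \<alpha>)) \<alpha>"
  by (auto simp: path_cons_def path_snoc_def trivial_path_def)

lemma path_cons_inj:
  assumes "path_cons Q \<alpha> q = path_cons Q \<beta> q'" "fst q = head Q \<alpha>" "fst q' = head Q \<beta>"
  shows "\<alpha> = \<beta>" "q = q'"
  using assms by (auto simp: path_cons_def prod_eq_iff)

lemma factorizations_trivial_right:
  "(q, trivial_path i) \<in> factorizations Q r \<longleftrightarrow> q = r \<and> r \<in> paths Q \<and> fst r = i"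
  by (cases r, cases q) (auto simp: factorizations_def trivial_path_def paths_def awalk_Nil_iff)

lemma factorizations_arrow_right:
  "\<alpha> \<in> arcs Q \<Longrightarrow> (q, arrow_path Q \<alpha>) \<in> factorizations Q r \<longleftrightarrow>
    q \<in> paths Q \<and> fst q = head Q \<alpha> \<and> r = path_cons Q \<alpha> q"
  by (cases r, cases q) (auto simp: factorizations_def arrow_path_def path_cons_def paths_def awalk_simps)

end

context quiver_algebra
begin

section \<open>Right multiplication and cutting off first arrows\<close>

lemma L_mult_path_right:
  assumes l: "l \<in> carrier L" and r: "r \<in> paths Q"
  shows "(q, p) \<in> factorizations Q r \<Longrightarrow> (\<And>q'. (q', p) \<in> factorizations Q r \<Longrightarrow> q' = q) \<Longrightarrow> (l \<otimes>\<^bsub>L\<^esub> path_el p) r = l q"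
    "(\<And>q. (q, p) \<notin> factorizations Q r) \<Longrightarrow> (l \<otimes>\<^bsub>L\<^esub> path_el p) r = \<zero>\<^bsub>A\<^esub>"
proof -
  have fp: "fst z \<in> paths Q" "snd z \<in> paths Q" if "z \<in> factorizations Q r" for z
    using that factorizations_paths[of "fst z" "snd z" r] by (cases z; simp)+
  have 0: "l (fst z) \<otimes>\<^bsub>A\<^esub> path_el p (snd z) = \<zero>\<^bsub>A\<^esub>" if "z \<in> factorizations Q r" "snd z \<noteq> p" for z
    using fp[OF that(1)] that(2) l by (simp add: path_el_apply)
  show "(l \<otimes>\<^bsub>L\<^esub> path_el p) r = l q"
    if q: "(q, p) \<in> factorizations Q r" and u: "\<And>q'. (q', p) \<in> factorizations Q r \<Longrightarrow> q' = q"
  proof -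
    have "(\<Oplus>\<^bsub>A\<^esub>z\<in>factorizations Q r. l (fst z) \<otimes>\<^bsub>A\<^esub> path_el p (snd z)) =
        l (fst (q, p)) \<otimes>\<^bsub>A\<^esub> path_el p (snd (q, p))"
    proof (rule A.finsum_delta[of _ _ "\<lambda>z. l (fst z) \<otimes>\<^bsub>A\<^esub> path_el p (snd z)", OF finite_factorizations q])
      show "l (fst (q, p)) \<otimes>\<^bsub>A\<^esub> path_el p (snd (q, p)) \<in> carrier A" using fp[OF q] l by simp
      fix z assume z: "z \<in> factorizations Q r" "z \<noteq> (q, p)"
      then have "snd z \<noteq> p" using u[of "fst z"] by (cases z) auto
      then show "l (fst z) \<otimes>\<^bsub>A\<^esub> path_el p (snd z) = \<zero>\<^bsub>A\<^esub>" by (rule 0[OF z(1)])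
    qed
    then show ?thesis using fp[OF q] l by (simp add: mult_L[OF r] path_el_apply)
  qed
  show "(l \<otimes>\<^bsub>L\<^esub> path_el p) r = \<zero>\<^bsub>A\<^esub>" if n: "\<And>q. (q, p) \<notin> factorizations Q r"
  proof -
    have "(\<Oplus>\<^bsub>A\<^esub>z\<in>factorizations Q r. l (fst z) \<otimes>\<^bsub>A\<^esub> path_el p (snd z)) = (\<Oplus>\<^bsub>A\<^esub>z\<in>factorizations Q r. \<zero>\<^bsub>A\<^esub>)"
    proof (rule A.finsum_cong'[OF refl])
      fix z assume z: "z \<in> factorizations Q r"
      then have "snd z \<noteq> p" using n[of "fst z"] by (cases z) auto
      then show "l (fst z) \<otimes>\<^bsub>A\<^esub> path_el p (snd z) = \<zero>\<^bsub>A\<^esub>" by (rule 0[OF z])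
    qed simp
    then show ?thesis by (simp add: mult_L[OF r])
  qed
qed

lemma L_right_mult:
  assumes l: "l \<in> carrier L" and r: "r \<in> paths Q"
  shows "(l \<otimes>\<^bsub>L\<^esub> vert_el i) r = (if fst r = i then l r else \<zero>\<^bsub>A\<^esub>)"
    "\<alpha> \<in> arcs Q \<Longrightarrow> q \<in> paths Q \<Longrightarrow> fst q = head Q \<alpha> \<Longrightarrow> r = path_cons Q \<alpha> q \<Longrightarrow> (l \<otimes>\<^bsub>L\<^esub> arrow_el \<alpha>) r = l q"
    "\<alpha> \<in> arcs Q \<Longrightarrow> (\<And>q. fst q = head Q \<alpha> \<Longrightarrow> r \<noteq> path_cons Q \<alpha> q) \<Longrightarrow> (l \<otimes>\<^bsub>L\<^esub> arrow_el \<alpha>) r = \<zero>\<^bsub>A\<^esub>"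
proof -
  show "(l \<otimes>\<^bsub>L\<^esub> vert_el i) r = (if fst r = i then l r else \<zero>\<^bsub>A\<^esub>)"
  proof (cases "fst r = i")
    case True
    then show ?thesis
      using L_mult_path_right(1)[OF l r, of r "trivial_path i"] r by (simp add: factorizations_trivial_right)
  next
    case False
    then show ?thesis
      using L_mult_path_right(2)[OF l r, of "trivial_path i"] by (simp add: factorizations_trivial_right)
  qed
  show "(l \<otimes>\<^bsub>L\<^esub> arrow_el \<alpha>) r = l q"
    if \<alpha>: "\<alpha> \<in> arcs Q" and q: "q \<in> paths Q" "fst q = head Q \<alpha>" "r = path_cons Q \<alpha> q"
  proof (rule L_mult_path_right(1)[OF l r])
    show "(q, arrow_path Q \<alpha>) \<in> factorizations Q r" using q factorizations_arrow_right[OF \<alpha>] by blast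
    fix q' assume "(q', arrow_path Q \<alpha>) \<in> factorizations Q r"
    then have "fst q' = head Q \<alpha>" "r = path_cons Q \<alpha> q'" using factorizations_arrow_right[OF \<alpha>] by blast+
    then show "q' = q" using q path_cons_inj(2)[of \<alpha> q' \<alpha> q] by simp
  qed
  show "(l \<otimes>\<^bsub>L\<^esub> arrow_el \<alpha>) r = \<zero>\<^bsub>A\<^esub>"
    if \<alpha>: "\<alpha> \<in> arcs Q" and n: "\<And>q. fst q = head Q \<alpha> \<Longrightarrow> r \<noteq> path_cons Q \<alpha> q"
    by (rule L_mult_path_right(2)[OF l r]) (use n factorizations_arrow_right[OF \<alpha>] in blast)
qed

text \<open>A trivial path factors only as its own square. The coefficient at it is thus
  multiplicative: it is the augmentation of \<open>L\<close> at i.\<close>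

lemma L_mult_trivial:
  assumes l: "l \<in> carrier L" "l' \<in> carrier L" and i: "i \<in> verts Q"
  shows "(l \<otimes>\<^bsub>L\<^esub> l') (trivial_path i) = l (trivial_path i) \<otimes>\<^bsub>A\<^esub> l' (trivial_path i)"
proof -
  have t: "trivial_path i \<in> paths Q" using i by simp
  have "factorizations Q (trivial_path i) = {(trivial_path i, trivial_path i)}"
    using t by (auto simp: factorizations_def trivial_path_def paths_def awalk_Nil_iff)
  then show ?thesis using l t by (simp add: mult_L)
qed

text \<open>Division by \<alpha> from the right: of the part of an element whose paths begin with
  \<alpha>, it returns the left factor.\<close>

definition costrip where
  "costrip \<alpha> l = (\<lambda>q\<in>paths Q. if fst q = head Q \<alpha> then l (path_cons Q \<alpha> q) else \<zero>\<^bsub>A\<^esub>)"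

lemma costrip_closed:
  assumes l: "l \<in> carrier L" and \<alpha>: "\<alpha> \<in> arcs Q" shows "costrip \<alpha> l \<in> carrier L"
  unfolding carrier_L costrip_def
  using L_closed[OF l path_cons_in_paths[OF _ \<alpha>]] by (auto simp del: split_paired_All)

text \<open>Cutting at the front commutes with left multiplication, which works at the back, except
  near a trivial path: multiplied by \<alpha>, the trivial path at the tail of \<alpha> becomes a
  path that can be cut. Hence the condition on that coefficient in the clause for arrows.\<close>

lemma costrip_left_mult:
  assumes l: "l \<in> carrier L" and \<alpha>: "\<alpha> \<in> arcs Q"
  shows "l' \<in> carrier L \<Longrightarrow> costrip \<alpha> (l \<oplus>\<^bsub>L\<^esub> l') = costrip \<alpha> l \<oplus>\<^bsub>L\<^esub> costrip \<alpha> l'"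
    and "a \<in> carrier A \<Longrightarrow> costrip \<alpha> (scal_el a \<otimes>\<^bsub>L\<^esub> l) = scal_el a \<otimes>\<^bsub>L\<^esub> costrip \<alpha> l"
    and "costrip \<alpha> (vert_el j \<otimes>\<^bsub>L\<^esub> l) = vert_el j \<otimes>\<^bsub>L\<^esub> costrip \<alpha> l"
    and "\<beta> \<in> arcs Q \<Longrightarrow> l (trivial_path (tail Q \<alpha>)) = \<zero>\<^bsub>A\<^esub> \<Longrightarrow>
      costrip \<alpha> (arrow_el \<beta> \<otimes>\<^bsub>L\<^esub> l) = arrow_el \<beta> \<otimes>\<^bsub>L\<^esub> costrip \<alpha> l"
    and "costrip \<alpha> \<zero>\<^bsub>L\<^esub> = \<zero>\<^bsub>L\<^esub>"
proof -
  note c = costrip_closed[OF _ \<alpha>]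
  have cp: "path_cons Q \<alpha> q \<in> paths Q" if "q \<in> paths Q" "fst q = head Q \<alpha>" for q
    by (rule path_cons_in_paths[OF that(1) \<alpha> that(2)])
  show "costrip \<alpha> (l \<oplus>\<^bsub>L\<^esub> l') = costrip \<alpha> l \<oplus>\<^bsub>L\<^esub> costrip \<alpha> l'" if l': "l' \<in> carrier L"
  proof (rule L_eqI)
    fix q assume q: "q \<in> paths Q"
    show "costrip \<alpha> (l \<oplus>\<^bsub>L\<^esub> l') q = (costrip \<alpha> l \<oplus>\<^bsub>L\<^esub> costrip \<alpha> l') q"
      using q cp[OF q] by (simp add: costrip_def add_L)
  qed (intro c L_add_closed l l')+
  show "costrip \<alpha> (scal_el a \<otimes>\<^bsub>L\<^esub> l) = scal_el a \<otimes>\<^bsub>L\<^esub> costrip \<alpha> l" if a: "a \<in> carrier A"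
  proof (rule L_eqI)
    fix q assume q: "q \<in> paths Q"
    show "costrip \<alpha> (scal_el a \<otimes>\<^bsub>L\<^esub> l) q = (scal_el a \<otimes>\<^bsub>L\<^esub> costrip \<alpha> l) q"
      unfolding L_left_mult(1)[OF c[OF l] a q]
      using q cp[OF q] a by (simp add: costrip_def L_left_mult(1)[OF l a])
  qed (intro c L_mult_closed scal_el_closed a l)+
  show "costrip \<alpha> (vert_el j \<otimes>\<^bsub>L\<^esub> l) = vert_el j \<otimes>\<^bsub>L\<^esub> costrip \<alpha> l"
  proof (rule L_eqI)
    fix q assume q: "q \<in> paths Q"
    show "costrip \<alpha> (vert_el j \<otimes>\<^bsub>L\<^esub> l) q = (vert_el j \<otimes>\<^bsub>L\<^esub> costrip \<alpha> l) q"
      unfolding L_left_mult(2)[OF c[OF l] q]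
      using q cp[OF q] by (simp add: costrip_def L_left_mult(2)[OF l] path_cons_simps)
  qed (intro c L_mult_closed path_el_closed l)+
  show "costrip \<alpha> \<zero>\<^bsub>L\<^esub> = \<zero>\<^bsub>L\<^esub>"
  proof (rule L_eqI)
    fix q assume q: "q \<in> paths Q"
    show "costrip \<alpha> \<zero>\<^bsub>L\<^esub> q = \<zero>\<^bsub>L\<^esub> q" using q cp[OF q] by (simp add: costrip_def zero_L)
  qed (intro c L_zero_closed)+
  assume \<beta>: "\<beta> \<in> arcs Q" and 0: "l (trivial_path (tail Q \<alpha>)) = \<zero>\<^bsub>A\<^esub>"
  show "costrip \<alpha> (arrow_el \<beta> \<otimes>\<^bsub>L\<^esub> l) = arrow_el \<beta> \<otimes>\<^bsub>L\<^esub> costrip \<alpha> l"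
  proof (rule L_eqI)
    fix q assume q: "q \<in> paths Q"
    note e = costrip_def[of \<alpha> "arrow_el \<beta> \<otimes>\<^bsub>L\<^esub> l"]
    show "costrip \<alpha> (arrow_el \<beta> \<otimes>\<^bsub>L\<^esub> l) q = (arrow_el \<beta> \<otimes>\<^bsub>L\<^esub> costrip \<alpha> l) q"
      using q
    proof (cases q rule: path_cases)
      case (trivial j)
      have rhs: "(arrow_el \<beta> \<otimes>\<^bsub>L\<^esub> costrip \<alpha> l) q = \<zero>\<^bsub>A\<^esub>"
        by (rule L_left_mult(4)[OF c[OF l] \<beta> q]) (simp add: trivial)
      show ?thesis
      proof (cases "j = head Q \<alpha>")
        case True
        have ta: "trivial_path (tail Q \<alpha>) \<in> paths Q" using \<alpha> by simp
        have pc: "path_cons Q \<alpha> q = path_snoc Q (trivial_path (tail Q \<alpha>)) \<alpha>"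
          unfolding trivial(2) True by (rule path_cons_simps(5))
        have pcp: "path_snoc Q (trivial_path (tail Q \<alpha>)) \<alpha> \<in> paths Q"
          by (rule path_snoc_in_paths[OF ta \<alpha>]) simp
        \<comment> \<open>Only for \<open>\<beta> = \<alpha>\<close> can this coefficient be
          nonzero, and then it is the coefficient of \<open>l\<close> at the trivial path, which is
          zero by assumption.\<close>
        have "(arrow_el \<beta> \<otimes>\<^bsub>L\<^esub> l) (path_snoc Q (trivial_path (tail Q \<alpha>)) \<alpha>) = \<zero>\<^bsub>A\<^esub>"
        proof (cases "\<beta> = \<alpha>")
          case True
          then show ?thesis using L_left_mult(3)[OF l \<alpha> ta] 0 by simp
        next
          case False
          show ?thesis
          proof (rule L_left_mult(4)[OF l \<beta> pcp])
            fix p :: "'d \<times> 'e list \<times> 'd" assume "path_end p = tail Q \<beta>"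
            then show "path_snoc Q (trivial_path (tail Q \<alpha>)) \<alpha> \<noteq> path_snoc Q p \<beta>"
              using path_snoc_inj(1)[of "trivial_path (tail Q \<alpha>)" \<alpha> p \<beta>] False by auto
          qed
        qed
        then show ?thesis using rhs q True trivial by (simp add: e pc[symmetric])
      next
        case False
        then show ?thesis using rhs q trivial by (simp add: e)
      qed
    next
      case (snoc p \<gamma>)
      show ?thesis
      proof (cases "fst q = head Q \<alpha>")
        case fq: True
        then have fp: "fst p = head Q \<alpha>" using snoc by simp
        have pp: "path_cons Q \<alpha> p \<in> paths Q" by (rule cp[OF snoc(1) fp])
        have lhs: "costrip \<alpha> (arrow_el \<beta> \<otimes>\<^bsub>L\<^esub> l) q = (arrow_el \<beta> \<otimes>\<^bsub>L\<^esub> l) (path_snoc Q (path_cons Q \<alpha> p) \<gamma>)"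
          using q fq snoc(4) by (simp add: e path_cons_simps(4)[symmetric])
        have pe: "path_end (path_cons Q \<alpha> p) = tail Q \<gamma>" using snoc(3) by (simp add: path_cons_simps)
        show ?thesis
        proof (cases "\<beta> = \<gamma>")
          case True
          have "(arrow_el \<gamma> \<otimes>\<^bsub>L\<^esub> l) (path_snoc Q (path_cons Q \<alpha> p) \<gamma>) = l (path_cons Q \<alpha> p)"
            by (rule L_left_mult(3)[OF l snoc(2) pp pe])
          moreover have "(arrow_el \<gamma> \<otimes>\<^bsub>L\<^esub> costrip \<alpha> l) (path_snoc Q p \<gamma>) = costrip \<alpha> l p"
            by (rule L_left_mult(3)[OF c[OF l] snoc(2,1,3)])
          moreover have "costrip \<alpha> l p = l (path_cons Q \<alpha> p)" using snoc(1) fp by (simp add: costrip_def)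
          ultimately show ?thesis using lhs True snoc(4) by simp
        next
          case False
          have "(arrow_el \<beta> \<otimes>\<^bsub>L\<^esub> l) (path_snoc Q (path_cons Q \<alpha> p) \<gamma>) = \<zero>\<^bsub>A\<^esub>"
          proof (rule L_left_mult(4)[OF l \<beta> path_snoc_in_paths[OF pp snoc(2) pe]])
            fix p' :: "'d \<times> 'e list \<times> 'd" assume "path_end p' = tail Q \<beta>"
            then show "path_snoc Q (path_cons Q \<alpha> p) \<gamma> \<noteq> path_snoc Q p' \<beta>"
              using path_snoc_inj(1)[of "path_cons Q \<alpha> p" \<gamma> p' \<beta>] pe False by auto
          qed
          moreover have "(arrow_el \<beta> \<otimes>\<^bsub>L\<^esub> costrip \<alpha> l) q = \<zero>\<^bsub>A\<^esub>"
          proof (rule L_left_mult(4)[OF c[OF l] \<beta> q])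
            fix p' :: "'d \<times> 'e list \<times> 'd" assume "path_end p' = tail Q \<beta>"
            then show "q \<noteq> path_snoc Q p' \<beta>"
              using path_snoc_inj(1)[of p \<gamma> p' \<beta>] snoc(3,4) False by auto
          qed
          ultimately show ?thesis using lhs by simp
        qed
      next
        case False
        have "(arrow_el \<beta> \<otimes>\<^bsub>L\<^esub> costrip \<alpha> l) q = \<zero>\<^bsub>A\<^esub>"
        proof (cases "\<beta> = \<gamma>")
          case True
          have "(arrow_el \<gamma> \<otimes>\<^bsub>L\<^esub> costrip \<alpha> l) (path_snoc Q p \<gamma>) = costrip \<alpha> l p"
            by (rule L_left_mult(3)[OF c[OF l] snoc(2,1,3)])
          then show ?thesis using True snoc False by (simp add: costrip_def)
        next
          case b: False
          show ?thesis
          proof (rule L_left_mult(4)[OF c[OF l] \<beta> q])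
            fix p' :: "'d \<times> 'e list \<times> 'd" assume "path_end p' = tail Q \<beta>"
            then show "q \<noteq> path_snoc Q p' \<beta>"
              using path_snoc_inj(1)[of p \<gamma> p' \<beta>] snoc(3,4) b by auto
          qed
        qed
        then show ?thesis using q False by (simp add: e)
      qed
    qed
  qed (intro c L_mult_closed path_el_closed l)+
qed

text \<open>A nontrivial path starting at i has a unique first arrow. This exhibits the arrow ideal
  inside \<open>L e_i\<close> as the sum of the \<open>L \<alpha>\<close>, with
  \<open>costrip\<close> as the coordinates.\<close>

lemma costrip_expansion:
  assumes l: "l \<in> carrier L" and li: "l \<otimes>\<^bsub>L\<^esub> vert_el i = l" and l0: "l (trivial_path i) = \<zero>\<^bsub>A\<^esub>"
  shows "l = (\<Oplus>\<^bsub>regular_module L\<^esub>\<alpha>\<in>out_arcs Q i. costrip \<alpha> l \<otimes>\<^bsub>L\<^esub> arrow_el \<alpha>)"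
  unfolding finsum_regular
proof (rule L_eqI[OF l])
  interpret L: ring L by (rule ring_L)
  have fin: "finite (out_arcs Q i)" by (rule finite_subset[OF _ finite_arcs]) auto
  have oa: "\<alpha> \<in> arcs Q" "tail Q \<alpha> = i" if "\<alpha> \<in> out_arcs Q i" for \<alpha> using that by auto
  have t: "(\<lambda>\<alpha>. costrip \<alpha> l \<otimes>\<^bsub>L\<^esub> arrow_el \<alpha>) \<in> out_arcs Q i \<rightarrow> carrier L"
    by (intro Pi_I L_mult_closed costrip_closed[OF l] path_el_closed oa(1))
  show "(\<Oplus>\<^bsub>L\<^esub>\<alpha>\<in>out_arcs Q i. costrip \<alpha> l \<otimes>\<^bsub>L\<^esub> arrow_el \<alpha>) \<in> carrier L" by (rule L.finsum_closed[OF t])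
  fix r assume r: "r \<in> paths Q"
  have S: "(\<Oplus>\<^bsub>L\<^esub>\<alpha>\<in>out_arcs Q i. costrip \<alpha> l \<otimes>\<^bsub>L\<^esub> arrow_el \<alpha>) r =
      (\<Oplus>\<^bsub>A\<^esub>\<alpha>\<in>out_arcs Q i. (costrip \<alpha> l \<otimes>\<^bsub>L\<^esub> arrow_el \<alpha>) r)" by (rule finsum_L_apply[OF fin t r])
  have S0: "(\<Oplus>\<^bsub>L\<^esub>\<alpha>\<in>out_arcs Q i. costrip \<alpha> l \<otimes>\<^bsub>L\<^esub> arrow_el \<alpha>) r = \<zero>\<^bsub>A\<^esub>"
    if "\<And>\<alpha>. \<alpha> \<in> out_arcs Q i \<Longrightarrow> (costrip \<alpha> l \<otimes>\<^bsub>L\<^esub> arrow_el \<alpha>) r = \<zero>\<^bsub>A\<^esub>"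
  proof -
    have "(\<Oplus>\<^bsub>A\<^esub>\<alpha>\<in>out_arcs Q i. (costrip \<alpha> l \<otimes>\<^bsub>L\<^esub> arrow_el \<alpha>) r) = (\<Oplus>\<^bsub>A\<^esub>\<alpha>\<in>out_arcs Q i. \<zero>\<^bsub>A\<^esub>)"
      by (rule A.finsum_cong'[OF refl]) (simp_all add: that)
    then show ?thesis using S by simp
  qed
  have lr: "l r = (if fst r = i then l r else \<zero>\<^bsub>A\<^esub>)" using L_right_mult(1)[OF l r, of i] li by simp
  show "l r = (\<Oplus>\<^bsub>L\<^esub>\<alpha>\<in>out_arcs Q i. costrip \<alpha> l \<otimes>\<^bsub>L\<^esub> arrow_el \<alpha>) r"
    using r
  proof (cases r rule: path_cons_cases)
    case (trivial j)
    have "(\<Oplus>\<^bsub>L\<^esub>\<alpha>\<in>out_arcs Q i. costrip \<alpha> l \<otimes>\<^bsub>L\<^esub> arrow_el \<alpha>) r = \<zero>\<^bsub>A\<^esub>"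
    proof (rule S0)
      fix \<alpha> assume \<alpha>: "\<alpha> \<in> out_arcs Q i"
      show "(costrip \<alpha> l \<otimes>\<^bsub>L\<^esub> arrow_el \<alpha>) r = \<zero>\<^bsub>A\<^esub>"
        by (rule L_right_mult(3)[OF costrip_closed[OF l oa(1)[OF \<alpha>]] r oa(1)[OF \<alpha>]])
          (metis trivial(2) path_cons_simps(3))
    qed
    then show ?thesis using lr l0 trivial(2) by auto
  next
    case (cons q \<beta>)
    have vanish: "(costrip \<alpha> l \<otimes>\<^bsub>L\<^esub> arrow_el \<alpha>) r = \<zero>\<^bsub>A\<^esub>" if \<alpha>: "\<alpha> \<in> out_arcs Q i" "\<alpha> \<noteq> \<beta>" for \<alpha>
    proof (rule L_right_mult(3)[OF costrip_closed[OF l oa(1)[OF \<alpha>(1)]] r oa(1)[OF \<alpha>(1)]])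
      fix q' :: "'d \<times> 'e list \<times> 'd" assume "fst q' = head Q \<alpha>"
      then show "r \<noteq> path_cons Q \<alpha> q'" using path_cons_inj(1)[of \<beta> q \<alpha> q'] cons(3,4) \<alpha>(2) by auto
    qed
    show ?thesis
    proof (cases "tail Q \<beta> = i")
      case True
      then have \<beta>: "\<beta> \<in> out_arcs Q i" using cons(2) by simp
      have "(\<Oplus>\<^bsub>A\<^esub>\<alpha>\<in>out_arcs Q i. (costrip \<alpha> l \<otimes>\<^bsub>L\<^esub> arrow_el \<alpha>) r) = (costrip \<beta> l \<otimes>\<^bsub>L\<^esub> arrow_el \<beta>) r"
      proof (rule A.finsum_delta[OF fin \<beta>])
        show "(costrip \<beta> l \<otimes>\<^bsub>L\<^esub> arrow_el \<beta>) r \<in> carrier A"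
          by (rule L_closed[OF L_mult_closed[OF costrip_closed[OF l cons(2)] path_el_closed] r])
      qed (rule vanish)
      also have "\<dots> = costrip \<beta> l q"
        by (rule L_right_mult(2)[OF costrip_closed[OF l cons(2)] r cons(2,1,3,4)])
      also have "\<dots> = l r" using cons by (simp add: costrip_def)
      finally show ?thesis using S by simp
    next
      case False
      have "(\<Oplus>\<^bsub>L\<^esub>\<alpha>\<in>out_arcs Q i. costrip \<alpha> l \<otimes>\<^bsub>L\<^esub> arrow_el \<alpha>) r = \<zero>\<^bsub>A\<^esub>"
        by (rule S0, rule vanish) (use False oa(2) in auto)
      moreover have "fst r \<noteq> i" using False cons(4) by (simp add: path_cons_simps)
      ultimately show ?thesis using lr by simp
    qed
  qed
qed

section \<open>Cutting off last arrows in the path algebra\<close>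

lemma L_as_induced':
  "l \<oplus>\<^bsub>Ind (verts Q) (regular_module A)\<^esub> l' = l \<oplus>\<^bsub>L\<^esub> l'"
  "\<zero>\<^bsub>Ind (verts Q) (regular_module A)\<^esub> = \<zero>\<^bsub>L\<^esub>"
  "finsum (Ind (verts Q) (regular_module A)) g S = finsum L g S"
proof -
  show a: "l \<oplus>\<^bsub>Ind (verts Q) (regular_module A)\<^esub> l' = l \<oplus>\<^bsub>L\<^esub> l'" for l l'
    by (simp add: induced_module_def paths_from_verts path_algebra_def)
  show z: "\<zero>\<^bsub>Ind (verts Q) (regular_module A)\<^esub> = \<zero>\<^bsub>L\<^esub>"
    by (simp add: induced_module_def paths_from_verts path_algebra_def)
  have "add (Ind (verts Q) (regular_module A)) = add L" by (rule ext, rule ext, rule a)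
  then show "finsum (Ind (verts Q) (regular_module A)) g S = finsum L g S"
    using z by (simp add: finsum_def finprod_def L_as_induced(1))
qed

definition strip where
  "strip = ind_strip (verts Q) (regular_module A)"

lemma strip_left_mult:
  assumes l: "l \<in> carrier L" and \<alpha>: "\<alpha> \<in> arcs Q"
  shows "strip \<alpha> l \<in> carrier L"
    and "l' \<in> carrier L \<Longrightarrow> strip \<alpha> (l \<oplus>\<^bsub>L\<^esub> l') = strip \<alpha> l \<oplus>\<^bsub>L\<^esub> strip \<alpha> l'"
    and "a \<in> carrier A \<Longrightarrow> strip \<alpha> (scal_el a \<otimes>\<^bsub>L\<^esub> l) = scal_el a \<otimes>\<^bsub>L\<^esub> strip \<alpha> l"
    and "\<beta> \<in> arcs Q \<Longrightarrow> strip \<beta> (arrow_el \<alpha> \<otimes>\<^bsub>L\<^esub> l) = (if \<beta> = \<alpha> then vert_el (tail Q \<alpha>) \<otimes>\<^bsub>L\<^esub> l else \<zero>\<^bsub>L\<^esub>)"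
proof -
  note M = left_module_A
  note e = L_as_induced L_as_induced'
  have l': "l \<in> carrier (Ind (verts Q) (regular_module A))" using l by (simp add: e)
  show "strip \<alpha> l \<in> carrier L" using ind_strip_closed[OF M l' \<alpha>] by (simp add: e strip_def)
  show "l' \<in> carrier L \<Longrightarrow> strip \<alpha> (l \<oplus>\<^bsub>L\<^esub> l') = strip \<alpha> l \<oplus>\<^bsub>L\<^esub> strip \<alpha> l'"
    using ind_strip_add[OF M l' _ \<alpha>] by (simp add: e strip_def)
  show "a \<in> carrier A \<Longrightarrow> strip \<alpha> (scal_el a \<otimes>\<^bsub>L\<^esub> l) = scal_el a \<otimes>\<^bsub>L\<^esub> strip \<alpha> l"
    using ind_strip_scal[OF M l' _ \<alpha>] by (simp add: e strip_def)
  show "\<beta> \<in> arcs Q \<Longrightarrow> strip \<beta> (arrow_el \<alpha> \<otimes>\<^bsub>L\<^esub> l) = (if \<beta> = \<alpha> then vert_el (tail Q \<alpha>) \<otimes>\<^bsub>L\<^esub> l else \<zero>\<^bsub>L\<^esub>)"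
    using ind_strip_arrow[OF M l' \<alpha>] by (simp add: e strip_def)
qed

text \<open>The decomposition of \<open>e_j L\<close> into \<open>A e_j\<close> and the
  \<open>\<beta> L\<close> over the arrows \<beta> ending at \<open>j\<close>.\<close>

lemma strip_expansion:
  assumes l: "l \<in> carrier L" and j: "j \<in> verts Q"
  shows "vert_el j \<otimes>\<^bsub>L\<^esub> l = scal_el (l (trivial_path j)) \<otimes>\<^bsub>L\<^esub> vert_el j \<oplus>\<^bsub>L\<^esub>
    (\<Oplus>\<^bsub>L\<^esub>\<beta>\<in>in_arcs Q j. arrow_el \<beta> \<otimes>\<^bsub>L\<^esub> strip \<beta> l)"
proof -
  note M = left_module_A
  note e = L_as_induced L_as_induced'
  have l': "l \<in> carrier (Ind (verts Q) (regular_module A))" using l by (simp add: e)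
  have tj: "trivial_path j \<in> paths Q" using j by simp
  have lj: "l (trivial_path j) \<in> carrier A" by (rule L_closed[OF l tj])
  have "ind_single (verts Q) (regular_module A) (trivial_path j) (l (trivial_path j)) = scal_el (l (trivial_path j)) \<otimes>\<^bsub>L\<^esub> vert_el j"
  proof (rule L_eqI)
    show "ind_single (verts Q) (regular_module A) (trivial_path j) (l (trivial_path j)) \<in> carrier L"
      using ind_single_closed[OF M, of "l (trivial_path j)" "verts Q" "trivial_path j"] lj by (simp add: e)
    fix r assume r: "r \<in> paths Q"
    show "ind_single (verts Q) (regular_module A) (trivial_path j) (l (trivial_path j)) r = (scal_el (l (trivial_path j)) \<otimes>\<^bsub>L\<^esub> vert_el j) r"
      using r lj L_left_mult(1)[OF path_el_closed lj r] by (simp add: ind_single_def paths_from_verts path_el_apply)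
  qed (intro L_mult_closed scal_el_closed lj path_el_closed)
  then show ?thesis using ind_expansion[OF M l' j] j by (simp add: e strip_def)
qed

end

section \<open>Projective modules over the path algebra\<close>

text \<open>The image of an idempotent is a direct summand: the old functionals, restricted, and the
  projected vectors form a dual basis.\<close>

lemma fg_projective_image:
  assumes V: "fg_projective R V" and \<kappa>: "\<kappa> \<in> mod_hom R V V"
    and idem: "\<And>x. x \<in> carrier V \<Longrightarrow> \<kappa> (\<kappa> x) = \<kappa> x"
  shows "left_submodule R V (\<kappa> ` carrier V)" "fg_projective R (restrict_carrier V (\<kappa> ` carrier V))"
proof -
  have M: "left_module R V" using V by (simp add: fg_projective_def)
  interpret V: left_module R V by (rule M)
  note \<kappa>D = mod_homD[OF \<kappa>]
  show S: "left_submodule R V (\<kappa> ` carrier V)"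
    unfolding left_submodule_def
  proof (intro conjI ballI)
    show "\<zero>\<^bsub>V\<^esub> \<in> \<kappa> ` carrier V" using mod_hom_zero[OF M M \<kappa>] by (metis V.M.zero_closed imageI)
  qed (use \<kappa>D(1) in \<open>auto simp: \<kappa>D(2,3)[symmetric]\<close>)
  obtain n :: nat and f b where "dual_basis R V {..<n} f b" using fg_projectiveE[OF V] .
  note db = dual_basisD[OF this]
  have sub: "x \<in> carrier V" if "x \<in> \<kappa> ` carrier V" for x using left_submoduleD(1)[OF S that] .
  have "dual_basis R (restrict_carrier V (\<kappa> ` carrier V)) {..<n} f (\<lambda>k. \<kappa> (b k))"
    unfolding dual_basis_def
  proof (intro conjI ballI)
    show "f k \<in> mod_hom R (restrict_carrier V (\<kappa> ` carrier V)) (regular_module R)" if "k \<in> {..<n}" for k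
      by (rule mod_hom_restrict_carrier(1)[OF db(2)[OF that]]) (use sub in blast)
    show "\<kappa> (b k) \<in> carrier (restrict_carrier V (\<kappa> ` carrier V))" if "k \<in> {..<n}" for k
      using db(3)[OF that] by simp
    fix x assume "x \<in> carrier (restrict_carrier V (\<kappa> ` carrier V))"
    then have x: "x \<in> carrier V" "\<kappa> x = x" "x \<in> \<kappa> ` carrier V" using sub idem by auto
    have "(\<lambda>k. f k x \<odot>\<^bsub>V\<^esub> \<kappa> (b k)) \<in> {..<n} \<rightarrow> \<kappa> ` carrier V"
      by (intro Pi_I left_submoduleD(4)[OF S] db(5)[OF _ x(1)] imageI db(3))
    then have "(\<Oplus>\<^bsub>restrict_carrier V (\<kappa> ` carrier V)\<^esub>k\<in>{..<n}. f k x \<odot>\<^bsub>V\<^esub> \<kappa> (b k)) =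
        (\<Oplus>\<^bsub>V\<^esub>k\<in>{..<n}. f k x \<odot>\<^bsub>V\<^esub> \<kappa> (b k))" by (rule finsum_restrict_carrier[OF M S])
    also have "\<dots> = \<kappa> (\<Oplus>\<^bsub>V\<^esub>k\<in>{..<n}. f k x \<odot>\<^bsub>V\<^esub> b k)"
      by (rule mod_hom_lincomb[OF M M \<kappa> _ db(5)[OF _ x(1)] db(3), symmetric]) simp
    also have "\<dots> = x" using db(4)[OF x(1)] x(2) by simp
    finally show "x = (\<Oplus>\<^bsub>restrict_carrier V (\<kappa> ` carrier V)\<^esub>k\<in>{..<n}.
        f k x \<odot>\<^bsub>restrict_carrier V (\<kappa> ` carrier V)\<^esub> \<kappa> (b k))" by simp
  qed simp
  then show "fg_projective R (restrict_carrier V (\<kappa> ` carrier V))"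
    by (rule fg_projectiveI[OF left_module_restrict[OF M S]])
qed

context quiver_algebra
begin

text \<open>
  The maps \<open>\<rho> \<alpha>\<close> are \<open>A\<close>-linear retractions of the structure maps, which single out the component of
  \<open>\<alpha>\<close> in the sum of the images.
\<close>

definition arrow_retraction where
  "arrow_retraction P \<rho> \<longleftrightarrow> (\<forall>\<alpha>\<in>arcs Q.
     (\<forall>x\<in>carrier P. \<rho> \<alpha> x \<in> carrier (Rep P (tail Q \<alpha>))) \<and>
     (\<forall>x\<in>carrier P. \<forall>y\<in>carrier P. \<rho> \<alpha> (x \<oplus>\<^bsub>P\<^esub> y) = \<rho> \<alpha> x \<oplus>\<^bsub>P\<^esub> \<rho> \<alpha> y) \<and>
     (\<forall>a\<in>carrier A. \<forall>x\<in>carrier P. \<rho> \<alpha> (scal_el a \<odot>\<^bsub>P\<^esub> x) = scal_el a \<odot>\<^bsub>P\<^esub> \<rho> \<alpha> x) \<and>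
     (\<forall>\<beta>\<in>arcs Q. \<forall>x\<in>carrier P. \<rho> \<beta> (arrow_el \<alpha> \<odot>\<^bsub>P\<^esub> x) =
       (if \<beta> = \<alpha> then vert_el (tail Q \<alpha>) \<odot>\<^bsub>P\<^esub> x else \<zero>\<^bsub>P\<^esub>)))"

lemma arrow_retractionD:
  assumes "arrow_retraction P \<rho>" "\<alpha> \<in> arcs Q" "x \<in> carrier P"
  shows "\<rho> \<alpha> x \<in> carrier (Rep P (tail Q \<alpha>))"
    "y \<in> carrier P \<Longrightarrow> \<rho> \<alpha> (x \<oplus>\<^bsub>P\<^esub> y) = \<rho> \<alpha> x \<oplus>\<^bsub>P\<^esub> \<rho> \<alpha> y"
    "a \<in> carrier A \<Longrightarrow> \<rho> \<alpha> (scal_el a \<odot>\<^bsub>P\<^esub> x) = scal_el a \<odot>\<^bsub>P\<^esub> \<rho> \<alpha> x"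
    "\<beta> \<in> arcs Q \<Longrightarrow> \<rho> \<beta> (arrow_el \<alpha> \<odot>\<^bsub>P\<^esub> x) = (if \<beta> = \<alpha> then vert_el (tail Q \<alpha>) \<odot>\<^bsub>P\<^esub> x else \<zero>\<^bsub>P\<^esub>)"
  using assms unfolding arrow_retraction_def by blast+

text \<open>On \<open>L\<close> itself the retraction is \<open>strip\<close>. It is applied to the
  \<open>L\<close>-valued coordinates of a dual basis; these are \<open>L\<close>-linear, so an
  arrow acting on \<open>P\<close> becomes left multiplication by it in every coordinate.\<close>

lemma projective_arrow_retraction:
  assumes P: "fg_projective L P"
  shows "\<exists>\<rho>. arrow_retraction P \<rho>"
proof -
  have M: "left_module L P" using P by (simp add: fg_projective_def)
  interpret P: left_module L P by (rule M)
  obtain m :: nat and F b where "dual_basis L P {..<m} F b" using fg_projectiveE[OF P] .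
  note db = dual_basisD[OF this]
  define R where "R \<alpha> x = (\<Oplus>\<^bsub>P\<^esub>k\<in>{..<m}. strip \<alpha> (F k x) \<odot>\<^bsub>P\<^esub> b k)" for \<alpha> x
  \<comment> \<open>The values of \<open>R \<alpha>\<close> need not lie in the space at the tail of
    \<alpha>. The idempotent enforces this without affecting the formula for arrows, in which it
    already occurs.\<close>
  define \<rho> where "\<rho> \<alpha> x = vert_el (tail Q \<alpha>) \<odot>\<^bsub>P\<^esub> R \<alpha> x" for \<alpha> x
  have FD: "F k (x \<oplus>\<^bsub>P\<^esub> y) = F k x \<oplus>\<^bsub>L\<^esub> F k y" "l \<in> carrier L \<Longrightarrow> F k (l \<odot>\<^bsub>P\<^esub> x) = l \<otimes>\<^bsub>L\<^esub> F k x"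
    if "k \<in> {..<m}" "x \<in> carrier P" "y \<in> carrier P" for k x y l
    using mod_homD(2,3)[OF db(2)[OF that(1)]] that(2,3) by simp_all
  have t: "(\<lambda>k. strip \<alpha> (F k x) \<odot>\<^bsub>P\<^esub> b k) \<in> {..<m} \<rightarrow> carrier P" if "\<alpha> \<in> arcs Q" "x \<in> carrier P" for \<alpha> x
    by (intro Pi_I P.smult_closed strip_left_mult(1) db(3) db(5) that)
  have Rc: "R \<alpha> x \<in> carrier P" if "\<alpha> \<in> arcs Q" "x \<in> carrier P" for \<alpha> x
    unfolding R_def by (rule P.M.finsum_closed[OF t[OF that]])
  have R_add: "R \<alpha> (x \<oplus>\<^bsub>P\<^esub> y) = R \<alpha> x \<oplus>\<^bsub>P\<^esub> R \<alpha> y" if \<alpha>: "\<alpha> \<in> arcs Q" and x: "x \<in> carrier P" and y: "y \<in> carrier P" for \<alpha> x y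
  proof -
    have "R \<alpha> (x \<oplus>\<^bsub>P\<^esub> y) = (\<Oplus>\<^bsub>P\<^esub>k\<in>{..<m}. strip \<alpha> (F k x) \<odot>\<^bsub>P\<^esub> b k \<oplus>\<^bsub>P\<^esub> strip \<alpha> (F k y) \<odot>\<^bsub>P\<^esub> b k)"
      unfolding R_def
    proof (rule P.M.finsum_cong'[OF refl])
      fix k assume k: "k \<in> {..<m}"
      show "strip \<alpha> (F k (x \<oplus>\<^bsub>P\<^esub> y)) \<odot>\<^bsub>P\<^esub> b k = strip \<alpha> (F k x) \<odot>\<^bsub>P\<^esub> b k \<oplus>\<^bsub>P\<^esub> strip \<alpha> (F k y) \<odot>\<^bsub>P\<^esub> b k"
        unfolding FD(1)[OF k x y] strip_left_mult(2)[OF db(5)[OF k x] \<alpha> db(5)[OF k y]]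
        by (rule P.smult_l_distr[OF strip_left_mult(1)[OF db(5)[OF k x] \<alpha>] strip_left_mult(1)[OF db(5)[OF k y] \<alpha>] db(3)[OF k]])
    qed (use t[OF \<alpha> x] t[OF \<alpha> y] in auto)
    also have "\<dots> = R \<alpha> x \<oplus>\<^bsub>P\<^esub> R \<alpha> y"
      unfolding R_def by (rule P.M.finsum_addf[OF t[OF \<alpha> x] t[OF \<alpha> y]])
    finally show ?thesis .
  qed
  have R_scal: "R \<alpha> (scal_el a \<odot>\<^bsub>P\<^esub> x) = scal_el a \<odot>\<^bsub>P\<^esub> R \<alpha> x" if \<alpha>: "\<alpha> \<in> arcs Q" and x: "x \<in> carrier P" and a: "a \<in> carrier A" for \<alpha> x a
    unfolding R_def P.smult_finsum_right[OF finite_lessThan t[OF \<alpha> x] scal_el_closed[OF a]]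
  proof (rule P.M.finsum_cong'[OF refl])
    show "(\<lambda>k. scal_el a \<odot>\<^bsub>P\<^esub> (strip \<alpha> (F k x) \<odot>\<^bsub>P\<^esub> b k)) \<in> {..<m} \<rightarrow> carrier P" using t[OF \<alpha> x] a by auto
    fix k assume k: "k \<in> {..<m}"
    show "strip \<alpha> (F k (scal_el a \<odot>\<^bsub>P\<^esub> x)) \<odot>\<^bsub>P\<^esub> b k = scal_el a \<odot>\<^bsub>P\<^esub> (strip \<alpha> (F k x) \<odot>\<^bsub>P\<^esub> b k)"
      unfolding FD(2)[OF k x x scal_el_closed[OF a]] strip_left_mult(3)[OF db(5)[OF k x] \<alpha> a]
      by (rule P.smult_assoc1[OF scal_el_closed[OF a] strip_left_mult(1)[OF db(5)[OF k x] \<alpha>] db(3)[OF k]])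
  qed
  have R_arrow: "R \<beta> (arrow_el \<alpha> \<odot>\<^bsub>P\<^esub> x) = (if \<beta> = \<alpha> then vert_el (tail Q \<alpha>) \<odot>\<^bsub>P\<^esub> x else \<zero>\<^bsub>P\<^esub>)"
    if \<alpha>: "\<alpha> \<in> arcs Q" and \<beta>: "\<beta> \<in> arcs Q" and x: "x \<in> carrier P" for \<alpha> \<beta> x
  proof -
    have t': "(\<lambda>k. F k x \<odot>\<^bsub>P\<^esub> b k) \<in> {..<m} \<rightarrow> carrier P" by (intro Pi_I P.smult_closed db(3) db(5) x)
    have s: "strip \<beta> (F k (arrow_el \<alpha> \<odot>\<^bsub>P\<^esub> x)) = (if \<beta> = \<alpha> then vert_el (tail Q \<alpha>) \<otimes>\<^bsub>L\<^esub> F k x else \<zero>\<^bsub>L\<^esub>)"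
      if "k \<in> {..<m}" for k
      unfolding FD(2)[OF that x x path_el_closed] by (rule strip_left_mult(4)[OF db(5)[OF that x] \<alpha> \<beta>])
    show ?thesis
    proof (cases "\<beta> = \<alpha>")
      case True
      have "R \<beta> (arrow_el \<alpha> \<odot>\<^bsub>P\<^esub> x) = (\<Oplus>\<^bsub>P\<^esub>k\<in>{..<m}. vert_el (tail Q \<alpha>) \<odot>\<^bsub>P\<^esub> (F k x \<odot>\<^bsub>P\<^esub> b k))"
        unfolding R_def
      proof (rule P.M.finsum_cong'[OF refl])
        show "(\<lambda>k. vert_el (tail Q \<alpha>) \<odot>\<^bsub>P\<^esub> (F k x \<odot>\<^bsub>P\<^esub> b k)) \<in> {..<m} \<rightarrow> carrier P" using t' by auto
        fix k assume k: "k \<in> {..<m}"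
        show "strip \<beta> (F k (arrow_el \<alpha> \<odot>\<^bsub>P\<^esub> x)) \<odot>\<^bsub>P\<^esub> b k = vert_el (tail Q \<alpha>) \<odot>\<^bsub>P\<^esub> (F k x \<odot>\<^bsub>P\<^esub> b k)"
          using s[OF k] True P.smult_assoc1[OF path_el_closed db(5)[OF k x] db(3)[OF k]] by simp
      qed
      also have "\<dots> = vert_el (tail Q \<alpha>) \<odot>\<^bsub>P\<^esub> (\<Oplus>\<^bsub>P\<^esub>k\<in>{..<m}. F k x \<odot>\<^bsub>P\<^esub> b k)"
        by (rule P.smult_finsum_right[OF finite_lessThan t' path_el_closed, symmetric])
      finally show ?thesis using True db(4)[OF x] by simp
    next
      case False
      have "R \<beta> (arrow_el \<alpha> \<odot>\<^bsub>P\<^esub> x) = (\<Oplus>\<^bsub>P\<^esub>k\<in>{..<m}. \<zero>\<^bsub>P\<^esub>)"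
        unfolding R_def by (rule P.M.finsum_cong'[OF refl]) (use s False db(3) in auto)
      then show ?thesis using False by simp
    qed
  qed
  have "arrow_retraction P \<rho>"
    unfolding arrow_retraction_def
  proof (intro ballI conjI)
    fix \<alpha> x assume \<alpha>: "\<alpha> \<in> arcs Q" and x: "x \<in> carrier P"
    have tv: "tail Q \<alpha> \<in> verts Q" using \<alpha> by simp
    show "\<rho> \<alpha> x \<in> carrier (Rep P (tail Q \<alpha>))" unfolding \<rho>_def by (rule rep_memI[OF M Rc[OF \<alpha> x]])
    show "\<rho> \<alpha> (x \<oplus>\<^bsub>P\<^esub> y) = \<rho> \<alpha> x \<oplus>\<^bsub>P\<^esub> \<rho> \<alpha> y" if "y \<in> carrier P" for y
      unfolding \<rho>_def R_add[OF \<alpha> x that] by (rule P.smult_r_distr[OF path_el_closed Rc[OF \<alpha> x] Rc[OF \<alpha> that]])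
    show "\<rho> \<alpha> (scal_el a \<odot>\<^bsub>P\<^esub> x) = scal_el a \<odot>\<^bsub>P\<^esub> \<rho> \<alpha> x" if "a \<in> carrier A" for a
      unfolding \<rho>_def R_scal[OF \<alpha> x that] by (rule scal_path[OF M that Rc[OF \<alpha> x], symmetric])
    show "\<rho> \<beta> (arrow_el \<alpha> \<odot>\<^bsub>P\<^esub> x) = (if \<beta> = \<alpha> then vert_el (tail Q \<alpha>) \<odot>\<^bsub>P\<^esub> x else \<zero>\<^bsub>P\<^esub>)" if "\<beta> \<in> arcs Q" for \<beta>
      unfolding \<rho>_def R_arrow[OF \<alpha> that x] using vert_vert[OF M tv x, of "tail Q \<alpha>"] by simp
  qed
  then show ?thesis by blast
qed

text \<open>The projection of \<open>P_i\<close> onto the sum of the incoming images: its summands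
  follow a retraction by the structure map it splits.\<close>

definition arrow_part where
  "arrow_part P \<rho> i x = (\<Oplus>\<^bsub>Rep P i\<^esub>\<alpha>\<in>in_arcs Q i. arrow_el \<alpha> \<odot>\<^bsub>P\<^esub> \<rho> \<alpha> x)"

text \<open>The complementary idempotent. Its kernel is the sum of the incoming images, so its image
  is a copy of the cokernel inside \<open>P_i\<close>, depending on the choice of
  \<open>\<rho>\<close>.\<close>

definition corner where
  "corner P \<rho> i x = x \<ominus>\<^bsub>Rep P i\<^esub> arrow_part P \<rho> i x"

lemma arrow_hom:
  assumes P: "left_module L P" and \<alpha>: "\<alpha> \<in> in_arcs Q i"
  shows "(\<lambda>x. arrow_el \<alpha> \<odot>\<^bsub>P\<^esub> x) \<in> mod_hom A (Rep P (tail Q \<alpha>)) (Rep P i)"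
proof (rule mod_homI)
  interpret P: left_module L P by (rule P)
  fix x assume x: "x \<in> carrier (Rep P (tail Q \<alpha>))"
  note xc = rep_carrier[OF P x]
  show "arrow_el \<alpha> \<odot>\<^bsub>P\<^esub> x \<in> carrier (Rep P i)"
    using rep_arrow[OF P in_arcsD(1)[OF \<alpha>] xc] in_arcsD(2)[OF \<alpha>] by simp
  show "arrow_el \<alpha> \<odot>\<^bsub>P\<^esub> (x \<oplus>\<^bsub>Rep P (tail Q \<alpha>)\<^esub> y) = arrow_el \<alpha> \<odot>\<^bsub>P\<^esub> x \<oplus>\<^bsub>Rep P i\<^esub> arrow_el \<alpha> \<odot>\<^bsub>P\<^esub> y"
    if "y \<in> carrier (Rep P (tail Q \<alpha>))" for y
    unfolding rep_space_simps(3) by (rule P.smult_r_distr[OF path_el_closed xc rep_carrier[OF P that]])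
  show "arrow_el \<alpha> \<odot>\<^bsub>P\<^esub> (a \<odot>\<^bsub>Rep P (tail Q \<alpha>)\<^esub> x) = a \<odot>\<^bsub>Rep P i\<^esub> (arrow_el \<alpha> \<odot>\<^bsub>P\<^esub> x)" if "a \<in> carrier A" for a
    unfolding rep_space_simps(4) by (rule scal_path[OF P that xc, symmetric])
qed

section \<open>The cokernel as a direct summand of the space at a vertex\<close>

context
  fixes P :: "('d \<times> 'e list \<times> 'd \<Rightarrow> 'c, 'm) module" and \<rho>
  assumes P: "left_module L P" and \<rho>: "arrow_retraction P \<rho>"
begin

interpretation P: left_module L P by (rule P)

lemma retraction_hom:
  "\<alpha> \<in> arcs Q \<Longrightarrow> \<rho> \<alpha> \<in> mod_hom A (Rep P i) (Rep P (tail Q \<alpha>))"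
  using arrow_retractionD[OF \<rho>] rep_carrier[OF P]
  by (intro mod_homI) (simp_all add: rep_space_simps(3,4))

text \<open>The retraction belonging to \<beta> kills the images of all other arrows, so it reads
  off one component of an arrow sum.\<close>

lemma retraction_sum:
  assumes i: "i \<in> verts Q" and y: "\<And>\<alpha>. \<alpha> \<in> in_arcs Q i \<Longrightarrow> y \<alpha> \<in> carrier (Rep P (tail Q \<alpha>))"
    and \<beta>: "\<beta> \<in> in_arcs Q i"
  shows "\<rho> \<beta> (\<Oplus>\<^bsub>P\<^esub>\<alpha>\<in>in_arcs Q i. arrow_el \<alpha> \<odot>\<^bsub>P\<^esub> y \<alpha>) = y \<beta>"
proof -
  note \<beta>' = in_arcsD(1)[OF \<beta>] and tv = in_arcsD(3)[OF \<beta>]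
  note yc = rep_carrier[OF P y]
  interpret V: left_module A "Rep P i" by (rule left_module_rep[OF P i])
  interpret W: left_module A "Rep P (tail Q \<beta>)" by (rule left_module_rep[OF P tv])
  have t: "(\<lambda>\<alpha>. arrow_el \<alpha> \<odot>\<^bsub>P\<^esub> y \<alpha>) \<in> in_arcs Q i \<rightarrow> carrier (Rep P i)" by (rule arrow_sum_terms(1)[OF P yc])
  have e: "\<rho> \<beta> (arrow_el \<alpha> \<odot>\<^bsub>P\<^esub> y \<alpha>) = (if \<beta> = \<alpha> then y \<beta> else \<zero>\<^bsub>P\<^esub>)" if "\<alpha> \<in> in_arcs Q i" for \<alpha>
    using arrow_retractionD(4)[OF \<rho> in_arcsD(1)[OF that] yc[OF that] \<beta>'] rep_vert[OF P tv y[OF \<beta>], of "tail Q \<beta>"] by auto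
  have "\<rho> \<beta> (\<Oplus>\<^bsub>Rep P i\<^esub>\<alpha>\<in>in_arcs Q i. arrow_el \<alpha> \<odot>\<^bsub>P\<^esub> y \<alpha>) =
      (\<Oplus>\<^bsub>Rep P (tail Q \<beta>)\<^esub>\<alpha>\<in>in_arcs Q i. \<rho> \<beta> (arrow_el \<alpha> \<odot>\<^bsub>P\<^esub> y \<alpha>))"
    by (rule mod_hom_finsum[OF V.M.abelian_group_axioms W.M.abelian_group_axioms retraction_hom[OF \<beta>'] finite_in_arcs t])
  also have "\<dots> = \<rho> \<beta> (arrow_el \<beta> \<odot>\<^bsub>P\<^esub> y \<beta>)"
    by (rule W.M.finsum_delta[OF finite_in_arcs \<beta>]) (use e e[OF \<beta>] y[OF \<beta>] in \<open>simp_all add: rep_space_simps(2) del: in_in_arcs_conv\<close>)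
  also have "\<dots> = y \<beta>" using e[OF \<beta>] by simp
  finally show ?thesis unfolding finsum_rep[OF P i t] .
qed

text \<open>Monicity of a module that admits arrow retractions; every projective module
  does.\<close>

lemma retraction_inj:
  assumes i: "i \<in> verts Q" and y: "\<And>\<alpha>. \<alpha> \<in> in_arcs Q i \<Longrightarrow> y \<alpha> \<in> carrier (Rep P (tail Q \<alpha>))"
    and z: "\<And>\<alpha>. \<alpha> \<in> in_arcs Q i \<Longrightarrow> z \<alpha> \<in> carrier (Rep P (tail Q \<alpha>))"
    and eq: "(\<Oplus>\<^bsub>P\<^esub>\<alpha>\<in>in_arcs Q i. arrow_el \<alpha> \<odot>\<^bsub>P\<^esub> y \<alpha>) = (\<Oplus>\<^bsub>P\<^esub>\<alpha>\<in>in_arcs Q i. arrow_el \<alpha> \<odot>\<^bsub>P\<^esub> z \<alpha>)"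
    and \<beta>: "\<beta> \<in> in_arcs Q i"
  shows "y \<beta> = z \<beta>"
  using retraction_sum[OF i y \<beta>] retraction_sum[OF i z \<beta>] eq by simp

context
  fixes i assumes i: "i \<in> verts Q"
begin

interpretation V: left_module A "Rep P i" by (rule left_module_rep[OF P i])

lemma arrow_part_hom: "arrow_part P \<rho> i \<in> mod_hom A (Rep P i) (Rep P i)"
  unfolding arrow_part_def
proof (rule mod_hom_finsum_fun[OF V.left_module_axioms finite_in_arcs])
  show "(\<lambda>x. arrow_el \<alpha> \<odot>\<^bsub>P\<^esub> \<rho> \<alpha> x) \<in> mod_hom A (Rep P i) (Rep P i)" if "\<alpha> \<in> in_arcs Q i" for \<alpha>
    by (rule mod_hom_comp[OF retraction_hom[OF in_arcsD(1)[OF that]] arrow_hom[OF P that]])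
qed

lemma arrow_part_eq:
  assumes "x \<in> carrier P"
  shows "arrow_part P \<rho> i x = (\<Oplus>\<^bsub>P\<^esub>\<alpha>\<in>in_arcs Q i. arrow_el \<alpha> \<odot>\<^bsub>P\<^esub> \<rho> \<alpha> x)"
proof -
  have "(\<lambda>\<alpha>. arrow_el \<alpha> \<odot>\<^bsub>P\<^esub> \<rho> \<alpha> x) \<in> in_arcs Q i \<rightarrow> carrier (Rep P i)"
    by (rule arrow_sum_terms(1)[OF P]) (rule rep_carrier[OF P arrow_retractionD(1)[OF \<rho> in_arcsD(1) assms]])
  then show ?thesis unfolding arrow_part_def by (rule finsum_rep[OF P i])
qed

lemma arrow_part_Incoming:
  assumes "x \<in> carrier P" shows "arrow_part P \<rho> i x \<in> Incoming P i"
  unfolding arrow_part_eq[OF assms]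
  by (rule IncomingI[OF P i]) (rule arrow_retractionD(1)[OF \<rho> in_arcsD(1) assms])

lemma arrow_part_id:
  assumes "x \<in> Incoming P i" shows "arrow_part P \<rho> i x = x"
proof -
  obtain y where y: "\<forall>\<alpha>\<in>in_arcs Q i. y \<alpha> \<in> carrier (Rep P (tail Q \<alpha>))"
    and x: "x = (\<Oplus>\<^bsub>P\<^esub>\<alpha>\<in>in_arcs Q i. arrow_el \<alpha> \<odot>\<^bsub>P\<^esub> y \<alpha>)"
    using Incoming_iff[OF P i] assms by blast
  have xP: "x \<in> carrier P" by (rule rep_carrier[OF P left_submoduleD(1)[OF Incoming_submodule[OF P i] assms]])
  have r: "\<rho> \<alpha> x = y \<alpha>" if "\<alpha> \<in> in_arcs Q i" for \<alpha>
    unfolding x by (rule retraction_sum[OF i _ that]) (use y in blast)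
  have "(\<lambda>\<alpha>. arrow_el \<alpha> \<odot>\<^bsub>P\<^esub> y \<alpha>) \<in> in_arcs Q i \<rightarrow> carrier P"
    by (rule arrow_sum_terms(2)[OF P]) (rule rep_carrier[OF P bspec[OF y]])
  then have "(\<Oplus>\<^bsub>P\<^esub>\<alpha>\<in>in_arcs Q i. arrow_el \<alpha> \<odot>\<^bsub>P\<^esub> \<rho> \<alpha> x) = x"
    unfolding x by (intro P.M.finsum_cong'[OF refl]) (simp_all add: r[unfolded x] del: in_in_arcs_conv)
  then show ?thesis using arrow_part_eq[OF xP] by simp
qed

lemma corner_hom: "corner P \<rho> i \<in> mod_hom A (Rep P i) (Rep P i)"
  unfolding corner_def
  by (rule mod_hom_minus_fun[OF V.left_module_axioms _ arrow_part_hom]) (simp add: mod_homI)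

lemma corner_zero_iff:
  assumes x: "x \<in> carrier (Rep P i)"
  shows "corner P \<rho> i x = \<zero>\<^bsub>Rep P i\<^esub> \<longleftrightarrow> x \<in> Incoming P i"
proof -
  have "corner P \<rho> i x = \<zero>\<^bsub>Rep P i\<^esub> \<longleftrightarrow> x = arrow_part P \<rho> i x"
    unfolding corner_def by (rule V.minus_eq_zero_iff[OF x mod_homD(1)[OF arrow_part_hom x]])
  then show ?thesis using arrow_part_id arrow_part_Incoming[OF rep_carrier[OF P x]] by metis
qed

lemma corner_idem:
  assumes x: "x \<in> carrier (Rep P i)"
  shows "corner P \<rho> i (corner P \<rho> i x) = corner P \<rho> i x"
proof -
  note c = mod_homD(1)[OF corner_hom x] and p = mod_homD(1)[OF arrow_part_hom x]
  have 0: "corner P \<rho> i (arrow_part P \<rho> i x) = \<zero>\<^bsub>Rep P i\<^esub>"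
    using corner_zero_iff[OF p] arrow_part_Incoming[OF rep_carrier[OF P x]] by simp
  have "corner P \<rho> i (corner P \<rho> i x) = corner P \<rho> i (x \<ominus>\<^bsub>Rep P i\<^esub> arrow_part P \<rho> i x)"
    by (simp add: corner_def)
  also have "\<dots> = corner P \<rho> i x \<ominus>\<^bsub>Rep P i\<^esub> corner P \<rho> i (arrow_part P \<rho> i x)"
    by (rule mod_hom_minus(2)[OF V.left_module_axioms V.left_module_axioms corner_hom x p])
  also have "\<dots> = corner P \<rho> i x" unfolding 0 using c by (simp add: a_minus_def)
  finally show ?thesis .
qed

end

end

end

section \<open>The spaces of a projective module, and functionals on the cokernels\<close>

context quiver_algebra
begin

text \<open>\<open>L\<close> is free over \<open>A\<close> on the paths. Coordinates over
  \<open>L\<close> therefore split into coefficients over \<open>A\<close>, indexed by pairs of an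
  old index and a path.\<close>

lemma fg_projective_rep:
  assumes P: "fg_projective L P" and i: "i \<in> verts Q"
  shows "fg_projective A (Rep P i)"
proof -
  have M: "left_module L P" using P by (simp add: fg_projective_def)
  interpret P: left_module L P by (rule M)
  have MV: "left_module A (Rep P i)" by (rule left_module_rep[OF M i])
  interpret V: left_module A "Rep P i" by (rule MV)
  obtain m :: nat and F b where "dual_basis L P {..<m} F b" using fg_projectiveE[OF P] .
  note db = dual_basisD[OF this]
  define h where "h z x = F (fst z) x (snd z)" for z :: "nat \<times> ('d \<times> 'e list \<times> 'd)" and x
  \<comment> \<open>The idempotent moves the vectors into \<open>P_i\<close>; elements of
    \<open>P_i\<close> are fixed by it, so their expansion survives.\<close>
  define c where "c z = vert_el i \<odot>\<^bsub>P\<^esub> (path_el (snd z) \<odot>\<^bsub>P\<^esub> b (fst z))" for z :: "nat \<times> ('d \<times> 'e list \<times> 'd)"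
  have "dual_basis A (Rep P i) ({..<m} \<times> paths Q) h c"
    unfolding dual_basis_def
  proof (intro conjI ballI)
    show "finite ({..<m} \<times> paths Q)" using finite_paths by simp
  next
    fix z :: "nat \<times> ('d \<times> 'e list \<times> 'd)" assume z: "z \<in> {..<m} \<times> paths Q"
    then have k: "fst z \<in> {..<m}" and r: "snd z \<in> paths Q" by auto
    show "c z \<in> carrier (Rep P i)" unfolding c_def
      by (rule rep_memI[OF M P.smult_closed[OF path_el_closed db(3)[OF k]]])
    show "h z \<in> mod_hom A (Rep P i) (regular_module A)"
    proof (rule mod_homI)
      fix x assume "x \<in> carrier (Rep P i)"
      then have x: "x \<in> carrier P" by (rule rep_carrier[OF M])
      show "h z x \<in> carrier (regular_module A)" unfolding h_def using db(5)[OF k x] r by simp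
      show "h z (x \<oplus>\<^bsub>Rep P i\<^esub> y) = h z x \<oplus>\<^bsub>regular_module A\<^esub> h z y" if "y \<in> carrier (Rep P i)" for y
        unfolding h_def rep_space_simps(3) mod_homD(2)[OF db(2)[OF k] x rep_carrier[OF M that]]
        using r by (simp add: add_L)
      show "h z (a \<odot>\<^bsub>Rep P i\<^esub> x) = a \<odot>\<^bsub>regular_module A\<^esub> h z x" if "a \<in> carrier A" for a
        unfolding h_def rep_space_simps(4) mod_homD(3)[OF db(2)[OF k] scal_el_closed[OF that] x]
        using L_left_mult(1)[OF db(5)[OF k x] that r] by simp
    qed
  next
    fix x assume x: "x \<in> carrier (Rep P i)"
    note xP = rep_carrier[OF M x]
    have tm: "vert_el i \<odot>\<^bsub>P\<^esub> (F k x \<odot>\<^bsub>P\<^esub> b k) = (\<Oplus>\<^bsub>Rep P i\<^esub>r\<in>paths Q. F k x r \<odot>\<^bsub>Rep P i\<^esub> c (k, r))"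
      if k: "k \<in> {..<m}" for k
    proof -
      note Fk = db(5)[OF k xP] and bk = db(3)[OF k]
      have cl: "F k x r \<in> carrier A" if "r \<in> paths Q" for r by (rule L_closed[OF Fk that])
      have t: "(\<lambda>r. pure_tensor A Q (F k x r) (path_basis K Q r)) \<in> paths Q \<rightarrow> carrier L"
        using cl by (intro Pi_I) simp
      have e: "vert_el i \<odot>\<^bsub>P\<^esub> (pure_tensor A Q (F k x r) (path_basis K Q r) \<odot>\<^bsub>P\<^esub> b k) = F k x r \<odot>\<^bsub>Rep P i\<^esub> c (k, r)"
        if r: "r \<in> paths Q" for r
        unfolding scal_el_path_el(1)[OF cl[OF r], symmetric] rep_space_simps(4) c_def fst_conv snd_conv
          P.smult_assoc1[OF scal_el_closed[OF cl[OF r]] path_el_closed bk]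
        by (rule scal_path[OF M cl[OF r] P.smult_closed[OF path_el_closed bk], symmetric])
      have "F k x \<odot>\<^bsub>P\<^esub> b k = (\<Oplus>\<^bsub>L\<^esub>r\<in>paths Q. pure_tensor A Q (F k x r) (path_basis K Q r)) \<odot>\<^bsub>P\<^esub> b k"
        using L_expansion[OF Fk] by simp
      also have "\<dots> = (\<Oplus>\<^bsub>P\<^esub>r\<in>paths Q. pure_tensor A Q (F k x r) (path_basis K Q r) \<odot>\<^bsub>P\<^esub> b k)"
        by (rule P.smult_finsum_left[OF finite_paths t bk])
      finally have "vert_el i \<odot>\<^bsub>P\<^esub> (F k x \<odot>\<^bsub>P\<^esub> b k) =
          vert_el i \<odot>\<^bsub>P\<^esub> (\<Oplus>\<^bsub>P\<^esub>r\<in>paths Q. pure_tensor A Q (F k x r) (path_basis K Q r) \<odot>\<^bsub>P\<^esub> b k)" by simp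
      also have "\<dots> = (\<Oplus>\<^bsub>P\<^esub>r\<in>paths Q. vert_el i \<odot>\<^bsub>P\<^esub> (pure_tensor A Q (F k x r) (path_basis K Q r) \<odot>\<^bsub>P\<^esub> b k))"
        by (rule P.smult_finsum_right[OF finite_paths _ path_el_closed]) (use t bk in \<open>auto intro!: P.smult_closed simp del: split_paired_All\<close>)
      also have "\<dots> = (\<Oplus>\<^bsub>Rep P i\<^esub>r\<in>paths Q. vert_el i \<odot>\<^bsub>P\<^esub> (pure_tensor A Q (F k x r) (path_basis K Q r) \<odot>\<^bsub>P\<^esub> b k))"
        by (rule finsum_rep[OF M i, symmetric]) (intro Pi_I rep_memI[OF M] P.smult_closed[OF funcset_mem[OF t] bk])
      also have "\<dots> = (\<Oplus>\<^bsub>Rep P i\<^esub>r\<in>paths Q. F k x r \<odot>\<^bsub>Rep P i\<^esub> c (k, r))"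
      proof (rule V.M.finsum_cong'[OF refl _ e])
        show "(\<lambda>r. F k x r \<odot>\<^bsub>Rep P i\<^esub> c (k, r)) \<in> paths Q \<rightarrow> carrier (Rep P i)"
          unfolding c_def fst_conv snd_conv
          by (intro Pi_I V.smult_closed cl rep_memI[OF M P.smult_closed[OF path_el_closed bk]])
      qed
      finally show ?thesis .
    qed
    have ct: "(\<lambda>z. h z x \<odot>\<^bsub>Rep P i\<^esub> c z) \<in> {..<m} \<times> paths Q \<rightarrow> carrier (Rep P i)"
      unfolding h_def c_def
      by (intro Pi_I V.smult_closed rep_memI[OF M P.smult_closed[OF path_el_closed db(3)]] L_closed[OF db(5)[OF _ xP]]) auto
    have ct2: "F k x r \<odot>\<^bsub>Rep P i\<^esub> c (k, r) \<in> carrier (Rep P i)" if "k \<in> {..<m}" "r \<in> paths Q" for k r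
      using funcset_mem[OF ct, of "(k, r)"] that by (simp add: h_def)
    have "x = vert_el i \<odot>\<^bsub>P\<^esub> (\<Oplus>\<^bsub>P\<^esub>k\<in>{..<m}. F k x \<odot>\<^bsub>P\<^esub> b k)"
      unfolding db(4)[OF xP] using rep_vert[OF M i x, of i] by simp
    also have "\<dots> = (\<Oplus>\<^bsub>P\<^esub>k\<in>{..<m}. vert_el i \<odot>\<^bsub>P\<^esub> (F k x \<odot>\<^bsub>P\<^esub> b k))"
      by (rule P.smult_finsum_right[OF finite_lessThan _ path_el_closed]) (intro Pi_I P.smult_closed db(3) db(5) xP)
    also have "\<dots> = (\<Oplus>\<^bsub>Rep P i\<^esub>k\<in>{..<m}. vert_el i \<odot>\<^bsub>P\<^esub> (F k x \<odot>\<^bsub>P\<^esub> b k))"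
      by (rule finsum_rep[OF M i, symmetric]) (intro Pi_I rep_memI[OF M] P.smult_closed db(3) db(5) xP)
    also have "\<dots> = (\<Oplus>\<^bsub>Rep P i\<^esub>k\<in>{..<m}. \<Oplus>\<^bsub>Rep P i\<^esub>r\<in>paths Q. F k x r \<odot>\<^bsub>Rep P i\<^esub> c (k, r))"
      by (rule V.M.finsum_cong'[OF refl _ tm]) (intro Pi_I V.M.finsum_closed ct2)
    also have "\<dots> = (\<Oplus>\<^bsub>Rep P i\<^esub>z\<in>{..<m} \<times> paths Q. F (fst z) x (snd z) \<odot>\<^bsub>Rep P i\<^esub> c (fst z, snd z))"
      by (rule V.M.finsum_Sigma[OF finite_lessThan finite_paths ct2])
    also have "\<dots> = (\<Oplus>\<^bsub>Rep P i\<^esub>z\<in>{..<m} \<times> paths Q. h z x \<odot>\<^bsub>Rep P i\<^esub> c z)"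
      by (simp add: h_def)
    finally show "x = (\<Oplus>\<^bsub>Rep P i\<^esub>z\<in>{..<m} \<times> paths Q. h z x \<odot>\<^bsub>Rep P i\<^esub> c z)" .
  qed
  then show ?thesis by (rule fg_projectiveI[OF MV])
qed

text \<open>
  Extended to \<open>X\<close> by zero on the other \<open>X\<^sub>j\<close>, the functional \<open>f\<close> is semilinear with respect to the
  augmentation \<open>L \<rightarrow> A\<close> at \<open>i\<close>.
\<close>

lemma corner_functional_mult:
  assumes X: "left_module L X" and i: "i \<in> verts Q"
    and f: "f \<in> mod_hom A (Rep X i) (regular_module A)" and f0: "\<And>x. x \<in> Incoming X i \<Longrightarrow> f x = \<zero>\<^bsub>A\<^esub>"
    and l: "l \<in> carrier L" and x: "x \<in> carrier X"
  shows "f (vert_el i \<odot>\<^bsub>X\<^esub> (l \<odot>\<^bsub>X\<^esub> x)) = l (trivial_path i) \<otimes>\<^bsub>A\<^esub> f (vert_el i \<odot>\<^bsub>X\<^esub> x)"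
proof -
  interpret L: ring L by (rule ring_L)
  interpret X: left_module L X by (rule X)
  note S = Incoming_submodule[OF X i] and MV = left_module_rep[OF X i]
  have a: "l (trivial_path i) \<in> carrier A" using l i by simp
  have s: "strip \<beta> l \<in> carrier L" if "\<beta> \<in> in_arcs Q i" for \<beta> by (rule strip_left_mult(1)[OF l in_arcsD(1)[OF that]])
  have t: "(\<lambda>\<beta>. arrow_el \<beta> \<otimes>\<^bsub>L\<^esub> strip \<beta> l) \<in> in_arcs Q i \<rightarrow> carrier L"
    by (intro Pi_I L.m_closed path_el_closed s)
  have inc: "arrow_el \<beta> \<odot>\<^bsub>X\<^esub> (strip \<beta> l \<odot>\<^bsub>X\<^esub> x) \<in> Incoming X i" if "\<beta> \<in> in_arcs Q i" for \<beta>
    using Incoming_arrow[OF X in_arcsD(1)[OF that] X.smult_closed[OF s[OF that] x]] in_arcsD(2)[OF that] by simp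
  \<comment> \<open>The contribution of the paths of positive length ending at i. It lies in the sum
    of the incoming images, where \<open>f\<close> vanishes.\<close>
  define z where "z = (\<Oplus>\<^bsub>Rep X i\<^esub>\<beta>\<in>in_arcs Q i. arrow_el \<beta> \<odot>\<^bsub>X\<^esub> (strip \<beta> l \<odot>\<^bsub>X\<^esub> x))"
  have z: "z \<in> Incoming X i" unfolding z_def by (rule left_submodule_finsum[OF MV S]) (intro Pi_I inc)
  have v: "vert_el i \<odot>\<^bsub>X\<^esub> x \<in> carrier (Rep X i)" by (rule rep_memI[OF X x])
  have "vert_el i \<odot>\<^bsub>X\<^esub> (l \<odot>\<^bsub>X\<^esub> x) = (vert_el i \<otimes>\<^bsub>L\<^esub> l) \<odot>\<^bsub>X\<^esub> x" by (rule el_assoc[OF X path_el_closed l x])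
  also have "\<dots> = (scal_el (l (trivial_path i)) \<otimes>\<^bsub>L\<^esub> vert_el i) \<odot>\<^bsub>X\<^esub> x \<oplus>\<^bsub>X\<^esub>
      (\<Oplus>\<^bsub>L\<^esub>\<beta>\<in>in_arcs Q i. arrow_el \<beta> \<otimes>\<^bsub>L\<^esub> strip \<beta> l) \<odot>\<^bsub>X\<^esub> x"
    unfolding strip_expansion[OF l i]
    by (rule X.smult_l_distr[OF L.m_closed[OF scal_el_closed[OF a] path_el_closed] L.finsum_closed[OF t] x])
  also have "(scal_el (l (trivial_path i)) \<otimes>\<^bsub>L\<^esub> vert_el i) \<odot>\<^bsub>X\<^esub> x = l (trivial_path i) \<odot>\<^bsub>Rep X i\<^esub> (vert_el i \<odot>\<^bsub>X\<^esub> x)"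
    unfolding rep_space_simps(4) by (rule X.smult_assoc1[OF scal_el_closed[OF a] path_el_closed x])
  also have "(\<Oplus>\<^bsub>L\<^esub>\<beta>\<in>in_arcs Q i. arrow_el \<beta> \<otimes>\<^bsub>L\<^esub> strip \<beta> l) \<odot>\<^bsub>X\<^esub> x =
      (\<Oplus>\<^bsub>X\<^esub>\<beta>\<in>in_arcs Q i. (arrow_el \<beta> \<otimes>\<^bsub>L\<^esub> strip \<beta> l) \<odot>\<^bsub>X\<^esub> x)"
    by (rule X.smult_finsum_left[OF finite_in_arcs t x])
  also have "\<dots> = (\<Oplus>\<^bsub>X\<^esub>\<beta>\<in>in_arcs Q i. arrow_el \<beta> \<odot>\<^bsub>X\<^esub> (strip \<beta> l \<odot>\<^bsub>X\<^esub> x))"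
    by (rule X.M.finsum_cong'[OF refl _ X.smult_assoc1[OF path_el_closed s x]])
       (intro Pi_I X.smult_closed path_el_closed s x)
  also have "\<dots> = z" unfolding z_def
    by (rule finsum_rep[OF X i, symmetric]) (intro Pi_I left_submoduleD(1)[OF S] inc)
  finally have e: "vert_el i \<odot>\<^bsub>X\<^esub> (l \<odot>\<^bsub>X\<^esub> x) = l (trivial_path i) \<odot>\<^bsub>Rep X i\<^esub> (vert_el i \<odot>\<^bsub>X\<^esub> x) \<oplus>\<^bsub>Rep X i\<^esub> z"
    by (simp add: rep_space_simps(3))
  interpret V: left_module A "Rep X i" by (rule MV)
  have "f (vert_el i \<odot>\<^bsub>X\<^esub> (l \<odot>\<^bsub>X\<^esub> x)) = f (l (trivial_path i) \<odot>\<^bsub>Rep X i\<^esub> (vert_el i \<odot>\<^bsub>X\<^esub> x)) \<oplus>\<^bsub>regular_module A\<^esub> f z"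
    unfolding e by (rule mod_homD(2)[OF f V.smult_closed[OF a v] left_submoduleD(1)[OF S z]])
  also have "\<dots> = l (trivial_path i) \<otimes>\<^bsub>A\<^esub> f (vert_el i \<odot>\<^bsub>X\<^esub> x)"
    unfolding mod_homD(3)[OF f a v] f0[OF z] using a mod_homD(1)[OF f v] by simp
  finally show ?thesis .
qed

text \<open>The way back from \<open>L\<close>-linear maps to functionals on the cokernel: a product
  with an arrow on the left has no coefficient at a trivial path.\<close>

lemma corner_functional_of_hom:
  assumes X: "left_module L X" and i: "i \<in> verts Q" and G: "G \<in> mod_hom L X (regular_module L)"
  shows "(\<lambda>y. G y (trivial_path i)) \<in> mod_hom A (Rep X i) (regular_module A)"
    and "y \<in> Incoming X i \<Longrightarrow> G y (trivial_path i) = \<zero>\<^bsub>A\<^esub>"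
proof -
  interpret X: left_module L X by (rule X)
  have tp: "trivial_path i \<in> paths Q" using i by simp
  have Gc: "G y \<in> carrier L" if "y \<in> carrier X" for y using mod_homD(1)[OF G that] by simp
  show h: "(\<lambda>y. G y (trivial_path i)) \<in> mod_hom A (Rep X i) (regular_module A)"
  proof (rule mod_homI)
    fix x assume "x \<in> carrier (Rep X i)"
    then have x: "x \<in> carrier X" by (rule rep_carrier[OF X])
    show "G x (trivial_path i) \<in> carrier (regular_module A)" using Gc[OF x] tp by simp
    show "G (x \<oplus>\<^bsub>Rep X i\<^esub> y) (trivial_path i) = G x (trivial_path i) \<oplus>\<^bsub>regular_module A\<^esub> G y (trivial_path i)"
      if "y \<in> carrier (Rep X i)" for y
      unfolding rep_space_simps(3) mod_homD(2)[OF G x rep_carrier[OF X that]] using tp by (simp add: add_L)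
    show "G (a \<odot>\<^bsub>Rep X i\<^esub> x) (trivial_path i) = a \<odot>\<^bsub>regular_module A\<^esub> G x (trivial_path i)" if "a \<in> carrier A" for a
      unfolding rep_space_simps(4) mod_homD(3)[OF G scal_el_closed[OF that] x]
      using L_left_mult(1)[OF Gc[OF x] that tp] by simp
  qed
  show "G y (trivial_path i) = \<zero>\<^bsub>A\<^esub>" if y: "y \<in> Incoming X i"
  proof -
    obtain z where z: "\<forall>\<alpha>\<in>in_arcs Q i. z \<alpha> \<in> carrier (Rep X (tail Q \<alpha>))"
      and ye: "y = (\<Oplus>\<^bsub>X\<^esub>\<alpha>\<in>in_arcs Q i. arrow_el \<alpha> \<odot>\<^bsub>X\<^esub> z \<alpha>)"
      using Incoming_iff[OF X i] y by blast
    have zX: "z \<alpha> \<in> carrier X" if "\<alpha> \<in> in_arcs Q i" for \<alpha> by (rule rep_carrier[OF X bspec[OF z that]])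
    have zR: "(\<lambda>\<alpha>. arrow_el \<alpha> \<odot>\<^bsub>X\<^esub> z \<alpha>) \<in> in_arcs Q i \<rightarrow> {y \<in> carrier (Rep X i). G y (trivial_path i) = \<zero>\<^bsub>regular_module A\<^esub>}"
    proof (intro Pi_I CollectI conjI)
      fix \<alpha> assume \<alpha>: "\<alpha> \<in> in_arcs Q i"
      show "arrow_el \<alpha> \<odot>\<^bsub>X\<^esub> z \<alpha> \<in> carrier (Rep X i)" by (rule funcset_mem[OF arrow_sum_terms(1)[OF X zX] \<alpha>])
      have "G (arrow_el \<alpha> \<odot>\<^bsub>X\<^esub> z \<alpha>) (trivial_path i) = (arrow_el \<alpha> \<otimes>\<^bsub>L\<^esub> G (z \<alpha>)) (trivial_path i)"
        unfolding mod_homD(3)[OF G path_el_closed zX[OF \<alpha>]] by simp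
      also have "\<dots> = \<zero>\<^bsub>A\<^esub>"
        using L_left_mult(4)[OF Gc[OF zX[OF \<alpha>]] in_arcsD(1)[OF \<alpha>] tp] by simp
      finally show "G (arrow_el \<alpha> \<odot>\<^bsub>X\<^esub> z \<alpha>) (trivial_path i) = \<zero>\<^bsub>regular_module A\<^esub>" by simp
    qed
    note MV = left_module_rep[OF X i]
    have "(\<Oplus>\<^bsub>Rep X i\<^esub>\<alpha>\<in>in_arcs Q i. arrow_el \<alpha> \<odot>\<^bsub>X\<^esub> z \<alpha>) \<in> {y \<in> carrier (Rep X i). G y (trivial_path i) = \<zero>\<^bsub>regular_module A\<^esub>}"
      by (rule left_submodule_finsum[OF MV left_submodule_kernel[OF MV left_module_A h] zR])
    then show ?thesis
      unfolding ye using finsum_rep[OF X i arrow_sum_terms(1)[of X i z, OF X zX]] by simp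
  qed
qed

text \<open>
  The functional \<open>f\<close> is the component at the trivial path of an \<open>L\<close>-linear map \<open>\<Phi>\<close> into \<open>L e\<^sub>i\<close>. Composed
  with the differential, \<open>\<Phi>\<close> takes values in the arrow ideal, which is the direct sum of the \<open>L \<alpha>\<close>
  over the arrows \<open>\<alpha>\<close> starting at \<open>i\<close>, so that the exactness of \<open>Hom(P, L)\<close> can be applied twice.
\<close>

lemma corner_hom_exact:
  assumes "complete_resolution L P d" and i: "i \<in> verts Q"
    and f: "f \<in> mod_hom A (Rep (P n) i) (regular_module A)"
    and f0: "\<And>x. x \<in> Incoming (P n) i \<Longrightarrow> f x = \<zero>\<^bsub>A\<^esub>"
    and fd: "\<And>x. x \<in> carrier (Rep (P (n - 1)) i) \<Longrightarrow> f (d (n - 1) x) = \<zero>\<^bsub>A\<^esub>"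
  shows "\<exists>g\<in>mod_hom A (Rep (P (n + 1)) i) (regular_module A).
    (\<forall>x\<in>Incoming (P (n + 1)) i. g x = \<zero>\<^bsub>A\<^esub>) \<and> (\<forall>x\<in>carrier (Rep (P n) i). f x = g (d n x))"
proof -
  interpret C: complete_resolution L P d by fact
  interpret L: ring L by (rule ring_L)
  note MR = left_module_L
  interpret LL: left_module L "regular_module L" by (rule MR)
  note M = C.left_module_terms[where n = n]
  note M' = C.left_module_terms[where n = "n - 1"]
  interpret P: left_module L "P n" by (rule M)
  interpret Pp: left_module L "P (n - 1)" by (rule M')
  have tp: "trivial_path i \<in> paths Q" using i by simp
  obtain m :: nat and F b where "dual_basis L (P n) {..<m} F b" using fg_projectiveE[OF C.fg_projective_terms] .
  note db = dual_basisD[OF this]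
  define fv where "fv x = f (vert_el i \<odot>\<^bsub>P n\<^esub> x)" for x
  note fvm = corner_functional_mult[OF M i f f0, folded fv_def]
  have fvc: "fv x \<in> carrier A" if "x \<in> carrier (P n)" for x
    unfolding fv_def using mod_homD(1)[OF f rep_memI[OF M that]] by simp
  \<comment> \<open>The vector is chosen so that \<open>F k x\<close> times \<open>c k\<close> has
    coefficient \<open>F k x (trivial_path i)\<close> times \<open>fv (b k)\<close> at the trivial
    path; by semilinearity these add up to \<open>fv x\<close>. The right factor keeps the values in
    \<open>L e_i\<close>.\<close>
  define c where "c k = scal_el (fv (b k)) \<otimes>\<^bsub>L\<^esub> vert_el i" for k
  have cc: "c k \<in> carrier L" if "k \<in> {..<m}" for k
    unfolding c_def by (intro L.m_closed scal_el_closed fvc db(3) that path_el_closed)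
  have ce: "c k \<otimes>\<^bsub>L\<^esub> vert_el i = c k" if "k \<in> {..<m}" for k
    unfolding c_def using L.m_assoc[OF scal_el_closed[OF fvc[OF db(3)[OF that]]] path_el_closed path_el_closed]
      path_el_mult(1)[OF tp, of i] by simp
  have ct: "c k (trivial_path i) = fv (b k)" if "k \<in> {..<m}" for k
    unfolding c_def L_left_mult(1)[OF path_el_closed fvc[OF db(3)[OF that]] tp] path_el_apply[OF tp]
    using fvc[OF db(3)[OF that]] by simp
  define \<Phi> where "\<Phi> x = (\<Oplus>\<^bsub>regular_module L\<^esub>k\<in>{..<m}. F k x \<odot>\<^bsub>regular_module L\<^esub> c k)" for x
  have \<Phi>: "\<Phi> \<in> mod_hom L (P n) (regular_module L)"
    unfolding \<Phi>_def
    by (rule mod_hom_finsum_fun[OF MR finite_lessThan]) (rule mod_hom_smult_vector[OF MR db(2)], simp_all add: cc)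
  have \<Phi>t: "(\<lambda>k. F k x \<otimes>\<^bsub>L\<^esub> c k) \<in> {..<m} \<rightarrow> carrier L" if "x \<in> carrier (P n)" for x
    by (intro Pi_I L.m_closed db(5) that cc)
  have \<Phi>e: "\<Phi> x = (\<Oplus>\<^bsub>L\<^esub>k\<in>{..<m}. F k x \<otimes>\<^bsub>L\<^esub> c k)" for x unfolding \<Phi>_def finsum_regular by simp
  have \<Phi>c: "\<Phi> x \<in> carrier L" if "x \<in> carrier (P n)" for x using mod_homD(1)[OF \<Phi> that] by simp
  have \<Phi>v: "\<Phi> x \<otimes>\<^bsub>L\<^esub> vert_el i = \<Phi> x" if x: "x \<in> carrier (P n)" for x
  proof -
    have "\<Phi> x \<otimes>\<^bsub>L\<^esub> vert_el i = (\<Oplus>\<^bsub>L\<^esub>k\<in>{..<m}. F k x \<otimes>\<^bsub>L\<^esub> c k \<otimes>\<^bsub>L\<^esub> vert_el i)"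
      unfolding \<Phi>e by (rule L.finsum_ldistr[OF finite_lessThan path_el_closed \<Phi>t[OF x]])
    also have "\<dots> = (\<Oplus>\<^bsub>L\<^esub>k\<in>{..<m}. F k x \<otimes>\<^bsub>L\<^esub> c k)"
    proof (rule L.finsum_cong'[OF refl \<Phi>t[OF x]])
      fix k assume k: "k \<in> {..<m}"
      show "F k x \<otimes>\<^bsub>L\<^esub> c k \<otimes>\<^bsub>L\<^esub> vert_el i = F k x \<otimes>\<^bsub>L\<^esub> c k"
        unfolding L.m_assoc[OF db(5)[OF k x] cc[OF k] path_el_closed] ce[OF k] ..
    qed
    finally show ?thesis unfolding \<Phi>e .
  qed
  have \<Phi>0: "\<Phi> x (trivial_path i) = fv x" if x: "x \<in> carrier (P n)" for x
  proof -
    have bt: "(\<lambda>k. F k x \<odot>\<^bsub>P n\<^esub> b k) \<in> {..<m} \<rightarrow> carrier (P n)" by (intro Pi_I P.smult_closed db(3) db(5) x)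
    have cl: "F k x (trivial_path i) \<otimes>\<^bsub>A\<^esub> fv (b k) \<in> carrier A" if "k \<in> {..<m}" for k
      by (intro A.m_closed L_closed[OF db(5)[OF that x] tp] fvc db(3) that)
    have "\<Phi> x (trivial_path i) = (\<Oplus>\<^bsub>A\<^esub>k\<in>{..<m}. (F k x \<otimes>\<^bsub>L\<^esub> c k) (trivial_path i))"
      unfolding \<Phi>e by (rule finsum_L_apply[OF finite_lessThan \<Phi>t[OF x] tp])
    also have "\<dots> = (\<Oplus>\<^bsub>A\<^esub>k\<in>{..<m}. F k x (trivial_path i) \<otimes>\<^bsub>A\<^esub> fv (b k))"
    proof (rule A.finsum_cong'[OF refl])
      fix k assume k: "k \<in> {..<m}"
      show "(F k x \<otimes>\<^bsub>L\<^esub> c k) (trivial_path i) = F k x (trivial_path i) \<otimes>\<^bsub>A\<^esub> fv (b k)"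
        unfolding L_mult_trivial[OF db(5)[OF k x] cc[OF k] i] ct[OF k] ..
    qed (intro Pi_I cl)
    also have "\<dots> = (\<Oplus>\<^bsub>A\<^esub>k\<in>{..<m}. fv (F k x \<odot>\<^bsub>P n\<^esub> b k))"
    proof (rule A.finsum_cong'[OF refl])
      show "(\<lambda>k. fv (F k x \<odot>\<^bsub>P n\<^esub> b k)) \<in> {..<m} \<rightarrow> carrier A" by (intro Pi_I fvc P.smult_closed db(3) db(5) x)
      show "F k x (trivial_path i) \<otimes>\<^bsub>A\<^esub> fv (b k) = fv (F k x \<odot>\<^bsub>P n\<^esub> b k)" if "k \<in> {..<m}" for k
        by (rule fvm[OF _ db(5)[OF that x] db(3)[OF that], symmetric])
    qed
    also have "\<dots> = f (\<Oplus>\<^bsub>Rep (P n) i\<^esub>k\<in>{..<m}. vert_el i \<odot>\<^bsub>P n\<^esub> (F k x \<odot>\<^bsub>P n\<^esub> b k))"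
    proof -
      interpret V: left_module A "Rep (P n) i" by (rule left_module_rep[OF M i])
      interpret AA: left_module A "regular_module A" by (rule left_module_A)
      show ?thesis
        unfolding fv_def finsum_regular[symmetric, where K = A]
        by (rule mod_hom_finsum[OF V.M.abelian_group_axioms AA.M.abelian_group_axioms f finite_lessThan, symmetric])
          (intro Pi_I rep_memI[OF M] funcset_mem[OF bt])
    qed
    also have "\<dots> = f (\<Oplus>\<^bsub>P n\<^esub>k\<in>{..<m}. vert_el i \<odot>\<^bsub>P n\<^esub> (F k x \<odot>\<^bsub>P n\<^esub> b k))"
      by (intro arg_cong[where f = f] finsum_rep[OF M i] Pi_I rep_memI[OF M] funcset_mem[OF bt])
    also have "\<dots> = fv (\<Oplus>\<^bsub>P n\<^esub>k\<in>{..<m}. F k x \<odot>\<^bsub>P n\<^esub> b k)"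
      unfolding fv_def P.smult_finsum_right[OF finite_lessThan bt path_el_closed] ..
    finally show ?thesis using db(4)[OF x] by simp
  qed
  \<comment> \<open>The obstruction to \<Phi> being a cocycle. By \<open>fd\<close> it has no
    coefficient at the trivial path, which is the condition for \<open>costrip\<close> to act
    linearly on it.\<close>
  define \<Psi> where "\<Psi> x = \<Phi> (d (n - 1) x)" for x
  have \<Psi>: "\<Psi> \<in> mod_hom L (P (n - 1)) (regular_module L)"
    unfolding \<Psi>_def by (rule mod_hom_comp[OF C.d_hom' \<Phi>])
  have \<Psi>c: "\<Psi> x \<in> carrier L" if "x \<in> carrier (P (n - 1))" for x using mod_homD(1)[OF \<Psi> that] by simp
  have \<Psi>0: "\<Psi> x (trivial_path i) = \<zero>\<^bsub>A\<^esub>" if x: "x \<in> carrier (P (n - 1))" for x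
    unfolding \<Psi>_def \<Phi>0[OF C.d_closed'[OF x]] fv_def mod_homD(3)[OF C.d_hom' path_el_closed x, symmetric]
    by (rule fd[OF rep_memI[OF M' x]])
  \<comment> \<open>Each coordinate of the obstruction is an \<open>L\<close>-linear cocycle in
    degree \<open>n - 1\<close>, hence extends to degree \<open>n\<close>.\<close>
  have "\<exists>g. g \<in> mod_hom L (P n) (regular_module L) \<and> (\<forall>x\<in>carrier (P (n - 1)). costrip \<alpha> (\<Psi> x) = g (d (n - 1) x))"
    if "\<alpha> \<in> out_arcs Q i" for \<alpha>
  proof -
    have \<alpha>: "\<alpha> \<in> arcs Q" "tail Q \<alpha> = i" using that by auto
    have h: "(\<lambda>x. costrip \<alpha> (\<Psi> x)) \<in> mod_hom L (P (n - 1)) (regular_module L)"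
    proof (rule L_homI[OF M' MR])
      fix x assume x: "x \<in> carrier (P (n - 1))"
      note cs = costrip_left_mult[OF \<Psi>c[OF x] \<alpha>(1)]
      show "costrip \<alpha> (\<Psi> x) \<in> carrier (regular_module L)" using costrip_closed[OF \<Psi>c[OF x] \<alpha>(1)] by simp
      show "costrip \<alpha> (\<Psi> (x \<oplus>\<^bsub>P (n - 1)\<^esub> y)) = costrip \<alpha> (\<Psi> x) \<oplus>\<^bsub>regular_module L\<^esub> costrip \<alpha> (\<Psi> y)"
        if "y \<in> carrier (P (n - 1))" for y
        unfolding mod_homD(2)[OF \<Psi> x that] using cs(1)[OF \<Psi>c[OF that]] by simp
      show "costrip \<alpha> (\<Psi> (scal_el a \<odot>\<^bsub>P (n - 1)\<^esub> x)) = scal_el a \<odot>\<^bsub>regular_module L\<^esub> costrip \<alpha> (\<Psi> x)"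
        if "a \<in> carrier A" for a
        unfolding mod_homD(3)[OF \<Psi> scal_el_closed[OF that] x] using cs(2)[OF that] by simp
      show "costrip \<alpha> (\<Psi> (vert_el j \<odot>\<^bsub>P (n - 1)\<^esub> x)) = vert_el j \<odot>\<^bsub>regular_module L\<^esub> costrip \<alpha> (\<Psi> x)" for j
        unfolding mod_homD(3)[OF \<Psi> path_el_closed x] using cs(3) by simp
      show "costrip \<alpha> (\<Psi> (arrow_el \<beta> \<odot>\<^bsub>P (n - 1)\<^esub> x)) = arrow_el \<beta> \<odot>\<^bsub>regular_module L\<^esub> costrip \<alpha> (\<Psi> x)"
        if "\<beta> \<in> arcs Q" for \<beta>
        unfolding mod_homD(3)[OF \<Psi> path_el_closed x] using cs(4)[OF that] \<Psi>0[OF x] \<alpha>(2) by simp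
    qed
    have k: "costrip \<alpha> (\<Psi> (d (n - 1 - 1) y)) = \<zero>\<^bsub>L\<^esub>" if y: "y \<in> carrier (P (n - 1 - 1))" for y
    proof -
      have "d (n - 1) (d (n - 1 - 1) y) = \<zero>\<^bsub>P (n - 1 + 1)\<^esub>" by (rule C.d_d[OF y])
      then have "\<Psi> (d (n - 1 - 1) y) = \<zero>\<^bsub>L\<^esub>"
        unfolding \<Psi>_def using mod_hom_zero[OF M MR \<Phi>] by simp
      then show ?thesis using costrip_left_mult(5)[OF L.zero_closed \<alpha>(1)] by simp
    qed
    have n1: "n - 1 + 1 = n" by simp
    show ?thesis using C.hom_exact_regular[OF h k] unfolding n1 .
  qed
  then obtain \<theta> where \<theta>: "\<forall>\<alpha>\<in>out_arcs Q i. \<theta> \<alpha> \<in> mod_hom L (P n) (regular_module L) \<and>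
      (\<forall>x\<in>carrier (P (n - 1)). costrip \<alpha> (\<Psi> x) = \<theta> \<alpha> (d (n - 1) x))"
    by metis
  \<comment> \<open>Reassembled along the arrows, the extensions have the same composite with the
    differential as \<Phi>, but no coefficient at the trivial path; subtracting \<Theta> repairs the
    lift without changing \<open>f\<close>.\<close>
  define \<Theta> where "\<Theta> x = (\<Oplus>\<^bsub>regular_module L\<^esub>\<alpha>\<in>out_arcs Q i. \<theta> \<alpha> x \<odot>\<^bsub>regular_module L\<^esub> arrow_el \<alpha>)" for x
  have fin: "finite (out_arcs Q i)" by (rule finite_subset[OF _ finite_arcs]) auto
  have \<theta>h: "\<theta> \<alpha> \<in> mod_hom L (P n) (regular_module L)" if "\<alpha> \<in> out_arcs Q i" for \<alpha> using bspec[OF \<theta> that] by simp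
  have \<theta>c: "\<theta> \<alpha> x \<in> carrier L" if "\<alpha> \<in> out_arcs Q i" "x \<in> carrier (P n)" for \<alpha> x
    using mod_homD(1)[OF \<theta>h[OF that(1)] that(2)] by simp
  have \<Theta>: "\<Theta> \<in> mod_hom L (P n) (regular_module L)"
    unfolding \<Theta>_def
    by (rule mod_hom_finsum_fun[OF MR fin]) (rule mod_hom_smult_vector[OF MR \<theta>h], simp_all)
  have \<Theta>d: "\<Theta> (d (n - 1) x) = \<Psi> x" if x: "x \<in> carrier (P (n - 1))" for x
  proof -
    have "\<Psi> x = (\<Oplus>\<^bsub>regular_module L\<^esub>\<alpha>\<in>out_arcs Q i. costrip \<alpha> (\<Psi> x) \<otimes>\<^bsub>L\<^esub> arrow_el \<alpha>)"
      by (rule costrip_expansion[OF \<Psi>c[OF x] _ \<Psi>0[OF x]]) (unfold \<Psi>_def, rule \<Phi>v[OF C.d_closed'[OF x]])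
    also have "\<dots> = \<Theta> (d (n - 1) x)"
      unfolding \<Theta>_def
    proof (rule LL.M.finsum_cong'[OF refl])
      show "(\<lambda>\<alpha>. \<theta> \<alpha> (d (n - 1) x) \<odot>\<^bsub>regular_module L\<^esub> arrow_el \<alpha>) \<in> out_arcs Q i \<rightarrow> carrier (regular_module L)"
        by (intro Pi_I LL.smult_closed \<theta>c C.d_closed'[OF x]) simp_all
      show "costrip \<alpha> (\<Psi> x) \<otimes>\<^bsub>L\<^esub> arrow_el \<alpha> = \<theta> \<alpha> (d (n - 1) x) \<odot>\<^bsub>regular_module L\<^esub> arrow_el \<alpha>"
        if "\<alpha> \<in> out_arcs Q i" for \<alpha>
        using bspec[OF \<theta> that] x by simp
    qed
    finally show ?thesis ..
  qed
  have \<Theta>0: "\<Theta> x (trivial_path i) = \<zero>\<^bsub>A\<^esub>" if x: "x \<in> carrier (P n)" for x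
  proof -
    have "\<Theta> x (trivial_path i) = (\<Oplus>\<^bsub>A\<^esub>\<alpha>\<in>out_arcs Q i. (\<theta> \<alpha> x \<otimes>\<^bsub>L\<^esub> arrow_el \<alpha>) (trivial_path i))"
      unfolding \<Theta>_def finsum_regular regular_module_simps
      by (rule finsum_L_apply[OF fin _ tp]) (intro Pi_I L.m_closed \<theta>c x path_el_closed)
    also have "\<dots> = (\<Oplus>\<^bsub>A\<^esub>\<alpha>\<in>out_arcs Q i. \<zero>\<^bsub>A\<^esub>)"
    proof (rule A.finsum_cong'[OF refl])
      fix \<alpha> assume \<alpha>: "\<alpha> \<in> out_arcs Q i"
      have "arrow_el \<alpha> (trivial_path i) = \<zero>\<^bsub>A\<^esub>"
        unfolding path_el_apply[OF tp] by (simp add: trivial_path_def arrow_path_def)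
      then show "(\<theta> \<alpha> x \<otimes>\<^bsub>L\<^esub> arrow_el \<alpha>) (trivial_path i) = \<zero>\<^bsub>A\<^esub>"
        unfolding L_mult_trivial[OF \<theta>c[OF \<alpha> x] path_el_closed i]
        using L_closed[OF \<theta>c[OF \<alpha> x] tp] by simp
    qed simp
    finally show ?thesis by simp
  qed
  define \<Delta> where "\<Delta> x = \<Phi> x \<ominus>\<^bsub>regular_module L\<^esub> \<Theta> x" for x
  have \<Delta>: "\<Delta> \<in> mod_hom L (P n) (regular_module L)"
    unfolding \<Delta>_def by (rule mod_hom_minus_fun[OF MR \<Phi> \<Theta>])
  have "\<Delta> (d (n - 1) x) = \<zero>\<^bsub>L\<^esub>" if x: "x \<in> carrier (P (n - 1))" for x
  proof -
    have "\<Delta> (d (n - 1) x) = \<Psi> x \<ominus>\<^bsub>regular_module L\<^esub> \<Psi> x"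
      unfolding \<Delta>_def \<Theta>d[OF x] \<Psi>_def ..
    also have "\<dots> = \<zero>\<^bsub>regular_module L\<^esub>"
      using LL.minus_eq_zero_iff[of "\<Psi> x" "\<Psi> x"] mod_homD(1)[OF \<Psi> x] by simp
    finally show ?thesis by simp
  qed
  then obtain G where G: "G \<in> mod_hom L (P (n + 1)) (regular_module L)"
    and Gd: "\<forall>x\<in>carrier (P n). \<Delta> x = G (d n x)"
    using C.hom_exact_regular[OF \<Delta>] by blast
  note G' = corner_functional_of_hom[OF C.left_module_terms i G]
  have eq: "f x = G (d n x) (trivial_path i)" if x: "x \<in> carrier (Rep (P n) i)" for x
  proof -
    note xP = rep_carrier[OF M x]
    note c = mod_homD(1)[OF \<Phi> xP] mod_homD(1)[OF \<Theta> xP] mod_homD(1)[OF \<Delta> xP]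
    have "f x = \<Phi> x (trivial_path i)" unfolding \<Phi>0[OF xP] fv_def using rep_vert[OF M i x, of i] by simp
    also have "\<Phi> x = \<Theta> x \<oplus>\<^bsub>L\<^esub> \<Delta> x"
      unfolding \<Delta>_def using LL.add_minus_cancel(1)[OF c(2,1)] by simp
    also have "\<dots> (trivial_path i) = \<Delta> x (trivial_path i)"
      using tp c(3) L_closed[of "\<Delta> x", OF _ tp] \<Theta>0[OF xP] by (simp add: add_L)
    also have "\<Delta> x = G (d n x)" using Gd xP by blast
    finally show ?thesis .
  qed
  show ?thesis
    by (rule bexI[of _ "\<lambda>y. G y (trivial_path i)"]) (use G' eq in blast)+
qed

end

section \<open>Complete resolutions over the path algebra\<close>

context quiver_algebra
begin

lemma rep_hom:
  assumes X: "left_module L X" and Y: "left_module L Y" and f: "f \<in> mod_hom L X Y"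
  shows "f \<in> mod_hom A (Rep X i) (Rep Y i)"
proof (rule mod_homI)
  fix x assume x: "x \<in> carrier (Rep X i)"
  note xX = rep_carrier[OF X x]
  obtain x0 where x0: "x0 \<in> carrier X" "x = vert_el i \<odot>\<^bsub>X\<^esub> x0" using x unfolding rep_space_simps(1) by blast
  show "f x \<in> carrier (Rep Y i)"
    unfolding x0(2) mod_homD(3)[OF f path_el_closed x0(1)] by (rule rep_memI[OF Y mod_homD(1)[OF f x0(1)]])
  show "f (x \<oplus>\<^bsub>Rep X i\<^esub> y) = f x \<oplus>\<^bsub>Rep Y i\<^esub> f y" if "y \<in> carrier (Rep X i)" for y
    unfolding rep_space_simps(3) by (rule mod_homD(2)[OF f xX rep_carrier[OF X that]])
  show "f (a \<odot>\<^bsub>Rep X i\<^esub> x) = a \<odot>\<^bsub>Rep Y i\<^esub> f x" if "a \<in> carrier A" for a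
    unfolding rep_space_simps(4) by (rule mod_homD(3)[OF f scal_el_closed[OF that] xX])
qed

lemma hom_arrow_sum:
  assumes X: "left_module L X" and Y: "left_module L Y" and f: "f \<in> mod_hom L X Y"
    and y: "\<And>\<alpha>. \<alpha> \<in> in_arcs Q i \<Longrightarrow> y \<alpha> \<in> carrier (Rep X (tail Q \<alpha>))"
  shows "f (\<Oplus>\<^bsub>X\<^esub>\<alpha>\<in>in_arcs Q i. arrow_el \<alpha> \<odot>\<^bsub>X\<^esub> y \<alpha>) = (\<Oplus>\<^bsub>Y\<^esub>\<alpha>\<in>in_arcs Q i. arrow_el \<alpha> \<odot>\<^bsub>Y\<^esub> f (y \<alpha>))"
  by (rule mod_hom_lincomb[OF X Y f finite_in_arcs path_el_closed rep_carrier[OF X y]])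

lemma hom_Incoming:
  assumes X: "left_module L X" and Y: "left_module L Y" and f: "f \<in> mod_hom L X Y"
    and i: "i \<in> verts Q" and x: "x \<in> Incoming X i"
  shows "f x \<in> Incoming Y i"
proof -
  obtain y where y: "\<forall>\<alpha>\<in>in_arcs Q i. y \<alpha> \<in> carrier (Rep X (tail Q \<alpha>))"
    and xe: "x = (\<Oplus>\<^bsub>X\<^esub>\<alpha>\<in>in_arcs Q i. arrow_el \<alpha> \<odot>\<^bsub>X\<^esub> y \<alpha>)"
    using Incoming_iff[OF X i] x by blast
  have "f x = (\<Oplus>\<^bsub>Y\<^esub>\<alpha>\<in>in_arcs Q i. arrow_el \<alpha> \<odot>\<^bsub>Y\<^esub> f (y \<alpha>))"
    unfolding xe by (rule hom_arrow_sum[OF X Y f bspec[OF y]])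
  also have "\<dots> \<in> Incoming Y i"
    by (rule IncomingI[OF Y i]) (rule mod_homD(1)[OF rep_hom[OF X Y f] bspec[OF y]])
  finally show ?thesis .
qed

lemma Incoming_vanishing:
  assumes X: "left_module L X" and N: "left_module A N" and i: "i \<in> verts Q"
    and h: "h \<in> mod_hom A (Rep X i) N"
    and 0: "\<And>\<beta> y. \<beta> \<in> in_arcs Q i \<Longrightarrow> y \<in> carrier (Rep X (tail Q \<beta>)) \<Longrightarrow> h (arrow_el \<beta> \<odot>\<^bsub>X\<^esub> y) = \<zero>\<^bsub>N\<^esub>"
    and x: "x \<in> Incoming X i"
  shows "h x = \<zero>\<^bsub>N\<^esub>"
proof -
  note MV = left_module_rep[OF X i]
  obtain y where y: "\<forall>\<alpha>\<in>in_arcs Q i. y \<alpha> \<in> carrier (Rep X (tail Q \<alpha>))"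
    and xe: "x = (\<Oplus>\<^bsub>X\<^esub>\<alpha>\<in>in_arcs Q i. arrow_el \<alpha> \<odot>\<^bsub>X\<^esub> y \<alpha>)"
    using Incoming_iff[OF X i] x by blast
  have t: "(\<lambda>\<alpha>. arrow_el \<alpha> \<odot>\<^bsub>X\<^esub> y \<alpha>) \<in> in_arcs Q i \<rightarrow> carrier (Rep X i)"
    by (rule arrow_sum_terms(1)[OF X rep_carrier[OF X bspec[OF y]]])
  have "(\<lambda>\<alpha>. arrow_el \<alpha> \<odot>\<^bsub>X\<^esub> y \<alpha>) \<in> in_arcs Q i \<rightarrow> {x \<in> carrier (Rep X i). h x = \<zero>\<^bsub>N\<^esub>}"
    by (intro Pi_I CollectI conjI funcset_mem[OF t] 0 bspec[OF y])
  then have "(\<Oplus>\<^bsub>Rep X i\<^esub>\<alpha>\<in>in_arcs Q i. arrow_el \<alpha> \<odot>\<^bsub>X\<^esub> y \<alpha>) \<in> {x \<in> carrier (Rep X i). h x = \<zero>\<^bsub>N\<^esub>}"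
    by (rule left_submodule_finsum[OF MV left_submodule_kernel[OF MV N h]])
  then show ?thesis unfolding xe using finsum_rep[OF X i t] by simp
qed

section \<open>The spaces of a complete resolution at a vertex\<close>

context
  fixes P :: "int \<Rightarrow> ('d \<times> 'e list \<times> 'd \<Rightarrow> 'c, 'm) module" and d
  assumes C: "complete_resolution L P d"
begin

interpretation C: complete_resolution L P d by (rule C)

lemma rep_d_hom: "d n \<in> mod_hom A (Rep (P n) i) (Rep (P (n + 1)) i)"
  by (rule rep_hom[OF C.left_module_terms C.left_module_terms C.d_hom])

lemma rep_d_hom': "d (n - 1) \<in> mod_hom A (Rep (P (n - 1)) i) (Rep (P n) i)"
  by (rule rep_hom[OF C.left_module_terms C.left_module_terms C.d_hom'])

lemma rep_exact:
  assumes i: "i \<in> verts Q" and x: "x \<in> carrier (Rep (P n) i)" and dx: "d n x = \<zero>\<^bsub>P (n + 1)\<^esub>"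
  obtains y where "y \<in> carrier (Rep (P (n - 1)) i)" "x = d (n - 1) y"
proof -
  obtain y where y: "y \<in> carrier (P (n - 1))" "x = d (n - 1) y"
    using C.exact[OF rep_carrier[OF C.left_module_terms x] dx] .
  have "x = vert_el i \<odot>\<^bsub>P n\<^esub> d (n - 1) y" using rep_vert[OF C.left_module_terms i x, of i] y(2) by simp
  then have "x = d (n - 1) (vert_el i \<odot>\<^bsub>P (n - 1)\<^esub> y)"
    unfolding mod_homD(3)[OF C.d_hom' path_el_closed y(1)] .
  then show thesis using that[OF rep_memI[OF C.left_module_terms y(1)]] by blast
qed

text \<open>A functional on \<open>P_i\<close> restricts along the arrows into i to functionals at
  their tails; it comes from the cokernel if all restrictions vanish. The restrictions are extended
  by induction on the rank, the retractions carry the extensions back to i, and the remainder is a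
  functional on the cokernel, settled by \<open>corner_hom_exact\<close>.\<close>

lemma rep_hom_exact:
  assumes "i \<in> verts Q" and "f \<in> mod_hom A (Rep (P n) i) (regular_module A)"
    and "\<forall>x\<in>carrier (Rep (P (n - 1)) i). f (d (n - 1) x) = \<zero>\<^bsub>A\<^esub>"
  shows "\<exists>g. g \<in> mod_hom A (Rep (P (n + 1)) i) (regular_module A) \<and> (\<forall>x\<in>carrier (Rep (P n) i). f x = g (d n x))"
  using assms
proof (induction "vert_rank i" arbitrary: i f rule: less_induct)
  case less
  note i = less.prems(1) and f = less.prems(2) and fd = less.prems(3)
  note MA = left_module_A
  interpret AA: left_module A "regular_module A" by (rule MA)
  let ?n = "n + 1"
  note M = C.left_module_terms[where n = n] and Mn = C.left_module_terms[where n = ?n]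
  note M0 = C.left_module_terms[where n = "n - 1"]
  obtain \<rho> where \<rho>: "arrow_retraction (P ?n) \<rho>" using projective_arrow_retraction[OF C.fg_projective_terms] by blast
  \<comment> \<open>Precomposition with \<alpha> turns \<open>f\<close> into a cocycle at the tail
    of \<alpha>, a vertex of smaller rank.\<close>
  have "\<exists>g. g \<in> mod_hom A (Rep (P ?n) (tail Q \<alpha>)) (regular_module A) \<and>
      (\<forall>y\<in>carrier (Rep (P n) (tail Q \<alpha>)). f (arrow_el \<alpha> \<odot>\<^bsub>P n\<^esub> y) = g (d n y))"
    if \<alpha>: "\<alpha> \<in> in_arcs Q i" for \<alpha>
  proof (rule less.hyps)
    show "vert_rank (tail Q \<alpha>) < vert_rank i" using vert_rank_less[OF in_arcsD(1)[OF \<alpha>]] in_arcsD(2)[OF \<alpha>] by simp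
    show "tail Q \<alpha> \<in> verts Q" by (rule in_arcsD(3)[OF \<alpha>])
    show "(\<lambda>y. f (arrow_el \<alpha> \<odot>\<^bsub>P n\<^esub> y)) \<in> mod_hom A (Rep (P n) (tail Q \<alpha>)) (regular_module A)"
      by (rule mod_hom_comp[OF arrow_hom[OF M \<alpha>] f])
    show "\<forall>x\<in>carrier (Rep (P (n - 1)) (tail Q \<alpha>)). f (arrow_el \<alpha> \<odot>\<^bsub>P n\<^esub> d (n - 1) x) = \<zero>\<^bsub>A\<^esub>"
    proof
      fix x assume x: "x \<in> carrier (Rep (P (n - 1)) (tail Q \<alpha>))"
      show "f (arrow_el \<alpha> \<odot>\<^bsub>P n\<^esub> d (n - 1) x) = \<zero>\<^bsub>A\<^esub>"
        unfolding mod_homD(3)[OF C.d_hom' path_el_closed rep_carrier[OF M0 x], symmetric]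
        by (rule bspec[OF fd mod_homD(1)[OF arrow_hom[OF M0 \<alpha>] x]])
    qed
  qed
  then obtain \<gamma> where \<gamma>: "\<forall>\<alpha>\<in>in_arcs Q i. \<gamma> \<alpha> \<in> mod_hom A (Rep (P ?n) (tail Q \<alpha>)) (regular_module A) \<and>
      (\<forall>y\<in>carrier (Rep (P n) (tail Q \<alpha>)). f (arrow_el \<alpha> \<odot>\<^bsub>P n\<^esub> y) = \<gamma> \<alpha> (d n y))"
    by metis
  have \<gamma>h: "\<gamma> \<alpha> \<in> mod_hom A (Rep (P ?n) (tail Q \<alpha>)) (regular_module A)" if "\<alpha> \<in> in_arcs Q i" for \<alpha>
    using bspec[OF \<gamma> that] by blast
  \<comment> \<open>The retractions are those of \<open>P (n + 1)\<close>, since \<open>g'\<close>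
    has to be evaluated after the differential. They separate the arrows, so \<open>g'\<close>
    restricts along each arrow to the extension found there.\<close>
  define g' where "g' x = (\<Oplus>\<^bsub>regular_module A\<^esub>\<alpha>\<in>in_arcs Q i. \<gamma> \<alpha> (\<rho> \<alpha> x))" for x
  have \<gamma>\<rho>: "(\<lambda>x. \<gamma> \<alpha> (\<rho> \<alpha> x)) \<in> mod_hom A (Rep (P ?n) i) (regular_module A)" if "\<alpha> \<in> in_arcs Q i" for \<alpha>
    by (rule mod_hom_comp[OF retraction_hom[OF Mn \<rho> in_arcsD(1)[OF that]] \<gamma>h[OF that]])
  have g': "g' \<in> mod_hom A (Rep (P ?n) i) (regular_module A)"
    unfolding g'_def by (rule mod_hom_finsum_fun[OF MA finite_in_arcs \<gamma>\<rho>])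
  \<comment> \<open>On arrow sums \<open>f\<close> and \<open>g' o d\<close> agree, so the
    difference is a functional on the cokernel.\<close>
  define f' where "f' x = f x \<ominus>\<^bsub>regular_module A\<^esub> g' (d n x)" for x
  have f': "f' \<in> mod_hom A (Rep (P n) i) (regular_module A)"
    unfolding f'_def by (rule mod_hom_minus_fun[OF MA f mod_hom_comp[OF rep_d_hom g']])
  have g'0: "g' \<zero>\<^bsub>P ?n\<^esub> = \<zero>\<^bsub>A\<^esub>"
    using mod_hom_zero[OF left_module_rep[OF Mn i] MA g'] by (simp add: rep_space_simps(2))
  have f'I: "f' x = \<zero>\<^bsub>A\<^esub>" if "x \<in> Incoming (P n) i" for x
  proof -
    have "f' (arrow_el \<beta> \<odot>\<^bsub>P n\<^esub> y) = \<zero>\<^bsub>regular_module A\<^esub>"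
      if \<beta>: "\<beta> \<in> in_arcs Q i" and y: "y \<in> carrier (Rep (P n) (tail Q \<beta>))" for \<beta> y
    proof -
      note \<beta>' = in_arcsD(1)[OF \<beta>]
      note dy = mod_homD(1)[OF rep_d_hom y]
      note ay = mod_homD(1)[OF arrow_hom[OF M \<beta>] y]
      note ady = mod_homD(1)[OF arrow_hom[OF Mn \<beta>] dy]
      have r: "\<rho> \<alpha> (arrow_el \<beta> \<odot>\<^bsub>P ?n\<^esub> d n y) = (if \<alpha> = \<beta> then d n y else \<zero>\<^bsub>P ?n\<^esub>)" if \<alpha>: "\<alpha> \<in> in_arcs Q i" for \<alpha>
        using arrow_retractionD(4)[OF \<rho> \<beta>' rep_carrier[OF Mn dy] in_arcsD(1)[OF \<alpha>]]
          rep_vert[OF Mn in_arcsD(3)[OF \<beta>] dy, of "tail Q \<beta>"] by auto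
      have z: "\<gamma> \<alpha> \<zero>\<^bsub>P ?n\<^esub> = \<zero>\<^bsub>regular_module A\<^esub>" if \<alpha>: "\<alpha> \<in> in_arcs Q i" for \<alpha>
        using mod_hom_zero[OF left_module_rep[OF Mn in_arcsD(3)[OF \<alpha>]] MA \<gamma>h[OF \<alpha>]] by (simp only: rep_space_simps(2))
      have "g' (d n (arrow_el \<beta> \<odot>\<^bsub>P n\<^esub> y)) = g' (arrow_el \<beta> \<odot>\<^bsub>P ?n\<^esub> d n y)"
        unfolding mod_homD(3)[OF C.d_hom path_el_closed rep_carrier[OF M y]] ..
      also have "\<dots> = \<gamma> \<beta> (\<rho> \<beta> (arrow_el \<beta> \<odot>\<^bsub>P ?n\<^esub> d n y))"
        unfolding g'_def
      proof (rule AA.M.finsum_delta[OF finite_in_arcs \<beta>])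
        show "\<gamma> \<beta> (\<rho> \<beta> (arrow_el \<beta> \<odot>\<^bsub>P ?n\<^esub> d n y)) \<in> carrier (regular_module A)"
          by (rule mod_homD(1)[OF \<gamma>\<rho>[OF \<beta>] ady])
        show "\<gamma> \<alpha> (\<rho> \<alpha> (arrow_el \<beta> \<odot>\<^bsub>P ?n\<^esub> d n y)) = \<zero>\<^bsub>regular_module A\<^esub>" if "\<alpha> \<in> in_arcs Q i" "\<alpha> \<noteq> \<beta>" for \<alpha>
          using r[OF that(1)] z[OF that(1)] that(2) by (simp only: if_False)
      qed
      also have "\<dots> = f (arrow_el \<beta> \<odot>\<^bsub>P n\<^esub> y)"
        using r[OF \<beta>] bspec[OF \<gamma> \<beta>] y by simp
      finally show ?thesis
        unfolding f'_def using AA.minus_eq_zero_iff[OF mod_homD(1)[OF f ay] mod_homD(1)[OF f ay]] by simp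
    qed
    then have "f' x = \<zero>\<^bsub>regular_module A\<^esub>" using that by (rule Incoming_vanishing[OF M MA i f'])
    then show ?thesis by simp
  qed
  have f'd: "f' (d (n - 1) x) = \<zero>\<^bsub>A\<^esub>" if x: "x \<in> carrier (Rep (P (n - 1)) i)" for x
    unfolding f'_def C.d_d[OF rep_carrier[OF M0 x]] g'0 bspec[OF fd x]
    using AA.minus_eq_zero_iff[of "\<zero>\<^bsub>A\<^esub>" "\<zero>\<^bsub>A\<^esub>"] by simp
  obtain g where g: "g \<in> mod_hom A (Rep (P ?n) i) (regular_module A)"
    and gd: "\<forall>x\<in>carrier (Rep (P n) i). f' x = g (d n x)"
    using corner_hom_exact[OF C i f' f'I f'd] by blast
  have "f x = g' (d n x) \<oplus>\<^bsub>regular_module A\<^esub> g (d n x)" if x: "x \<in> carrier (Rep (P n) i)" for x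
    using AA.add_minus_cancel(1)[OF mod_homD(1)[OF g' mod_homD(1)[OF rep_d_hom x]] mod_homD(1)[OF f x]] bspec[OF gd x]
    unfolding f'_def by simp
  then show ?case using mod_hom_add_fun[OF MA g' g] by blast
qed

lemma complete_resolution_rep:
  assumes i: "i \<in> verts Q" shows "complete_resolution A (\<lambda>n. Rep (P n) i) d"
proof (rule complete_resolutionI)
  show "fg_projective A (Rep (P n) i)" for n by (rule fg_projective_rep[OF C.fg_projective_terms i])
  show "d n \<in> mod_hom A (Rep (P n) i) (Rep (P (n + 1)) i)" for n by (rule rep_d_hom)
  show "d n (d (n - 1) x) = \<zero>\<^bsub>Rep (P (n + 1)) i\<^esub>" if "x \<in> carrier (Rep (P (n - 1)) i)" for n x
    unfolding rep_space_simps(2) by (rule C.d_d[OF rep_carrier[OF C.left_module_terms that]])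
  show "x \<in> d (n - 1) ` carrier (Rep (P (n - 1)) i)"
    if x: "x \<in> carrier (Rep (P n) i)" and "d n x = \<zero>\<^bsub>Rep (P (n + 1)) i\<^esub>" for n x
  proof -
    have "d n x = \<zero>\<^bsub>P (n + 1)\<^esub>" using that(2) by (simp only: rep_space_simps(2))
    from rep_exact[OF i x this] show ?thesis by blast
  qed
  show "\<exists>g\<in>mod_hom A (Rep (P (n + 1)) i) (regular_module A). \<forall>x\<in>carrier (Rep (P n) i). f x = g (d n x)"
    if "f \<in> mod_hom A (Rep (P n) i) (regular_module A)"
      "\<And>x. x \<in> carrier (Rep (P (n - 1)) i) \<Longrightarrow> f (d (n - 1) x) = \<zero>\<^bsub>A\<^esub>" for n f
    using rep_hom_exact[OF i that(1)] that(2) by blast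
qed

text \<open>\<open>P (n + 1)\<close> is monic, so an arrow sum of differentials vanishes only if
  every component does.\<close>

lemma incoming_kernel:
  assumes i: "i \<in> verts Q" and z: "\<And>\<alpha>. \<alpha> \<in> in_arcs Q i \<Longrightarrow> z \<alpha> \<in> carrier (Rep (P n) (tail Q \<alpha>))"
    and 0: "d n (\<Oplus>\<^bsub>P n\<^esub>\<alpha>\<in>in_arcs Q i. arrow_el \<alpha> \<odot>\<^bsub>P n\<^esub> z \<alpha>) = \<zero>\<^bsub>P (n + 1)\<^esub>" and \<beta>: "\<beta> \<in> in_arcs Q i"
  shows "d n (z \<beta>) = \<zero>\<^bsub>P (n + 1)\<^esub>"
proof -
  note M = C.left_module_terms
  obtain \<rho> where \<rho>: "arrow_retraction (P (n + 1)) \<rho>" using projective_arrow_retraction[OF C.fg_projective_terms] by blast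
  have "(\<Oplus>\<^bsub>P (n + 1)\<^esub>\<alpha>\<in>in_arcs Q i. arrow_el \<alpha> \<odot>\<^bsub>P (n + 1)\<^esub> d n (z \<alpha>)) =
      d n (\<Oplus>\<^bsub>P n\<^esub>\<alpha>\<in>in_arcs Q i. arrow_el \<alpha> \<odot>\<^bsub>P n\<^esub> z \<alpha>)"
    by (rule hom_arrow_sum[OF M M C.d_hom z, symmetric])
  also have "\<dots> = (\<Oplus>\<^bsub>P (n + 1)\<^esub>\<alpha>\<in>in_arcs Q i. arrow_el \<alpha> \<odot>\<^bsub>P (n + 1)\<^esub> \<zero>\<^bsub>P (n + 1)\<^esub>)"
    unfolding arrow_sum_zero[OF M] by (rule 0)
  finally have e: "(\<Oplus>\<^bsub>P (n + 1)\<^esub>\<alpha>\<in>in_arcs Q i. arrow_el \<alpha> \<odot>\<^bsub>P (n + 1)\<^esub> d n (z \<alpha>)) =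
      (\<Oplus>\<^bsub>P (n + 1)\<^esub>\<alpha>\<in>in_arcs Q i. arrow_el \<alpha> \<odot>\<^bsub>P (n + 1)\<^esub> \<zero>\<^bsub>P (n + 1)\<^esub>)" .
  show ?thesis
    by (rule retraction_inj[OF M \<rho> i _ _ e \<beta>])
      (rule mod_homD(1)[OF rep_d_hom z] rep_zero[OF M in_arcsD(3)], assumption)+
qed

text \<open>Exactness of the cokernel complex, stated in the spaces. The components of
  \<open>d n y\<close> along the arrows are cycles, hence boundaries at the tails; an arrow sum of
  their preimages has the same differential as \<open>y\<close>.\<close>

lemma rep_exact_incoming:
  assumes i: "i \<in> verts Q" and y: "y \<in> carrier (Rep (P n) i)" and dy: "d n y \<in> Incoming (P (n + 1)) i"
  obtains w b where "w \<in> carrier (Rep (P (n - 1)) i)" "b \<in> Incoming (P n) i" "y = d (n - 1) w \<oplus>\<^bsub>Rep (P n) i\<^esub> b"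
proof -
  note M = C.left_module_terms
  note MV = left_module_rep[OF M i]
  interpret V: left_module A "Rep (P n) i" by (rule MV)
  obtain z where z: "\<forall>\<alpha>\<in>in_arcs Q i. z \<alpha> \<in> carrier (Rep (P (n + 1)) (tail Q \<alpha>))"
    and e: "d n y = (\<Oplus>\<^bsub>P (n + 1)\<^esub>\<alpha>\<in>in_arcs Q i. arrow_el \<alpha> \<odot>\<^bsub>P (n + 1)\<^esub> z \<alpha>)"
    using Incoming_iff[OF M i] dy by blast
  have yP: "y \<in> carrier (P (n + 1 - 1))" using rep_carrier[OF M y] by simp
  have dd: "d (n + 1) (d n y) = \<zero>\<^bsub>P (n + 1 + 1)\<^esub>" using C.d_d[OF yP] by simp
  have dz: "d (n + 1) (z \<alpha>) = \<zero>\<^bsub>P (n + 1 + 1)\<^esub>" if "\<alpha> \<in> in_arcs Q i" for \<alpha>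
    by (rule incoming_kernel[OF i bspec[OF z] dd[unfolded e] that])
  have "\<exists>w. w \<in> carrier (Rep (P n) (tail Q \<alpha>)) \<and> z \<alpha> = d n w" if \<alpha>: "\<alpha> \<in> in_arcs Q i" for \<alpha>
  proof -
    obtain w where "w \<in> carrier (Rep (P (n + 1 - 1)) (tail Q \<alpha>))" "z \<alpha> = d (n + 1 - 1) w"
      using rep_exact[OF in_arcsD(3)[OF \<alpha>] bspec[OF z \<alpha>] dz[OF \<alpha>]] .
    then show ?thesis by auto
  qed
  then obtain w where w: "\<forall>\<alpha>\<in>in_arcs Q i. w \<alpha> \<in> carrier (Rep (P n) (tail Q \<alpha>)) \<and> z \<alpha> = d n (w \<alpha>)" by metis
  have wc: "w \<alpha> \<in> carrier (Rep (P n) (tail Q \<alpha>))" if "\<alpha> \<in> in_arcs Q i" for \<alpha> using bspec[OF w that] by blast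
  define b where "b = (\<Oplus>\<^bsub>P n\<^esub>\<alpha>\<in>in_arcs Q i. arrow_el \<alpha> \<odot>\<^bsub>P n\<^esub> w \<alpha>)"
  have b: "b \<in> Incoming (P n) i" unfolding b_def by (rule IncomingI[OF M i wc])
  note bV = left_submoduleD(1)[OF Incoming_submodule[OF M i] b]
  have "d n b = (\<Oplus>\<^bsub>P (n + 1)\<^esub>\<alpha>\<in>in_arcs Q i. arrow_el \<alpha> \<odot>\<^bsub>P (n + 1)\<^esub> d n (w \<alpha>))"
    unfolding b_def by (rule hom_arrow_sum[OF M M C.d_hom wc])
  also have "\<dots> = d n y"
  proof -
    interpret P1: left_module L "P (n + 1)" by (rule M)
    show ?thesis unfolding e
      by (rule P1.M.finsum_cong'[OF refl arrow_sum_terms(2)[OF M rep_carrier[OF M bspec[OF z]]]]) (use w in auto)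
  qed
  finally have db: "d n b = d n y" .
  have "d n (y \<ominus>\<^bsub>Rep (P n) i\<^esub> b) = \<zero>\<^bsub>Rep (P (n + 1)) i\<^esub>"
  proof -
    interpret V1: left_module A "Rep (P (n + 1)) i" by (rule left_module_rep[OF M i])
    note c = mod_homD(1)[OF rep_d_hom y]
    show ?thesis unfolding mod_hom_minus(2)[OF MV V1.left_module_axioms rep_d_hom y bV] db
      using V1.minus_eq_zero_iff[OF c c] by blast
  qed
  then have "d n (y \<ominus>\<^bsub>Rep (P n) i\<^esub> b) = \<zero>\<^bsub>P (n + 1)\<^esub>" by (simp only: rep_space_simps(2))
  then obtain u where u: "u \<in> carrier (Rep (P (n - 1)) i)" "y \<ominus>\<^bsub>Rep (P n) i\<^esub> b = d (n - 1) u"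
    by (rule rep_exact[OF i V.M.minus_closed[OF y bV]]) blast
  have "y = d (n - 1) u \<oplus>\<^bsub>Rep (P n) i\<^esub> b"
    using V.add_minus_cancel(1)[OF bV y] V.M.a_comm[OF bV V.M.minus_closed[OF y bV]] u(2) by simp
  then show thesis by (rule that[OF u(1) b])
qed

end

end

section \<open>The cokernels of a complete resolution at a vertex\<close>

context quiver_algebra
begin

text \<open>The cokernels are modelled by the images of the idempotents \<open>\<kappa> n\<close>.
  The differential preserves these images only modulo the incoming ones, hence the additional
  \<open>\<kappa> (n + 1)\<close>. The last two facts concern all of \<open>P_i\<close>, because the
  cokernel of \<open>X\<close> is mapped into the model from elements of \<open>P 0\<close> outside
  it.\<close>

lemma complete_resolution_corner:
  assumes C: "complete_resolution L P d" and i: "i \<in> verts Q" and \<rho>: "\<And>n. arrow_retraction (P n) (\<rho> n)"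
  defines "\<kappa> \<equiv> \<lambda>n. corner (P n) (\<rho> n) i"
  shows "complete_resolution A (\<lambda>n. restrict_carrier (Rep (P n) i) (\<kappa> n ` carrier (Rep (P n) i))) (\<lambda>n x. \<kappa> (n + 1) (d n x))"
    and "y \<in> carrier (Rep (P n) i) \<Longrightarrow> \<kappa> (n + 1) (d n (\<kappa> n y)) = \<kappa> (n + 1) (d n y)"
    and "y \<in> carrier (Rep (P n) i) \<Longrightarrow> \<kappa> (n + 1) (d n y) = \<zero>\<^bsub>P (n + 1)\<^esub> \<Longrightarrow>
      \<exists>w\<in>carrier (Rep (P (n - 1)) i). \<kappa> n y = \<kappa> n (d (n - 1) w)"
proof -
  interpret C: complete_resolution L P d by (rule C)
  note M = C.left_module_terms
  let ?V = "\<lambda>n. Rep (P n) i"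
  let ?K = "\<lambda>n. restrict_carrier (?V n) (\<kappa> n ` carrier (?V n))"
  note MV = left_module_rep[OF M i] and MA = left_module_A
  interpret V: left_module A "?V n" for n by (rule MV)
  have \<kappa>: "\<kappa> n \<in> mod_hom A (?V n) (?V n)" for n unfolding \<kappa>_def by (rule corner_hom[OF M \<rho> i])
  have \<kappa>0: "\<kappa> n x = \<zero>\<^bsub>?V n\<^esub> \<longleftrightarrow> x \<in> Incoming (P n) i" if "x \<in> carrier (?V n)" for n x
    unfolding \<kappa>_def by (rule corner_zero_iff[OF M \<rho> i that])
  have \<kappa>\<kappa>: "\<kappa> n (\<kappa> n x) = \<kappa> n x" if "x \<in> carrier (?V n)" for n x
    unfolding \<kappa>_def by (rule corner_idem[OF M \<rho> i that])
  note \<kappa>c = mod_homD(1)[OF \<kappa>] and dc = mod_homD(1)[OF rep_d_hom[OF C]] and dc' = mod_homD(1)[OF rep_d_hom'[OF C]]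
  have ap: "arrow_part (P n) (\<rho> n) i x \<in> Incoming (P n) i" if "x \<in> carrier (?V n)" for n x
    by (rule arrow_part_Incoming[OF M \<rho> i rep_carrier[OF M that]])
  note IV = left_submoduleD(1)[OF Incoming_submodule[OF M i]]
  \<comment> \<open>\<open>x\<close> and \<open>\<kappa> n x\<close> differ by an arrow sum, so a
    map that vanishes on arrow sums does not distinguish them.\<close>
  have kill: "h (\<kappa> n x) = h x"
    if N: "left_module A N" and h: "h \<in> mod_hom A (?V n) N" and h0: "\<And>x. x \<in> Incoming (P n) i \<Longrightarrow> h x = \<zero>\<^bsub>N\<^esub>"
      and x: "x \<in> carrier (?V n)" for h and N :: "('c, 'o) module" and n x
  proof -
    interpret N: left_module A N by (rule N)
    have "h (\<kappa> n x) = h x \<ominus>\<^bsub>N\<^esub> h (arrow_part (P n) (\<rho> n) i x)"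
      unfolding \<kappa>_def corner_def by (rule mod_hom_minus(2)[OF MV N h x IV[OF ap[OF x]]])
    also have "\<dots> = h x" unfolding h0[OF ap[OF x]] using mod_homD(1)[OF h x] by (simp add: a_minus_def)
    finally show ?thesis .
  qed
  have \<kappa>d: "(\<lambda>x. \<kappa> (n + 1) (d n x)) \<in> mod_hom A (?V n) (?V (n + 1))" for n
    by (rule mod_hom_comp[OF rep_d_hom[OF C] \<kappa>])
  have \<kappa>d0: "\<kappa> (n + 1) (d n x) = \<zero>\<^bsub>?V (n + 1)\<^esub>" if x: "x \<in> Incoming (P n) i" for n x
    using \<kappa>0[OF dc[OF IV[OF x]]] hom_Incoming[OF M M C.d_hom i x] by blast
  have d\<kappa>: "\<kappa> (n + 1) (d n (\<kappa> n y)) = \<kappa> (n + 1) (d n y)" if "y \<in> carrier (?V n)" for n y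
    by (rule kill[OF MV \<kappa>d \<kappa>d0 that])
  then show "y \<in> carrier (?V n) \<Longrightarrow> \<kappa> (n + 1) (d n (\<kappa> n y)) = \<kappa> (n + 1) (d n y)" .
  have ex: "\<exists>w\<in>carrier (?V (n - 1)). \<kappa> n y = \<kappa> n (d (n - 1) w)"
    if y: "y \<in> carrier (?V n)" and 0: "\<kappa> (n + 1) (d n y) = \<zero>\<^bsub>P (n + 1)\<^esub>" for n y
  proof -
    have "d n y \<in> Incoming (P (n + 1)) i" by (rule iffD1[OF \<kappa>0[OF dc[OF y], unfolded rep_space_simps(2)] 0])
    from rep_exact_incoming[OF C i y this] obtain w b where w: "w \<in> carrier (?V (n - 1))"
      and b: "b \<in> Incoming (P n) i" and e: "y = d (n - 1) w \<oplus>\<^bsub>?V n\<^esub> b" .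
    have "\<kappa> n y = \<kappa> n (d (n - 1) w) \<oplus>\<^bsub>?V n\<^esub> \<kappa> n b" unfolding e by (rule mod_homD(2)[OF \<kappa> dc'[OF w] IV[OF b]])
    also have "\<kappa> n b = \<zero>\<^bsub>?V n\<^esub>" using \<kappa>0[OF IV[OF b]] b by blast
    also have "\<kappa> n (d (n - 1) w) \<oplus>\<^bsub>?V n\<^esub> \<zero>\<^bsub>?V n\<^esub> = \<kappa> n (d (n - 1) w)" by (rule V.M.r_zero[OF \<kappa>c[OF dc'[OF w]]])
    finally show ?thesis using w by blast
  qed
  then show "y \<in> carrier (?V n) \<Longrightarrow> \<kappa> (n + 1) (d n y) = \<zero>\<^bsub>P (n + 1)\<^esub> \<Longrightarrow>
      \<exists>w\<in>carrier (?V (n - 1)). \<kappa> n y = \<kappa> n (d (n - 1) w)" .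
  have sub: "\<kappa> n ` carrier (?V n) \<subseteq> carrier (?V n)" for n using \<kappa>c by blast
  show "complete_resolution A ?K (\<lambda>n x. \<kappa> (n + 1) (d n x))"
  proof (rule complete_resolutionI)
    show "fg_projective A (?K n)" for n
      by (rule fg_projective_image(2)[OF fg_projective_rep[OF C.fg_projective_terms i] \<kappa> \<kappa>\<kappa>])
    show "(\<lambda>x. \<kappa> (n + 1) (d n x)) \<in> mod_hom A (?K n) (?K (n + 1))" for n
      by (rule mod_hom_restrict_carrier(1)[OF mod_hom_restrict_carrier(2)[OF \<kappa>d] sub]) (rule imageI[OF dc])
    show "\<kappa> (n + 1) (d n (\<kappa> (n - 1 + 1) (d (n - 1) x))) = \<zero>\<^bsub>?K (n + 1)\<^esub>" if "x \<in> carrier (?K (n - 1))" for n x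
    proof -
      have x: "x \<in> carrier (?V (n - 1))" using that sub by auto
      have "\<kappa> (n + 1) (d n (\<kappa> n (d (n - 1) x))) = \<kappa> (n + 1) (d n (d (n - 1) x))" by (rule d\<kappa>[OF dc'[OF x]])
      also have "\<dots> = \<kappa> (n + 1) \<zero>\<^bsub>?V (n + 1)\<^esub>"
        unfolding C.d_d[OF rep_carrier[OF M x]] rep_space_simps(2) ..
      also have "\<dots> = \<zero>\<^bsub>?V (n + 1)\<^esub>" by (rule mod_hom_zero[OF MV MV \<kappa>])
      finally show ?thesis unfolding diff_add_cancel by (simp only: restrict_carrier_simps)
    qed
    show "x \<in> (\<lambda>x. \<kappa> (n - 1 + 1) (d (n - 1) x)) ` carrier (?K (n - 1))"
      if xK: "x \<in> carrier (?K n)" and 0: "\<kappa> (n + 1) (d n x) = \<zero>\<^bsub>?K (n + 1)\<^esub>" for n x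
    proof -
      obtain x0 where x0: "x0 \<in> carrier (?V n)" "x = \<kappa> n x0" using xK by auto
      have x: "x \<in> carrier (?V n)" "\<kappa> n x = x" unfolding x0(2) by (rule \<kappa>c[OF x0(1)], rule \<kappa>\<kappa>[OF x0(1)])
      obtain w where w: "w \<in> carrier (?V (n - 1))" "\<kappa> n x = \<kappa> n (d (n - 1) w)"
        using ex[OF x(1)] 0 by (auto simp: rep_space_simps(2))
      have "x = \<kappa> (n - 1 + 1) (d (n - 1) (\<kappa> (n - 1) w))"
        unfolding d\<kappa>[OF w(1)] unfolding diff_add_cancel using x(2) w(2) by simp
      then show ?thesis using w(1) by (intro image_eqI[of _ _ "\<kappa> (n - 1) w"]) auto
    qed
    show "\<exists>g\<in>mod_hom A (?K (n + 1)) (regular_module A). \<forall>x\<in>carrier (?K n). f x = g (\<kappa> (n + 1) (d n x))"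
      if f: "f \<in> mod_hom A (?K n) (regular_module A)"
        and fd: "\<And>x. x \<in> carrier (?K (n - 1)) \<Longrightarrow> f (\<kappa> (n - 1 + 1) (d (n - 1) x)) = \<zero>\<^bsub>A\<^esub>" for n f
    proof -
      have f': "(\<lambda>x. f (\<kappa> n x)) \<in> mod_hom A (?V n) (regular_module A)"
        by (rule mod_hom_comp[OF _ f], rule mod_hom_restrict_carrier(2)[OF \<kappa>]) simp
      have MK: "left_module A (?K n)"
        by (rule left_module_restrict[OF MV fg_projective_image(1)[OF fg_projective_rep[OF C.fg_projective_terms i] \<kappa> \<kappa>\<kappa>]])
      have f'0: "f (\<kappa> n b) = \<zero>\<^bsub>A\<^esub>" if b: "b \<in> Incoming (P n) i" for b
      proof -
        have "\<kappa> n b = \<zero>\<^bsub>?K n\<^esub>" using \<kappa>0[OF IV[OF b]] b by simp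
        then show ?thesis using mod_hom_zero[OF MK MA f] by simp
      qed
      have f'd: "f (\<kappa> n (d (n - 1) x)) = \<zero>\<^bsub>A\<^esub>" if x: "x \<in> carrier (?V (n - 1))" for x
      proof -
        have "\<kappa> (n - 1) x \<in> carrier (?K (n - 1))" using x by simp
        from fd[OF this] show ?thesis unfolding d\<kappa>[OF x] unfolding diff_add_cancel .
      qed
      obtain g where g: "g \<in> mod_hom A (?V (n + 1)) (regular_module A)"
        and g0: "\<forall>x\<in>Incoming (P (n + 1)) i. g x = \<zero>\<^bsub>A\<^esub>" and gd: "\<forall>x\<in>carrier (?V n). f (\<kappa> n x) = g (d n x)"
        using corner_hom_exact[OF C i f' f'0 f'd] by blast
      show ?thesis
      proof (intro bexI[of _ g] ballI)
        show "g \<in> mod_hom A (?K (n + 1)) (regular_module A)" by (rule mod_hom_restrict_carrier(1)[OF g sub])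
        fix x assume "x \<in> carrier (?K n)"
        then obtain x0 where x0: "x0 \<in> carrier (?V n)" "x = \<kappa> n x0" by auto
        have x: "x \<in> carrier (?V n)" "\<kappa> n x = x" unfolding x0(2) by (rule \<kappa>c[OF x0(1)], rule \<kappa>\<kappa>[OF x0(1)])
        have "g (\<kappa> (n + 1) (d n x)) = g (d n x)"
          by (rule kill[OF MA g _ dc[OF x(1)]]) (use g0 in simp)
        then show "f x = g (\<kappa> (n + 1) (d n x))" using bspec[OF gd x(1)] x(2) by simp
      qed
    qed
  qed
qed

text \<open>Monicity and the spaces are inherited directly from the embedding of \<open>X\<close>
  onto the cycles of \<open>P 0\<close>. For the cokernels one must show that \<open>X_i\<close>
  meets the incoming images of \<open>P 0\<close> only in its own, and that every cycle of the
  cokernel complex in degree 0 comes from \<open>X_i\<close>.\<close>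

theorem gorenstein_projective_monic_rep:
  assumes X: "left_module L X" and G: "gorenstein_projective L X"
  shows "monic_rep Q (rep_space K A Q X) (rep_map K A Q X)"
    and "i \<in> verts Q \<Longrightarrow> gorenstein_projective A (Rep X i)"
    and "i \<in> verts Q \<Longrightarrow> gorenstein_projective A (quotient_module (Rep X i) (Incoming X i))"
proof -
  obtain P :: "int \<Rightarrow> ('d \<times> 'e list \<times> 'd \<Rightarrow> 'c, nat \<Rightarrow> 'd \<times> 'e list \<times> 'd \<Rightarrow> 'c) module" and d \<iota>
    where C: "complete_resolution L P d" and \<iota>: "\<iota> \<in> mod_hom L X (P 0)" and inj: "inj_on \<iota> (carrier X)"
      and im: "\<iota> ` carrier X = {x \<in> carrier (P 0). d 0 x = \<zero>\<^bsub>P 1\<^esub>}"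
    using gorenstein_projectiveE[OF G] .
  interpret C: complete_resolution L P d by (rule C)
  note M = C.left_module_terms
  have "\<exists>\<rho>. arrow_retraction (P n) \<rho>" for n by (rule projective_arrow_retraction[OF C.fg_projective_terms])
  then obtain \<rho> where \<rho>: "\<And>n. arrow_retraction (P n) (\<rho> n)" by metis
  have d0: "d 0 (\<iota> x) = \<zero>\<^bsub>P 1\<^esub>" if "x \<in> carrier X" for x using im that by blast
  have ker: "\<exists>x. x \<in> carrier (Rep X i) \<and> p = \<iota> x"
    if i: "i \<in> verts Q" and p: "p \<in> carrier (Rep (P 0) i)" and "d 0 p = \<zero>\<^bsub>P 1\<^esub>" for i p
  proof -
    have "p \<in> \<iota> ` carrier X" unfolding im using rep_carrier[OF M p] that(3) by simp
    then obtain x where x: "x \<in> carrier X" "p = \<iota> x" by blast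
    have "p = vert_el i \<odot>\<^bsub>P 0\<^esub> \<iota> x" using rep_vert[OF M i p, of i] x(2) by simp
    then have "p = \<iota> (vert_el i \<odot>\<^bsub>X\<^esub> x)" unfolding mod_homD(3)[OF \<iota> path_el_closed x(1)] .
    then show ?thesis using rep_memI[OF X x(1)] by blast
  qed
  note \<iota>V = rep_hom[OF X M \<iota>]
  note \<iota>c = mod_homD(1)[OF \<iota>V]
  show "monic_rep Q (rep_space K A Q X) (rep_map K A Q X)"
    unfolding monic_rep_iff[OF X]
  proof (intro ballI allI impI)
    fix i y z \<beta>
    assume i: "i \<in> verts Q" and y: "\<forall>\<alpha>\<in>in_arcs Q i. y \<alpha> \<in> carrier (Rep X (tail Q \<alpha>))"
      and z: "\<forall>\<alpha>\<in>in_arcs Q i. z \<alpha> \<in> carrier (Rep X (tail Q \<alpha>))" and \<beta>: "\<beta> \<in> in_arcs Q i"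
      and e: "(\<Oplus>\<^bsub>X\<^esub>\<alpha>\<in>in_arcs Q i. arrow_el \<alpha> \<odot>\<^bsub>X\<^esub> y \<alpha>) = (\<Oplus>\<^bsub>X\<^esub>\<alpha>\<in>in_arcs Q i. arrow_el \<alpha> \<odot>\<^bsub>X\<^esub> z \<alpha>)"
    have "(\<Oplus>\<^bsub>P 0\<^esub>\<alpha>\<in>in_arcs Q i. arrow_el \<alpha> \<odot>\<^bsub>P 0\<^esub> \<iota> (y \<alpha>)) = \<iota> (\<Oplus>\<^bsub>X\<^esub>\<alpha>\<in>in_arcs Q i. arrow_el \<alpha> \<odot>\<^bsub>X\<^esub> y \<alpha>)"
      by (rule hom_arrow_sum[OF X M \<iota> bspec[OF y], symmetric])
    also have "\<dots> = \<iota> (\<Oplus>\<^bsub>X\<^esub>\<alpha>\<in>in_arcs Q i. arrow_el \<alpha> \<odot>\<^bsub>X\<^esub> z \<alpha>)" unfolding e ..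
    also have "\<dots> = (\<Oplus>\<^bsub>P 0\<^esub>\<alpha>\<in>in_arcs Q i. arrow_el \<alpha> \<odot>\<^bsub>P 0\<^esub> \<iota> (z \<alpha>))"
      by (rule hom_arrow_sum[OF X M \<iota> bspec[OF z]])
    finally have e': "(\<Oplus>\<^bsub>P 0\<^esub>\<alpha>\<in>in_arcs Q i. arrow_el \<alpha> \<odot>\<^bsub>P 0\<^esub> \<iota> (y \<alpha>)) =
        (\<Oplus>\<^bsub>P 0\<^esub>\<alpha>\<in>in_arcs Q i. arrow_el \<alpha> \<odot>\<^bsub>P 0\<^esub> \<iota> (z \<alpha>))" .
    have "\<iota> (y \<beta>) = \<iota> (z \<beta>)"
      by (rule retraction_inj[OF M \<rho> i _ _ e' \<beta>]) (rule \<iota>c[OF bspec[OF y]] \<iota>c[OF bspec[OF z]], assumption)+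
    then show "y \<beta> = z \<beta>"
      by (rule inj_onD[OF inj _ rep_carrier[OF X bspec[OF y \<beta>]] rep_carrier[OF X bspec[OF z \<beta>]]])
  qed
  show "gorenstein_projective A (Rep X i)" if i: "i \<in> verts Q"
  proof (rule gorenstein_projectiveI[OF complete_resolution_rep[OF C i] left_module_rep[OF X i] \<iota>V])
    show "inj_on \<iota> (carrier (Rep X i))" by (rule inj_on_subset[OF inj]) (use rep_carrier[OF X] in blast)
    show "\<iota> ` carrier (Rep X i) = {x \<in> carrier (Rep (P 0) i). d 0 x = \<zero>\<^bsub>Rep (P 1) i\<^esub>}"
      unfolding rep_space_simps(2) using ker[OF i] \<iota>c d0 rep_carrier[OF X] by blast
  qed
  show "gorenstein_projective A (quotient_module (Rep X i) (Incoming X i))" if i: "i \<in> verts Q"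
  proof -
    note MX = left_module_rep[OF X i] and MV = left_module_rep[OF M i]
    interpret V: left_module A "Rep (P 0) i" by (rule MV)
    define \<kappa> where "\<kappa> n = corner (P n) (\<rho> n) i" for n
    define W where "W n = restrict_carrier (Rep (P n) i) (\<kappa> n ` carrier (Rep (P n) i))" for n
    note cor = complete_resolution_corner[OF C i \<rho>, folded \<kappa>_def]
    have CW: "complete_resolution A W (\<lambda>n x. \<kappa> (n + 1) (d n x))" unfolding W_def by (rule cor(1))
    interpret CW: complete_resolution A W "\<lambda>n x. \<kappa> (n + 1) (d n x)" by (rule CW)
    have \<kappa>: "\<kappa> n \<in> mod_hom A (Rep (P n) i) (Rep (P n) i)" for n unfolding \<kappa>_def by (rule corner_hom[OF M \<rho> i])
    note \<kappa>c = mod_homD(1)[OF \<kappa>]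
    have \<kappa>0: "\<kappa> n x = \<zero>\<^bsub>Rep (P n) i\<^esub> \<longleftrightarrow> x \<in> Incoming (P n) i" if "x \<in> carrier (Rep (P n) i)" for n x
      unfolding \<kappa>_def by (rule corner_zero_iff[OF M \<rho> i that])
    have \<mu>: "(\<lambda>x. \<kappa> 0 (\<iota> x)) \<in> mod_hom A (Rep X i) (W 0)"
      unfolding W_def by (rule mod_hom_restrict_carrier(2)[OF mod_hom_comp[OF \<iota>V \<kappa>]]) (rule imageI[OF \<iota>c])
    \<comment> \<open>If an element of \<open>X\<close> is an arrow sum in \<open>P 0\<close>, its
      components are cycles by \<open>incoming_kernel\<close> and therefore come from
      \<open>X\<close>; injectivity of the embedding makes it an arrow sum in
      \<open>X\<close>.\<close>
    have kernel: "\<kappa> 0 (\<iota> x) = \<zero>\<^bsub>W 0\<^esub> \<longleftrightarrow> x \<in> Incoming X i" if x: "x \<in> carrier (Rep X i)" for x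
    proof
      assume "\<kappa> 0 (\<iota> x) = \<zero>\<^bsub>W 0\<^esub>"
      then have "\<iota> x \<in> Incoming (P 0) i" using \<kappa>0[OF \<iota>c[OF x]] by (simp add: W_def)
      then obtain z where z: "\<forall>\<alpha>\<in>in_arcs Q i. z \<alpha> \<in> carrier (Rep (P 0) (tail Q \<alpha>))"
        and e: "\<iota> x = (\<Oplus>\<^bsub>P 0\<^esub>\<alpha>\<in>in_arcs Q i. arrow_el \<alpha> \<odot>\<^bsub>P 0\<^esub> z \<alpha>)"
        using Incoming_iff[OF M i] by blast
      have dx: "d 0 (\<Oplus>\<^bsub>P 0\<^esub>\<alpha>\<in>in_arcs Q i. arrow_el \<alpha> \<odot>\<^bsub>P 0\<^esub> z \<alpha>) = \<zero>\<^bsub>P (0 + 1)\<^esub>"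
        using d0[OF rep_carrier[OF X x]] e by simp
      have "\<exists>y. y \<in> carrier (Rep X (tail Q \<alpha>)) \<and> z \<alpha> = \<iota> y" if \<alpha>: "\<alpha> \<in> in_arcs Q i" for \<alpha>
        by (rule ker[OF in_arcsD(3)[OF \<alpha>] bspec[OF z \<alpha>] incoming_kernel[OF C i bspec[OF z] dx \<alpha>, unfolded add_0]])
      then obtain y where y: "\<forall>\<alpha>\<in>in_arcs Q i. y \<alpha> \<in> carrier (Rep X (tail Q \<alpha>)) \<and> z \<alpha> = \<iota> (y \<alpha>)" by metis
      have yc: "y \<alpha> \<in> carrier (Rep X (tail Q \<alpha>))" if "\<alpha> \<in> in_arcs Q i" for \<alpha> using bspec[OF y that] by blast
      interpret P0: left_module L "P 0" by (rule M)
      note I = IncomingI[where y = y, OF X i yc]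
      have "\<iota> (\<Oplus>\<^bsub>X\<^esub>\<alpha>\<in>in_arcs Q i. arrow_el \<alpha> \<odot>\<^bsub>X\<^esub> y \<alpha>) = (\<Oplus>\<^bsub>P 0\<^esub>\<alpha>\<in>in_arcs Q i. arrow_el \<alpha> \<odot>\<^bsub>P 0\<^esub> \<iota> (y \<alpha>))"
        by (rule hom_arrow_sum[OF X M \<iota> yc])
      also have "\<dots> = \<iota> x" unfolding e
        by (rule P0.M.finsum_cong'[OF refl arrow_sum_terms(2)[OF M rep_carrier[OF M bspec[OF z]]]]) (use y in auto)
      finally have "(\<Oplus>\<^bsub>X\<^esub>\<alpha>\<in>in_arcs Q i. arrow_el \<alpha> \<odot>\<^bsub>X\<^esub> y \<alpha>) = x"
        by (rule inj_onD[OF inj _ rep_carrier[OF X left_submoduleD(1)[OF Incoming_submodule[OF X i] I]] rep_carrier[OF X x]])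
      then show "x \<in> Incoming X i" using I by simp
    next
      assume "x \<in> Incoming X i"
      then show "\<kappa> 0 (\<iota> x) = \<zero>\<^bsub>W 0\<^esub>"
        using \<kappa>0[OF \<iota>c[OF x]] hom_Incoming[OF X M \<iota> i] by (simp add: W_def)
    qed
    have image: "(\<lambda>x. \<kappa> 0 (\<iota> x)) ` carrier (Rep X i) = {p \<in> carrier (W 0). \<kappa> (0 + 1) (d 0 p) = \<zero>\<^bsub>W 1\<^esub>}"
    proof (intro equalityI subsetI)
      fix p assume "p \<in> (\<lambda>x. \<kappa> 0 (\<iota> x)) ` carrier (Rep X i)"
      then obtain x where x: "x \<in> carrier (Rep X i)" "p = \<kappa> 0 (\<iota> x)" by blast
      have "\<kappa> (0 + 1) (d 0 p) = \<kappa> (0 + 1) (d 0 (\<iota> x))" unfolding x(2) by (rule cor(2)[OF \<iota>c[OF x(1)]])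
      also have "\<dots> = \<kappa> 1 \<zero>\<^bsub>Rep (P 1) i\<^esub>" unfolding d0[OF rep_carrier[OF X x(1)]] rep_space_simps(2) add_0 ..
      also have "\<dots> = \<zero>\<^bsub>Rep (P 1) i\<^esub>" by (rule mod_hom_zero[OF MV MV \<kappa>])
      finally show "p \<in> {p \<in> carrier (W 0). \<kappa> (0 + 1) (d 0 p) = \<zero>\<^bsub>W 1\<^esub>}"
        using mod_homD(1)[OF \<mu> x(1)] x(2) by (simp add: W_def)
    next
      fix p assume p: "p \<in> {p \<in> carrier (W 0). \<kappa> (0 + 1) (d 0 p) = \<zero>\<^bsub>W 1\<^esub>}"
      then obtain q where q: "q \<in> carrier (Rep (P 0) i)" "p = \<kappa> 0 q" by (auto simp: W_def)
      have pV: "p \<in> carrier (Rep (P 0) i)" and pp: "\<kappa> 0 p = p"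
        unfolding q(2) by (rule \<kappa>c[OF q(1)], unfold \<kappa>_def, rule corner_idem[OF M \<rho> i q(1)])
      have "\<kappa> (0 + 1) (d 0 p) = \<zero>\<^bsub>P (0 + 1)\<^esub>" using p by (simp add: W_def rep_space_simps(2))
      \<comment> \<open>A cycle of the cokernel complex need not be a cycle of \<open>P\<close>. It
        has the same image under \<open>\<kappa> 0\<close> as a boundary of \<open>P\<close>, and
        that boundary comes from \<open>X\<close>.\<close>
      from cor(3)[OF pV this] obtain w where w: "w \<in> carrier (Rep (P (0 - 1)) i)" "\<kappa> 0 p = \<kappa> 0 (d (0 - 1) w)" by blast
      have "d 0 (d (0 - 1) w) = \<zero>\<^bsub>P 1\<^esub>" using C.d_d[OF rep_carrier[OF M w(1)]] by (simp only: add_0)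
      from ker[OF i mod_homD(1)[OF rep_d_hom'[OF C] w(1)] this] obtain x
        where "x \<in> carrier (Rep X i)" "d (0 - 1) w = \<iota> x" by blast
      then show "p \<in> (\<lambda>x. \<kappa> 0 (\<iota> x)) ` carrier (Rep X i)" using w(2) pp by (intro image_eqI[of _ _ x]) simp_all
    qed
    obtain \<mu>' where \<mu>': "\<mu>' \<in> mod_hom A (quotient_module (Rep X i) (Incoming X i)) (W 0)"
        "inj_on \<mu>' (carrier (quotient_module (Rep X i) (Incoming X i)))"
        "\<mu>' ` carrier (quotient_module (Rep X i) (Incoming X i)) = (\<lambda>x. \<kappa> 0 (\<iota> x)) ` carrier (Rep X i)"
      using quotient_module_embedding[OF MX Incoming_submodule[OF X i] CW.left_module_terms \<mu> kernel] .
    show ?thesis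
      by (rule gorenstein_projectiveI[OF CW left_module_quotient[OF MX Incoming_submodule[OF X i]] \<mu>'(1,2)])
        (unfold \<mu>'(3), rule image)
  qed
qed

end

theorem theorem4p1:
  fixes K :: "('k, 'z) ring_scheme"
    and A :: "('k, 'a) module"
    and Q :: "('v, 'e) pre_digraph"
    and X :: "(('v, 'e) path \<Rightarrow> 'a, 'm) module"
  assumes "fd_algebra K A"
    and "fin_digraph Q"
    and "\<nexists>c. pre_digraph.cycle Q c"
    and "fd_module K (path_algebra A Q) X"
  shows "gorenstein_projective (path_algebra A Q) X \<longleftrightarrow>
    monic_rep Q (rep_space K A Q X) (rep_map K A Q X) \<and>
    (\<forall>i\<in>verts Q.
       gorenstein_projective A (rep_space K A Q X i) \<and>
       gorenstein_projective A
         (quotient_module (rep_space K A Q X i)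
           (incoming_image Q (rep_space K A Q X) (rep_map K A Q X) i)))"
proof -
  interpret quiver_algebra K A Q
    by (intro quiver_algebra.intro acyclic_quiver.intro acyclic_quiver_axioms.intro assms(1-3))
  have X: "left_module L X" using assms(4) by (simp add: fd_module_def)
  show ?thesis
    using gorenstein_projective_monic_rep[OF X] monic_rep_gorenstein_projective[OF X] by blast
qed

end
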